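(* Let $k\neq l$ in $\{1,\dots,d\}$ with $\rho_k\le\rho_l$, and let $(a_1,\dots,a_N)$ be a family of elements of $\mathcal A$ of type $(k,l)$ such that $$\chi^{\mathcal D}(a_1,\dots,a_N)=\chi^{\mathcal D}(a_1)+\cdots+\chi^{\mathcal D}(a_N)>-\infty.$$ Then the family $(a_1,\dots,a_N)$ is free with amalgamation over $\mathcal D$.
   Context: $(\mathcal A,\varphi)$ is a tracial $W^*$-probability space with nonzero self-adjoint pairwise orthogonal projections $p_1,\dots,p_d$ with sum $1$; $\rho_i=\varphi(p_i)$; $\mathcal D=\mathrm{Span}\{p_1,\dots,p_d\}$; $\mathcal A_{ij}=p_i\mathcal Ap_j$; $\varphi_i=\rho_i^{-1}\varphi|_{\mathcal A_{ii}}$; $E(x)=\sum_i\varphi_i(p_ixp_i)p_i$. An element has type $(k,l)$ if it is a nonzero element of $\mathcal A_{kl}$. $*$-subalgebras $(\mathcal A_i)$ containing $\mathcal D$ are free with amalgamation over $\mathcal D$ if $E(x(1)\cdots x(m))=0$ whenever $i_1\ne\cdots\ne i_m$ (consecutive indices distinct) and $x(j)\in\mathcal A_{i_j}\cap\ker E$; elements are free with amalgamation over $\mathcal D$ if they belong respectively to such $*$-subalgebras. Let $q_k(n)$ be the integer part of $\rho_kn$, and let $p_1(n),\dots,p_d(n)$ be the diagonal projections of the $n\times n$ complex matrices $\mathfrak M_n$ onto consecutive disjoint blocks of coordinates of sizes $q_1(n),\dots,q_d(n)$. For matrices, $E(A)=\sum_k\frac{1}{q_k(n)}\mathrm{Tr}(p_k(n)Ap_k(n))\,p_k\in\mathcal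 D$. Put $\mathfrak M_n(k,l)=p_k(n)\mathfrak M_np_l(n)$, with Lebesgue measure from the Euclidean structure $\langle M,N\rangle=\mathrm{Re}\,\mathrm{Tr}(M^*N)$; $\Lambda$ denotes the product measure on $\mathfrak M_n(k,l)^m$. $\|\cdot\|$ is the operator norm (on $\mathcal D$ too). For $m\ge1$ and $a_1,\dots,a_m$ of type $(k,l)$, $k\neq l$, positive integers $n,r$ and $\varepsilon,R>0$, $\Gamma_R(a_1,\dots,a_m;n,r,\varepsilon)$ is the set of $(A_1,\dots,A_m)\in\mathfrak M_n(k,l)^m$ with $\|A_i\|\le R$ and $\|E(A_{i_1}^{\varepsilon_1}\cdots A_{i_p}^{\varepsilon_p})-E(a_{i_1}^{\varepsilon_1}\cdots a_{i_p}^{\varepsilon_p})\|\le\varepsilon$ for all $1\le p\le r$, $i_1,\dots,i_p\in\{1,\dots,m\}$, $\varepsilon_1,\dots,\varepsilon_p\in\{1,*\}$. The free entropy is $\chi^{\mathcal D}(a_1,\dots,a_m)=\sup_R\inf_{r,\varepsilon}\limsup_{n\to\infty}\big[\frac1{n^2}\log\Lambda(\Gamma_R(a_1,\dots,a_m;n,r,\varepsilon))+m\rho_k\rho_l\log n\big]$ (with $\log 0=-\infty$). *)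

theory Defs
  imports
    "HOL-Analysis.Lebesgue_Measure"
    "HOL-Analysis.Finite_Product_Measure"
    "HOL-Analysis.Embed_Measure"
    "HOL-Analysis.Operator_Norm"
    "Jordan_Normal_Form.Schur_Decomposition"
begin

section \<open>Tracial W*-probability spaces\<close>

class cstar_algebra = real_normed_algebra_1 + banach +
  fixes scaleC :: "complex \<Rightarrow> 'a \<Rightarrow> 'a" (infixr \<open>*\<^sub>C\<close> 75)
    and star :: "'a \<Rightarrow> 'a"
  assumes scaleC_add_right: "c *\<^sub>C (x + y) = c *\<^sub>C x + c *\<^sub>C y"
    and scaleC_add_left: "(b + c) *\<^sub>C x = b *\<^sub>C x + c *\<^sub>C x"
    and scaleC_scaleC: "b *\<^sub>C c *\<^sub>C x = (b * c) *\<^sub>C x"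
    and scaleR_scaleC: "r *\<^sub>R x = complex_of_real r *\<^sub>C x"
    and mult_scaleC_left: "(c *\<^sub>C x) * y = c *\<^sub>C (x * y)"
    and mult_scaleC_right: "x * (c *\<^sub>C y) = c *\<^sub>C (x * y)"
    and norm_scaleC: "norm (c *\<^sub>C x) = cmod c * norm x"
    and star_star: "star (star x) = x"
    and star_add: "star (x + y) = star x + star y"
    and star_scaleC: "star (c *\<^sub>C x) = cnj c *\<^sub>C star x"
    and star_mult: "star (x * y) = star y * star x"
    and cstar_identity: "norm (star x * x) = (norm x)\<^sup>2"

definition complex_linear :: "('a::cstar_algebra \<Rightarrow> complex) \<Rightarrow> bool" where
  "complex_linear f \<longleftrightarrow>
     (\<forall>x y. f (x + y) = f x + f y) \<and> (\<forall>c x. f (c *\<^sub>C x) = c * f x)"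

definition bounded_functional :: "('a::cstar_algebra \<Rightarrow> complex) \<Rightarrow> bool" where
  "bounded_functional f \<longleftrightarrow> complex_linear f \<and> (\<exists>K. \<forall>x. cmod (f x) \<le> K * norm x)"

text \<open>
  A W*-algebra is a C*-algebra that is the dual of a Banach space (Sakai). The predual is
  represented as a norm-closed subspace \<open>V\<close> of the dual of the algebra such that evaluation is an
  isometric isomorphism from the algebra onto the dual of \<open>V\<close>. Such a \<open>V\<close> is unique when it
  exists; it is the set of normal functionals.
\<close>

definition is_predual :: "('a::cstar_algebra \<Rightarrow> complex) set \<Rightarrow> bool" where
  "is_predual V \<longleftrightarrow>
     (\<forall>v\<in>V. bounded_functional v) \<and>
     (\<lambda>_. 0) \<in> V \<and>
     (\<forall>v\<in>V. \<forall>w\<in>V. (\<lambda>x. v x + w x) \<in> V) \<and>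
     (\<forall>c. \<forall>v\<in>V. (\<lambda>x. c * v x) \<in> V) \<and>
     (\<forall>f. bounded_functional f \<and> (\<forall>e>0. \<exists>v\<in>V. onorm (\<lambda>x. f x - v x) < e) \<longrightarrow> f \<in> V) \<and>
     (\<forall>x. norm x = (SUP v\<in>{v \<in> V. onorm v \<le> 1}. cmod (v x))) \<and>
     (\<forall>F :: ('a \<Rightarrow> complex) \<Rightarrow> complex.
        (\<forall>v\<in>V. \<forall>w\<in>V. F (\<lambda>x. v x + w x) = F v + F w) \<and>
        (\<forall>c. \<forall>v\<in>V. F (\<lambda>x. c * v x) = c * F v) \<and>
        (\<exists>K. \<forall>v\<in>V. cmod (F v) \<le> K * onorm v)
        \<longrightarrow> (\<exists>x. \<forall>v\<in>V. F v = v x))"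

definition normal_functional :: "('a::cstar_algebra \<Rightarrow> complex) \<Rightarrow> bool" where
  "normal_functional \<phi> \<longleftrightarrow> (\<exists>V. is_predual V \<and> \<phi> \<in> V)"

text \<open>
  That the algebra is a W*-algebra is part of \<^const>\<open>normal_functional\<close>.
\<close>

definition tracial_wstar_probability_space :: "('a::cstar_algebra \<Rightarrow> complex) \<Rightarrow> bool" where
  "tracial_wstar_probability_space \<phi> \<longleftrightarrow>
     complex_linear \<phi> \<and>
     \<phi> 1 = 1 \<and>
     (\<forall>x. Im (\<phi> (star x * x)) = 0 \<and> 0 \<le> Re (\<phi> (star x * x))) \<and>
     (\<forall>x. \<phi> (star x * x) = 0 \<longrightarrow> x = 0) \<and>
     (\<forall>x y. \<phi> (x * y) = \<phi> (y * x)) \<and>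
     normal_functional \<phi>"

section \<open>The rectangular structure\<close>

definition projection_partition :: "nat \<Rightarrow> (nat \<Rightarrow> 'a::cstar_algebra) \<Rightarrow> bool" where
  "projection_partition d p \<longleftrightarrow>
     (\<forall>i\<in>{1..d}. p i \<noteq> 0 \<and> star (p i) = p i \<and> p i * p i = p i) \<and>
     (\<forall>i\<in>{1..d}. \<forall>j\<in>{1..d}. i \<noteq> j \<longrightarrow> p i * p j = 0) \<and>
     (\<Sum>i=1..d. p i) = 1"

definition rho :: "('a::cstar_algebra \<Rightarrow> complex) \<Rightarrow> (nat \<Rightarrow> 'a) \<Rightarrow> nat \<Rightarrow> real" where
  "rho \<phi> p i = Re (\<phi> (p i))"

definition diagonal_algebra :: "nat \<Rightarrow> (nat \<Rightarrow> 'a::cstar_algebra) \<Rightarrow> 'a set" where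
  "diagonal_algebra d p = {\<Sum>i=1..d. c i *\<^sub>C p i | c. True}"

definition cond_exp ::
    "('a::cstar_algebra \<Rightarrow> complex) \<Rightarrow> nat \<Rightarrow> (nat \<Rightarrow> 'a) \<Rightarrow> 'a \<Rightarrow> 'a" where
  "cond_exp \<phi> d p x =
     (\<Sum>i=1..d. (\<phi> (p i * x * p i) / complex_of_real (rho \<phi> p i)) *\<^sub>C p i)"

definition has_type :: "(nat \<Rightarrow> 'a::cstar_algebra) \<Rightarrow> nat \<Rightarrow> nat \<Rightarrow> 'a \<Rightarrow> bool" where
  "has_type p k l x \<longleftrightarrow> x \<noteq> 0 \<and> x \<in> {p k * y * p l | y. True}"

section \<open>Freeness with amalgamation over the diagonal algebra\<close>

definition star_subalgebra :: "'a::cstar_algebra set \<Rightarrow> bool" where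
  "star_subalgebra B \<longleftrightarrow>
     0 \<in> B \<and>
     (\<forall>x\<in>B. \<forall>y\<in>B. x + y \<in> B \<and> x * y \<in> B) \<and>
     (\<forall>c. \<forall>x\<in>B. c *\<^sub>C x \<in> B) \<and>
     (\<forall>x\<in>B. star x \<in> B)"

definition free_subalgebras ::
    "('a::cstar_algebra \<Rightarrow> complex) \<Rightarrow> nat \<Rightarrow> (nat \<Rightarrow> 'a) \<Rightarrow> nat set \<Rightarrow> (nat \<Rightarrow> 'a set) \<Rightarrow> bool"
  where
  "free_subalgebras \<phi> d p I B \<longleftrightarrow>
     (\<forall>i\<in>I. star_subalgebra (B i) \<and> diagonal_algebra d p \<subseteq> B i) \<and>
     (\<forall>(m::nat) (ix :: nat \<Rightarrow> nat) (x :: nat \<Rightarrow> 'a).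
        1 \<le> m \<and>
        (\<forall>j\<in>{1..m}. ix j \<in> I \<and> x j \<in> B (ix j) \<and> cond_exp \<phi> d p (x j) = 0) \<and>
        (\<forall>j\<in>{1..<m}. ix j \<noteq> ix (j + 1))
        \<longrightarrow> cond_exp \<phi> d p (prod_list (map x [1..<Suc m])) = 0)"

definition free_with_amalgamation ::
    "('a::cstar_algebra \<Rightarrow> complex) \<Rightarrow> nat \<Rightarrow> (nat \<Rightarrow> 'a) \<Rightarrow> nat \<Rightarrow> (nat \<Rightarrow> 'a) \<Rightarrow> bool" where
  "free_with_amalgamation \<phi> d p N a \<longleftrightarrow>
     (\<exists>B. free_subalgebras \<phi> d p {1..N} B \<and> (\<forall>i\<in>{1..N}. a i \<in> B i))"

section \<open>Rectangular block matrices\<close>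

definition block_size ::
    "('a::cstar_algebra \<Rightarrow> complex) \<Rightarrow> (nat \<Rightarrow> 'a) \<Rightarrow> nat \<Rightarrow> nat \<Rightarrow> nat" where
  "block_size \<phi> p n k = nat \<lfloor>rho \<phi> p k * real n\<rfloor>"

text \<open>The matrix library indexes rows and columns from \<open>0\<close>.\<close>

definition block ::
    "('a::cstar_algebra \<Rightarrow> complex) \<Rightarrow> (nat \<Rightarrow> 'a) \<Rightarrow> nat \<Rightarrow> nat \<Rightarrow> nat set" where
  "block \<phi> p n k =
     {(\<Sum>j=1..<k. block_size \<phi> p n j) ..< (\<Sum>j=1..<Suc k. block_size \<phi> p n j)}"

definition block_projection ::
    "('a::cstar_algebra \<Rightarrow> complex) \<Rightarrow> (nat \<Rightarrow> 'a) \<Rightarrow> nat \<Rightarrow> nat \<Rightarrow> complex Matrix.mat" where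
  "block_projection \<phi> p n k =
     Matrix.mat n n (\<lambda>(i, j). if i = j \<and> i \<in> block \<phi> p n k then 1 else 0)"

definition block_matrices ::
    "('a::cstar_algebra \<Rightarrow> complex) \<Rightarrow> (nat \<Rightarrow> 'a) \<Rightarrow> nat \<Rightarrow> nat \<Rightarrow> nat \<Rightarrow> complex Matrix.mat set"
  where
  "block_matrices \<phi> p n k l =
     {block_projection \<phi> p n k * A * block_projection \<phi> p n l | A. A \<in> carrier_mat n n}"

definition mat_trace :: "complex Matrix.mat \<Rightarrow> complex" where
  "mat_trace A = (\<Sum>i<dim_row A. A $$ (i, i))"

definition vec_l2_norm :: "complex Matrix.vec \<Rightarrow> real" where
  "vec_l2_norm v = sqrt (\<Sum>i<dim_vec v. (cmod (vec_index v i))\<^sup>2)"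

definition mat_op_norm :: "complex Matrix.mat \<Rightarrow> real" where
  "mat_op_norm A =
     (SUP v\<in>{v \<in> carrier_vec (dim_col A). vec_l2_norm v \<le> 1}. vec_l2_norm (mult_mat_vec A v))"

text \<open>The values lie in the span of the projections of the algebra, not of the matrices.\<close>

definition mat_cond_exp ::
    "('a::cstar_algebra \<Rightarrow> complex) \<Rightarrow> nat \<Rightarrow> (nat \<Rightarrow> 'a) \<Rightarrow> nat \<Rightarrow> complex Matrix.mat \<Rightarrow> 'a" where
  "mat_cond_exp \<phi> d p n A =
     (\<Sum>k=1..d.
        (mat_trace (block_projection \<phi> p n k * A * block_projection \<phi> p n k)
           / of_nat (block_size \<phi> p n k)) *\<^sub>C p k)"

text \<open>
  For the inner product \<open>Re (Tr (M\<^sup>* N))\<close> the entries of a matrix are orthogonal coordinates, each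
  of them carrying the Euclidean structure of the complex plane. Lebesgue measure on the block
  \<open>(k, l)\<close> is therefore the image, under filling in the entries, of the product of the planar
  Lebesgue measures.
\<close>

definition fill_block ::
    "('a::cstar_algebra \<Rightarrow> complex) \<Rightarrow> (nat \<Rightarrow> 'a) \<Rightarrow> nat \<Rightarrow> nat \<Rightarrow> nat \<Rightarrow> (nat \<times> nat \<Rightarrow> complex)
       \<Rightarrow> complex Matrix.mat" where
  "fill_block \<phi> p n k l z =
     Matrix.mat n n (\<lambda>(i, j). if i \<in> block \<phi> p n k \<and> j \<in> block \<phi> p n l then z (i, j) else 0)"

definition block_lebesgue ::
    "('a::cstar_algebra \<Rightarrow> complex) \<Rightarrow> (nat \<Rightarrow> 'a) \<Rightarrow> nat \<Rightarrow> nat \<Rightarrow> nat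
       \<Rightarrow> complex Matrix.mat measure" where
  "block_lebesgue \<phi> p n k l =
     embed_measure
       (Pi\<^sub>M (block \<phi> p n k \<times> block \<phi> p n l) (\<lambda>_. lborel :: complex measure))
       (fill_block \<phi> p n k l)"

definition tuple_lebesgue ::
    "('a::cstar_algebra \<Rightarrow> complex) \<Rightarrow> (nat \<Rightarrow> 'a) \<Rightarrow> nat \<Rightarrow> nat \<Rightarrow> nat \<Rightarrow> nat
       \<Rightarrow> (nat \<Rightarrow> complex Matrix.mat) measure" where
  "tuple_lebesgue \<phi> p n k l m = Pi\<^sub>M {1..m} (\<lambda>_. block_lebesgue \<phi> p n k l)"

section \<open>Free entropy\<close>

text \<open>
  A word is a list of pairs \<open>(i, s)\<close>; the Boolean \<open>s\<close> says whether the letter of index \<open>i\<close> carries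
  a star.
\<close>

definition word :: "(nat \<Rightarrow> 'a::cstar_algebra) \<Rightarrow> (nat \<times> bool) list \<Rightarrow> 'a" where
  "word a w = prod_list (map (\<lambda>(i, s). if s then star (a i) else a i) w)"

definition mat_word ::
    "nat \<Rightarrow> (nat \<Rightarrow> complex Matrix.mat) \<Rightarrow> (nat \<times> bool) list \<Rightarrow> complex Matrix.mat" where
  "mat_word n A w =
     foldr (*) (map (\<lambda>(i, s). if s then mat_adjoint (A i) else A i) w) (1\<^sub>m n)"

definition microstates ::
    "('a::cstar_algebra \<Rightarrow> complex) \<Rightarrow> nat \<Rightarrow> (nat \<Rightarrow> 'a) \<Rightarrow> nat \<Rightarrow> nat \<Rightarrow> real \<Rightarrow> nat \<Rightarrow> (nat \<Rightarrow> 'a)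
       \<Rightarrow> nat \<Rightarrow> nat \<Rightarrow> real \<Rightarrow> (nat \<Rightarrow> complex Matrix.mat) set" where
  "microstates \<phi> d p k l R m a n r \<epsilon> =
     {A \<in> {1..m} \<rightarrow>\<^sub>E block_matrices \<phi> p n k l.
        (\<forall>i\<in>{1..m}. mat_op_norm (A i) \<le> R) \<and>
        (\<forall>w. 1 \<le> length w \<and> length w \<le> r \<and> fst ` set w \<subseteq> {1..m} \<longrightarrow>
           norm (mat_cond_exp \<phi> d p n (mat_word n A w) - cond_exp \<phi> d p (word a w)) \<le> \<epsilon>)}"

definition ln_ennreal :: "ennreal \<Rightarrow> ereal" where
  "ln_ennreal v =
     (if v = 0 then - \<infinity> else if v = \<infinity> then \<infinity> else ereal (ln (enn2real v)))"

definition free_entropy ::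
    "('a::cstar_algebra \<Rightarrow> complex) \<Rightarrow> nat \<Rightarrow> (nat \<Rightarrow> 'a) \<Rightarrow> nat \<Rightarrow> nat \<Rightarrow> nat \<Rightarrow> (nat \<Rightarrow> 'a) \<Rightarrow> ereal"
  where
  "free_entropy \<phi> d p k l m a =
     (SUP R\<in>{0<..}. INF r\<in>{1..}. INF \<epsilon>\<in>{0<..}.
        limsup (\<lambda>n.
          ereal (1 / (real n)\<^sup>2) *
            ln_ennreal (emeasure (tuple_lebesgue \<phi> p n k l m) (microstates \<phi> d p k l R m a n r \<epsilon>))
          + ereal (real m * rho \<phi> p k * rho \<phi> p l * ln (real n))))"

end

theory Submission
  imports Defs
begin

text \<open>
  For a word \<open>w\<close> and a block projection \<open>P\<close>, the vector field \<open>A\<^sub>i \<mapsto> [P w(A) P, A\<^sub>i]\<close> on tuples of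
  matrices has as divergence the matricial version \<open>\<Delta>(A)\<close> of the liberation gradient of \<open>w\<close>, and
  it annihilates every trace polynomial in a single matrix, so also a cut-off to the matrices
  \<open>A\<^sub>1, \<dots>, A\<^sub>N\<close> that are separately microstates of \<open>a\<^sub>1, \<dots>, a\<^sub>N\<close>. Integrating by
  parts bounds the moments of \<open>\<Delta>\<close> recursively: the one of order \<open>2s\<close> is at most \<open>2s K n\<^sup>2\<close> times the
  one of order \<open>2s - 2\<close>, the constant \<open>K\<close> coming from a chessboard estimate for traces and hence only
  from moments of the \<open>a\<^sub>i\<close>. If the liberation gradient does not vanish, then \<open>|\<Delta>|\<close> is of order \<open>n\<^sup>2\<close>
  on the joint microstates, and Markov's inequality with \<open>s\<close> of order \<open>n\<^sup>2\<close> makes them a fraction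
  \<open>exp(- \<gamma> n\<^sup>2)\<close> of the product of the separate ones, which contradicts additivity of the entropy.
  A vanishing liberation gradient forces freeness, by induction on the length of alternating words.
\<close>

section \<open>Freeness from a vanishing liberation gradient\<close>

text \<open>For antihermitian block diagonal \<open>E\<close> the field [E, A_i] conjugates
  \<open>A_i\<close> by unitaries and leaves the other matrices alone. It fixes the law of each
  single matrix and moves only the joint law, whereas additivity makes the joint microstates, on the
  scale exp(n^2), as large as the product of the separate ones. Three obstacles shape the argument.
  The operator norm is not differentiable; the cut-off uses instead the trace of a power of A* A
  whose exponent depends on \<open>n\<close>, so that passing between norm and trace costs only
  \<open>R\<close> to \<open>R + 1\<close>. The entropy takes a supremum over \<open>R\<close>, so
  the rate \<gamma> has to be independent of \<open>R\<close>: words are bounded through traces,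
  each at most a constant times \<open>n\<close>, never through operator norms. The gradient is
  complex valued, so its conjugate is carried along as a second trace polynomial, and derivatives
  are taken complex linearly in matrix units. In the algebraic half the derivation is compressed by
  \<open>p j\<close>, which puts the non-zero factor \<open>\<phi> (p j)\<close> in front of the
  moment that is to vanish.\<close>

text \<open>
  \<open>(\<phi> \<otimes> \<phi>)(q (u \<cdot> \<delta> v) q)\<close> for the derivation \<open>\<delta>\<close> with \<open>\<delta> x = 1 \<otimes> x - x \<otimes> 1\<close> on letters of
  index \<open>i\<close> and \<open>\<delta> x = 0\<close> on the others. Letters carry their index, since it cannot be read off from
  the element.
\<close>

fun liberation_gradient ::
    "('a::cstar_algebra \<Rightarrow> complex) \<Rightarrow> nat \<Rightarrow> 'a \<Rightarrow> 'a \<Rightarrow> (nat \<times> 'a) list \<Rightarrow> complex" where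
  "liberation_gradient \<phi> i q u [] = 0"
| "liberation_gradient \<phi> i q u ((i', x) # v) =
     (if i' = i
      then \<phi> (u * q) * \<phi> (q * x * prod_list (map snd v)) -
           \<phi> (u * x * q) * \<phi> (q * prod_list (map snd v))
      else 0) + liberation_gradient \<phi> i q (u * x) v"

definition letter :: "(nat \<Rightarrow> 'a::cstar_algebra) \<Rightarrow> nat \<times> bool \<Rightarrow> nat \<times> 'a" where
  "letter a = (\<lambda>(i, s). (i, if s then star (a i) else a i))"

lemma snd_letter: "snd (letter a x) = (if snd x then star (a (fst x)) else a (fst x))"
  by (simp add: letter_def case_prod_beta)

lemma fst_letter: "fst (letter a x) = fst x"
  by (simp add: letter_def case_prod_beta)

text \<open>These are the algebras that turn out to be free. Keeping star out of the constructors
  leaves only cases that the liberation gradient respects; closure under star follows since the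
  generators are closed under it.\<close>

inductive_set generated_algebra :: "nat \<Rightarrow> (nat \<Rightarrow> 'a::cstar_algebra) \<Rightarrow> 'a \<Rightarrow> 'a set"
  for d p x where
  proj: "j \<in> {1..d} \<Longrightarrow> p j \<in> generated_algebra d p x"
| elem: "x \<in> generated_algebra d p x"
| elem_star: "star x \<in> generated_algebra d p x"
| add: "y \<in> generated_algebra d p x \<Longrightarrow> z \<in> generated_algebra d p x \<Longrightarrow>
        y + z \<in> generated_algebra d p x"
| mult: "y \<in> generated_algebra d p x \<Longrightarrow> z \<in> generated_algebra d p x \<Longrightarrow>
        y * z \<in> generated_algebra d p x"
| scale: "y \<in> generated_algebra d p x \<Longrightarrow> c *\<^sub>C y \<in> generated_algebra d p x"

section \<open>Scalars, the trace and the diagonal projections\<close>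

lemma scaleC_zero_left [simp]: "0 *\<^sub>C (x::'a::cstar_algebra) = 0"
  by (metis of_real_0 scaleR_scaleC scaleR_zero_left)

lemma scaleC_zero_right [simp]: "c *\<^sub>C (0::'a::cstar_algebra) = 0"
  by (metis mult_scaleC_right mult_zero_left mult_zero_right)

lemma scaleC_one [simp]: "1 *\<^sub>C (x::'a::cstar_algebra) = x"
  by (metis of_real_1 scaleR_one scaleR_scaleC)

locale rect_space =
  fixes \<phi> :: "'a::cstar_algebra \<Rightarrow> complex" and p :: "nat \<Rightarrow> 'a" and d :: nat
  assumes tracial: "tracial_wstar_probability_space \<phi>"
    and part: "projection_partition d p"
begin

lemma phi_add: "\<phi> (x + y) = \<phi> x + \<phi> y"
  and phi_scale: "\<phi> (c *\<^sub>C x) = c * \<phi> x"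
  and phi_one: "\<phi> 1 = 1"
  and phi_pos: "Im (\<phi> (star x * x)) = 0" "0 \<le> Re (\<phi> (star x * x))"
  and phi_faithful: "\<phi> (star x * x) = 0 \<Longrightarrow> x = 0"
  and phi_comm: "\<phi> (x * y) = \<phi> (y * x)"
  using tracial by (auto simp: tracial_wstar_probability_space_def complex_linear_def)

lemma p_star: "i \<in> {1..d} \<Longrightarrow> star (p i) = p i"
  and p_idem: "i \<in> {1..d} \<Longrightarrow> p i * p i = p i"
  and p_nonzero: "i \<in> {1..d} \<Longrightarrow> p i \<noteq> 0"
  and p_orth: "i \<in> {1..d} \<Longrightarrow> j \<in> {1..d} \<Longrightarrow> i \<noteq> j \<Longrightarrow> p i * p j = 0"
  and p_sum: "(\<Sum>i=1..d. p i) = 1"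
  using part by (auto simp: projection_partition_def)

lemma phi_zero: "\<phi> 0 = 0"
  using phi_scale[of 0 0] by simp

lemma phi_sum: "\<phi> (sum f S) = (\<Sum>x\<in>S. \<phi> (f x))"
  by (induction S rule: infinite_finite_induct) (auto simp: phi_zero phi_add)

lemma rho_pos: "i \<in> {1..d} \<Longrightarrow> rho \<phi> p i > 0"
  and phi_p: "i \<in> {1..d} \<Longrightarrow> \<phi> (p i) = of_real (rho \<phi> p i)"
proof -
  assume i: "i \<in> {1..d}"
  have *: "star (p i) * p i = p i" using i by (simp add: p_star p_idem)
  show 1: "\<phi> (p i) = of_real (rho \<phi> p i)"
    using phi_pos(1)[of "p i"] unfolding * by (simp add: rho_def complex_eq_iff)
  have "\<phi> (p i) \<noteq> 0" using phi_faithful[of "p i"] * p_nonzero[OF i] by auto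
  thus "rho \<phi> p i > 0" using phi_pos(2)[of "p i"] 1 unfolding *
    by (metis Re_complex_of_real of_real_0 order_le_less)
qed

lemma rho_sum: "(\<Sum>i=1..d. rho \<phi> p i) = 1"
proof -
  have "complex_of_real (\<Sum>i=1..d. rho \<phi> p i) = (\<Sum>i=1..d. \<phi> (p i))"
    by (simp add: phi_p)
  also have "\<dots> = 1" by (simp only: phi_sum[symmetric] p_sum phi_one)
  finally show ?thesis by (metis of_real_eq_1_iff)
qed

lemma p_mult_diag: 
  assumes "j \<in> {1..d}"
  shows "p j * (\<Sum>i=1..d. c i *\<^sub>C p i) = c j *\<^sub>C p j"
proof -
  have "p j * (\<Sum>i=1..d. c i *\<^sub>C p i) = (\<Sum>i=1..d. if i = j then c j *\<^sub>C p j else 0)"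
    unfolding sum_distrib_left
    by (rule sum.cong) (use assms in \<open>auto simp: mult_scaleC_right p_idem p_orth\<close>)
  thus ?thesis using assms by simp
qed

lemma phi_cut: "j \<in> {1..d} \<Longrightarrow> \<phi> (p j * x * p j) = \<phi> (p j * x)"
  by (metis mult.assoc p_idem phi_comm)

lemma cond_exp_eq: "cond_exp \<phi> d p x = (\<Sum>i=1..d. (\<phi> (p i * x) / of_real (rho \<phi> p i)) *\<^sub>C p i)"
  unfolding cond_exp_def by (rule sum.cong) (auto simp: phi_cut)

lemma scaleC_p_eq_0: "j \<in> {1..d} \<Longrightarrow> c *\<^sub>C p j = 0 \<longleftrightarrow> c = 0"
  using norm_scaleC[of c "p j"] p_nonzero[of j] by auto

text \<open>Multiplication by \<open>p j\<close> isolates one coefficient, so being centred becomes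
  \<open>d\<close> scalar conditions on the trace, the form in which it enters the induction on
  words.\<close>

lemma cond_exp_zero_iff: "cond_exp \<phi> d p x = 0 \<longleftrightarrow> (\<forall>j\<in>{1..d}. \<phi> (p j * x) = 0)"
proof
  assume *: "cond_exp \<phi> d p x = 0"
  show "\<forall>j\<in>{1..d}. \<phi> (p j * x) = 0"
  proof
    fix j assume j: "j \<in> {1..d}"
    have "p j * cond_exp \<phi> d p x = (\<phi> (p j * x) / of_real (rho \<phi> p j)) *\<^sub>C p j"
      unfolding cond_exp_eq by (rule p_mult_diag[OF j])
    thus "\<phi> (p j * x) = 0" using * rho_pos[OF j] scaleC_p_eq_0[OF j] by auto
  qed
qed (simp add: cond_exp_eq)

lemma phi_cond_exp: "j \<in> {1..d} \<Longrightarrow> \<phi> (p j * cond_exp \<phi> d p x) = \<phi> (p j * x)"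
  unfolding cond_exp_eq using rho_pos[of j]
  by (subst p_mult_diag) (auto simp: phi_scale phi_p)

lemma phi_split: "\<phi> x = (\<Sum>j=1..d. \<phi> (p j * x))"
proof -
  have "\<phi> x = \<phi> ((\<Sum>j=1..d. p j) * x)" by (simp only: p_sum mult_1)
  thus ?thesis by (simp add: sum_distrib_right phi_sum)
qed

section \<open>Linearity and product rules of the liberation gradient\<close>

lemma lg_add_left:
  "liberation_gradient \<phi> i q (u + u') v =
   liberation_gradient \<phi> i q u v + liberation_gradient \<phi> i q u' v"
  by (induction v arbitrary: u u') (auto simp: phi_add algebra_simps)

lemma lg_scale_left:
  "liberation_gradient \<phi> i q (c *\<^sub>C u) v = c * liberation_gradient \<phi> i q u v"
  by (induction v arbitrary: u) (auto simp: phi_scale algebra_simps mult_scaleC_left)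

lemma lg_zero_left: "liberation_gradient \<phi> i q 0 v = 0"
  using lg_scale_left[of i q 0 0 v] by simp

lemma lg_add:
  "liberation_gradient \<phi> i q u (us @ (i', x + y) # vs) =
   liberation_gradient \<phi> i q u (us @ (i', x) # vs) + liberation_gradient \<phi> i q u (us @ (i', y) # vs)"
  by (induction us arbitrary: u) (auto simp: phi_add lg_add_left algebra_simps)

lemma lg_scale:
  "liberation_gradient \<phi> i q u (us @ (i', c *\<^sub>C x) # vs) =
   c * liberation_gradient \<phi> i q u (us @ (i', x) # vs)"
  by (induction us arbitrary: u)
    (auto simp: phi_scale lg_scale_left algebra_simps mult_scaleC_left mult_scaleC_right)

lemma lg_zero: "liberation_gradient \<phi> i q u (us @ (i', 0) # vs) = 0"
  using lg_scale[of i q u us i' 0 0 vs] by simp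

text \<open>The derivation rule: the terms with x on the left and y on the right of the tensor sign
  cancel. A product may therefore be cut into two letters of the same index.\<close>

lemma lg_mult:
  "liberation_gradient \<phi> i q u (us @ (i', x * y) # vs) =
   liberation_gradient \<phi> i q u (us @ (i', x) # (i', y) # vs)"
  by (induction us arbitrary: u) (auto simp: mult.assoc)

text \<open>Compressed by \<open>p j\<close>, the two terms of the letter \<open>p j'\<close>
  coincide if j = j' and vanish otherwise. Projections contribute nothing, whatever index they
  carry.\<close>

lemma lg_proj:
  assumes "j \<in> {1..d}" "j' \<in> {1..d}"
  shows "liberation_gradient \<phi> i (p j) u ((i', p j') # vs) = liberation_gradient \<phi> i (p j) (u * p j') vs"
proof (cases "j = j'")
  case True
  thus ?thesis using assms by (simp add: p_idem mult.assoc)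
next
  case False
  thus ?thesis using assms by (simp add: p_orth mult.assoc phi_zero)
qed

text \<open>As the projection makes no contribution of its own, it may be absorbed into the letter
  before it, even when the two carry different indices.\<close>

lemma lg_mult_proj:
  assumes "j \<in> {1..d}" "j' \<in> {1..d}"
  shows "liberation_gradient \<phi> i (p j) u (us @ (i', y) # (i'', p j') # vs) =
         liberation_gradient \<phi> i (p j) u (us @ (i', y * p j') # vs)"
proof (induction us arbitrary: u)
  case Nil
  have "\<phi> (u * y * p j) * \<phi> (p j * (p j' * P)) = \<phi> (u * (y * p j') * p j) * \<phi> (p j * P)" for P
    using assms by (cases "j = j'") (auto simp: p_orth p_idem mult.assoc[symmetric] phi_zero
        , simp_all add: mult.assoc p_idem p_orth phi_zero)
  thus ?case using lg_proj[OF assms] by (simp add: mult.assoc)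
qed (auto simp: mult.assoc)

text \<open>The counterpart for a projection with no letter before it: it is absorbed into the
  letter after it.\<close>

lemma lg_proj_left:
  assumes "j \<in> {1..d}" "j' \<in> {1..d}"
  shows "liberation_gradient \<phi> i (p j) (p j') ((i', y) # vs) =
         liberation_gradient \<phi> i (p j) 1 ((i', p j' * y) # vs)"
proof -
  have "\<phi> (p j' * p j) * \<phi> (p j * y * P) = \<phi> (1 * p j) * \<phi> (p j * (p j' * y) * P)" for P
    using assms by (cases "j = j'") (auto simp: p_orth p_idem mult.assoc[symmetric] phi_zero)
  thus ?thesis by (simp add: mult.assoc)
qed

lemma generated_zero: "0 \<in> generated_algebra d p x"
  using generated_algebra.scale[OF generated_algebra.elem, where c=0] by simp

lemma generated_diag: "S \<subseteq> {1..d} \<Longrightarrow> (\<Sum>i\<in>S. c i *\<^sub>C p i) \<in> generated_algebra d p x"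
proof (induction S rule: infinite_finite_induct)
  case (insert i S)
  thus ?case by (auto intro!: generated_algebra.add generated_algebra.scale generated_algebra.proj)
qed (auto simp: generated_zero)

lemma generated_star: "y \<in> generated_algebra d p x \<Longrightarrow> star y \<in> generated_algebra d p x"
proof (induction rule: generated_algebra.induct)
  case (proj j) thus ?case using p_star by (auto intro: generated_algebra.proj)
qed (auto simp: star_star star_add star_mult star_scaleC intro: generated_algebra.intros)

section \<open>Letters of type (k, l) under the diagonal projections\<close>

context
  fixes N k l :: nat and a :: "nat \<Rightarrow> 'a"
  assumes kl: "k \<in> {1..d}" "l \<in> {1..d}" "k \<noteq> l"
    and types: "\<And>i. i \<in> {1..N} \<Longrightarrow> has_type p k l (a i)"
begin

lemma type_left: "i \<in> {1..N} \<Longrightarrow> j \<in> {1..d} \<Longrightarrow> p j * a i = (if j = k then a i else 0)"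
  using types[of i] kl p_orth[of j k] unfolding has_type_def
  by (auto simp: mult.assoc[symmetric] p_idem)

lemma type_right: "i \<in> {1..N} \<Longrightarrow> j \<in> {1..d} \<Longrightarrow> a i * p j = (if j = l then a i else 0)"
  using types[of i] kl p_orth[of l j] unfolding has_type_def
  by (auto simp: mult.assoc p_idem)

lemma type_star_left: "i \<in> {1..N} \<Longrightarrow> j \<in> {1..d} \<Longrightarrow> p j * star (a i) = (if j = l then star (a i) else 0)"
  using type_right[of i j] p_star[of j]
  by (metis star_mult scaleC_zero_left star_scaleC complex_cnj_zero)

lemma type_star_right: "i \<in> {1..N} \<Longrightarrow> j \<in> {1..d} \<Longrightarrow> star (a i) * p j = (if j = k then star (a i) else 0)"
  using type_left[of i j] p_star[of j]
  by (metis star_mult scaleC_zero_left star_scaleC complex_cnj_zero)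

text \<open>By homogeneity a projection either keeps a letter or kills it. Absorbing projections
  thus never leads out of the words in the letters, up to 0.\<close>

lemma letter_proj_left:
  "fst x \<in> {1..N} \<Longrightarrow> j \<in> {1..d} \<Longrightarrow> p j * snd (letter a x) = snd (letter a x) \<or> p j * snd (letter a x) = 0"
  by (auto simp: snd_letter type_left type_star_left)

lemma letter_proj_right:
  "fst x \<in> {1..N} \<Longrightarrow> j \<in> {1..d} \<Longrightarrow> snd (letter a x) * p j = snd (letter a x) \<or> snd (letter a x) * p j = 0"
  by (auto simp: snd_letter type_right type_star_right)

section \<open>From words in the letters to words in the generated algebras\<close>

context
  fixes i j :: nat
  assumes i: "i \<in> {1..N}" and j: "j \<in> {1..d}"
    and lg_words: "\<And>w. fst ` set w \<subseteq> {1..N} \<Longrightarrow> liberation_gradient \<phi> i (p j) 1 (map (letter a) w) = 0"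
begin

text \<open>A tail \<open>vs\<close> that annihilates the gradient behind every word in the letters.
  The initial factor \<open>e\<close> records a projection that has reached the front, as happens in
  the projection case of \<open>good_Cons\<close>.\<close>

definition good :: "(nat \<times> 'a) list \<Rightarrow> bool" where
  "good vs \<longleftrightarrow> (\<forall>w e. fst ` set w \<subseteq> {1..N} \<and> (e = 1 \<or> (\<exists>j'\<in>{1..d}. e = p j')) \<longrightarrow>
     liberation_gradient \<phi> i (p j) e (map (letter a) w @ vs) = 0)"

lemma good_Nil: "good []"
  unfolding good_def
proof (intro allI impI, elim conjE)
  fix w :: "(nat \<times> bool) list" and e
  assume w: "fst ` set w \<subseteq> {1..N}" and e: "e = 1 \<or> (\<exists>j'\<in>{1..d}. e = p j')"
  show "liberation_gradient \<phi> i (p j) e (map (letter a) w @ []) = 0"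
  proof (cases "e = 1")
    case False
    then obtain j' where j': "j' \<in> {1..d}" "e = p j'" using e by auto
    show ?thesis
    proof (cases w)
      case (Cons x w')
      have x: "letter a x = (fst x, snd (letter a x))" by (metis fst_letter prod.collapse)
      have fx: "fst x \<in> {1..N}" using w Cons by auto
      have "liberation_gradient \<phi> i (p j) e (map (letter a) w @ []) =
            liberation_gradient \<phi> i (p j) 1 ([] @ (fst x, p j' * snd (letter a x)) # map (letter a) w')"
        using lg_proj_left[OF j j'(1)] j'(2) x Cons by (metis append_Nil append_Nil2 list.simps(9))
      also have "\<dots> = 0"
        using letter_proj_left[OF fx j'(1)] lg_words[OF w] Cons x lg_zero[of i "p j" 1 "[]"]
        by (metis append_Nil list.simps(9))
      finally show ?thesis .
    qed simp
  qed (use lg_words[OF w] in auto)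
qed

text \<open>Induction over the algebra: a projection is absorbed to its left, a letter joins the
  word in front, sums and multiples use linearity, and a product is cut into two letters. The last
  case is why the tail has to be arbitrary.\<close>

lemma good_Cons:
  assumes "x \<in> generated_algebra d p (a i')" "i' \<in> {1..N}" "good vs"
  shows "good ((i', x) # vs)"
  using assms(1,3)
proof (induction arbitrary: vs rule: generated_algebra.induct)
  case (proj j')
  show ?case unfolding good_def
  proof (intro allI impI, elim conjE)
    fix w :: "(nat \<times> bool) list" and e
    assume w: "fst ` set w \<subseteq> {1..N}" and e: "e = 1 \<or> (\<exists>j'\<in>{1..d}. e = p j')"
    show "liberation_gradient \<phi> i (p j) e (map (letter a) w @ (i', p j') # vs) = 0"
    proof (cases w rule: rev_cases)
      case Nil
      have "e * p j' = 0 \<or> (\<exists>j''\<in>{1..d}. e * p j' = p j'')"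
        using e proj(1) p_orth p_idem by (metis mult_1)
      hence cases: "e * p j' \<noteq> 0 \<Longrightarrow> \<exists>j'a\<in>{1..d}. e * p j' = p j'a" by blast
      have "liberation_gradient \<phi> i (p j) (e * p j') vs = 0"
      proof (cases "e * p j' = 0")
        case False
        from cases[OF False] show ?thesis
          using proj(2)[unfolded good_def, rule_format, of "[]" "e * p j'"] by simp
      qed (simp only: lg_zero_left)
      thus ?thesis using Nil lg_proj[OF j proj(1)] by simp
    next
      case (snoc w' y)
      have y: "letter a y = (fst y, snd (letter a y))" by (metis fst_letter prod.collapse)
      have fy: "fst y \<in> {1..N}" using w snoc by auto
      have "liberation_gradient \<phi> i (p j) e (map (letter a) w @ (i', p j') # vs) =
        liberation_gradient \<phi> i (p j) e (map (letter a) w' @ (fst y, snd (letter a y) * p j') # vs)"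
        using lg_mult_proj[OF j proj(1), of i e "map (letter a) w'" "fst y" "snd (letter a y)"] snoc
        by (simp flip: y)
      also have "\<dots> = 0" 
        using letter_proj_right[OF fy proj(1)]
      proof
        assume "snd (letter a y) * p j' = snd (letter a y)"
        moreover have "liberation_gradient \<phi> i (p j) e (map (letter a) w @ vs) = 0"
          using proj(2) w e unfolding good_def by blast
        ultimately show ?thesis using y snoc by simp
      qed (simp add: lg_zero)
      finally show ?thesis .
    qed
  qed
next
  case elem
  have "liberation_gradient \<phi> i (p j) e (map (letter a) w @ (i', a i') # vs) = 0" 
    if "fst ` set w \<subseteq> {1..N}" "e = 1 \<or> (\<exists>j'\<in>{1..d}. e = p j')" for w e
  proof -
    have "liberation_gradient \<phi> i (p j) e (map (letter a) (w @ [(i', False)]) @ vs) = 0"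
      using elem that assms(2) unfolding good_def by (intro elem[unfolded good_def, rule_format]) auto
    thus ?thesis by (simp add: letter_def)
  qed
  thus ?case by (auto simp: good_def)
next
  case elem_star
  have "liberation_gradient \<phi> i (p j) e (map (letter a) w @ (i', star (a i')) # vs) = 0" 
    if "fst ` set w \<subseteq> {1..N}" "e = 1 \<or> (\<exists>j'\<in>{1..d}. e = p j')" for w e
  proof -
    have "liberation_gradient \<phi> i (p j) e (map (letter a) (w @ [(i', True)]) @ vs) = 0"
      using that assms(2) by (intro elem_star[unfolded good_def, rule_format]) auto
    thus ?thesis by (simp add: letter_def)
  qed
  thus ?case by (auto simp: good_def)
next
  case (add y z)
  thus ?case by (auto simp: good_def lg_add)
next
  case (mult y z)
  have "good ((i', y) # (i', z) # vs)" using mult by blast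
  thus ?case by (auto simp: good_def lg_mult)
next
  case (scale y c)
  thus ?case by (auto simp: good_def lg_scale)
qed

lemma lg_generated:
  assumes "\<And>x. x \<in> set xs \<Longrightarrow> fst x \<in> {1..N} \<and> snd x \<in> generated_algebra d p (a (fst x))"
  shows "liberation_gradient \<phi> i (p j) 1 xs = 0"
proof -
  have "good xs" using assms
  proof (induction xs)
    case (Cons x xs)
    thus ?case using good_Cons[of "snd x" "fst x" xs] by auto
  qed (rule good_Nil)
  thus ?thesis unfolding good_def by (metis append_Nil empty_set empty_subsetI image_empty list.simps(8))
qed

end

text \<open>Each term of the gradient has as left factor the trace of \<open>u\<close> times a
  prefix of \<open>v\<close>. Only the second term of the last letter involves all of
  \<open>v\<close>, and the condition on the last index removes it.\<close>

lemma lg_zero_if: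
  assumes "\<And>v1 v2. v = v1 @ v2 \<Longrightarrow> v2 \<noteq> [] \<Longrightarrow> \<phi> (u * prod_list (map snd v1) * q) = 0"
    and "v \<noteq> [] \<Longrightarrow> fst (last v) \<noteq> i"
  shows "liberation_gradient \<phi> i q u v = 0"
  using assms
proof (induction v arbitrary: u)
  case (Cons x v)
  obtain i' y where x: "x = (i', y)" by force
  have 1: "\<phi> (u * q) = 0" using Cons(2)[of "[]" "x # v"] by simp
  have 2: "\<phi> (u * y * q) = 0" if "v \<noteq> []" using Cons(2)[of "[x]" "v"] that x by simp
  have 3: "v = [] \<Longrightarrow> i' \<noteq> i" using Cons(3) x by simp
  have "liberation_gradient \<phi> i q (u * y) v = 0"
  proof (rule Cons.IH)
    fix v1 v2 assume "v = v1 @ v2" "v2 \<noteq> []"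
    thus "\<phi> (u * y * prod_list (map snd v1) * q) = 0"
      using Cons(2)[of "x # v1" v2] x by (simp add: mult.assoc)
  qed (use Cons(3) in auto)
  thus ?case using 1 2 3 x by (cases "v = []") auto
qed simp

text \<open>If the last index differs from the first, the gradient for the first index reduces to
  \<open>\<phi> (p j)\<close> times the moment in question: every other term has as factor the trace
  of a shorter alternating word, zero by induction. If the two indices agree, the trace allows the
  last letter to be moved to the front and merged with the first.\<close>

lemma alternating_zero:
  assumes lg: "\<And>i j w. i \<in> {1..N} \<Longrightarrow> j \<in> {1..d} \<Longrightarrow> fst ` set w \<subseteq> {1..N} \<Longrightarrow>
             liberation_gradient \<phi> i (p j) 1 (map (letter a) w) = 0"
    and "\<And>x. x \<in> set xs \<Longrightarrow> fst x \<in> {1..N} \<and> snd x \<in> generated_algebra d p (a (fst x)) \<and>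
             cond_exp \<phi> d p (snd x) = 0"
    and "distinct_adj (map fst xs)" and "xs \<noteq> []" and "j \<in> {1..d}"
  shows "\<phi> (p j * prod_list (map snd xs)) = 0"
  using assms(2-)
proof (induction "length xs" arbitrary: xs j rule: less_induct)
  case less
  define P where "P = (\<lambda>xs :: (nat \<times> 'a) list. prod_list (map snd xs))"
  obtain i x v where xs: "xs = (i, x) # v" using less.prems(3) by (cases xs) auto
  have i: "i \<in> {1..N}" and x: "x \<in> generated_algebra d p (a i)" 
    and Ex: "\<And>j. j \<in> {1..d} \<Longrightarrow> \<phi> (p j * x) = 0"
    using less.prems(1)[of "(i, x)"] xs by (auto simp: cond_exp_zero_iff)
  show ?case
  proof (cases "v \<noteq> [] \<and> fst (last v) = i")
    case False
    have "liberation_gradient \<phi> i (p j) 1 xs = 0"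
      by (rule lg_generated[OF i less.prems(4) lg[OF i less.prems(4)]]) (use less.prems in auto)
    moreover have "liberation_gradient \<phi> i (p j) x v = 0"
    proof (rule lg_zero_if)
      fix v1 v2 assume v: "v = v1 @ v2" "v2 \<noteq> []"
      have "\<phi> (p j * prod_list (map snd ((i, x) # v1))) = 0"
      proof (rule less.hyps)
        show "distinct_adj (map fst ((i, x) # v1))"
          using less.prems(2) xs v(1) by (metis append_Cons distinct_adj_appendD1 map_append)
      qed (use less.prems xs v in auto)
      thus "\<phi> (x * prod_list (map snd v1) * p j) = 0" using phi_comm[of "p j"] by simp
    qed (use False in auto)
    moreover have "\<phi> (x * p j) = 0" using Ex[OF less.prems(4)] phi_comm[of "p j"] by simp
    ultimately have "\<phi> (p j) * \<phi> (p j * P xs) = 0"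
      using xs by (simp add: P_def mult.assoc)
    thus ?thesis using phi_p[OF less.prems(4)] rho_pos[OF less.prems(4)] by (simp add: P_def)
  next
    case True
    then obtain ys y where v: "v = ys @ [(i, y)]" 
      by (metis append_butlast_last_id prod.collapse)
    have ys: "ys \<noteq> []" using less.prems(2) xs v by auto
    have y: "y \<in> generated_algebra d p (a i)" using less.prems(1)[of "(i, y)"] xs v by auto
    \<comment> \<open>Cyclicity joins the last letter to the first. Recentring \<open>z\<close>
      gives an alternating word one letter shorter, and its expectation, lying in the diagonal
      algebra, leaves \<open>ys\<close>, two letters shorter.\<close>
    define z where "z = y * p j * x"
    define e where "e = cond_exp \<phi> d p z"
    have z: "z \<in> generated_algebra d p (a i)" unfolding z_def
      by (intro generated_algebra.mult y x generated_algebra.proj less.prems)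
    have "(-1) *\<^sub>C e \<in> generated_algebra d p (a i)" unfolding e_def cond_exp_eq
      by (intro generated_algebra.scale generated_diag) auto
    hence zm: "z + (-1) *\<^sub>C e \<in> generated_algebra d p (a i)"
      by (intro generated_algebra.add z)
    have Ez: "\<phi> (p j' * (z + (-1) *\<^sub>C e)) = 0" if "j' \<in> {1..d}" for j'
      using that by (simp add: distrib_left phi_add phi_scale mult_scaleC_right e_def phi_cond_exp)
    have ad: "distinct_adj (map fst ((i, z + (-1) *\<^sub>C e) # ys))" "distinct_adj (map fst ys)"
      using less.prems(2) xs v by (auto simp: distinct_adj_Cons distinct_adj_append_iff)
    have A: "\<phi> (p j' * ((z + (-1) *\<^sub>C e) * P ys)) = 0" if "j' \<in> {1..d}" for j'
    proof -
      have "\<phi> (p j' * prod_list (map snd ((i, z + (-1) *\<^sub>C e) # ys))) = 0"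
      proof (rule less.hyps[OF _ _ ad(1) _ that])
        fix t assume "t \<in> set ((i, z + (-1) *\<^sub>C e) # ys)"
        hence "t = (i, z + (-1) *\<^sub>C e) \<or> t \<in> set xs" using xs v by auto
        thus "fst t \<in> {1..N} \<and> snd t \<in> generated_algebra d p (a (fst t)) \<and> cond_exp \<phi> d p (snd t) = 0"
          using less.prems(1)[of t] zm Ez i cond_exp_zero_iff[of "z + (-1) *\<^sub>C e"] by auto
      qed (use xs v in auto)
      thus ?thesis by (simp add: P_def)
    qed
    have B: "\<phi> (p j' * P ys) = 0" if "j' \<in> {1..d}" for j'
      unfolding P_def by (rule less.hyps) (use that ad ys less.prems(1) xs v in auto)
    have "\<phi> (p j * P xs) = \<phi> (p j * x * P ys * y)" by (simp add: P_def xs v mult.assoc)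
    also have "\<dots> = \<phi> (y * (p j * x * P ys))" by (rule phi_comm)
    also have "\<dots> = \<phi> (z * P ys)" by (simp add: z_def mult.assoc)
    also have "z = (z + (-1) *\<^sub>C e) + e"
      using scaleC_add_left[of "-1" 1 e] by (simp add: add.assoc)
    also have "\<phi> (\<dots> * P ys) = \<phi> ((z + (-1) *\<^sub>C e) * P ys) + \<phi> (e * P ys)"
      by (simp only: distrib_right phi_add)
    also have "\<phi> ((z + (-1) *\<^sub>C e) * P ys) = 0"
      by (subst phi_split) (simp add: A)
    also have "\<phi> (e * P ys) = 0"
      unfolding e_def cond_exp_eq
      by (simp add: sum_distrib_right phi_sum mult_scaleC_left phi_scale B)
    finally show ?thesis by (simp add: P_def)
  qed
qed

theorem free_if_lg_zero:
  assumes lg: "\<And>i j w. i \<in> {1..N} \<Longrightarrow> j \<in> {1..d} \<Longrightarrow> fst ` set w \<subseteq> {1..N} \<Longrightarrow>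
             liberation_gradient \<phi> i (p j) 1 (map (letter a) w) = 0"
  shows "free_with_amalgamation \<phi> d p N a"
  unfolding free_with_amalgamation_def free_subalgebras_def
proof (intro exI[of _ "\<lambda>i. generated_algebra d p (a i)"] conjI ballI allI impI)
  fix i
  show "star_subalgebra (generated_algebra d p (a i))"
    unfolding star_subalgebra_def
    by (auto intro: generated_zero generated_star generated_algebra.intros)
  show "diagonal_algebra d p \<subseteq> generated_algebra d p (a i)"
    unfolding diagonal_algebra_def using generated_diag by blast
  show "a i \<in> generated_algebra d p (a i)" by (rule generated_algebra.elem)
next
  fix m ix and x :: "nat \<Rightarrow> 'a"
  assume *: "1 \<le> m \<and>
        (\<forall>j\<in>{1..m}. ix j \<in> {1..N} \<and> x j \<in> generated_algebra d p (a (ix j)) \<and> cond_exp \<phi> d p (x j) = 0) \<and>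
        (\<forall>j\<in>{1..<m}. ix j \<noteq> ix (j + 1))"
  define xs where "xs = map (\<lambda>j. (ix j, x j)) [1..<Suc m]"
  have "\<phi> (p j * prod_list (map snd xs)) = 0" if "j \<in> {1..d}" for j
  proof (rule alternating_zero[OF lg])
    show "distinct_adj (map fst xs)"
      unfolding xs_def distinct_adj_conv_nth using * by (auto simp del: upt_Suc)
  qed (use * that in \<open>auto simp: xs_def simp del: upt_Suc\<close>)
  moreover have "map snd xs = map x [1..<Suc m]" by (simp add: xs_def comp_def del: upt_Suc)
  ultimately show "cond_exp \<phi> d p (prod_list (map x [1..<Suc m])) = 0"
    unfolding cond_exp_zero_iff by metis
qed

end

end

section \<open>Traces of words in matrices\<close>

lemma mat_adjoint_carrier [simp, intro]: "A \<in> carrier_mat n m \<Longrightarrow> mat_adjoint A \<in> carrier_mat m n"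
  by (auto simp: mat_adjoint_def)

lemma mat_adjoint_index [simp]:
  "i < dim_col A \<Longrightarrow> j < dim_row A \<Longrightarrow> mat_adjoint A $$ (i, j) = cnj (A $$ (j, i))"
  by (simp add: mat_adjoint_def mat_of_rows_def)

lemma dim_mat_adjoint [simp]: "dim_row (mat_adjoint A) = dim_col A" "dim_col (mat_adjoint A) = dim_row A"
  by (auto simp: mat_adjoint_def)

lemma mat_adjoint_adjoint [simp]: "mat_adjoint (mat_adjoint A) = (A :: complex Matrix.mat)"
  by (rule eq_matI) auto

lemma mat_adjoint_one [simp]: "mat_adjoint (1\<^sub>m n :: complex Matrix.mat) = 1\<^sub>m n"
  by (rule eq_matI) auto

lemma mat_mult_index:
  "A \<in> carrier_mat n m \<Longrightarrow> B \<in> carrier_mat m k \<Longrightarrow> i < n \<Longrightarrow> j < k \<Longrightarrow>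
   (A * B) $$ (i, j) = (\<Sum>s<m. A $$ (i, s) * B $$ (s, j))"
  by (auto simp: scalar_prod_def atLeast0LessThan)

lemma mat_adjoint_mult:
  assumes "A \<in> carrier_mat n m" "B \<in> carrier_mat m k"
  shows "mat_adjoint (A * B) = mat_adjoint B * mat_adjoint (A :: complex Matrix.mat)"
proof (rule eq_matI)
  fix i j assume *: "i < dim_row (mat_adjoint B * mat_adjoint A)" "j < dim_col (mat_adjoint B * mat_adjoint A)"
  hence "i < k" "j < n" using assms by auto
  thus "mat_adjoint (A * B) $$ (i, j) = (mat_adjoint B * mat_adjoint A) $$ (i, j)"
    using assms by (simp add: mat_mult_index[OF assms] mult.commute
      mat_mult_index[OF mat_adjoint_carrier[OF assms(2)] mat_adjoint_carrier[OF assms(1)]]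
      del: index_mult_mat(1)) 
qed (use assms in auto)

section \<open>Products of lists of matrices and their adjoints\<close>

definition mprod :: "nat \<Rightarrow> complex Matrix.mat list \<Rightarrow> complex Matrix.mat" where
  "mprod n Bs = foldr (*) Bs (1\<^sub>m n)"

lemma mprod_simps [simp]: "mprod n [] = 1\<^sub>m n" "mprod n (B # Bs) = B * mprod n Bs"
  by (auto simp: mprod_def)

lemma mprod_carrier [simp, intro]: "set Bs \<subseteq> carrier_mat n n \<Longrightarrow> mprod n Bs \<in> carrier_mat n n"
  by (induction Bs) (auto intro: mult_carrier_mat)

lemma mprod_append:
  "set Bs \<subseteq> carrier_mat n n \<Longrightarrow> set Cs \<subseteq> carrier_mat n n \<Longrightarrow>
   mprod n (Bs @ Cs) = mprod n Bs * mprod n Cs"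
  by (induction Bs) (auto simp: assoc_mult_mat[of _ n n _ n _ n] left_mult_one_mat[of _ n n])

definition star_list :: "complex Matrix.mat list \<Rightarrow> complex Matrix.mat list" where
  "star_list Bs = map mat_adjoint (rev Bs)"

lemma length_star_list [simp]: "length (star_list Bs) = length Bs"
  by (simp add: star_list_def)

lemma set_star_list: "set (star_list Bs) = mat_adjoint ` set Bs"
  by (simp add: star_list_def)

lemma star_list_append: "star_list (Bs @ Cs) = star_list Cs @ star_list Bs"
  by (simp add: star_list_def)

lemma mprod_star:
  "set Bs \<subseteq> carrier_mat n n \<Longrightarrow> mprod n (star_list Bs) = mat_adjoint (mprod n Bs)"
proof (induction Bs)
  case (Cons B Bs)
  have "star_list (B # Bs) = star_list Bs @ [mat_adjoint B]" by (simp add: star_list_def)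
  moreover have "set (star_list Bs) \<subseteq> carrier_mat n n" using Cons.prems by (auto simp: set_star_list)
  ultimately show ?case
    using Cons by (simp add: mprod_append mat_adjoint_mult[of _ n n _ n] right_mult_one_mat[of _ n n])
qed (auto simp: star_list_def)

section \<open>Traces and the Cauchy-Schwarz inequality\<close>

lemma mat_trace_mult:
  "X \<in> carrier_mat n m \<Longrightarrow> Y \<in> carrier_mat m n \<Longrightarrow>
   mat_trace (X * Y) = (\<Sum>i<n. \<Sum>j<m. X $$ (i, j) * Y $$ (j, i))"
  by (simp add: mat_trace_def mat_mult_index del: index_mult_mat(1))

lemma mat_trace_comm:
  "X \<in> carrier_mat n m \<Longrightarrow> Y \<in> carrier_mat m n \<Longrightarrow> mat_trace (X * Y) = mat_trace (Y * X)"
  by (simp add: mat_trace_mult mult.commute) (rule sum.swap)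

lemma mat_trace_mult_adjoint:
  "X \<in> carrier_mat n m \<Longrightarrow> mat_trace (X * mat_adjoint X) = of_real (\<Sum>i<n. \<Sum>j<m. (cmod (X $$ (i, j)))\<^sup>2)"
  by (subst mat_trace_mult[OF _ mat_adjoint_carrier]) (auto simp: complex_norm_square simp del: of_real_power)

lemma mat_trace_adjoint_mult:
  "X \<in> carrier_mat n m \<Longrightarrow> mat_trace (mat_adjoint X * X) = of_real (\<Sum>i<n. \<Sum>j<m. (cmod (X $$ (i, j)))\<^sup>2)"
  using mat_trace_comm[OF mat_adjoint_carrier[of X n m], of X] mat_trace_mult_adjoint by auto

lemma mat_trace_Cauchy_Schwarz:
  assumes "X \<in> carrier_mat n m" "Y \<in> carrier_mat m n"
  shows "(cmod (mat_trace (X * Y)))\<^sup>2 \<le> Re (mat_trace (X * mat_adjoint X)) * Re (mat_trace (mat_adjoint Y * Y))"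
proof -
  let ?S = "{..<n} \<times> {..<m}"
  have "cmod (mat_trace (X * Y)) \<le> (\<Sum>(i,j)\<in>?S. cmod (X $$ (i, j)) * cmod (Y $$ (j, i)))"
    unfolding mat_trace_mult[OF assms] sum.cartesian_product
    by (rule order_trans[OF norm_sum]) (auto simp: norm_mult case_prod_beta)
  hence "(cmod (mat_trace (X * Y)))\<^sup>2 \<le> (\<Sum>(i,j)\<in>?S. cmod (X $$ (i, j)) * cmod (Y $$ (j, i)))\<^sup>2"
    by (rule power_mono) simp
  also have "\<dots> \<le> (\<Sum>x\<in>?S. (cmod (X $$ x))\<^sup>2) * (\<Sum>x\<in>?S. (cmod (Y $$ (snd x, fst x)))\<^sup>2)"
    using Cauchy_Schwarz_ineq_sum[of "\<lambda>x. cmod (X $$ x)" "\<lambda>x. cmod (Y $$ (snd x, fst x))" ?S]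
    by (simp add: case_prod_beta)
  also have "(\<Sum>x\<in>?S. (cmod (X $$ x))\<^sup>2) = Re (mat_trace (X * mat_adjoint X))"
    by (simp add: mat_trace_mult_adjoint[OF assms(1)] sum.cartesian_product)
  also have "(\<Sum>x\<in>?S. (cmod (Y $$ (snd x, fst x)))\<^sup>2) = (\<Sum>i<n. \<Sum>j<m. (cmod (Y $$ (j, i)))\<^sup>2)"
    by (simp add: sum.cartesian_product case_prod_beta)
  also have "\<dots> = Re (mat_trace (mat_adjoint Y * Y))"
    by (subst sum.swap) (simp add: mat_trace_adjoint_mult[OF assms(2)])
  finally show ?thesis .
qed

definition alternating_list :: "complex Matrix.mat \<Rightarrow> nat \<Rightarrow> complex Matrix.mat list" where
  "alternating_list C t = concat (replicate t [C, mat_adjoint C])"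

lemma length_alternating_list [simp]: "length (alternating_list C t) = 2 * t"
  by (induction t) (auto simp: alternating_list_def)

lemma alternating_list_add: "alternating_list C (s + t) = alternating_list C s @ alternating_list C t"
  by (simp add: alternating_list_def replicate_add)

lemma star_alternating_list [simp]: "star_list (alternating_list C t) = alternating_list C t"
proof (induction t)
  case (Suc t)
  have "alternating_list C (Suc t) = [C, mat_adjoint C] @ alternating_list C t"
    by (simp add: alternating_list_def)
  moreover have "alternating_list C (Suc t) = alternating_list C t @ [C, mat_adjoint C]"
    using alternating_list_add[of C t 1] by (simp add: alternating_list_def)
  ultimately show ?case using Suc by (metis star_list_append star_list_def mat_adjoint_adjoint rev.simps append.simps list.simps(9) list.simps(8))
qed (simp add: alternating_list_def star_list_def)

text \<open>
  Reflecting a maximiser of \<open>u \<mapsto> Tr (u u\<^sup>*)\<close> doubles the length of an alternating run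
  \<open>C C\<^sup>* C C\<^sup>* \<dots>\<close> in it, so some maximiser is a single alternating run.
\<close>

lemma trace_chessboard:
  assumes fin: "finite \<C>" and car: "\<C> \<subseteq> carrier_mat n n"
    and adj: "\<And>C. C \<in> \<C> \<Longrightarrow> mat_adjoint C \<in> \<C>"
    and bound: "\<And>C. C \<in> \<C> \<Longrightarrow> Re (mat_trace (mprod n (alternating_list C (2 ^ q)))) \<le> b"
    and L: "set L \<subseteq> \<C>" "length L = 2 * 2 ^ q"
  shows "cmod (mat_trace (mprod n L)) \<le> b"
proof -
  let ?m = "2 ^ q :: nat"
  \<comment> \<open>By Cauchy-Schwarz the trace of a word is controlled by \<open>f\<close> on its
    two halves, so the maximum \<open>S\<close> over words of half length bounds every
    trace.\<close>
  define f where "f = (\<lambda>u. Re (mat_trace (mprod n u * mat_adjoint (mprod n u))))"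
  define U where "U = {u. set u \<subseteq> \<C> \<and> length u = ?m}"
  define S where "S = Max (f ` U)"
  have carr: "set u \<subseteq> \<C> \<Longrightarrow> mprod n u \<in> carrier_mat n n" for u using car by auto
  have f_eq: "f u = Re (mat_trace (mprod n (u @ star_list u)))" if "set u \<subseteq> \<C>" for u
    unfolding f_def using that car by (subst mprod_append) (auto simp: mprod_star set_star_list)
  have star: "set u \<subseteq> \<C> \<Longrightarrow> set (star_list u) \<subseteq> \<C>" for u using adj by (auto simp: set_star_list)
  have finU: "finite U" unfolding U_def by (rule finite_lists_length_eq[OF fin])
  have neU: "U \<noteq> {}"
  proof -
    have "L \<noteq> []" using L(2) by auto
    then obtain C where "C \<in> \<C>" using L(1) by (cases L) auto
    hence "replicate ?m C \<in> U" by (auto simp: U_def)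
    thus ?thesis by auto
  qed
  have S_max: "f u \<le> S" if "u \<in> U" for u
    unfolding S_def using that finU by auto
  have f_nonneg: "f u \<ge> 0" if "set u \<subseteq> \<C>" for u
    unfolding f_def using mat_trace_mult_adjoint[OF carr[OF that]] by (auto intro!: sum_nonneg)
  have CS: "(cmod (mat_trace (mprod n (x @ y))))\<^sup>2 \<le> f x * f (star_list y)" 
    if "set x \<subseteq> \<C>" "set y \<subseteq> \<C>" for x y
  proof -
    have "mprod n (x @ y) = mprod n x * mprod n y" using that car by (intro mprod_append) auto
    moreover have "f (star_list y) = Re (mat_trace (mat_adjoint (mprod n y) * mprod n y))"
      unfolding f_def using that car by (subst (1 2) mprod_star) auto
    ultimately show ?thesis
      using mat_trace_Cauchy_Schwarz[OF carr[OF that(1)] carr[OF that(2)]] by (simp add: f_def)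
  qed
  have comm: "mat_trace (mprod n (x @ y)) = mat_trace (mprod n (y @ x))" 
    if "set x \<subseteq> \<C>" "set y \<subseteq> \<C>" for x y
    using that car mat_trace_comm[OF carr[OF that(1)] carr[OF that(2)]] by (subst (1 2) mprod_append) auto
  have "S \<in> f ` U" unfolding S_def using finU neU by (intro Max_in) auto
  then obtain u0 where u0: "u0 \<in> U" "f u0 = S" by blast
  have "S \<le> b"
  proof (cases "S > 0")
    \<comment> \<open>Here it is enough that \<open>b\<close> is non-negative, and it is, because an
      alternating trace is itself a value of \<open>f\<close>.\<close>
    case False
    have "u0 \<noteq> []" using u0 by (auto simp: U_def)
    then obtain C where C: "C \<in> \<C>" using u0 by (cases u0) (auto simp: U_def)
    have "set (alternating_list C (2 ^ (q - 1))) \<subseteq> \<C>" 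
      using C adj by (auto simp: alternating_list_def)
    have "0 \<le> Re (mat_trace (mprod n (alternating_list C (2 ^ q))))"
    proof (cases q)
      case 0
      have "Re (mat_trace (mprod n (alternating_list C (2 ^ q)))) = f [C]"
        using C by (subst f_eq) (auto simp: 0 alternating_list_def star_list_def)
      thus ?thesis using f_nonneg[of "[C]"] C by simp
    next
      case (Suc q')
      have s: "set (alternating_list C (2 ^ q')) \<subseteq> \<C>" using C adj by (auto simp: alternating_list_def)
      have "Re (mat_trace (mprod n (alternating_list C (2 ^ q)))) = f (alternating_list C (2 ^ q'))"
        using alternating_list_add[of C "2 ^ q'" "2 ^ q'"] by (simp add: f_eq[OF s] Suc mult_2)
      thus ?thesis using f_nonneg[OF s] by simp
    qed
    thus ?thesis using bound[OF C] False by simp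
  next
    case True
    have reflect: "\<exists>y. y @ r @ star_list r \<in> U \<and> f (y @ r @ star_list r) = S"
      if xr: "x @ r \<in> U" "f (x @ r) = S" "2 * length r \<le> ?m" for x r
    proof -
      have sx: "set x \<subseteq> \<C>" "set r \<subseteq> \<C>" "length x + length r = ?m" using xr by (auto simp: U_def)
      \<comment> \<open>The trace of x r r* x*, read cyclically as x* x r r*, is cut after half of
        its letters. As \<open>r\<close> is short, the cut falls in x* x and r r* stays whole; at
        the maximum, Cauchy-Schwarz then forces y r r* to be a maximiser too.\<close>
      define z where "z = take ?m (star_list x @ x)"
      define y where "y = drop ?m (star_list x @ x)"
      have zy: "z @ y = star_list x @ x" unfolding z_def y_def by (rule append_take_drop_id)
      have sz: "set z \<subseteq> \<C>" "set y \<subseteq> \<C>" 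
        using set_take_subset[of ?m "star_list x @ x"] set_drop_subset[of ?m "star_list x @ x"] sx star[OF sx(1)]
        by (auto simp: z_def y_def)
      have lz: "length z = ?m" "length y + 2 * length r = ?m"
        using sx(3) xr(3) by (auto simp: z_def y_def)
      have sr: "set (star_list r) \<subseteq> \<C>" by (rule star[OF sx(2)])
      have "S = Re (mat_trace (mprod n ((x @ r @ star_list r) @ star_list x)))"
        using xr(2) f_eq[of "x @ r"] sx by (simp add: star_list_append)
      also have "\<dots> = Re (mat_trace (mprod n (star_list x @ x @ r @ star_list r)))"
        by (subst comm) (use sx sr star in auto)
      also have "\<dots> = Re (mat_trace (mprod n (z @ (y @ r @ star_list r))))"
        using zy by (metis append_assoc)
      also have "\<dots> = Re (mat_trace (mprod n ((y @ r @ star_list r) @ z)))"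
        by (subst comm) (use sx sr sz in auto)
      also have "\<dots> \<le> cmod (mat_trace (mprod n ((y @ r @ star_list r) @ z)))"
        by (rule complex_Re_le_cmod)
      finally have "S\<^sup>2 \<le> (cmod (mat_trace (mprod n ((y @ r @ star_list r) @ z))))\<^sup>2"
        using True by (intro power_mono) auto
      also have "\<dots> \<le> f (y @ r @ star_list r) * f (star_list z)"
        by (rule CS) (use sx sr sz in auto)
      also have "\<dots> \<le> f (y @ r @ star_list r) * S"
        using S_max[of "star_list z"] star[OF sz(1)] lz(1) sx sr sz
        by (intro mult_left_mono f_nonneg) (auto simp: U_def)
      finally have "S \<le> f (y @ r @ star_list r)"
        using True by (simp add: power2_eq_square)
      moreover have "y @ r @ star_list r \<in> U" using sx sr sz lz by (auto simp: U_def)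
      ultimately show ?thesis using S_max by fastforce
    qed
    \<comment> \<open>An alternating run with an even number of letters is its own reflection, so
      reflecting doubles it; a single letter C starts with the run C C*.\<close>
    have runs: "\<exists>x C. C \<in> \<C> \<and> x @ alternating_list C (2 ^ s) \<in> U \<and> f (x @ alternating_list C (2 ^ s)) = S"
      if "Suc s \<le> q" for s using that
    proof (induction s)
      case 0
      have "u0 \<noteq> []" using u0 by (auto simp: U_def)
      then obtain x C where u0x: "u0 = x @ [C]" by (metis append_butlast_last_id)
      have "C \<in> \<C>" using u0 u0x by (auto simp: U_def)
      moreover have "2 * length [C] \<le> ?m" using power_increasing[of 1 q "2::nat"] 0 by simp
      ultimately show ?case using reflect[of x "[C]"] u0 u0x
        by (auto simp: alternating_list_def star_list_def)
    next
      case (Suc s)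
      then obtain x C where C: "C \<in> \<C>" "x @ alternating_list C (2 ^ s) \<in> U"
          "f (x @ alternating_list C (2 ^ s)) = S" by auto
      have "2 * length (alternating_list C (2 ^ s)) \<le> ?m"
        using power_increasing[of "Suc (Suc s)" q "2::nat"] Suc.prems by simp
      from reflect[OF C(2,3) this] obtain y where 
        "y @ alternating_list C (2 ^ s) @ alternating_list C (2 ^ s) \<in> U"
        "f (y @ alternating_list C (2 ^ s) @ alternating_list C (2 ^ s)) = S" by auto
      thus ?case using C(1) alternating_list_add[of C "2 ^ s" "2 ^ s"]
        by (intro exI[of _ y] exI[of _ C]) (simp add: mult_2)
    qed
    show ?thesis
    proof (cases q)
      case 0
      then obtain C where C: "u0 = [C]" using u0 by (auto simp: U_def length_Suc_conv)
      hence "C \<in> \<C>" using u0 by (auto simp: U_def)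
      moreover have "S = Re (mat_trace (mprod n (alternating_list C (2 ^ q))))"
        using u0(2) C \<open>C \<in> \<C>\<close> by (subst (asm) f_eq) (auto simp: 0 alternating_list_def star_list_def)
      ultimately show ?thesis using bound by simp
    next
      case (Suc q')
      then obtain x C where C: "C \<in> \<C>" "x @ alternating_list C (2 ^ q') \<in> U"
          "f (x @ alternating_list C (2 ^ q')) = S" using runs[of q'] by auto
      have "x = []" using C(2) Suc by (auto simp: U_def)
      hence "S = Re (mat_trace (mprod n (alternating_list C (2 ^ q))))"
        using C f_eq[of "alternating_list C (2 ^ q')"] alternating_list_add[of C "2 ^ q'" "2 ^ q'"] Suc
        by (simp add: U_def mult_2)
      thus ?thesis using bound[OF C(1)] by simp
    qed
  qed
  define x where "x = take ?m L"
  define y where "y = drop ?m L"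
  have xy: "L = x @ y" "set x \<subseteq> \<C>" "set y \<subseteq> \<C>" "length x = ?m" "length y = ?m"
    using L set_take_subset[of ?m L] set_drop_subset[of ?m L] by (auto simp: x_def y_def)
  have "x \<in> U" "star_list y \<in> U" using xy star[OF xy(3)] by (auto simp: U_def)
  have "(cmod (mat_trace (mprod n L)))\<^sup>2 \<le> f x * f (star_list y)"
    using CS xy by simp
  also have "\<dots> \<le> S * S"
    using \<open>x \<in> U\<close> \<open>star_list y \<in> U\<close> S_max f_nonneg xy star by (intro mult_mono) (auto intro: order_trans[OF f_nonneg S_max])
  finally have "(cmod (mat_trace (mprod n L)))\<^sup>2 \<le> S\<^sup>2" by (simp add: power2_eq_square)
  hence "cmod (mat_trace (mprod n L)) \<le> S"
    using \<open>x \<in> U\<close> xy(2) f_nonneg S_max by (meson order_trans power2_le_imp_le)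
  thus ?thesis using \<open>S \<le> b\<close> by simp
qed

section \<open>The operator norm and traces of powers\<close>

lemma vec_l2_norm_sq: "(vec_l2_norm v)\<^sup>2 = (\<Sum>i<dim_vec v. (cmod (vec_index v i))\<^sup>2)"
  by (simp add: vec_l2_norm_def sum_nonneg)

lemma vec_l2_norm_nonneg [simp]: "vec_l2_norm v \<ge> 0"
  by (simp add: vec_l2_norm_def sum_nonneg)

lemma vec_inner_le:
  "cmod (\<Sum>i<n. cnj (vec_index u i) * vec_index v i) \<le> vec_l2_norm u * vec_l2_norm v"
  if "dim_vec u = n" "dim_vec v = n"
proof -
  have "cmod (\<Sum>i<n. cnj (vec_index u i) * vec_index v i) \<le> (\<Sum>i<n. cmod (vec_index u i) * cmod (vec_index v i))"
    by (rule order_trans[OF norm_sum]) (simp add: norm_mult)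
  moreover have "(\<Sum>i<n. cmod (vec_index u i) * cmod (vec_index v i))\<^sup>2 \<le> (vec_l2_norm u * vec_l2_norm v)\<^sup>2"
    using Cauchy_Schwarz_ineq_sum[of "\<lambda>i. cmod (vec_index u i)" "\<lambda>i. cmod (vec_index v i)" "{..<n}"] that
    by (simp add: power_mult_distrib vec_l2_norm_sq)
  ultimately show ?thesis
    by (meson order_trans power2_le_imp_le mult_nonneg_nonneg vec_l2_norm_nonneg)
qed

lemma mult_mat_vec_index:
  "A \<in> carrier_mat n m \<Longrightarrow> v \<in> carrier_vec m \<Longrightarrow> i < n \<Longrightarrow>
   vec_index (A *\<^sub>v v) i = (\<Sum>s<m. A $$ (i, s) * vec_index v s)"
  by (auto simp: scalar_prod_def atLeast0LessThan)

lemma mat_adjoint_inner: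
  assumes "A \<in> carrier_mat n n" "u \<in> carrier_vec n" "v \<in> carrier_vec n"
  shows "(\<Sum>i<n. cnj (vec_index u i) * vec_index (A *\<^sub>v v) i) =
         (\<Sum>i<n. cnj (vec_index (mat_adjoint A *\<^sub>v u) i) * vec_index v i)"
proof -
  have "(\<Sum>i<n. cnj (vec_index u i) * vec_index (A *\<^sub>v v) i) =
        (\<Sum>i<n. \<Sum>s<n. cnj (vec_index u i) * (A $$ (i, s) * vec_index v s))"
    by (intro sum.cong refl) (simp add: mult_mat_vec_index[OF assms(1,3)] sum_distrib_left del: index_mult_mat_vec)
  also have "\<dots> = (\<Sum>s<n. \<Sum>i<n. cnj (vec_index u i) * (A $$ (i, s) * vec_index v s))"
    by (rule sum.swap)
  also have "\<dots> = (\<Sum>i<n. cnj (vec_index (mat_adjoint A *\<^sub>v u) i) * vec_index v i)"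
    using assms by (intro sum.cong refl)
      (simp add: mult_mat_vec_index[OF mat_adjoint_carrier[OF assms(1)] assms(2)] sum_distrib_left
         sum_distrib_right mult_ac del: index_mult_mat_vec)
  finally show ?thesis .
qed

lemma vec_l2_norm_mult_sq:
  assumes "A \<in> carrier_mat n n" "v \<in> carrier_vec n"
  shows "(vec_l2_norm (A *\<^sub>v v))\<^sup>2 \<le> vec_l2_norm v * vec_l2_norm ((mat_adjoint A * A) *\<^sub>v v)"
proof -
  have Av: "A *\<^sub>v v \<in> carrier_vec n" using assms by auto
  have "complex_of_real ((vec_l2_norm (A *\<^sub>v v))\<^sup>2) =
        (\<Sum>i<n. cnj (vec_index (A *\<^sub>v v) i) * vec_index (A *\<^sub>v v) i)"
    using Av assms(1) by (simp add: vec_l2_norm_sq complex_norm_square mult.commute del: index_mult_mat_vec of_real_power)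
  also have "\<dots> = (\<Sum>i<n. cnj (vec_index (mat_adjoint A *\<^sub>v (A *\<^sub>v v)) i) * vec_index v i)"
    by (rule mat_adjoint_inner[OF assms(1) Av assms(2)])
  also have "mat_adjoint A *\<^sub>v (A *\<^sub>v v) = (mat_adjoint A * A) *\<^sub>v v"
    by (rule assoc_mult_mat_vec[symmetric, OF mat_adjoint_carrier[OF assms(1)] assms])
  finally have "(vec_l2_norm (A *\<^sub>v v))\<^sup>2 =
      cmod (\<Sum>i<n. cnj (vec_index ((mat_adjoint A * A) *\<^sub>v v) i) * vec_index v i)"
    by (metis norm_of_real abs_of_nonneg zero_le_power2)
  also have "\<dots> \<le> vec_l2_norm ((mat_adjoint A * A) *\<^sub>v v) * vec_l2_norm v"
    using assms by (intro vec_inner_le) auto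
  finally show ?thesis by (simp add: mult.commute)
qed

lemma vec_l2_norm_HS:
  assumes "A \<in> carrier_mat n n" "v \<in> carrier_vec n"
  shows "(vec_l2_norm (A *\<^sub>v v))\<^sup>2 \<le> Re (mat_trace (A * mat_adjoint A)) * (vec_l2_norm v)\<^sup>2"
proof -
  have "(cmod (\<Sum>s<n. A $$ (i, s) * vec_index v s))\<^sup>2 \<le> (\<Sum>s<n. (cmod (A $$ (i, s)))\<^sup>2) * (vec_l2_norm v)\<^sup>2" for i
  proof -
    have "cmod (\<Sum>s<n. A $$ (i, s) * vec_index v s) \<le> (\<Sum>s<n. cmod (A $$ (i, s)) * cmod (vec_index v s))"
      by (rule order_trans[OF norm_sum]) (simp add: norm_mult)
    hence "(cmod (\<Sum>s<n. A $$ (i, s) * vec_index v s))\<^sup>2 \<le> (\<Sum>s<n. cmod (A $$ (i, s)) * cmod (vec_index v s))\<^sup>2"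
      by (rule power_mono) simp
    also have "\<dots> \<le> (\<Sum>s<n. (cmod (A $$ (i, s)))\<^sup>2) * (\<Sum>s<n. (cmod (vec_index v s))\<^sup>2)"
      by (rule Cauchy_Schwarz_ineq_sum)
    finally show ?thesis using assms by (simp add: vec_l2_norm_sq)
  qed
  hence "(\<Sum>i<n. (cmod (vec_index (A *\<^sub>v v) i))\<^sup>2) \<le> (\<Sum>i<n. (\<Sum>s<n. (cmod (A $$ (i, s)))\<^sup>2) * (vec_l2_norm v)\<^sup>2)"
    by (intro sum_mono) (simp add: mult_mat_vec_index[OF assms] del: index_mult_mat_vec)
  thus ?thesis using assms
    by (simp add: vec_l2_norm_sq[of "A *\<^sub>v v"] mat_trace_mult_adjoint[OF assms(1)] sum_distrib_right del: index_mult_mat_vec)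
qed

lemma mat_op_norm_bdd:
  assumes "A \<in> carrier_mat n n"
  shows "bdd_above ((\<lambda>v. vec_l2_norm (A *\<^sub>v v)) ` {v \<in> carrier_vec (dim_col A). vec_l2_norm v \<le> 1})"
proof (rule bdd_aboveI2)
  fix v assume v: "v \<in> {v \<in> carrier_vec (dim_col A). vec_l2_norm v \<le> 1}"
  have T: "Re (mat_trace (A * mat_adjoint A)) \<ge> 0"
    using mat_trace_mult_adjoint[OF assms] by (auto intro!: sum_nonneg)
  have "(vec_l2_norm (A *\<^sub>v v))\<^sup>2 \<le> Re (mat_trace (A * mat_adjoint A)) * (vec_l2_norm v)\<^sup>2"
    using v assms by (intro vec_l2_norm_HS) auto
  also have "\<dots> \<le> Re (mat_trace (A * mat_adjoint A)) * 1"
    using v T by (intro mult_left_mono) (auto simp: power_le_one)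
  finally show "vec_l2_norm (A *\<^sub>v v) \<le> sqrt (Re (mat_trace (A * mat_adjoint A)))"
    by (simp add: real_le_rsqrt)
qed

lemma mat_op_norm_le_iff:
  assumes "A \<in> carrier_mat n n"
  shows "mat_op_norm A \<le> R \<longleftrightarrow> (\<forall>v\<in>carrier_vec n. vec_l2_norm v \<le> 1 \<longrightarrow> vec_l2_norm (A *\<^sub>v v) \<le> R)"
proof -
  have "0\<^sub>v n \<in> {v \<in> carrier_vec (dim_col A). vec_l2_norm v \<le> 1}" using assms by (auto simp: vec_l2_norm_def)
  hence ne: "{v \<in> carrier_vec (dim_col A). vec_l2_norm v \<le> 1} \<noteq> {}" by blast
  show ?thesis unfolding mat_op_norm_def cSUP_le_iff[OF ne mat_op_norm_bdd[OF assms]] using assms by auto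
qed

lemma vec_l2_norm_smult: "vec_l2_norm (c \<cdot>\<^sub>v v) = cmod c * vec_l2_norm v"
proof -
  have "(vec_l2_norm (c \<cdot>\<^sub>v v))\<^sup>2 = (cmod c * vec_l2_norm v)\<^sup>2"
    by (simp add: vec_l2_norm_sq power_mult_distrib norm_mult sum_distrib_left)
  thus ?thesis by (simp add: power2_eq_iff_nonneg)
qed

lemma mat_op_norm_bound:
  assumes "A \<in> carrier_mat n n" "mat_op_norm A \<le> R" "v \<in> carrier_vec n"
  shows "vec_l2_norm (A *\<^sub>v v) \<le> R * vec_l2_norm v"
proof (cases "vec_l2_norm v = 0")
  case True
  have "(vec_l2_norm (A *\<^sub>v v))\<^sup>2 \<le> 0" using vec_l2_norm_HS[OF assms(1,3)] True by simp
  thus ?thesis using True by simp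
next
  case False
  hence pos: "vec_l2_norm v > 0" using vec_l2_norm_nonneg[of v] by linarith
  define c where "c = complex_of_real (1 / vec_l2_norm v)"
  have c: "cmod c = 1 / vec_l2_norm v" using pos unfolding c_def norm_of_real by simp
  have "vec_l2_norm (A *\<^sub>v (c \<cdot>\<^sub>v v)) \<le> R"
    using assms(2)[unfolded mat_op_norm_le_iff[OF assms(1)], rule_format, of "c \<cdot>\<^sub>v v"] assms(3) pos
    by (simp add: vec_l2_norm_smult c)
  also have "A *\<^sub>v (c \<cdot>\<^sub>v v) = c \<cdot>\<^sub>v (A *\<^sub>v v)" by (rule mult_mat_vec[OF assms(1,3)])
  finally show ?thesis using pos by (simp add: vec_l2_norm_smult c field_simps)
qed

text \<open>|A* v|^2 is at most |v| |A A* v|, hence at most R |v| |A* v|; the factor |A* v| is then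
  divided out.\<close>

lemma mat_op_norm_bound_adjoint:
  assumes "A \<in> carrier_mat n n" "mat_op_norm A \<le> R" "v \<in> carrier_vec n"
  shows "vec_l2_norm (mat_adjoint A *\<^sub>v v) \<le> R * vec_l2_norm v"
proof -
  let ?u = "mat_adjoint A *\<^sub>v v"
  have u: "?u \<in> carrier_vec n"
    by (rule mult_mat_vec_carrier[OF mat_adjoint_carrier[OF assms(1)] assms(3)])
  have "(vec_l2_norm ?u)\<^sup>2 \<le> vec_l2_norm v * vec_l2_norm ((mat_adjoint (mat_adjoint A) * mat_adjoint A) *\<^sub>v v)"
    by (rule vec_l2_norm_mult_sq) (use assms in auto)
  also have "(mat_adjoint (mat_adjoint A) * mat_adjoint A) *\<^sub>v v = A *\<^sub>v ?u"
    using assoc_mult_mat_vec[OF assms(1) mat_adjoint_carrier[OF assms(1)] assms(3)] by simp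
  also have "vec_l2_norm v * vec_l2_norm (A *\<^sub>v ?u) \<le> vec_l2_norm v * (R * vec_l2_norm ?u)"
    by (intro mult_left_mono mat_op_norm_bound[OF assms(1,2) u]) simp
  finally have *: "vec_l2_norm ?u * vec_l2_norm ?u \<le> (R * vec_l2_norm v) * vec_l2_norm ?u"
    by (simp add: power2_eq_square mult_ac)
  show ?thesis
  proof (cases "vec_l2_norm ?u = 0")
    case True
    have "0 \<le> vec_l2_norm (A *\<^sub>v v)" by simp
    also have "\<dots> \<le> R * vec_l2_norm v" by (rule mat_op_norm_bound[OF assms])
    finally show ?thesis using True by simp
  next
    case False
    hence "vec_l2_norm ?u > 0" using vec_l2_norm_nonneg[of ?u] by linarith
    thus ?thesis using * by (simp add: mult_le_cancel_right)
  qed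
qed

lemma alternating_list_carrier:
  "A \<in> carrier_mat n n \<Longrightarrow> set (alternating_list A t) \<subseteq> carrier_mat n n"
  by (auto simp: alternating_list_def)

lemma set_alternating_list: "set (alternating_list C t) \<subseteq> {C, mat_adjoint C}"
  by (auto simp: alternating_list_def)

lemma vec_l2_norm_mprod:
  assumes "\<And>B v. B \<in> set Bs \<Longrightarrow> v \<in> carrier_vec n \<Longrightarrow> vec_l2_norm (B *\<^sub>v v) \<le> R * vec_l2_norm v"
    "set Bs \<subseteq> carrier_mat n n" "v \<in> carrier_vec n" "R \<ge> 0"
  shows "vec_l2_norm (mprod n Bs *\<^sub>v v) \<le> R ^ length Bs * vec_l2_norm v"
  using assms
proof (induction Bs)
  case (Cons B Bs)
  have c: "B \<in> carrier_mat n n" "mprod n Bs \<in> carrier_mat n n" using Cons.prems by auto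
  have "vec_l2_norm (mprod n (B # Bs) *\<^sub>v v) = vec_l2_norm (B *\<^sub>v (mprod n Bs *\<^sub>v v))"
    using assoc_mult_mat_vec[OF c Cons.prems(3)] by simp
  also have "\<dots> \<le> R * vec_l2_norm (mprod n Bs *\<^sub>v v)"
    by (rule Cons.prems(1)[OF _ mult_mat_vec_carrier[OF c(2) Cons.prems(3)]]) simp
  also have "\<dots> \<le> R * (R ^ length Bs * vec_l2_norm v)"
    using Cons by (intro mult_left_mono) auto
  finally show ?case by simp
qed auto

lemma cmod_index_le:
  assumes "i < dim_vec v" shows "cmod (vec_index v i) \<le> vec_l2_norm v"
proof -
  have "(cmod (vec_index v i))\<^sup>2 \<le> (vec_l2_norm v)\<^sup>2"
    unfolding vec_l2_norm_sq using assms by (intro member_le_sum) auto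
  thus ?thesis by (rule power2_le_imp_le) simp
qed

text \<open>Every diagonal entry of the word is bounded by the product of the norms of its letters.
  Through this the norm bound on microstates controls the cut-off.\<close>

lemma trace_alternating_le:
  assumes "A \<in> carrier_mat n n" "mat_op_norm A \<le> R" "R > 0"
  shows "Re (mat_trace (mprod n (alternating_list (mat_adjoint A) t))) \<le> real n * R ^ (2 * t)"
proof -
  let ?M = "mprod n (alternating_list (mat_adjoint A) t)"
  have M: "?M \<in> carrier_mat n n"
    by (intro mprod_carrier alternating_list_carrier mat_adjoint_carrier assms(1))
  have "cmod (?M $$ (i, i)) \<le> R ^ (2 * t)" if i: "i < n" for i
  proof -
    have e: "(unit_vec n i :: complex Matrix.vec) \<in> carrier_vec n" by simp
    have ne: "vec_l2_norm (unit_vec n i :: complex Matrix.vec) = 1"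
    proof -
      have "(\<Sum>j<n. (cmod (vec_index (unit_vec n i :: complex Matrix.vec) j))\<^sup>2) = (\<Sum>j<n. if j = i then 1 else 0)"
        by (rule sum.cong) (auto simp: i)
      thus ?thesis using i by (simp add: vec_l2_norm_def)
    qed
    have "vec_l2_norm (?M *\<^sub>v unit_vec n i) \<le> R ^ length (alternating_list (mat_adjoint A) t) * vec_l2_norm (unit_vec n i :: complex Matrix.vec)"
    proof (rule vec_l2_norm_mprod[OF _ alternating_list_carrier[OF mat_adjoint_carrier[OF assms(1)]] e])
      fix B and v :: "complex Matrix.vec" assume B: "B \<in> set (alternating_list (mat_adjoint A) t)" and v: "v \<in> carrier_vec n"
      have "B = A \<or> B = mat_adjoint A" using B set_alternating_list[of "mat_adjoint A" t] by auto
      thus "vec_l2_norm (B *\<^sub>v v) \<le> R * vec_l2_norm v"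
        using mat_op_norm_bound[OF assms(1,2) v] mat_op_norm_bound_adjoint[OF assms(1,2) v] by blast
    qed (use assms(3) in simp)
    moreover have "cmod (vec_index (?M *\<^sub>v unit_vec n i) i) \<le> vec_l2_norm (?M *\<^sub>v unit_vec n i)"
      using i M by (intro cmod_index_le) simp
    moreover have "vec_index (?M *\<^sub>v unit_vec n i) i = ?M $$ (i, i)"
    proof -
      have "vec_index (?M *\<^sub>v unit_vec n i) i = (\<Sum>s<n. if s = i then ?M $$ (i, i) else 0)"
        unfolding mult_mat_vec_index[OF M e i] by (rule sum.cong) (auto simp: i)
      thus ?thesis using i by simp
    qed
    ultimately show ?thesis using ne by simp
  qed
  hence "cmod (mat_trace ?M) \<le> (\<Sum>i<n. R ^ (2 * t))"
    unfolding mat_trace_def carrier_matD(1)[OF M] by (intro sum_norm_le) simp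
  thus ?thesis using complex_Re_le_cmod[of "mat_trace ?M"] by simp
qed

text \<open>With M_t the t-th power of A* A, self-adjointness gives |M_t v|^2 \<le> |M_(2t) v| for
  |v| \<le> 1. Iterating doubles the exponent, and the last step passes to the Hilbert-Schmidt norm,
  which is a trace.\<close>

lemma op_norm_power_le_trace:
  assumes A: "A \<in> carrier_mat n n" and v: "v \<in> carrier_vec n" "vec_l2_norm v \<le> 1"
  shows "vec_l2_norm (A *\<^sub>v v) ^ (2 * 2 ^ Suc q) \<le>
         Re (mat_trace (mprod n (alternating_list (mat_adjoint A) (2 ^ Suc q))))"
proof -
  define M where "M = (\<lambda>t. mprod n (alternating_list (mat_adjoint A) t))"
  have M: "M t \<in> carrier_mat n n" for t
    unfolding M_def by (intro mprod_carrier alternating_list_carrier mat_adjoint_carrier A)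
  have car: "set (alternating_list (mat_adjoint A) t) \<subseteq> carrier_mat n n" for t
    by (intro alternating_list_carrier mat_adjoint_carrier A)
  have Madj: "mat_adjoint (M t) = M t" for t
    unfolding M_def using mprod_star[OF car] by simp
  have Mdouble: "M t * M t = M (2 * t)" for t
    unfolding M_def mult_2 alternating_list_add by (rule mprod_append[OF car car, symmetric])
  have sq: "(vec_l2_norm (M t *\<^sub>v v))\<^sup>2 \<le> vec_l2_norm (M (2 * t) *\<^sub>v v)" for t
  proof -
    have "(vec_l2_norm (M t *\<^sub>v v))\<^sup>2 \<le> vec_l2_norm v * vec_l2_norm ((mat_adjoint (M t) * M t) *\<^sub>v v)"
      by (rule vec_l2_norm_mult_sq[OF M v(1)])
    also have "\<dots> \<le> 1 * vec_l2_norm ((mat_adjoint (M t) * M t) *\<^sub>v v)"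
      by (intro mult_right_mono v) simp
    finally show ?thesis by (simp add: Madj Mdouble)
  qed
  have *: "vec_l2_norm (A *\<^sub>v v) ^ (2 * 2 ^ q) \<le> vec_l2_norm (M (2 ^ q) *\<^sub>v v)"
  proof (induction q)
    case 0
    have "(vec_l2_norm (A *\<^sub>v v))\<^sup>2 \<le> vec_l2_norm v * vec_l2_norm ((mat_adjoint A * A) *\<^sub>v v)"
      by (rule vec_l2_norm_mult_sq[OF A v(1)])
    also have "\<dots> \<le> 1 * vec_l2_norm ((mat_adjoint A * A) *\<^sub>v v)"
      by (intro mult_right_mono v) simp
    finally show ?case using A
      by (simp add: M_def alternating_list_def right_mult_one_mat[of _ n n])
  next
    case (Suc q)
    have "vec_l2_norm (A *\<^sub>v v) ^ (2 * 2 ^ Suc q) = (vec_l2_norm (A *\<^sub>v v) ^ (2 * 2 ^ q))\<^sup>2"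
      by (simp add: power_mult[symmetric] mult_ac)
    also have "\<dots> \<le> (vec_l2_norm (M (2 ^ q) *\<^sub>v v))\<^sup>2"
      by (intro power_mono Suc) simp
    also have "\<dots> \<le> vec_l2_norm (M (2 ^ Suc q) *\<^sub>v v)" using sq[of "2 ^ q"] by simp
    finally show ?case .
  qed
  have "vec_l2_norm (A *\<^sub>v v) ^ (2 * 2 ^ Suc q) = (vec_l2_norm (A *\<^sub>v v) ^ (2 * 2 ^ q))\<^sup>2"
    by (simp add: power_mult[symmetric] mult_ac)
  also have "\<dots> \<le> (vec_l2_norm (M (2 ^ q) *\<^sub>v v))\<^sup>2"
    by (intro power_mono *) simp
  also have "\<dots> \<le> Re (mat_trace (M (2 ^ q) * mat_adjoint (M (2 ^ q)))) * (vec_l2_norm v)\<^sup>2"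
    by (rule vec_l2_norm_HS[OF M v(1)])
  also have "\<dots> \<le> Re (mat_trace (M (2 ^ q) * mat_adjoint (M (2 ^ q)))) * 1"
  proof (rule mult_left_mono)
    show "0 \<le> Re (mat_trace (M (2 ^ q) * mat_adjoint (M (2 ^ q))))"
      using mat_trace_mult_adjoint[OF M] by (auto intro!: sum_nonneg)
  qed (use v in \<open>auto simp: power_le_one\<close>)
  also have "M (2 ^ q) * mat_adjoint (M (2 ^ q)) = M (2 ^ Suc q)" by (simp add: Madj Mdouble)
  finally show ?thesis by (simp add: M_def)
qed

text \<open>A bound on a single trace, without a factor \<open>n\<close>, already bounds the norm.
  Through this the support of the cut-off obeys a norm bound.\<close>

lemma mat_op_norm_le_if_trace:
  assumes A: "A \<in> carrier_mat n n" and R: "R \<ge> 0"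
    and "Re (mat_trace (mprod n (alternating_list (mat_adjoint A) (2 ^ Suc q)))) \<le> R ^ (2 * 2 ^ Suc q)"
  shows "mat_op_norm A \<le> R"
  unfolding mat_op_norm_le_iff[OF A]
proof (intro ballI impI)
  fix v assume v: "v \<in> carrier_vec n" "vec_l2_norm v \<le> 1"
  have "vec_l2_norm (A *\<^sub>v v) ^ (2 * 2 ^ Suc q) \<le> R ^ (2 * 2 ^ Suc q)"
    using op_norm_power_le_trace[OF A v] assms(3) by (rule order_trans)
  thus "vec_l2_norm (A *\<^sub>v v) \<le> R" using R by (subst (asm) power_mono_iff) auto
qed

text \<open>The factor \<open>n\<close> disappears in the limit of high roots. The norm condition
  becomes countably many polynomial inequalities in the entries and their conjugates, which makes it
  measurable.\<close>

lemma mat_op_norm_le_iff_trace: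
  assumes A: "A \<in> carrier_mat n n" and R: "R > 0"
  shows "mat_op_norm A \<le> R \<longleftrightarrow>
    (\<forall>q. Re (mat_trace (mprod n (alternating_list (mat_adjoint A) (2 ^ Suc q)))) \<le> real n * R ^ (2 * 2 ^ Suc q))"
proof
  assume *: "\<forall>q. Re (mat_trace (mprod n (alternating_list (mat_adjoint A) (2 ^ Suc q)))) \<le> real n * R ^ (2 * 2 ^ Suc q)"
  show "mat_op_norm A \<le> R"
    unfolding mat_op_norm_le_iff[OF A]
  proof (intro ballI impI, rule ccontr)
    fix v assume v: "v \<in> carrier_vec n" "vec_l2_norm v \<le> 1" and "\<not> vec_l2_norm (A *\<^sub>v v) \<le> R"
    hence x: "vec_l2_norm (A *\<^sub>v v) / R > 1" (is "?x > 1") using R by simp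
    have le: "?x ^ (2 * 2 ^ Suc q) \<le> real n" for q
    proof -
      have "vec_l2_norm (A *\<^sub>v v) ^ (2 * 2 ^ Suc q) \<le> real n * R ^ (2 * 2 ^ Suc q)"
        using op_norm_power_le_trace[OF A v, of q] *[rule_format, of q] by linarith
      thus ?thesis using R by (simp add: power_divide field_simps)
    qed
    obtain m where m: "real n < ?x ^ m" using real_arch_pow[OF x] by blast
    have "m \<le> 2 * 2 ^ Suc m" using less_exp[of m] unfolding power_Suc by linarith
    hence "?x ^ m \<le> ?x ^ (2 * 2 ^ Suc m)" using x by (intro power_increasing) auto
    thus False using m le[of m] by linarith
  qed
qed (intro allI trace_alternating_le[OF A _ R])

section \<open>The derivation of a commutator vector field on words\<close>

definition bproj :: "nat \<Rightarrow> nat set \<Rightarrow> complex Matrix.mat" where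
  "bproj n S = Matrix.mat n n (\<lambda>(i, j). if i = j \<and> i \<in> S then 1 else 0)"

definition btr :: "nat set \<Rightarrow> complex Matrix.mat \<Rightarrow> complex" where
  "btr S M = (\<Sum>i\<in>S. M $$ (i, i))"

lemma bproj_carrier [simp, intro]: "bproj n S \<in> carrier_mat n n"
  by (simp add: bproj_def)

lemma bproj_adjoint [simp]: "mat_adjoint (bproj n S) = bproj n S"
  by (rule eq_matI) (auto simp: bproj_def)

lemma bproj_mult_index:
  assumes "M \<in> carrier_mat n n" "i < n" "j < n"
  shows "(bproj n S * M) $$ (i, j) = (if i \<in> S then M $$ (i, j) else 0)"
    and "(M * bproj n S) $$ (i, j) = (if j \<in> S then M $$ (i, j) else 0)"
proof -
  have "(bproj n S * M) $$ (i, j) = (\<Sum>s<n. if s = i then (if i \<in> S then M $$ (i, j) else 0) else 0)"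
    unfolding mat_mult_index[OF bproj_carrier assms] using assms
    by (intro sum.cong) (auto simp: bproj_def)
  thus "(bproj n S * M) $$ (i, j) = (if i \<in> S then M $$ (i, j) else 0)" using assms by simp
  have "(M * bproj n S) $$ (i, j) = (\<Sum>s<n. if s = j then (if j \<in> S then M $$ (i, j) else 0) else 0)"
    unfolding mat_mult_index[OF assms(1) bproj_carrier assms(2,3)] using assms
    by (intro sum.cong) (auto simp: bproj_def)
  thus "(M * bproj n S) $$ (i, j) = (if j \<in> S then M $$ (i, j) else 0)" using assms by simp
qed

lemma btr_eq_trace:
  assumes "M \<in> carrier_mat n n" "S \<subseteq> {..<n}"
  shows "mat_trace (bproj n S * M) = btr S M"
proof -
  have "mat_trace (bproj n S * M) = (\<Sum>i<n. if i \<in> S then M $$ (i, i) else 0)"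
    unfolding mat_trace_def using bproj_mult_index(1)[OF assms(1)] by (intro sum.cong) (auto simp: bproj_def)
  thus ?thesis using assms(2) by (simp add: btr_def sum.inter_restrict[symmetric] Int_absorb1)
qed

lemma btr_cut:
  assumes "M \<in> carrier_mat n n" "S \<subseteq> {..<n}"
  shows "mat_trace (bproj n S * M * bproj n S) = btr S M"
proof -
  have "mat_trace (bproj n S * M * bproj n S) = (\<Sum>i<n. if i \<in> S then M $$ (i, i) else 0)"
    unfolding mat_trace_def
  proof (rule sum.cong)
    fix i assume i: "i \<in> {..<n}"
    have "bproj n S * M \<in> carrier_mat n n" using assms(1) by (intro mult_carrier_mat[of _ n n]) auto
    thus "(bproj n S * M * bproj n S) $$ (i, i) = (if i \<in> S then M $$ (i, i) else 0)"
      using bproj_mult_index[of _ n i i] assms(1) i by auto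
  qed (use assms in \<open>auto simp: bproj_def\<close>)
  thus ?thesis using assms(2) by (simp add: btr_def sum.inter_restrict[symmetric] Int_absorb1)
qed

lemma btr_adjoint: "A \<in> carrier_mat n n \<Longrightarrow> S \<subseteq> {..<n} \<Longrightarrow> btr S (mat_adjoint A) = cnj (btr S A)"
  unfolding btr_def cnj_sum by (intro sum.cong) auto

definition lmat :: "(nat \<Rightarrow> complex Matrix.mat) \<Rightarrow> nat \<times> bool \<Rightarrow> complex Matrix.mat" where
  "lmat A x = (if snd x then mat_adjoint (A (fst x)) else A (fst x))"

lemma mat_word_eq: "mat_word n A w = mprod n (map (lmat A) w)"
proof -
  have "(\<lambda>(i, s). if s then mat_adjoint (A i) else A i) = lmat A"
    by (auto simp: lmat_def fun_eq_iff)
  thus ?thesis by (simp add: mat_word_def mprod_def)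
qed

definition star_word :: "(nat \<times> bool) list \<Rightarrow> (nat \<times> bool) list" where
  "star_word w = map (\<lambda>x. (fst x, \<not> snd x)) (rev w)"

lemma fst_star_word [simp]: "fst ` set (star_word w) = fst ` set w"
  by (simp add: star_word_def image_image)

lemma length_star_word [simp]: "length (star_word w) = length w"
  by (simp add: star_word_def)

type_synonym trace_poly = "(complex \<times> (nat \<times> bool) list \<times> (nat \<times> bool) list) list"

text \<open>The recursion of \<open>liberation_gradient\<close> on words instead of elements, so
  that the same terms can be evaluated in the algebra, evaluated in matrices, and
  differentiated.\<close>

fun liberation_terms :: "nat \<Rightarrow> (nat \<times> bool) list \<Rightarrow> (nat \<times> bool) list \<Rightarrow> trace_poly" where
  "liberation_terms i u [] = []"
| "liberation_terms i u (x # w) =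
     (if fst x = i then [(1, u, x # w), (- 1, u @ [x], w)] else []) @ liberation_terms i (u @ [x]) w"

lemma liberation_terms_fst:
  "(c, v1, v2) \<in> set (liberation_terms i u w) \<Longrightarrow> set v1 \<subseteq> set u \<union> set w \<and> set v2 \<subseteq> set w"
proof (induction w arbitrary: u)
  case (Cons x w)
  show ?case using Cons.prems Cons.IH[of "u @ [x]"] by (auto split: if_splits)
qed simp

definition tpoly :: "nat \<Rightarrow> nat set \<Rightarrow> trace_poly \<Rightarrow> (nat \<Rightarrow> complex Matrix.mat) \<Rightarrow> complex" where
  "tpoly n S T A = (\<Sum>(c, u, v)\<leftarrow>T. c * btr S (mat_word n A u) * btr S (mat_word n A v))"

lemma tpoly_simps [simp]: "tpoly n S [] A = 0"
  "tpoly n S ((c, u, v) # T) A = c * btr S (mat_word n A u) * btr S (mat_word n A v) + tpoly n S T A"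
  by (simp_all add: tpoly_def)

text \<open>On matrices this is the complex conjugate, see \<open>tpoly_star\<close>; as a trace
  polynomial it is differentiated by the same formula as the original.\<close>

definition star_terms :: "trace_poly \<Rightarrow> trace_poly" where
  "star_terms T = map (\<lambda>(c, u, v). (cnj c, star_word u, star_word v)) T"

text \<open>For antihermitian \<open>E\<close> this is the derivative of the word under conjugation
  of \<open>A i\<close>. Treating starred letters like the others keeps it complex linear in
  \<open>E\<close>, so that matrix units may be inserted.\<close>

fun dword :: "nat \<Rightarrow> (nat \<Rightarrow> complex Matrix.mat) \<Rightarrow> nat \<Rightarrow> complex Matrix.mat \<Rightarrow> (nat \<times> bool) list \<Rightarrow> complex Matrix.mat"
  where
  "dword n A i E [] = 0\<^sub>m n n"
| "dword n A i E (x # w) =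
     (if fst x = i then (E * lmat A x - lmat A x * E) * mat_word n A w else 0\<^sub>m n n) +
     lmat A x * dword n A i E w"

definition dtpoly :: "nat \<Rightarrow> nat set \<Rightarrow> trace_poly \<Rightarrow> (nat \<Rightarrow> complex Matrix.mat) \<Rightarrow> nat \<Rightarrow> complex Matrix.mat \<Rightarrow> complex"
  where
  "dtpoly n S T A i E = (\<Sum>(c, u, v)\<leftarrow>T.
     c * (btr S (dword n A i E u) * btr S (mat_word n A v) + btr S (mat_word n A u) * btr S (dword n A i E v)))"

lemma mat_minus_index:
  "X \<in> carrier_mat n m \<Longrightarrow> Y \<in> carrier_mat n m \<Longrightarrow> i < n \<Longrightarrow> j < m \<Longrightarrow> (X - Y) $$ (i, j) = X $$ (i, j) - Y $$ (i, j)"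
  by auto

lemma mat_add_index:
  "X \<in> carrier_mat n m \<Longrightarrow> Y \<in> carrier_mat n m \<Longrightarrow> i < n \<Longrightarrow> j < m \<Longrightarrow> (X + Y) $$ (i, j) = X $$ (i, j) + Y $$ (i, j)"
  by auto

lemma mat_minus_add_minus:
  assumes "X \<in> carrier_mat n m" "Y \<in> carrier_mat n m" "Z \<in> carrier_mat n m"
  shows "X - Y + (Y - Z) = X - (Z :: complex Matrix.mat)"
proof (rule eq_matI)
  fix i j assume "i < dim_row (X - Z)" "j < dim_col (X - Z)"
  hence ij: "i < n" "j < m" using assms by auto
  show "(X - Y + (Y - Z)) $$ (i, j) = (X - Z) $$ (i, j)"
    using mat_add_index[OF minus_carrier_mat[OF assms(2)] minus_carrier_mat[OF assms(3)] ij, of X Y]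
      mat_minus_index[OF assms(1,2) ij] mat_minus_index[OF assms(2,3) ij] mat_minus_index[OF assms(1,3) ij]
    by simp
qed (use assms in auto)

definition munit :: "nat \<Rightarrow> nat \<Rightarrow> nat \<Rightarrow> complex Matrix.mat" where
  "munit n r c = Matrix.mat n n (\<lambda>(u, v). if u = r \<and> v = c then 1 else 0)"

lemma munit_carrier [simp, intro]: "munit n r c \<in> carrier_mat n n"
  by (simp add: munit_def)

lemma munit_mult_index:
  assumes "M \<in> carrier_mat n n" "i < n" "j < n" "r < n" "c < n"
  shows "(munit n r c * M) $$ (i, j) = (if i = r then M $$ (c, j) else 0)"
    and "(M * munit n r c) $$ (i, j) = (if j = c then M $$ (i, r) else 0)"
proof -
  have "(munit n r c * M) $$ (i, j) = (\<Sum>s<n. if s = c then (if i = r then M $$ (c, j) else 0) else 0)"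
    unfolding mat_mult_index[OF munit_carrier assms(1,2,3)] using assms
    by (intro sum.cong) (auto simp: munit_def)
  thus "(munit n r c * M) $$ (i, j) = (if i = r then M $$ (c, j) else 0)" using assms by simp
  have "(M * munit n r c) $$ (i, j) = (\<Sum>s<n. if s = r then (if j = c then M $$ (i, r) else 0) else 0)"
    unfolding mat_mult_index[OF assms(1) munit_carrier assms(2,3)] using assms
    by (intro sum.cong) (auto simp: munit_def)
  thus "(M * munit n r c) $$ (i, j) = (if j = c then M $$ (i, r) else 0)" using assms by simp
qed

section \<open>Words in a tuple of matrices and their derivatives\<close>

locale mat_tuple =
  fixes n N :: nat and A :: "nat \<Rightarrow> complex Matrix.mat"
  assumes A_carrier: "i \<in> {1..N} \<Longrightarrow> A i \<in> carrier_mat n n"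
begin

lemma lmat_carrier: "fst x \<in> {1..N} \<Longrightarrow> lmat A x \<in> carrier_mat n n"
  using A_carrier[of "fst x"] by (auto simp: lmat_def)

lemma lmats_carrier: "fst ` set w \<subseteq> {1..N} \<Longrightarrow> set (map (lmat A) w) \<subseteq> carrier_mat n n"
  by (auto intro!: lmat_carrier )

lemma word_carrier: "fst ` set w \<subseteq> {1..N} \<Longrightarrow> mat_word n A w \<in> carrier_mat n n"
  unfolding mat_word_eq by (rule mprod_carrier[OF lmats_carrier])

lemma word_append:
  "fst ` set u \<subseteq> {1..N} \<Longrightarrow> fst ` set v \<subseteq> {1..N} \<Longrightarrow> mat_word n A (u @ v) = mat_word n A u * mat_word n A v"
  unfolding mat_word_eq map_append by (intro mprod_append lmats_carrier)

lemma word_Cons: "mat_word n A (x # w) = lmat A x * mat_word n A w"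
  by (simp add: mat_word_eq)

lemma word_star: 
  assumes "fst ` set w \<subseteq> {1..N}"
  shows "mat_word n A (star_word w) = mat_adjoint (mat_word n A w)"
proof -
  have "map (lmat A) (star_word w) = star_list (map (lmat A) w)"
    by (simp add: star_word_def star_list_def rev_map lmat_def)
  thus ?thesis unfolding mat_word_eq using mprod_star[OF lmats_carrier[OF assms]] by simp
qed

lemma word_single:
  assumes "fst x \<in> {1..N}" shows "mat_word n A [x] = lmat A x"
  by (simp add: mat_word_eq right_mult_one_mat[OF lmat_carrier[OF assms]])

lemma tpoly_star:
  assumes "S \<subseteq> {..<n}" "\<And>c u v. (c, u, v) \<in> set T \<Longrightarrow> fst ` set u \<subseteq> {1..N} \<and> fst ` set v \<subseteq> {1..N}"
  shows "tpoly n S (star_terms T) A = cnj (tpoly n S T A)"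
  using assms(2)
proof (induction T)
  case (Cons t T)
  obtain c u v where t: "t = (c, u, v)" by (cases t)
  have uv: "fst ` set u \<subseteq> {1..N}" "fst ` set v \<subseteq> {1..N}" using Cons.prems[of c u v] t by auto
  have "tpoly n S (star_terms T) A = cnj (tpoly n S T A)"
  proof (rule Cons.IH)
    fix c' u' v' assume "(c', u', v') \<in> set T"
    thus "fst ` set u' \<subseteq> {1..N} \<and> fst ` set v' \<subseteq> {1..N}" by (rule Cons.prems[OF list.set_intros(2)])
  qed
  moreover have "star_terms (t # T) = (cnj c, star_word u, star_word v) # star_terms T"
    by (simp add: star_terms_def t)
  ultimately show ?case unfolding t
    by (simp only: tpoly_simps word_star[OF uv(1)] word_star[OF uv(2)] complex_cnj_add complex_cnj_mult
      btr_adjoint[OF word_carrier[OF uv(1)] assms(1)] btr_adjoint[OF word_carrier[OF uv(2)] assms(1)])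
qed (simp add: star_terms_def)

lemma commutator_carrier:
  "E \<in> carrier_mat n n \<Longrightarrow> fst x \<in> {1..N} \<Longrightarrow> E * lmat A x - lmat A x * E \<in> carrier_mat n n"
  using lmat_carrier[of x] by auto

lemma dword_carrier: 
  "E \<in> carrier_mat n n \<Longrightarrow> fst ` set w \<subseteq> {1..N} \<Longrightarrow> dword n A i E w \<in> carrier_mat n n"
proof (induction w)
  case (Cons x w)
  have x: "fst x \<in> {1..N}" "fst ` set w \<subseteq> {1..N}" using Cons.prems by auto
  have "(E * lmat A x - lmat A x * E) * mat_word n A w \<in> carrier_mat n n"
    by (rule mult_carrier_mat[OF commutator_carrier[OF Cons.prems(1) x(1)] word_carrier[OF x(2)]])
  moreover have "lmat A x * dword n A i E w \<in> carrier_mat n n"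
    by (rule mult_carrier_mat[OF lmat_carrier[OF x(1)] Cons.IH[OF Cons.prems(1) x(2)]])
  ultimately show ?case by auto
qed auto

text \<open>On words in the one index \<open>i\<close> the derivation is inner: the commutators of
  the letters telescope.\<close>

lemma dword_single_index:
  assumes E: "E \<in> carrier_mat n n" and i: "i \<in> {1..N}"
  shows "fst ` set w \<subseteq> {i} \<Longrightarrow> dword n A i E w = E * mat_word n A w - mat_word n A w * E"
proof (induction w)
  case Nil
  show ?case using E by (auto simp: mat_word_eq left_mult_one_mat[of _ n n] right_mult_one_mat[of _ n n])
next
  case (Cons x w)
  define y where "y = lmat A x"
  define W where "W = mat_word n A w"
  have c: "y \<in> carrier_mat n n" "W \<in> carrier_mat n n"
    unfolding y_def W_def using Cons.prems i by (intro lmat_carrier word_carrier; auto)+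
  have yW: "y * W \<in> carrier_mat n n" and Ey: "E * y \<in> carrier_mat n n" and yE: "y * E \<in> carrier_mat n n"
    and EW: "E * W \<in> carrier_mat n n" and WE: "W * E \<in> carrier_mat n n" using c E by auto
  have "dword n A i E (x # w) = (E * y - y * E) * W + y * (E * W - W * E)"
    using Cons by (auto simp: y_def W_def)
  also have "\<dots> = (E * y * W - y * E * W) + (y * (E * W) - y * (W * E))"
    using minus_mult_distrib_mat[OF Ey yE c(2)] mult_minus_distrib_mat[OF c(1) EW WE] by simp
  also have "\<dots> = E * (y * W) - (y * W) * E"
  proof -
    have assoc: "E * y * W = E * (y * W)" "y * E * W = y * (E * W)" "y * (W * E) = y * W * E"
      using c E by (auto simp: assoc_mult_mat[of _ n n _ n _ n])
    have "E * (y * W) \<in> carrier_mat n n" "y * (E * W) \<in> carrier_mat n n" "y * W * E \<in> carrier_mat n n"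
      using c E by auto
    thus ?thesis unfolding assoc by (rule mat_minus_add_minus)
  qed
  finally show ?case by (simp add: word_Cons y_def W_def)
qed

text \<open>The derivative is the commutator of a matrix unit with W; its trace over
  \<open>S\<close> counts W_(\<beta>\<alpha>) once for \<alpha> and once, with the opposite sign,
  for \<beta>. Block traces and full traces of words in a single matrix are therefore invariant
  under the field.\<close>

lemma btr_dword_single_index:
  assumes "i \<in> {1..N}" "fst ` set w \<subseteq> {i}" "S \<subseteq> {..<n}" "\<alpha> < n" "\<beta> < n" "\<alpha> \<in> S \<longleftrightarrow> \<beta> \<in> S"
  shows "btr S (dword n A i (munit n \<alpha> \<beta>) w) = 0"
proof -
  define W where "W = mat_word n A w"
  have W: "W \<in> carrier_mat n n" unfolding W_def using assms by (intro word_carrier) auto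
  have fin: "finite S" using assms(3) finite_subset by blast
  have "btr S (dword n A i (munit n \<alpha> \<beta>) w) = 
    (\<Sum>s\<in>S. (if s = \<alpha> then W $$ (\<beta>, \<alpha>) else 0) - (if s = \<beta> then W $$ (\<beta>, \<alpha>) else 0))"
    unfolding btr_def dword_single_index[OF munit_carrier assms(1,2)] W_def[symmetric]
  proof (rule sum.cong)
    fix s assume "s \<in> S"
    hence s: "s < n" using assms by auto
    have c: "munit n \<alpha> \<beta> * W \<in> carrier_mat n n" "W * munit n \<alpha> \<beta> \<in> carrier_mat n n"
      using W by (auto intro: mult_carrier_mat[of _ n n])
    show "(munit n \<alpha> \<beta> * W - W * munit n \<alpha> \<beta>) $$ (s, s) =
      (if s = \<alpha> then W $$ (\<beta>, \<alpha>) else 0) - (if s = \<beta> then W $$ (\<beta>, \<alpha>) else 0)"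
      using munit_mult_index[OF W s s assms(4,5)] by (simp add: mat_minus_index[OF c s s])
  qed simp
  thus ?thesis using assms(6) fin by (auto simp: sum_subtractf)
qed

text \<open>A matrix unit with indices \<alpha>, \<beta> between X and Y gives X_(\<alpha>\<alpha>)
  Y_(\<beta>\<beta>) at the entry (\<alpha>, \<beta>), so the double sum factors into two block
  traces. For empty \<open>u\<close> this is the divergence of the field of P w P as a trace
  polynomial; the prefix \<open>u\<close> is there for the induction.\<close>

lemma sum_dword:
  assumes S: "S \<subseteq> {..<n}" and "fst ` set w \<subseteq> {1..N}" "fst ` set u \<subseteq> {1..N}"
  shows "(\<Sum>\<alpha>\<in>S. \<Sum>\<beta>\<in>S. (mat_word n A u * dword n A i (munit n \<alpha> \<beta>) w) $$ (\<alpha>, \<beta>)) =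
         tpoly n S (liberation_terms i u w) A"
  using assms(2,3)
proof (induction w arbitrary: u)
  case Nil
  have "(mat_word n A u * 0\<^sub>m n n) $$ (\<alpha>, \<beta>) = 0" if "\<alpha> \<in> S" "\<beta> \<in> S" for \<alpha> \<beta>
  proof -
    have "\<alpha> < n" "\<beta> < n" using that S by auto
    thus ?thesis using right_mult_zero_mat[OF word_carrier[OF Nil(2)], of n] by simp
  qed
  thus ?case by simp
next
  case (Cons x w)
  define y where "y = lmat A x"
  define W where "W = mat_word n A w"
  define U where "U = mat_word n A u"
  define D where "D = (\<lambda>\<alpha> \<beta>. dword n A i (munit n \<alpha> \<beta>) w)"
  have x: "fst x \<in> {1..N}" "fst ` set w \<subseteq> {1..N}" using Cons.prems by auto
  have c: "y \<in> carrier_mat n n" "W \<in> carrier_mat n n" "U \<in> carrier_mat n n" "\<And>\<alpha> \<beta>. D \<alpha> \<beta> \<in> carrier_mat n n"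
    unfolding y_def W_def U_def D_def
    by (rule lmat_carrier[OF x(1)], rule word_carrier[OF x(2)], rule word_carrier[OF Cons.prems(2)],
        rule dword_carrier[OF munit_carrier x(2)])
  have ux: "fst ` set (u @ [x]) \<subseteq> {1..N}" using x(1) Cons.prems(2) by auto
  have Uy: "mat_word n A (u @ [x]) = U * y"
    using word_append[OF Cons.prems(2), of "[x]"] x(1) by (simp add: U_def y_def word_single)
  have xw: "mat_word n A (x # w) = y * W" by (simp add: word_Cons y_def W_def)
  have fin: "finite S" using S finite_subset by blast
  have first: "(U * ((munit n \<alpha> \<beta> * y - y * munit n \<alpha> \<beta>) * W)) $$ (\<alpha>, \<beta>) =
      U $$ (\<alpha>, \<alpha>) * (y * W) $$ (\<beta>, \<beta>) - (U * y) $$ (\<alpha>, \<alpha>) * W $$ (\<beta>, \<beta>)" 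
    if ab: "\<alpha> \<in> S" "\<beta> \<in> S" for \<alpha> \<beta>
  proof -
    let ?E = "munit n \<alpha> \<beta>"
    have ab': "\<alpha> < n" "\<beta> < n" using ab S by auto
    have car: "?E * y \<in> carrier_mat n n" "y * ?E \<in> carrier_mat n n" "?E * (y * W) \<in> carrier_mat n n" "?E * W \<in> carrier_mat n n"
      "y * (?E * W) \<in> carrier_mat n n" "U * y \<in> carrier_mat n n" "y * W \<in> carrier_mat n n"
      using c by (auto intro!: mult_carrier_mat[of _ n n])
    have "(?E * y - y * ?E) * W = ?E * (y * W) - y * (?E * W)"
      using minus_mult_distrib_mat[OF car(1,2) c(2)] c by (simp add: assoc_mult_mat[of _ n n _ n _ n])
    hence "U * ((?E * y - y * ?E) * W) = U * (?E * (y * W)) - (U * y) * (?E * W)"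
      using mult_minus_distrib_mat[OF c(3) car(3,5)] assoc_mult_mat[OF c(3,1) car(4)] by simp
    moreover have "(U * (?E * (y * W))) $$ (\<alpha>, \<beta>) = U $$ (\<alpha>, \<alpha>) * (y * W) $$ (\<beta>, \<beta>)"
    proof -
      have "(U * (?E * (y * W))) $$ (\<alpha>, \<beta>) = (\<Sum>s<n. if s = \<alpha> then U $$ (\<alpha>, \<alpha>) * (y * W) $$ (\<beta>, \<beta>) else 0)"
        unfolding mat_mult_index[OF c(3) car(3) ab'] using munit_mult_index(1)[OF car(7) _ ab'(2) ab']
        by (intro sum.cong) auto
      thus ?thesis using ab' by simp
    qed
    moreover have "((U * y) * (?E * W)) $$ (\<alpha>, \<beta>) = (U * y) $$ (\<alpha>, \<alpha>) * W $$ (\<beta>, \<beta>)"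
    proof -
      have "((U * y) * (?E * W)) $$ (\<alpha>, \<beta>) = (\<Sum>s<n. if s = \<alpha> then (U * y) $$ (\<alpha>, \<alpha>) * W $$ (\<beta>, \<beta>) else 0)"
        unfolding mat_mult_index[OF car(6) car(4) ab'] using munit_mult_index(1)[OF c(2) _ ab'(2) ab']
        by (intro sum.cong) auto
      thus ?thesis using ab' by simp
    qed
    moreover have "U * (?E * (y * W)) \<in> carrier_mat n n" "(U * y) * (?E * W) \<in> carrier_mat n n"
      using c car by (auto intro!: mult_carrier_mat[of _ n n])
    ultimately show ?thesis using ab' by (simp add: mat_minus_index[of _ n n])
  qed
  have dist: "U * dword n A i (munit n \<alpha> \<beta>) (x # w) = 
      (if fst x = i then U * ((munit n \<alpha> \<beta> * y - y * munit n \<alpha> \<beta>) * W) else 0\<^sub>m n n) + (U * y) * D \<alpha> \<beta>" for \<alpha> \<beta>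
  proof -
    have car: "(munit n \<alpha> \<beta> * y - y * munit n \<alpha> \<beta>) * W \<in> carrier_mat n n" "y * D \<alpha> \<beta> \<in> carrier_mat n n"
      using c by (auto intro!: mult_carrier_mat[of _ n n] minus_carrier_mat)
    have "U * (y * D \<alpha> \<beta>) = (U * y) * D \<alpha> \<beta>" using c by (simp add: assoc_mult_mat[of _ n n _ n _ n])
    moreover have "dword n A i (munit n \<alpha> \<beta>) (x # w) =
      (if fst x = i then (munit n \<alpha> \<beta> * y - y * munit n \<alpha> \<beta>) * W else 0\<^sub>m n n) + y * D \<alpha> \<beta>"
      by (simp add: y_def W_def D_def)
    moreover have "U * 0\<^sub>m n n = 0\<^sub>m n n" by (rule right_mult_zero_mat[OF c(3)])
    ultimately show ?thesis using mult_add_distrib_mat[OF c(3) car] mult_add_distrib_mat[OF c(3) zero_carrier_mat car(2)]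
      by (cases "fst x = i") (simp_all only: if_True if_False simp_thms)
  qed
  have "(U * dword n A i (munit n \<alpha> \<beta>) (x # w)) $$ (\<alpha>, \<beta>) =
     (if fst x = i then U $$ (\<alpha>, \<alpha>) * (y * W) $$ (\<beta>, \<beta>) - (U * y) $$ (\<alpha>, \<alpha>) * W $$ (\<beta>, \<beta>) else 0) +
     ((U * y) * D \<alpha> \<beta>) $$ (\<alpha>, \<beta>)" if ab: "\<alpha> \<in> S" "\<beta> \<in> S" for \<alpha> \<beta>
  proof -
    have "(U * y) * D \<alpha> \<beta> \<in> carrier_mat n n" using c by (auto intro!: mult_carrier_mat[of _ n n])
    moreover have "\<alpha> < n" "\<beta> < n" using ab S by auto
    moreover have "U * ((munit n \<alpha> \<beta> * y - y * munit n \<alpha> \<beta>) * W) \<in> carrier_mat n n"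
      using c by (auto intro!: mult_carrier_mat[of _ n n] minus_carrier_mat)
    ultimately show ?thesis unfolding dist using first[OF ab] by (simp add: mat_add_index[of _ n n])
  qed
  hence "(\<Sum>\<alpha>\<in>S. \<Sum>\<beta>\<in>S. (U * dword n A i (munit n \<alpha> \<beta>) (x # w)) $$ (\<alpha>, \<beta>)) =
    (\<Sum>\<alpha>\<in>S. \<Sum>\<beta>\<in>S. if fst x = i then U $$ (\<alpha>, \<alpha>) * (y * W) $$ (\<beta>, \<beta>) - (U * y) $$ (\<alpha>, \<alpha>) * W $$ (\<beta>, \<beta>) else 0) +
    (\<Sum>\<alpha>\<in>S. \<Sum>\<beta>\<in>S. ((U * y) * D \<alpha> \<beta>) $$ (\<alpha>, \<beta>))"
    by (simp add: sum.distrib)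
  also have "(\<Sum>\<alpha>\<in>S. \<Sum>\<beta>\<in>S. ((U * y) * D \<alpha> \<beta>) $$ (\<alpha>, \<beta>)) = tpoly n S (liberation_terms i (u @ [x]) w) A"
    using Cons.IH[OF x(2) ux] by (simp add: Uy D_def)
  also have "(\<Sum>\<alpha>\<in>S. \<Sum>\<beta>\<in>S. if fst x = i then U $$ (\<alpha>, \<alpha>) * (y * W) $$ (\<beta>, \<beta>) - (U * y) $$ (\<alpha>, \<alpha>) * W $$ (\<beta>, \<beta>) else 0) =
    (if fst x = i then btr S U * btr S (y * W) - btr S (U * y) * btr S W else 0)"
    by (auto simp: btr_def sum_subtractf sum_product)
  finally show ?case by (auto simp: U_def[symmetric] xw Uy W_def[symmetric])
qed

text \<open>
  The matrices \<open>Cs\<close> are the letters together with the block projections, so every term of the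
  derivative of a trace polynomial in the direction of a word is a product of traces of such lists.
\<close>

lemma btr_dword_bound:
  assumes S: "S \<subseteq> {..<n}" and E: "P \<in> carrier_mat n n" "fst ` set v \<subseteq> {1..N}" and b: "b \<ge> 0"
    and bound: "\<And>L. set L \<subseteq> lmat A ` ({1..N} \<times> UNIV) \<union> {P, P'} \<Longrightarrow> length L \<le> m \<Longrightarrow> cmod (mat_trace (mprod n L)) \<le> b"
    and P': "P' \<in> carrier_mat n n"
  shows "fst ` set w \<subseteq> {1..N} \<Longrightarrow> set L \<subseteq> lmat A ` ({1..N} \<times> UNIV) \<union> {P, P'} \<Longrightarrow>
    length L + length w + length v + 2 \<le> m \<Longrightarrow>
    cmod (mat_trace (mprod n L * dword n A i (P * mat_word n A v * P) w)) \<le> real (2 * length w) * b"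
proof (induction w arbitrary: L)
  case Nil
  have "lmat A ` ({1..N} \<times> UNIV) \<union> {P, P'} \<subseteq> carrier_mat n n" using E(1) P' lmat_carrier by auto
  hence "set L \<subseteq> carrier_mat n n" using Nil.prems(2) by blast
  hence "mprod n L * 0\<^sub>m n n = 0\<^sub>m n n" by (intro right_mult_zero_mat mprod_carrier)
  thus ?case by (simp add: mat_trace_def)
next
  case (Cons x w)
  define y where "y = lmat A x"
  define W where "W = mat_word n A w"
  define U where "U = mprod n L"
  define X where "X = P * mat_word n A v * P"
  define D where "D = dword n A i X w"
  let ?C = "lmat A ` ({1..N} \<times> UNIV) \<union> {P, P'}"
  have x: "fst x \<in> {1..N}" "fst ` set w \<subseteq> {1..N}" using Cons.prems by auto
  have memb: "lmat A z \<in> ?C" if "fst z \<in> {1..N}" for z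
    using that by (intro UnI1 image_eqI[of _ _ z]) (auto simp: mem_Times_iff)
  have Ccar: "?C \<subseteq> carrier_mat n n" using E(1) P' lmat_carrier by auto
  have Lc: "set L \<subseteq> carrier_mat n n" using Cons.prems(2) Ccar by blast
  have sub: "set (map (lmat A) z) \<subseteq> ?C" if "fst ` set z \<subseteq> {1..N}" for z
    using that memb by auto
  have y: "y \<in> ?C" using memb x(1) by (auto simp: y_def)
  have c: "y \<in> carrier_mat n n" "W \<in> carrier_mat n n" "U \<in> carrier_mat n n" "X \<in> carrier_mat n n" 
    unfolding y_def W_def U_def X_def
    by (rule lmat_carrier[OF x(1)], rule word_carrier[OF x(2)], rule mprod_carrier[OF Lc],
        rule mult_carrier_mat[OF mult_carrier_mat[OF E(1) word_carrier[OF E(2)]] E(1)])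
  have D: "D \<in> carrier_mat n n" unfolding D_def by (rule dword_carrier[OF c(4) x(2)])
  define V where "V = [P] @ map (lmat A) v @ [P]"
  \<comment> \<open>The two products in the commutator of P v P with a letter, written as lists so
    that \<open>bound\<close> applies; they account for the 2 per letter of
    \<open>w\<close>.\<close>
  define L1 where "L1 = L @ (V @ (y # map (lmat A) w))"
  define L2 where "L2 = (L @ [y]) @ (V @ map (lmat A) w)"
  have Vc: "set V \<subseteq> carrier_mat n n" using E lmats_carrier[OF E(2)] by (auto simp: V_def)
  have wc: "set (map (lmat A) w) \<subseteq> carrier_mat n n" by (rule lmats_carrier[OF x(2)])
  have yc: "set [y] \<subseteq> carrier_mat n n" "set (y # map (lmat A) w) \<subseteq> carrier_mat n n" using c(1) wc by auto
  have Wm: "mprod n (map (lmat A) w) = W" by (simp add: W_def mat_word_eq)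
  have V: "mprod n V = X"
  proof -
    have "set (map (lmat A) v @ [P]) \<subseteq> carrier_mat n n" "set [P] \<subseteq> carrier_mat n n"
      using E(1) lmats_carrier[OF E(2)] by auto
    hence "mprod n V = P * (mat_word n A v * P)"
      using mprod_append[OF lmats_carrier[OF E(2)], of "[P]"]
      by (simp add: V_def mat_word_eq right_mult_one_mat[OF E(1)])
    thus ?thesis using assoc_mult_mat[OF E(1) word_carrier[OF E(2)] E(1)] by (simp add: X_def)
  qed
  have Ly: "mprod n (L @ [y]) = U * y" "set (L @ [y]) \<subseteq> carrier_mat n n"
    using mprod_append[OF Lc yc(1)] Lc c(1) by (simp_all add: U_def right_mult_one_mat[OF c(1)])
  have L1: "mprod n L1 = U * (X * (y * W))"
  proof -
    have "set (V @ (y # map (lmat A) w)) \<subseteq> carrier_mat n n" using Vc yc(2) by (simp only: set_append Un_subset_iff)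
    thus ?thesis unfolding L1_def
      by (simp only: mprod_append[OF Lc] mprod_append[OF Vc yc(2)] V mprod_simps Wm U_def)
  qed
  have L2: "mprod n L2 = U * (y * (X * W))"
  proof -
    have "set (V @ map (lmat A) w) \<subseteq> carrier_mat n n" using Vc wc by (simp only: set_append Un_subset_iff)
    hence "mprod n L2 = (U * y) * (X * W)" unfolding L2_def
      by (simp only: mprod_append[OF Ly(2)] mprod_append[OF Vc wc] V Wm Ly(1))
    also have "\<dots> = U * (y * (X * W))"
      by (rule assoc_mult_mat[OF c(3,1) mult_carrier_mat[OF c(4,2)]])
    finally show ?thesis .
  qed
  have b1: "cmod (mat_trace (U * (X * (y * W)))) \<le> b"
    unfolding L1[symmetric] using Cons.prems sub[OF x(2)] sub[OF E(2)] y
    by (intro bound) (auto simp: L1_def V_def)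
  have b2: "cmod (mat_trace (U * (y * (X * W)))) \<le> b"
    unfolding L2[symmetric] using Cons.prems sub[OF x(2)] sub[OF E(2)] y
    by (intro bound) (auto simp: L2_def V_def)
  have "cmod (mat_trace (mprod n (L @ [y]) * dword n A i (P * mat_word n A v * P) w)) \<le> real (2 * length w) * b"
    by (rule Cons.IH) (use Cons.prems y x in auto)
  moreover have "mprod n (L @ [y]) * dword n A i (P * mat_word n A v * P) w = U * (y * D)"
    unfolding Ly(1) X_def[symmetric] D_def[symmetric] by (rule assoc_mult_mat[OF c(3,1) D])
  ultimately have b3: "cmod (mat_trace (U * (y * D))) \<le> real (2 * length w) * b" by simp
  have car: "X * y \<in> carrier_mat n n" "y * X \<in> carrier_mat n n" "X * (y * W) \<in> carrier_mat n n" "y * (X * W) \<in> carrier_mat n n"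
    "y * D \<in> carrier_mat n n" "X * W \<in> carrier_mat n n" "y * W \<in> carrier_mat n n"
    using c D by (auto intro!: mult_carrier_mat[of _ n n])
  have tr: "mat_trace (M - M') = mat_trace M - mat_trace M'" "mat_trace (M + M') = mat_trace M + mat_trace M'"
    if "M \<in> carrier_mat n n" "M' \<in> carrier_mat n n" for M M'
    using that by (auto simp: mat_trace_def sum_subtractf sum.distrib)
  have comm: "(X * y - y * X) * W = X * (y * W) - y * (X * W)"
    using minus_mult_distrib_mat[OF car(1,2) c(2)] c by (simp add: assoc_mult_mat[of _ n n _ n _ n])
  have car2: "U * (X * (y * W)) \<in> carrier_mat n n" "U * (y * (X * W)) \<in> carrier_mat n n" "U * (y * D) \<in> carrier_mat n n"
    using c car by (auto intro!: mult_carrier_mat[of _ n n])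
  have "mat_trace (U * dword n A i X (x # w)) = 
    (if fst x = i then mat_trace (U * (X * (y * W))) - mat_trace (U * (y * (X * W))) else 0) + mat_trace (U * (y * D))"
  proof (cases "fst x = i")
    case True
    have "U * dword n A i X (x # w) = U * (X * (y * W) - y * (X * W) + y * D)"
      unfolding comm[symmetric] using True by (simp only: dword.simps y_def W_def D_def if_True simp_thms)
    also have "\<dots> = (U * (X * (y * W)) - U * (y * (X * W))) + U * (y * D)"
      using mult_add_distrib_mat[OF c(3) minus_carrier_mat[OF car(4), of "X * (y * W)"] car(5)] mult_minus_distrib_mat[OF c(3) car(3,4)]
      by simp
    finally show ?thesis using True tr(2)[OF minus_carrier_mat[OF car2(2)] car2(3)] tr(1)[OF car2(1,2)] by simp
  next
    case False
    have "dword n A i X (x # w) = y * D" using False car(5) by (simp add: y_def D_def)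
    thus ?thesis using False by simp
  qed
  moreover have "cmod (if fst x = i then mat_trace (U * (X * (y * W))) - mat_trace (U * (y * (X * W))) else 0) \<le> 2 * b"
    using b1 b2 b norm_triangle_ineq4[of "mat_trace (U * (X * (y * W)))" "mat_trace (U * (y * (X * W)))"] by auto
  ultimately have "cmod (mat_trace (U * dword n A i X (x # w))) \<le> 2 * b + real (2 * length w) * b"
    using b3 norm_triangle_ineq[of "if fst x = i then mat_trace (U * (X * (y * W))) - mat_trace (U * (y * (X * W))) else 0" "mat_trace (U * (y * D))"]
    by simp
  moreover have "real (2 * length (x # w)) * b = 2 * b + real (2 * length w) * b" by (simp add: algebra_simps)
  ultimately show ?case unfolding U_def X_def by (simp only:)
qed

end

section \<open>Integration by parts on tuples of matrices\<close>

text \<open>Checked on boxes: the preimage of a box is again a box, altered only in the side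
  \<open>i\<close>.\<close>

lemma (in product_sigma_finite) distr_PiM_update:
  assumes I: "finite I" "i \<in> I" and g: "g \<in> measurable (M i) (M i)" and inv: "distr (M i) (M i) g = M i"
  shows "(\<lambda>x. x(i := g (x i))) \<in> measurable (PiM I M) (PiM I M)"
    and "distr (PiM I M) (PiM I M) (\<lambda>x. x(i := g (x i))) = PiM I M"
proof -
  show meas: "(\<lambda>x. x(i := g (x i))) \<in> measurable (PiM I M) (PiM I M)"
  proof (rule measurable_PiM_single')
    fix j assume j: "j \<in> I"
    show "(\<lambda>x. (x(i := g (x i))) j) \<in> measurable (PiM I M) (M j)"
      using j g I by (cases "j = i") (auto intro: measurable_compose[OF measurable_component_singleton])
  next
    show "(\<lambda>x j. (x(i := g (x i))) j) \<in> space (PiM I M) \<rightarrow> (\<Pi>\<^sub>E i\<in>I. space (M i))"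
      using g I measurable_space[OF g] by (auto simp: space_PiM PiE_def extensional_def Pi_iff)
  qed
  show "distr (PiM I M) (PiM I M) (\<lambda>x. x(i := g (x i))) = PiM I M"
  proof (rule PiM_eqI)
    fix A assume A: "\<And>i. i \<in> I \<Longrightarrow> A i \<in> sets (M i)"
    have gA: "g -` A i \<inter> space (M i) \<in> sets (M i)" using g A I by auto
    have eq: "(\<lambda>x. x(i := g (x i))) -` (Pi\<^sub>E I A) \<inter> space (PiM I M) = Pi\<^sub>E I (A(i := g -` A i \<inter> space (M i)))"
    proof (rule subset_antisym; rule subsetI)
      fix x assume x: "x \<in> (\<lambda>x. x(i := g (x i))) -` (Pi\<^sub>E I A) \<inter> space (PiM I M)"
      hence "x j \<in> (A(i := g -` A i \<inter> space (M i))) j" if "j \<in> I" for j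
        using that PiE_mem[of "x(i := g (x i))" I A j] PiE_mem[of x I "\<lambda>i. space (M i)" j]
        by (auto simp: space_PiM)
      thus "x \<in> Pi\<^sub>E I (A(i := g -` A i \<inter> space (M i)))"
        using x by (auto simp: space_PiM PiE_def)
    next
      fix x assume x: "x \<in> Pi\<^sub>E I (A(i := g -` A i \<inter> space (M i)))"
      have "x j \<in> space (M j)" if "j \<in> I" for j
        using PiE_mem[OF x that] sets.sets_into_space[OF A[OF that]] by (cases "j = i") auto
      thus "x \<in> (\<lambda>x. x(i := g (x i))) -` (Pi\<^sub>E I A) \<inter> space (PiM I M)"
        using x I by (auto simp: space_PiM PiE_def extensional_def Pi_iff split: if_splits)
    qed
    have "emeasure (distr (PiM I M) (PiM I M) (\<lambda>x. x(i := g (x i)))) (Pi\<^sub>E I A) =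
        emeasure (PiM I M) (Pi\<^sub>E I (A(i := g -` A i \<inter> space (M i))))"
      using meas A I by (subst emeasure_distr) (auto simp: eq intro!: sets_PiM_I_finite)
    also have "\<dots> = (\<Prod>j\<in>I. emeasure (M j) ((A(i := g -` A i \<inter> space (M i))) j))"
      using A gA I by (intro emeasure_PiM) auto
    also have "\<dots> = (\<Prod>j\<in>I. emeasure (M j) (A j))"
    proof (rule prod.cong)
      fix j assume j: "j \<in> I"
      show "emeasure (M j) ((A(i := g -` A i \<inter> space (M i))) j) = emeasure (M j) (A j)"
        using emeasure_distr[OF g, of "A i"] A I inv by (cases "j = i") auto
    qed simp
    finally show "emeasure (distr (PiM I M) (PiM I M) (\<lambda>x. x(i := g (x i)))) (Pi\<^sub>E I A) = (\<Prod>j\<in>I. emeasure (M j) (A j))" .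
  qed (use I in auto)
qed

text \<open>The integral of f composed with T_\<zeta> does not depend on \<zeta>, so its derivative
  is zero. Dominated convergence brings the derivative under the integral, because \<open>f\<close>
  moves by at most C |\<zeta>| on the set \<open>K\<close> of finite measure and stays zero
  elsewhere.\<close>

lemma integral_derivative_zero:
  fixes f g h :: "'a \<Rightarrow> complex" and T :: "complex \<Rightarrow> 'a \<Rightarrow> 'a"
  assumes T: "\<And>\<zeta>. T \<zeta> \<in> measurable M M" "\<And>\<zeta>. distr M M (T \<zeta>) = M"
    and T_add: "\<And>\<zeta> \<zeta>' x. x \<in> space M \<Longrightarrow> T \<zeta> (T \<zeta>' x) = T (\<zeta> + \<zeta>') x"
    and T_0: "\<And>x. x \<in> space M \<Longrightarrow> T 0 x = x"
    and meas: "f \<in> borel_measurable M" "g \<in> borel_measurable M" "h \<in> borel_measurable M"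
    and deriv: "\<And>x. x \<in> space M \<Longrightarrow> ((\<lambda>\<zeta>. f (T \<zeta> x)) has_derivative (\<lambda>\<zeta>. g x * \<zeta> + h x * cnj \<zeta>)) (at 0)"
    and K: "K \<in> sets M" "emeasure M K < \<infinity>"
    and supp: "\<And>x \<zeta>. x \<in> space M \<Longrightarrow> x \<notin> K \<Longrightarrow> cmod \<zeta> \<le> 1 \<Longrightarrow> f (T \<zeta> x) = 0"
    and bound: "\<And>x \<zeta>. x \<in> K \<Longrightarrow> cmod \<zeta> \<le> 1 \<Longrightarrow> cmod (f (T \<zeta> x)) \<le> C"
      "\<And>x \<zeta>. x \<in> K \<Longrightarrow> cmod \<zeta> \<le> 1 \<Longrightarrow> cmod (g (T \<zeta> x)) + cmod (h (T \<zeta> x)) \<le> C"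
  shows "integrable M g \<and> integrable M h \<and> integral\<^sup>L M g = 0 \<and> integral\<^sup>L M h = 0"
proof -
  have Ksp: "x \<in> space M" if "x \<in> K" for x using K(1) that sets.sets_into_space by blast
  \<comment> \<open>Off \<open>K\<close>, \<open>f\<close> vanishes along the orbit for |\<zeta>|
    \<le> 1, so its differential is zero; the directions 1 and \<i> separate the two
    coefficients.\<close>
  have off: "g x = 0 \<and> h x = 0" if x: "x \<in> space M" "x \<notin> K" for x
  proof -
    have "((\<lambda>\<zeta>. f (T \<zeta> x)) has_derivative (\<lambda>_. 0)) (at 0)"
      by (rule has_derivative_transform_within_open[of "\<lambda>_. 0" _ _ _ "ball 0 1"])
        (use supp[OF x] in \<open>auto simp: dist_norm\<close>)
    from has_derivative_unique[OF this deriv[OF x(1)]]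
    have z: "g x * \<zeta> + h x * cnj \<zeta> = 0" for \<zeta> by metis
    from z[of 1] z[of \<i>] show ?thesis by (auto simp: complex_eq_iff)
  qed
  have C0: "C \<ge> 0" if "x \<in> K" for x using bound(1)[OF that, of 0] order_trans[OF norm_ge_zero] by auto
  have intb: "integrable M F" if "F \<in> borel_measurable M" "\<And>x. x \<in> K \<Longrightarrow> cmod (F x) \<le> C" "\<And>x. x \<in> space M \<Longrightarrow> x \<notin> K \<Longrightarrow> F x = 0" for F
  proof (rule Bochner_Integration.integrable_bound)
    show "integrable M (\<lambda>x. C * indicator K x)" using K by (simp add: integrable_mult_right)
    show "AE x in M. cmod (F x) \<le> norm (C * indicator K x :: real)"
      using that(2,3) C0 by (intro AE_I2) (auto simp: indicator_def split: if_splits)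
  qed (rule that)
  have int: "integrable M f" "integrable M g" "integrable M h"
  proof -
    show "integrable M f" using bound(1)[of _ 0] supp[of _ 0] T_0 Ksp by (intro intb meas) auto
    have b: "cmod (g x) + cmod (h x) \<le> C" if "x \<in> K" for x using bound(2)[OF that, of 0] T_0[OF Ksp[OF that]] by simp
    have b': "cmod (g x) \<le> C" "cmod (h x) \<le> C" if "x \<in> K" for x
      using b[OF that] norm_ge_zero[of "g x"] norm_ge_zero[of "h x"] by linarith+
    show "integrable M g" by (rule intb[OF meas(2) b'(1)]) (use off in auto)
    show "integrable M h" by (rule intb[OF meas(3) b'(2)]) (use off in auto)
  qed
  have deriv': "((\<lambda>\<zeta>. f (T \<zeta> x)) has_derivative (\<lambda>\<zeta>. g (T \<zeta>0 x) * \<zeta> + h (T \<zeta>0 x) * cnj \<zeta>)) (at \<zeta>0)"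
    if x: "x \<in> space M" for x \<zeta>0
  proof -
    have Tx: "T \<zeta>0 x \<in> space M" using T(1) x by (rule measurable_space)
    have "((\<lambda>\<zeta>. f (T (\<zeta> - \<zeta>0) (T \<zeta>0 x))) has_derivative (\<lambda>\<zeta>. g (T \<zeta>0 x) * \<zeta> + h (T \<zeta>0 x) * cnj \<zeta>)) (at \<zeta>0)"
      by (rule has_derivative_compose[of "\<lambda>\<zeta>. \<zeta> - \<zeta>0" "\<lambda>\<zeta>. \<zeta>" \<zeta>0 UNIV "\<lambda>\<zeta>. f (T \<zeta> (T \<zeta>0 x))"])
        (auto intro!: derivative_eq_intros deriv[OF Tx])
    thus ?thesis by (simp add: T_add[OF x])
  qed
  have lip: "cmod (f (T \<eta> x) - f x) \<le> C * cmod \<eta>" if x: "x \<in> K" and \<eta>: "cmod \<eta> \<le> 1" for x \<eta>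
  proof -
    have "norm (f (T \<eta> x) - f (T 0 x)) \<le> C * norm (\<eta> - 0)"
    proof (rule differentiable_bound[of "cball 0 1"])
      fix \<zeta> :: complex assume z: "\<zeta> \<in> cball 0 1"
      show "((\<lambda>\<zeta>. f (T \<zeta> x)) has_derivative (\<lambda>\<zeta>'. g (T \<zeta> x) * \<zeta>' + h (T \<zeta> x) * cnj \<zeta>')) (at \<zeta> within cball 0 1)"
        by (rule has_derivative_at_withinI[OF deriv'[OF Ksp[OF x]]])
      show "onorm (\<lambda>\<zeta>'. g (T \<zeta> x) * \<zeta>' + h (T \<zeta> x) * cnj \<zeta>') \<le> C"
      proof (rule onorm_le)
        fix \<zeta>'
        have "norm (g (T \<zeta> x) * \<zeta>' + h (T \<zeta> x) * cnj \<zeta>') \<le> (cmod (g (T \<zeta> x)) + cmod (h (T \<zeta> x))) * cmod \<zeta>'"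
          by (rule order_trans[OF norm_triangle_ineq]) (simp add: norm_mult algebra_simps)
        also have "\<dots> \<le> C * cmod \<zeta>'" using bound(2)[OF x] z by (intro mult_right_mono) auto
        finally show "norm (g (T \<zeta> x) * \<zeta>' + h (T \<zeta> x) * cnj \<zeta>') \<le> C * cmod \<zeta>'" .
      qed
    qed (use \<eta> in auto)
    thus ?thesis using T_0[OF Ksp[OF x]] by simp
  qed
  have inv: "integral\<^sup>L M (\<lambda>x. f (T \<zeta> x)) = integral\<^sup>L M f" "integrable M (\<lambda>x. f (T \<zeta> x))" for \<zeta>
    using integral_distr[OF T(1) meas(1), of \<zeta>] integrable_distr[OF T(1), of \<zeta> f] int(1)
    unfolding T(2) by simp_all
  have dir: "integral\<^sup>L M (\<lambda>x. g x * \<zeta> + h x * cnj \<zeta>) = 0" if \<zeta>: "cmod \<zeta> = 1" for \<zeta>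
  proof -
    \<comment> \<open>\<open>Suc m\<close> is the inverse length of the step because |\<zeta>| = 1,
      and it is never 0.\<close>
    define s where "s = (\<lambda>m x. of_nat (Suc m) * (f (T (\<zeta> / of_nat (Suc m)) x) - f x))"
    have small: "cmod (\<zeta> / of_nat (Suc m)) \<le> 1" "cmod (\<zeta> / of_nat (Suc m)) = 1 / real (Suc m)" for m
      using \<zeta> by (auto simp: norm_divide simp del: of_nat_Suc)
    have "(\<lambda>m. integral\<^sup>L M (s m)) \<longlonglongrightarrow> integral\<^sup>L M (\<lambda>x. g x * \<zeta> + h x * cnj \<zeta>)"
    proof (rule integral_dominated_convergence)
      show "integrable M (\<lambda>x. C * indicator K x)" using K by (simp add: integrable_mult_right)
      show "AE x in M. (\<lambda>m. s m x) \<longlonglongrightarrow> g x * \<zeta> + h x * cnj \<zeta>"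
      proof (rule AE_I2)
        fix x assume x: "x \<in> space M"
        let ?F = "\<lambda>\<zeta>. g x * \<zeta> + h x * cnj \<zeta>"
        define e where "e = (\<lambda>y. (1 / norm (y - 0)) *\<^sub>R (f (T y x) - (f (T 0 x) + ?F (y - 0))))"
        have "e \<midarrow>0\<rightarrow> 0" using deriv[OF x] unfolding has_derivative_at2 e_def by blast
        moreover have "filterlim (\<lambda>m. \<zeta> / of_nat (Suc m)) (at 0) sequentially"
        proof (rule filterlim_atI)
          show "(\<lambda>m. \<zeta> / of_nat (Suc m)) \<longlonglongrightarrow> 0"
            using tendsto_mult[OF tendsto_const[of \<zeta>] LIMSEQ_inverse_real_of_nat[THEN tendsto_of_real, where 'a=complex]]
            by (simp add: field_simps)
          show "\<forall>\<^sub>F m in sequentially. \<zeta> / of_nat (Suc m) \<noteq> 0" using \<zeta> by (auto simp del: of_nat_Suc)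
        qed
        ultimately have "(\<lambda>m. e (\<zeta> / of_nat (Suc m))) \<longlonglongrightarrow> 0" by (rule filterlim_compose)
        hence "(\<lambda>m. e (\<zeta> / of_nat (Suc m)) + ?F \<zeta>) \<longlonglongrightarrow> 0 + ?F \<zeta>" by (intro tendsto_intros)
        moreover have "e (\<zeta> / of_nat (Suc m)) + ?F \<zeta> = s m x" for m
        proof -
          have "e (\<zeta> / of_nat (Suc m)) = of_nat (Suc m) * (f (T (\<zeta> / of_nat (Suc m)) x) - (f x + ?F (\<zeta> / of_nat (Suc m))))"
            unfolding e_def diff_zero small(2) using T_0[OF x] by (simp add: scaleR_conv_of_real del: of_nat_Suc)
          moreover have "of_nat (Suc m) * ?F (\<zeta> / of_nat (Suc m)) = ?F \<zeta>" by (simp add: field_simps del: of_nat_Suc)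
          ultimately show ?thesis unfolding s_def by (simp add: algebra_simps del: of_nat_Suc)
        qed
        ultimately show "(\<lambda>m. s m x) \<longlonglongrightarrow> ?F \<zeta>" by simp
      qed
      fix m
      show "AE x in M. norm (s m x) \<le> C * indicator K x"
      proof (rule AE_I2)
        fix x assume x: "x \<in> space M"
        show "norm (s m x) \<le> C * indicator K x"
        proof (cases "x \<in> K")
          case True
          have "norm (s m x) \<le> real (Suc m) * (C * (1 / real (Suc m)))"
            unfolding s_def norm_mult using lip[OF True small(1), of m] small(2)[of m]
            by (intro mult_mono) (auto simp del: of_nat_Suc)
          thus ?thesis using True by (simp del: of_nat_Suc)
        next
          case False
          have "f (T (\<zeta> / of_nat (Suc m)) x) = 0" "f x = 0"
            using supp[OF x False small(1)] supp[OF x False, of 0] T_0[OF x] by auto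
          thus ?thesis using False by (simp add: s_def)
        qed
      qed
      show "s m \<in> borel_measurable M"
        unfolding s_def using meas(1) measurable_compose[OF T(1) meas(1)] by measurable
    next
      show "(\<lambda>x. g x * \<zeta> + h x * cnj \<zeta>) \<in> borel_measurable M" using meas by measurable
    qed
    moreover have "integral\<^sup>L M (s m) = 0" for m
      unfolding s_def using inv int(1) by simp
    ultimately have "(\<lambda>m. 0) \<longlonglongrightarrow> integral\<^sup>L M (\<lambda>x. g x * \<zeta> + h x * cnj \<zeta>)" by simp
    thus ?thesis using LIMSEQ_unique[OF tendsto_const] by metis
  qed
  \<comment> \<open>The directions 1 and \<i> give the sum and the difference of the two
    integrals.\<close>
  have "integral\<^sup>L M g + integral\<^sup>L M h = 0" using dir[of 1] int by simp
  moreover have "integral\<^sup>L M g * \<i> - integral\<^sup>L M h * \<i> = 0" using dir[of \<i>] int by simp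
  ultimately have "integral\<^sup>L M g = 0" "integral\<^sup>L M h = 0" by (auto simp: complex_eq_iff)
  thus ?thesis using int by blast
qed

text \<open>Versions of \<open>block_matrices\<close>, \<open>fill_block\<close> and
  \<open>block_lebesgue\<close> for arbitrary index sets, which keep the algebra out of the
  integration theory; \<open>block_matrices_eq\<close> and \<open>block_lebesgue_eq\<close> link
  them.\<close>

definition rect_mats :: "nat \<Rightarrow> nat set \<Rightarrow> nat set \<Rightarrow> complex Matrix.mat set" where
  "rect_mats n I J = {A \<in> carrier_mat n n. \<forall>u<n. \<forall>v<n. u \<notin> I \<or> v \<notin> J \<longrightarrow> A $$ (u, v) = 0}"

definition fill_mat :: "nat \<Rightarrow> nat set \<Rightarrow> nat set \<Rightarrow> (nat \<times> nat \<Rightarrow> complex) \<Rightarrow> complex Matrix.mat" where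
  "fill_mat n I J z = Matrix.mat n n (\<lambda>(i, j). if i \<in> I \<and> j \<in> J then z (i, j) else 0)"

definition rect_lebesgue :: "nat \<Rightarrow> nat set \<Rightarrow> nat set \<Rightarrow> complex Matrix.mat measure" where
  "rect_lebesgue n I J = embed_measure (Pi\<^sub>M (I \<times> J) (\<lambda>_. lborel)) (fill_mat n I J)"

definition shift_entry :: "nat \<Rightarrow> nat \<Rightarrow> nat \<Rightarrow> complex \<Rightarrow> complex Matrix.mat \<Rightarrow> complex Matrix.mat" where
  "shift_entry n r c \<zeta> A = Matrix.mat n n (\<lambda>(u, v). A $$ (u, v) + (if u = r \<and> v = c then \<zeta> else 0))"

lemma shift_entry_index [simp]:
  "u < n \<Longrightarrow> v < n \<Longrightarrow> shift_entry n r c \<zeta> A $$ (u, v) = A $$ (u, v) + (if u = r \<and> v = c then \<zeta> else 0)"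
  by (simp add: shift_entry_def)

interpretation lborel_product: product_sigma_finite "\<lambda>_. lborel :: complex measure"
  by standard

section \<open>Lebesgue measure on tuples of rectangular matrices and its translations\<close>

locale rect_tuple =
  fixes n N :: nat and I J :: "nat set"
  assumes I_sub: "I \<subseteq> {..<n}" and J_sub: "J \<subseteq> {..<n}"
begin

abbreviation "R \<equiv> rect_lebesgue n I J"
abbreviation "P \<equiv> Pi\<^sub>M (I \<times> J) (\<lambda>_. lborel :: complex measure)"

definition M :: "(nat \<Rightarrow> complex Matrix.mat) measure" where
  "M = Pi\<^sub>M {1..N} (\<lambda>_. R)"

lemma finite_IJ: "finite I" "finite J" "finite (I \<times> J)"
  using I_sub J_sub finite_subset by blast+

lemma fill_mat_inj: "inj_on (fill_mat n I J) (space P)"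
proof (rule inj_onI)
  fix z z' assume z: "z \<in> space P" "z' \<in> space P" and eq: "fill_mat n I J z = fill_mat n I J z'"
  show "z = z'"
  proof (rule PiE_ext[of _ "I \<times> J" "\<lambda>_. UNIV"])
    fix x assume x: "x \<in> I \<times> J"
    obtain u v where uv: "x = (u, v)" "u \<in> I" "v \<in> J" using x by auto
    hence "u < n" "v < n" using I_sub J_sub by auto
    moreover have "fill_mat n I J z $$ x = fill_mat n I J z' $$ x" using eq by simp
    ultimately show "z x = z' x" using uv by (simp add: fill_mat_def)
  qed (use z in \<open>auto simp: space_PiM\<close>)
qed

lemma space_R: "space R = rect_mats n I J"
proof -
  have "A \<in> fill_mat n I J ` space P" if A: "A \<in> rect_mats n I J" for A
  proof (rule image_eqI)
    show "A = fill_mat n I J (restrict (\<lambda>x. A $$ x) (I \<times> J))"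
      using A by (intro eq_matI) (auto simp: fill_mat_def rect_mats_def)
  qed (auto simp: space_PiM)
  moreover have "fill_mat n I J z \<in> rect_mats n I J" for z
    by (auto simp: fill_mat_def rect_mats_def)
  ultimately show ?thesis unfolding rect_lebesgue_def space_embed_measure by blast
qed

lemma fill_mat_measurable: "fill_mat n I J \<in> measurable P R"
  unfolding rect_lebesgue_def by (rule measurable_embed_measure2'[OF fill_mat_inj])

lemma R_distr: "R = distr P R (fill_mat n I J)"
  unfolding rect_lebesgue_def by (rule embed_measure_eq_distr'[OF fill_mat_inj])

lemma entry_measurable_R: "u < n \<Longrightarrow> v < n \<Longrightarrow> (\<lambda>A. A $$ (u, v)) \<in> borel_measurable R"
  unfolding rect_lebesgue_def
proof (rule measurable_embed_measure1)
  assume uv: "u < n" "v < n"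
  show "(\<lambda>x. fill_mat n I J x $$ (u, v)) \<in> borel_measurable P"
  proof (cases "u \<in> I \<and> v \<in> J")
    case True
    have "(\<lambda>x. x (u, v)) \<in> measurable P lborel" using True by (intro measurable_component_singleton) auto
    thus ?thesis using uv True by (simp add: fill_mat_def)
  qed (use uv in \<open>auto simp: fill_mat_def\<close>)
qed

lemma R_entries_le:
  "{X \<in> space R. \<forall>u\<in>{..<n}. \<forall>v\<in>{..<n}. cmod (X $$ (u, v)) \<le> L} \<in> sets R" (is "?B \<in> _")
  "emeasure R {X \<in> space R. \<forall>u\<in>{..<n}. \<forall>v\<in>{..<n}. cmod (X $$ (u, v)) \<le> L} < \<infinity>"
proof -
  have "{X \<in> space R. cmod (X $$ (u, v)) \<le> L} \<in> sets R" if "u < n" "v < n" for u v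
    by (rule borel_measurable_le[OF measurable_compose[OF entry_measurable_R[OF that] borel_measurable_norm] borel_measurable_const])
  thus B: "?B \<in> sets R" by (intro sets.sets_Collect_finite_All) auto
  have "emeasure R ?B = emeasure P (fill_mat n I J -` ?B \<inter> space P)"
    by (subst R_distr, rule emeasure_distr[OF fill_mat_measurable B])
  also have "\<dots> \<le> emeasure P (Pi\<^sub>E (I \<times> J) (\<lambda>_. cball 0 L))"
  proof (rule emeasure_mono)
    show "fill_mat n I J -` ?B \<inter> space P \<subseteq> Pi\<^sub>E (I \<times> J) (\<lambda>_. cball 0 L)"
    proof
      fix z assume z: "z \<in> fill_mat n I J -` ?B \<inter> space P"
      have "cmod (z x) \<le> L" if x: "x \<in> I \<times> J" for x
      proof -
        obtain u v where uv: "x = (u, v)" "u \<in> I" "v \<in> J" using x by auto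
        hence lt: "u < n" "v < n" using I_sub J_sub by auto
        hence "cmod (fill_mat n I J z $$ (u, v)) \<le> L" using z by auto
        thus ?thesis using uv lt by (simp add: fill_mat_def)
      qed
      thus "z \<in> Pi\<^sub>E (I \<times> J) (\<lambda>_. cball 0 L)" using z by (auto simp: space_PiM PiE_def dist_norm)
    qed
    show "Pi\<^sub>E (I \<times> J) (\<lambda>_. cball 0 L) \<in> sets P" using finite_IJ by (intro sets_PiM_I_finite) auto
  qed
  also have "\<dots> = (\<Prod>x\<in>I \<times> J. emeasure lborel (cball 0 L :: complex set))"
    using finite_IJ by (intro lborel_product.emeasure_PiM) auto
  also have "\<dots> < \<infinity>"
    using emeasure_lborel_cball_finite[of "0::complex" L] by (simp add: power_less_top_ennreal)
  finally show "emeasure R ?B < \<infinity>" .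
qed

lemma sigma_finite_R: "sigma_finite_measure R"
proof
  let ?B = "\<lambda>L :: real. {X \<in> space R. \<forall>u\<in>{..<n}. \<forall>v\<in>{..<n}. cmod (X $$ (u, v)) \<le> L}"
  have cover: "X \<in> (\<Union>m. ?B (real m))" if X: "X \<in> space R" for X
  proof -
    obtain m where m: "(\<Sum>x\<in>{..<n} \<times> {..<n}. cmod (X $$ x)) \<le> real m" using real_arch_simple by blast
    have "cmod (X $$ (u, v)) \<le> real m" if "u < n" "v < n" for u v
      using member_le_sum[of "(u, v)" "{..<n} \<times> {..<n}" "\<lambda>x. cmod (X $$ x)"] that m by auto
    thus ?thesis using X by auto
  qed
  show "\<exists>A. countable A \<and> A \<subseteq> sets R \<and> \<Union> A = space R \<and> (\<forall>a\<in>A. emeasure R a \<noteq> \<infinity>)"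
    by (intro exI[of _ "range (\<lambda>m::nat. ?B (real m))"] conjI)
      (use cover R_entries_le in \<open>auto simp: less_top[symmetric] image_subset_iff\<close>)
qed

sublocale R: product_sigma_finite "\<lambda>_ :: nat. R"
  by (intro product_sigma_finite.intro sigma_finite_R)

text \<open>Through \<open>fill_mat\<close> the shift becomes the translation of one planar
  coordinate.\<close>

lemma shift_entry_invariant:
  assumes rc: "r \<in> I" "c \<in> J"
  shows "shift_entry n r c \<zeta> \<in> measurable R R" and "distr R R (shift_entry n r c \<zeta>) = R"
proof -
  let ?g = "\<lambda>x :: complex. \<zeta> + x"
  let ?G = "\<lambda>x. x((r, c) := ?g (x (r, c)))"
  have g: "?g \<in> measurable lborel lborel" "distr lborel lborel ?g = lborel"
    using lborel_distr_plus[of \<zeta>] by (auto cong: distr_cong)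
  have G: "?G \<in> measurable P P" "distr P P ?G = P"
    using lborel_product.distr_PiM_update[OF finite_IJ(3), of "(r, c)" ?g] rc g by auto
  have sf: "shift_entry n r c \<zeta> (fill_mat n I J z) = fill_mat n I J (?G z)" for z
    using rc by (intro eq_matI) (auto simp: fill_mat_def shift_entry_def)
  show meas: "shift_entry n r c \<zeta> \<in> measurable R R"
    unfolding rect_lebesgue_def
  proof (rule measurable_embed_measure1)
    show "(\<lambda>x. shift_entry n r c \<zeta> (fill_mat n I J x)) \<in> measurable P (embed_measure P (fill_mat n I J))"
      unfolding sf using measurable_compose[OF G(1) fill_mat_measurable] by (simp add: rect_lebesgue_def)
  qed
  have "distr R R (shift_entry n r c \<zeta>) = distr (distr P R (fill_mat n I J)) R (shift_entry n r c \<zeta>)"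
    using R_distr by simp
  also have "\<dots> = distr P R (\<lambda>z. fill_mat n I J (?G z))"
    by (subst distr_distr[OF meas fill_mat_measurable]) (simp add: comp_def sf)
  also have "\<dots> = distr (distr P P ?G) R (fill_mat n I J)"
    by (subst distr_distr[OF fill_mat_measurable G(1)]) (simp add: comp_def)
  also have "\<dots> = R" using G(2) R_distr by simp
  finally show "distr R R (shift_entry n r c \<zeta>) = R" .
qed

definition tshift :: "nat \<Rightarrow> nat \<times> nat \<Rightarrow> complex \<Rightarrow> (nat \<Rightarrow> complex Matrix.mat) \<Rightarrow> nat \<Rightarrow> complex Matrix.mat" where
  "tshift i rc \<zeta> A = A(i := shift_entry n (fst rc) (snd rc) \<zeta> (A i))"

lemma tshift_invariant:
  assumes "i \<in> {1..N}" "rc \<in> I \<times> J"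
  shows "tshift i rc \<zeta> \<in> measurable M M" and "distr M M (tshift i rc \<zeta>) = M"
  using R.distr_PiM_update[of "{1..N}" i "shift_entry n (fst rc) (snd rc) \<zeta>"] assms
    shift_entry_invariant[of "fst rc" "snd rc" \<zeta>] unfolding M_def tshift_def by auto

lemma space_M: "space M = {1..N} \<rightarrow>\<^sub>E rect_mats n I J"
  by (simp add: M_def space_PiM space_R)

lemma space_M_D: 
  assumes "A \<in> space M" "i \<in> {1..N}"
  shows "A i \<in> carrier_mat n n" "A i \<in> space R" "\<And>u v. u < n \<Longrightarrow> v < n \<Longrightarrow> u \<notin> I \<or> v \<notin> J \<Longrightarrow> A i $$ (u, v) = 0"
  using PiE_mem[of A "{1..N}" "\<lambda>_. rect_mats n I J" i] assms unfolding space_M space_R rect_mats_def by auto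

lemma tshift_space: "i \<in> {1..N} \<Longrightarrow> rc \<in> I \<times> J \<Longrightarrow> A \<in> space M \<Longrightarrow> tshift i rc \<zeta> A \<in> space M"
  using tshift_invariant(1) by (rule measurable_space)

lemma entry_measurable: "i \<in> {1..N} \<Longrightarrow> u < n \<Longrightarrow> v < n \<Longrightarrow> (\<lambda>A. A i $$ (u, v)) \<in> borel_measurable M"
  unfolding M_def by (rule measurable_compose[OF measurable_component_singleton[of i "{1..N}" "\<lambda>_. R"] entry_measurable_R])

lemma tshift_add: "i \<in> {1..N} \<Longrightarrow> A \<in> space M \<Longrightarrow> tshift i rc \<zeta> (tshift i rc \<zeta>' A) = tshift i rc (\<zeta> + \<zeta>') A"
proof -
  have "shift_entry n r c \<zeta> (shift_entry n r c \<zeta>' X) = shift_entry n r c (\<zeta> + \<zeta>') X" for r c X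
    by (intro eq_matI) (auto simp: shift_entry_def)
  thus ?thesis by (simp add: tshift_def)
qed

lemma tshift_0: "i \<in> {1..N} \<Longrightarrow> A \<in> space M \<Longrightarrow> tshift i rc 0 A = A"
proof -
  assume *: "i \<in> {1..N}" "A \<in> space M"
  have "shift_entry n r c 0 (A i) = A i" for r c
    using space_M_D(1)[OF *(2,1)] by (intro eq_matI) (auto simp: shift_entry_def)
  thus ?thesis by (simp add: tshift_def)
qed

text \<open>Entrywise bounds suit the translations: a shift of one entry enlarges the box by no more
  than its own size. Boxes have finite measure and contain the support of the cut-off.\<close>

definition Box :: "real \<Rightarrow> (nat \<Rightarrow> complex Matrix.mat) set" where
  "Box L = {A \<in> space M. \<forall>i\<in>{1..N}. \<forall>u\<in>{..<n}. \<forall>v\<in>{..<n}. cmod (A i $$ (u, v)) \<le> L}"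

lemma Box_sets [measurable]: "Box L \<in> sets M"
proof -
  have "{A \<in> space M. cmod (A i $$ (u, v)) \<le> L} \<in> sets M" if "i \<in> {1..N}" "u < n" "v < n" for i u v
    by (rule borel_measurable_le[OF measurable_compose[OF entry_measurable[OF that] borel_measurable_norm] borel_measurable_const])
  thus ?thesis unfolding Box_def by (intro sets.sets_Collect_finite_All) auto
qed

lemma emeasure_Box: "emeasure M (Box L) < \<infinity>"
proof -
  let ?B = "{X \<in> space R. \<forall>u\<in>{..<n}. \<forall>v\<in>{..<n}. cmod (X $$ (u, v)) \<le> L}"
  have "emeasure M (Box L) \<le> emeasure M (Pi\<^sub>E {1..N} (\<lambda>_. ?B))"
  proof (rule emeasure_mono)
    show "Box L \<subseteq> Pi\<^sub>E {1..N} (\<lambda>_. ?B)" unfolding Box_def space_M space_R by (auto simp: PiE_def)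
    show "Pi\<^sub>E {1..N} (\<lambda>_. ?B) \<in> sets M" unfolding M_def using R_entries_le by (intro sets_PiM_I_finite) auto
  qed
  also have "\<dots> = (\<Prod>x\<in>{1..N}. emeasure R ?B)" unfolding M_def using R_entries_le by (intro R.emeasure_PiM) auto
  also have "\<dots> < \<infinity>" using R_entries_le(2)[of L] by (simp add: power_less_top_ennreal)
  finally show ?thesis .
qed

lemma tshift_Box:
  assumes "i \<in> {1..N}" "rc \<in> I \<times> J" "A \<in> Box L" "cmod \<zeta> \<le> e"
  shows "tshift i rc \<zeta> A \<in> Box (L + e)"
proof -
  have A: "A \<in> space M" using assms by (auto simp: Box_def)
  have e: "e \<ge> 0" using assms(4) norm_ge_zero order_trans by blast
  have "cmod (tshift i rc \<zeta> A i' $$ (u, v)) \<le> L + e" if "i' \<in> {1..N}" "u < n" "v < n" for i' u v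
  proof -
    have 1: "cmod (A i' $$ (u, v)) \<le> L" using assms(3) that by (auto simp: Box_def)
    show ?thesis
    proof (cases "i' = i \<and> u = fst rc \<and> v = snd rc")
      case True
      thus ?thesis using that 1 assms(4) norm_triangle_ineq[of "A i' $$ (u, v)" \<zeta>]
        by (cases rc) (simp add: tshift_def)
    next
      case False
      hence "tshift i rc \<zeta> A i' $$ (u, v) = A i' $$ (u, v)" using that by (auto simp: tshift_def)
      thus ?thesis using 1 e by simp
    qed
  qed
  thus ?thesis using tshift_space[OF assms(1,2) A] by (auto simp: Box_def)
qed

text \<open>Boundedness on boxes suffices for integrals, since every integrand has a factor
  supported in one; unlike integrability it is preserved by products.\<close>

definition regular :: "((nat \<Rightarrow> complex Matrix.mat) \<Rightarrow> complex) \<Rightarrow> bool" where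
  "regular f \<longleftrightarrow> f \<in> borel_measurable M \<and> (\<forall>L. \<exists>B. \<forall>A\<in>Box L. cmod (f A) \<le> B)"

text \<open>\<open>g\<close> and \<open>h\<close> are the Wirtinger derivatives of \<open>f\<close> in the entry \<open>rc\<close> of the \<open>i\<close>-th matrix.\<close>

definition wirtinger :: "nat \<Rightarrow> nat \<times> nat \<Rightarrow> ((nat \<Rightarrow> complex Matrix.mat) \<Rightarrow> complex) \<Rightarrow>
    ((nat \<Rightarrow> complex Matrix.mat) \<Rightarrow> complex) \<Rightarrow> ((nat \<Rightarrow> complex Matrix.mat) \<Rightarrow> complex) \<Rightarrow> bool" where
  "wirtinger i rc f g h \<longleftrightarrow> regular f \<and> regular g \<and> regular h \<and>
     (\<forall>A\<in>space M. ((\<lambda>\<zeta>. f (tshift i rc \<zeta> A)) has_derivative (\<lambda>\<zeta>. g A * \<zeta> + h A * cnj \<zeta>)) (at 0))"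

lemma wirtinger_integral:
  assumes wd: "wirtinger i rc f g h" and i: "i \<in> {1..N}" "rc \<in> I \<times> J"
    and supp: "\<And>A. A \<in> space M \<Longrightarrow> A \<notin> Box L \<Longrightarrow> f A = 0"
  shows "integrable M g \<and> integrable M h \<and> integral\<^sup>L M g = 0 \<and> integral\<^sup>L M h = 0"
proof -
  obtain Bf Bg Bh where B: "\<And>A. A \<in> Box (L + 2) \<Longrightarrow> cmod (f A) \<le> Bf" "\<And>A. A \<in> Box (L + 2) \<Longrightarrow> cmod (g A) \<le> Bg"
      "\<And>A. A \<in> Box (L + 2) \<Longrightarrow> cmod (h A) \<le> Bh"
    using wd unfolding wirtinger_def regular_def by metis
  have T: "tshift i rc \<zeta> A \<in> Box (L + 2)" if "A \<in> Box (L + 1)" "cmod \<zeta> \<le> 1" for A \<zeta>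
    using tshift_Box[OF i that] by (simp add: add.commute)
  show ?thesis
  \<comment> \<open>A shift of size at most 1 carries only points of \<open>Box (L + 1)\<close> into
    the support \<open>Box L\<close>, and it carries them no further than
    \<open>Box (L + 2)\<close>, where the bounds were taken.\<close>
  proof (rule integral_derivative_zero[where T="tshift i rc" and K="Box (L + 1)" and C="\<bar>Bf\<bar> + \<bar>Bg\<bar> + \<bar>Bh\<bar>"])
    fix A \<zeta> assume A: "A \<in> space M" "A \<notin> Box (L + 1)" "cmod \<zeta> \<le> 1"
    have "tshift i rc \<zeta> A \<notin> Box L"
    proof
      assume "tshift i rc \<zeta> A \<in> Box L"
      hence "tshift i rc (- \<zeta>) (tshift i rc \<zeta> A) \<in> Box (L + 1)" using A by (intro tshift_Box[OF i]) auto
      thus False using A tshift_add[OF i(1) A(1)] tshift_0[OF i(1) A(1)] by simp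
    qed
    thus "f (tshift i rc \<zeta> A) = 0" using supp tshift_space[OF i A(1)] by blast
  next
    fix A \<zeta> assume "A \<in> Box (L + 1)" "cmod \<zeta> \<le> 1"
    from B[OF T[OF this]] show "cmod (f (tshift i rc \<zeta> A)) \<le> \<bar>Bf\<bar> + \<bar>Bg\<bar> + \<bar>Bh\<bar>"
      "cmod (g (tshift i rc \<zeta> A)) + cmod (h (tshift i rc \<zeta> A)) \<le> \<bar>Bf\<bar> + \<bar>Bg\<bar> + \<bar>Bh\<bar>" by linarith+
  qed (use wd i tshift_invariant[OF i] tshift_add[OF i(1)] tshift_0[OF i(1)] emeasure_Box in
    \<open>auto simp: wirtinger_def regular_def\<close>)
qed

end

section \<open>Functions bounded on boxes and their Wirtinger derivatives\<close>

context rect_tuple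
begin

lemma regularI:
  "f \<in> borel_measurable M \<Longrightarrow> (\<And>L. \<exists>B. \<forall>A\<in>Box L. cmod (f A) \<le> B) \<Longrightarrow> regular f"
  by (auto simp: regular_def)

lemma Box_space: "A \<in> Box L \<Longrightarrow> A \<in> space M"
  by (simp add: Box_def)

lemma regular_cong: "(\<And>A. A \<in> space M \<Longrightarrow> f A = g A) \<Longrightarrow> regular f = regular g"
  unfolding regular_def using measurable_cong[of M f g borel] Box_space by auto

lemma regular_const [simp]: "regular (\<lambda>_. c)"
  by (auto simp: regular_def)

lemma regular_add: assumes "regular f" "regular g" shows "regular (\<lambda>A. f A + g A)"
proof (rule regularI)
  show "(\<lambda>A. f A + g A) \<in> borel_measurable M" using assms by (auto simp: regular_def)
  fix L
  obtain B B' where "\<forall>A\<in>Box L. cmod (f A) \<le> B" "\<forall>A\<in>Box L. cmod (g A) \<le> B'" using assms unfolding regular_def by blast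
  thus "\<exists>B. \<forall>A\<in>Box L. cmod (f A + g A) \<le> B" by (intro exI[of _ "B + B'"]) (auto intro: norm_triangle_mono)
qed

lemma regular_mult: assumes "regular f" "regular g" shows "regular (\<lambda>A. f A * g A)"
proof (rule regularI)
  show "(\<lambda>A. f A * g A) \<in> borel_measurable M" using assms by (auto simp: regular_def)
  fix L
  obtain B B' where B: "\<forall>A\<in>Box L. cmod (f A) \<le> B" "\<forall>A\<in>Box L. cmod (g A) \<le> B'" using assms unfolding regular_def by blast
  have "cmod (f A * g A) \<le> \<bar>B\<bar> * \<bar>B'\<bar>" if "A \<in> Box L" for A
    unfolding norm_mult by (rule mult_mono) (use B that in \<open>auto intro: order_trans[OF _ abs_ge_self]\<close>)
  thus "\<exists>B. \<forall>A\<in>Box L. cmod (f A * g A) \<le> B" by blast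
qed

lemma regular_sum: "(\<And>s. s \<in> S \<Longrightarrow> regular (f s)) \<Longrightarrow> regular (\<lambda>A. \<Sum>s\<in>S. f s A)"
  by (induction S rule: infinite_finite_induct) (auto intro: regular_add)

lemma regular_cnj: assumes "regular f" shows "regular (\<lambda>A. cnj (f A))"
proof -
  have "cnj \<in> borel_measurable borel" by (intro borel_measurable_continuous_onI continuous_intros)
  thus ?thesis using assms measurable_compose[of f M borel cnj borel] by (auto simp: regular_def)
qed

lemma regular_entry: 
  assumes "i \<in> {1..N}" "u < n" "v < n" shows "regular (\<lambda>A. A i $$ (u, v))"
proof (rule regularI[OF entry_measurable[OF assms]])
  fix L
  have "\<forall>A\<in>Box L. cmod (A i $$ (u, v)) \<le> L" using assms by (auto simp: Box_def)
  thus "\<exists>B. \<forall>A\<in>Box L. cmod (A i $$ (u, v)) \<le> B" by blast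
qed

lemma regular_real:
  assumes "regular Q" "continuous_on UNIV (\<beta> :: real \<Rightarrow> real)"
  shows "regular (\<lambda>A. of_real (\<beta> (Re (Q A))))"
proof (rule regularI)
  have "\<beta> \<in> borel_measurable borel" using assms(2) by (rule borel_measurable_continuous_onI)
  moreover have "(\<lambda>A. Re (Q A)) \<in> borel_measurable M" using assms(1) by (auto simp: regular_def)
  ultimately have "(\<lambda>A. \<beta> (Re (Q A))) \<in> borel_measurable M" using measurable_compose by blast
  thus "(\<lambda>A. complex_of_real (\<beta> (Re (Q A)))) \<in> borel_measurable M" by measurable
  fix L
  obtain B where B: "\<forall>A\<in>Box L. cmod (Q A) \<le> B" using assms unfolding regular_def by blast
  have "compact (\<beta> ` {-B..B})" by (intro compact_continuous_image continuous_on_subset[OF assms(2)]) auto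
  then obtain B' where B': "\<And>x. x \<in> {-B..B} \<Longrightarrow> \<bar>\<beta> x\<bar> \<le> B'"
    using compact_imp_bounded[of "\<beta> ` {-B..B}"] unfolding bounded_iff by (metis imageI real_norm_def)
  have "\<bar>\<beta> (Re (Q A))\<bar> \<le> B'" if "A \<in> Box L" for A
    using B[rule_format, OF that] abs_Re_le_cmod[of "Q A"] by (intro B') (auto simp: abs_le_iff)
  thus "\<exists>B. \<forall>A\<in>Box L. cmod (complex_of_real (\<beta> (Re (Q A)))) \<le> B" by auto
qed

lemma wirtinger_cong:
  assumes "i \<in> {1..N}" "rc \<in> I \<times> J" "\<And>A. A \<in> space M \<Longrightarrow> f A = f' A" "wirtinger i rc f g h"
  shows "wirtinger i rc f' g h"
  using assms tshift_space[OF assms(1,2)] regular_cong[OF assms(3)] by (auto simp: wirtinger_def)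

lemma wirtinger_const: "wirtinger i rc (\<lambda>_. c) (\<lambda>_. 0) (\<lambda>_. 0)"
  by (auto simp: wirtinger_def)

lemma wirtinger_add:
  assumes "wirtinger i rc f1 g1 h1" "wirtinger i rc f2 g2 h2"
  shows "wirtinger i rc (\<lambda>A. f1 A + f2 A) (\<lambda>A. g1 A + g2 A) (\<lambda>A. h1 A + h2 A)"
  unfolding wirtinger_def
proof (intro conjI ballI)
  fix A assume A: "A \<in> space M"
  have "((\<lambda>\<zeta>. f1 (tshift i rc \<zeta> A) + f2 (tshift i rc \<zeta> A)) has_derivative
     (\<lambda>\<zeta>. (g1 A * \<zeta> + h1 A * cnj \<zeta>) + (g2 A * \<zeta> + h2 A * cnj \<zeta>))) (at 0)"
    using assms A by (intro has_derivative_add) (auto simp: wirtinger_def)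
  thus "((\<lambda>\<zeta>. f1 (tshift i rc \<zeta> A) + f2 (tshift i rc \<zeta> A)) has_derivative
     (\<lambda>\<zeta>. (g1 A + g2 A) * \<zeta> + (h1 A + h2 A) * cnj \<zeta>)) (at 0)"
    by (simp add: algebra_simps)
qed (use assms in \<open>auto simp: wirtinger_def intro: regular_add\<close>)

lemma wirtinger_mult:
  assumes "i \<in> {1..N}" "wirtinger i rc f1 g1 h1" "wirtinger i rc f2 g2 h2"
  shows "wirtinger i rc (\<lambda>A. f1 A * f2 A) (\<lambda>A. f1 A * g2 A + g1 A * f2 A) (\<lambda>A. f1 A * h2 A + h1 A * f2 A)"
  unfolding wirtinger_def
proof (intro conjI ballI)
  fix A assume A: "A \<in> space M"
  have "((\<lambda>\<zeta>. f1 (tshift i rc \<zeta> A) * f2 (tshift i rc \<zeta> A)) has_derivative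
     (\<lambda>\<zeta>. f1 (tshift i rc 0 A) * (g2 A * \<zeta> + h2 A * cnj \<zeta>) + (g1 A * \<zeta> + h1 A * cnj \<zeta>) * f2 (tshift i rc 0 A))) (at 0)"
    using assms A by (intro has_derivative_mult) (auto simp: wirtinger_def)
  thus "((\<lambda>\<zeta>. f1 (tshift i rc \<zeta> A) * f2 (tshift i rc \<zeta> A)) has_derivative
     (\<lambda>\<zeta>. (f1 A * g2 A + g1 A * f2 A) * \<zeta> + (f1 A * h2 A + h1 A * f2 A) * cnj \<zeta>)) (at 0)"
    by (simp add: algebra_simps tshift_0[OF assms(1) A])
qed (use assms in \<open>auto simp: wirtinger_def intro: regular_add regular_mult\<close>)

lemma wirtinger_sum:
  "(\<And>s. s \<in> S \<Longrightarrow> wirtinger i rc (f s) (g s) (h s)) \<Longrightarrow>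
   wirtinger i rc (\<lambda>A. \<Sum>s\<in>S. f s A) (\<lambda>A. \<Sum>s\<in>S. g s A) (\<lambda>A. \<Sum>s\<in>S. h s A)"
  by (induction S rule: infinite_finite_induct) (auto intro: wirtinger_add wirtinger_const)

lemma wirtinger_entry:
  assumes "i' \<in> {1..N}" "u < n" "v < n"
  shows "wirtinger i rc (\<lambda>A. A i' $$ (u, v)) (\<lambda>_. if i' = i \<and> (u, v) = rc then 1 else 0) (\<lambda>_. 0)"
    and "wirtinger i rc (\<lambda>A. cnj (A i' $$ (u, v))) (\<lambda>_. 0) (\<lambda>_. if i' = i \<and> (u, v) = rc then 1 else 0)"
proof -
  have t: "tshift i rc \<zeta> A i' $$ (u, v) = A i' $$ (u, v) + (if i' = i \<and> (u, v) = rc then 1 else 0) * \<zeta>" for A \<zeta>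
    using assms by (cases rc) (auto simp: tshift_def)
  show "wirtinger i rc (\<lambda>A. A i' $$ (u, v)) (\<lambda>_. if i' = i \<and> (u, v) = rc then 1 else 0) (\<lambda>_. 0)"
    unfolding wirtinger_def t
    by (intro conjI ballI regular_const regular_entry[OF assms]) (rule derivative_eq_intros refl | simp)+
  show "wirtinger i rc (\<lambda>A. cnj (A i' $$ (u, v))) (\<lambda>_. 0) (\<lambda>_. if i' = i \<and> (u, v) = rc then 1 else 0)"
    unfolding wirtinger_def t
    by (intro conjI ballI regular_const regular_cnj[OF regular_entry[OF assms]])
      (rule bounded_linear.has_derivative[OF bounded_linear_cnj] derivative_eq_intros refl | simp)+
qed

text \<open>As \<open>Q\<close> is real along all shifts, its differential equals its own real part,
  so the real chain rule for \<beta> may be written with the complex coefficients \<open>g\<close>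
  and \<open>h\<close>.\<close>

lemma wirtinger_real:
  assumes i: "i \<in> {1..N}" "rc \<in> I \<times> J" and w: "wirtinger i rc Q g h"
    and real: "\<And>A. A \<in> space M \<Longrightarrow> Im (Q A) = 0"
    and \<beta>: "\<And>x. (\<beta> has_real_derivative \<beta>' x) (at x)" "continuous_on UNIV \<beta>'"
  shows "wirtinger i rc (\<lambda>A. of_real (\<beta> (Re (Q A)))) (\<lambda>A. of_real (\<beta>' (Re (Q A))) * g A)
    (\<lambda>A. of_real (\<beta>' (Re (Q A))) * h A)"
  unfolding wirtinger_def
proof (intro conjI ballI)
  have cont: "continuous_on UNIV \<beta>" by (intro continuous_at_imp_continuous_on ballI DERIV_isCont[OF \<beta>(1)])
  have r: "regular Q" "regular g" "regular h" using w by (auto simp: wirtinger_def)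
  show "regular (\<lambda>A. of_real (\<beta> (Re (Q A))))" by (rule regular_real[OF r(1) cont])
  show "regular (\<lambda>A. of_real (\<beta>' (Re (Q A))) * g A)" "regular (\<lambda>A. of_real (\<beta>' (Re (Q A))) * h A)"
    by (intro regular_mult regular_real[OF r(1) \<beta>(2)] r)+
  fix A assume A: "A \<in> space M"
  let ?F = "\<lambda>\<zeta>. g A * \<zeta> + h A * cnj \<zeta>"
  have d: "((\<lambda>\<zeta>. Q (tshift i rc \<zeta> A)) has_derivative ?F) (at 0)" using w A by (auto simp: wirtinger_def)
  have dR: "((\<lambda>\<zeta>. Re (Q (tshift i rc \<zeta> A))) has_derivative (\<lambda>\<zeta>. Re (?F \<zeta>))) (at 0)"
    by (rule bounded_linear.has_derivative[OF bounded_linear_Re d])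
  have "((\<lambda>\<zeta>. complex_of_real (Re (Q (tshift i rc \<zeta> A)))) has_derivative (\<lambda>\<zeta>. of_real (Re (?F \<zeta>)))) (at 0)"
    by (rule bounded_linear.has_derivative[OF bounded_linear_of_real dR])
  moreover have "complex_of_real (Re (Q (tshift i rc \<zeta> A))) = Q (tshift i rc \<zeta> A)" for \<zeta>
    using real[OF tshift_space[OF i A]] by (simp add: complex_eq_iff)
  ultimately have "((\<lambda>\<zeta>. Q (tshift i rc \<zeta> A)) has_derivative (\<lambda>\<zeta>. of_real (Re (?F \<zeta>)))) (at 0)" by (simp only:)
  from has_derivative_unique[OF d this]
  have Re: "of_real (Re (?F \<zeta>)) = ?F \<zeta>" for \<zeta> by (rule fun_cong[symmetric])
  have "((\<lambda>\<zeta>. \<beta> (Re (Q (tshift i rc \<zeta> A)))) has_derivative (\<lambda>\<zeta>. \<beta>' (Re (Q (tshift i rc 0 A))) * Re (?F \<zeta>))) (at 0)"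
    by (rule has_derivative_compose[OF dR, of \<beta>]) (use \<beta>(1) in \<open>auto simp: has_field_derivative_def\<close>)
  from bounded_linear.has_derivative[OF bounded_linear_of_real this]
  have "((\<lambda>\<zeta>. complex_of_real (\<beta> (Re (Q (tshift i rc \<zeta> A))))) has_derivative
     (\<lambda>\<zeta>. of_real (\<beta>' (Re (Q A)) * Re (?F \<zeta>)))) (at 0)" by (simp only: tshift_0[OF i(1) A])
  moreover have "complex_of_real (\<beta>' (Re (Q A)) * Re (?F \<zeta>)) = of_real (\<beta>' (Re (Q A))) * g A * \<zeta> + of_real (\<beta>' (Re (Q A))) * h A * cnj \<zeta>" for \<zeta>
    unfolding of_real_mult Re by (simp add: algebra_simps)
  ultimately show "((\<lambda>\<zeta>. complex_of_real (\<beta> (Re (Q (tshift i rc \<zeta> A))))) has_derivative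
     (\<lambda>\<zeta>. of_real (\<beta>' (Re (Q A))) * g A * \<zeta> + of_real (\<beta>' (Re (Q A))) * h A * cnj \<zeta>)) (at 0)" by (simp only:)
qed

definition field :: "nat \<Rightarrow> complex Matrix.mat \<Rightarrow> (nat \<Rightarrow> complex Matrix.mat) \<Rightarrow> nat \<times> bool \<Rightarrow> complex Matrix.mat" where
  "field i E A x = (if fst x = i then E * lmat A x - lmat A x * E else 0\<^sub>m n n)"

text \<open>
  \<open>f'\<close> is the derivative of \<open>f\<close> along \<open>A i \<mapsto> [E, A i]\<close>, extended complex linearly from
  antihermitian to arbitrary \<open>E\<close>; hence \<open>A i\<^sup>* \<mapsto> [E, A i\<^sup>*]\<close> for the conjugate coordinates.
\<close>

definition Der :: "nat \<Rightarrow> complex Matrix.mat \<Rightarrow> ((nat \<Rightarrow> complex Matrix.mat) \<Rightarrow> complex) \<Rightarrow>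
    ((nat \<Rightarrow> complex Matrix.mat) \<Rightarrow> complex) \<Rightarrow> bool" where
  "Der i E f f' \<longleftrightarrow> regular f \<and> (\<exists>g h. (\<forall>rc\<in>I \<times> J. wirtinger i rc f (g rc) (h rc)) \<and>
     (\<forall>A\<in>space M. f' A = (\<Sum>rc\<in>I \<times> J. field i E A (i, False) $$ rc * g rc A +
        field i E A (i, True) $$ (snd rc, fst rc) * h rc A)))"

lemma DerI:
  assumes "regular f" "\<And>rc. rc \<in> I \<times> J \<Longrightarrow> wirtinger i rc f (g rc) (h rc)"
    and "\<And>A. A \<in> space M \<Longrightarrow> f' A = (\<Sum>rc\<in>I \<times> J. field i E A (i, False) $$ rc * g rc A +
        field i E A (i, True) $$ (snd rc, fst rc) * h rc A)"
  shows "Der i E f f'"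
  using assms unfolding Der_def by blast

section \<open>Calculus of the derivation along a commutator field\<close>

context
  fixes i :: nat and E :: "complex Matrix.mat"
  assumes i: "i \<in> {1..N}" and E: "E \<in> carrier_mat n n"
    and E_block: "\<And>u v. u < n \<Longrightarrow> v < n \<Longrightarrow> E $$ (u, v) \<noteq> 0 \<Longrightarrow> (u \<in> I \<longleftrightarrow> v \<in> I) \<and> (u \<in> J \<longleftrightarrow> v \<in> J)"
begin

lemma Der_regular: "Der i E f f' \<Longrightarrow> regular f"
  by (simp add: Der_def)

lemma Der_cong:
  assumes "Der i E f f'" "\<And>A. A \<in> space M \<Longrightarrow> f A = g A" "\<And>A. A \<in> space M \<Longrightarrow> f' A = g' A"
  shows "Der i E g g'"
proof -
  obtain g1 h1 where 1: "\<forall>rc\<in>I \<times> J. wirtinger i rc f (g1 rc) (h1 rc)"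
    "\<forall>A\<in>space M. f' A = (\<Sum>rc\<in>I \<times> J. field i E A (i, False) $$ rc * g1 rc A +
        field i E A (i, True) $$ (snd rc, fst rc) * h1 rc A)" using assms(1) unfolding Der_def by blast
  show ?thesis
  proof (rule DerI[where g=g1 and h=h1])
    have "regular f = regular g" by (rule regular_cong) (rule assms(2))
    thus "regular g" using Der_regular[OF assms(1)] by simp
    fix rc assume rc: "rc \<in> I \<times> J"
    show "wirtinger i rc g (g1 rc) (h1 rc)"
      by (rule wirtinger_cong[OF i rc assms(2) 1(1)[rule_format, OF rc]])
  next
    fix A assume A: "A \<in> space M"
    show "g' A = (\<Sum>rc\<in>I \<times> J. field i E A (i, False) $$ rc * g1 rc A +
        field i E A (i, True) $$ (snd rc, fst rc) * h1 rc A)"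
      using 1(2)[rule_format, OF A] assms(3)[OF A] by (simp only:)
  qed
qed

lemma Der_const: "Der i E (\<lambda>_. c) (\<lambda>_. 0)"
  by (rule DerI[where g="\<lambda>_ _. 0" and h="\<lambda>_ _. 0"]) (auto intro: wirtinger_const)

lemma Der_add:
  assumes "Der i E f f'" "Der i E g g'" shows "Der i E (\<lambda>A. f A + g A) (\<lambda>A. f' A + g' A)"
proof -
  obtain g1 h1 where 1: "\<forall>rc\<in>I \<times> J. wirtinger i rc f (g1 rc) (h1 rc)"
    "\<forall>A\<in>space M. f' A = (\<Sum>rc\<in>I \<times> J. field i E A (i, False) $$ rc * g1 rc A +
        field i E A (i, True) $$ (snd rc, fst rc) * h1 rc A)" using assms(1) unfolding Der_def by blast
  obtain g2 h2 where 2: "\<forall>rc\<in>I \<times> J. wirtinger i rc g (g2 rc) (h2 rc)"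
    "\<forall>A\<in>space M. g' A = (\<Sum>rc\<in>I \<times> J. field i E A (i, False) $$ rc * g2 rc A +
        field i E A (i, True) $$ (snd rc, fst rc) * h2 rc A)" using assms(2) unfolding Der_def by blast
  show ?thesis 
  proof (rule DerI[where g="\<lambda>rc A. g1 rc A + g2 rc A" and h="\<lambda>rc A. h1 rc A + h2 rc A"])
    show "regular (\<lambda>A. f A + g A)" using assms Der_regular by (intro regular_add)
    fix rc assume "rc \<in> I \<times> J"
    thus "wirtinger i rc (\<lambda>A. f A + g A) (\<lambda>A. g1 rc A + g2 rc A) (\<lambda>A. h1 rc A + h2 rc A)"
      using 1(1) 2(1) by (intro wirtinger_add) auto
  next
    fix A assume A: "A \<in> space M"
    show "f' A + g' A = (\<Sum>rc\<in>I \<times> J. field i E A (i, False) $$ rc * (g1 rc A + g2 rc A) +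
        field i E A (i, True) $$ (snd rc, fst rc) * (h1 rc A + h2 rc A))"
      unfolding 1(2)[rule_format, OF A] 2(2)[rule_format, OF A] sum.distrib[symmetric]
      by (rule sum.cong) (simp_all add: algebra_simps)
  qed
qed

lemma Der_mult:
  assumes "Der i E f f'" "Der i E g g'" shows "Der i E (\<lambda>A. f A * g A) (\<lambda>A. f A * g' A + f' A * g A)"
proof -
  obtain g1 h1 where 1: "\<forall>rc\<in>I \<times> J. wirtinger i rc f (g1 rc) (h1 rc)"
    "\<forall>A\<in>space M. f' A = (\<Sum>rc\<in>I \<times> J. field i E A (i, False) $$ rc * g1 rc A +
        field i E A (i, True) $$ (snd rc, fst rc) * h1 rc A)" using assms(1) unfolding Der_def by blast
  obtain g2 h2 where 2: "\<forall>rc\<in>I \<times> J. wirtinger i rc g (g2 rc) (h2 rc)"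
    "\<forall>A\<in>space M. g' A = (\<Sum>rc\<in>I \<times> J. field i E A (i, False) $$ rc * g2 rc A +
        field i E A (i, True) $$ (snd rc, fst rc) * h2 rc A)" using assms(2) unfolding Der_def by blast
  show ?thesis 
  proof (rule DerI[where g="\<lambda>rc A. f A * g2 rc A + g1 rc A * g A" and h="\<lambda>rc A. f A * h2 rc A + h1 rc A * g A"])
    show "regular (\<lambda>A. f A * g A)" using assms Der_regular by (intro regular_mult)
    fix rc assume "rc \<in> I \<times> J"
    thus "wirtinger i rc (\<lambda>A. f A * g A) (\<lambda>A. f A * g2 rc A + g1 rc A * g A) (\<lambda>A. f A * h2 rc A + h1 rc A * g A)"
      using 1(1) 2(1) by (intro wirtinger_mult i) auto
  next
    fix A assume A: "A \<in> space M"
    show "f A * g' A + f' A * g A = (\<Sum>rc\<in>I \<times> J. field i E A (i, False) $$ rc * (f A * g2 rc A + g1 rc A * g A) +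
        field i E A (i, True) $$ (snd rc, fst rc) * (f A * h2 rc A + h1 rc A * g A))"
      unfolding 1(2)[rule_format, OF A] 2(2)[rule_format, OF A] sum_distrib_left sum_distrib_right sum.distrib[symmetric]
      by (rule sum.cong) (simp_all add: algebra_simps)
  qed
qed

lemma Der_sum:
  "(\<And>s. s \<in> S \<Longrightarrow> Der i E (f s) (f' s)) \<Longrightarrow> Der i E (\<lambda>A. \<Sum>s\<in>S. f s A) (\<lambda>A. \<Sum>s\<in>S. f' s A)"
  by (induction S rule: infinite_finite_induct) (auto intro: Der_add Der_const)

lemma Der_cmult: "Der i E f f' \<Longrightarrow> Der i E (\<lambda>A. c * f A) (\<lambda>A. c * f' A)"
  using Der_mult[OF Der_const[of c]] by simp

lemma Der_power:
  assumes "Der i E f f'" shows "Der i E (\<lambda>A. f A ^ s) (\<lambda>A. of_nat s * f A ^ (s - 1) * f' A)"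
proof (induction s)
  case 0 show ?case using Der_const[of 1] by simp
next
  case (Suc s)
  have "Der i E (\<lambda>A. f A * f A ^ s) (\<lambda>A. f A * (of_nat s * f A ^ (s - 1) * f' A) + f' A * f A ^ s)"
    by (rule Der_mult[OF assms Suc])
  thus ?case
  proof (rule Der_cong)
    fix A
    have e: "f A * (of_nat s * f A ^ (s - 1) * f' A) = of_nat s * f A ^ s * f' A"
      by (cases s) auto
    show "f A * (of_nat s * f A ^ (s - 1) * f' A) + f' A * f A ^ s = of_nat (Suc s) * f A ^ (Suc s - 1) * f' A"
      unfolding e by (simp add: algebra_simps)
  qed simp
qed

text \<open>The chain rule only multiplies by \<beta>', so a function of an invariant is invariant.
  The cut-off inherits its invariance from a polynomial in this way.\<close>

lemma Der_real:
  assumes "Der i E Q (\<lambda>_. 0)" "\<And>A. A \<in> space M \<Longrightarrow> Im (Q A) = 0"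
    and \<beta>: "\<And>x. (\<beta> has_real_derivative \<beta>' x) (at x)" "continuous_on UNIV \<beta>'"
  shows "Der i E (\<lambda>A. of_real (\<beta> (Re (Q A)))) (\<lambda>_. 0)"
proof -
  obtain g h where 1: "\<forall>rc\<in>I \<times> J. wirtinger i rc Q (g rc) (h rc)"
    "\<forall>A\<in>space M. 0 = (\<Sum>rc\<in>I \<times> J. field i E A (i, False) $$ rc * g rc A +
        field i E A (i, True) $$ (snd rc, fst rc) * h rc A)" using assms(1) unfolding Der_def by blast
  show ?thesis 
  proof (rule DerI[where g="\<lambda>rc A. of_real (\<beta>' (Re (Q A))) * g rc A" and h="\<lambda>rc A. of_real (\<beta>' (Re (Q A))) * h rc A"])
    have "continuous_on UNIV \<beta>" by (intro continuous_at_imp_continuous_on ballI DERIV_isCont[OF \<beta>(1)])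
    thus "regular (\<lambda>A. of_real (\<beta> (Re (Q A))))" using Der_regular[OF assms(1)] by (intro regular_real)
    fix rc assume rc: "rc \<in> I \<times> J"
    show "wirtinger i rc (\<lambda>A. of_real (\<beta> (Re (Q A)))) (\<lambda>A. of_real (\<beta>' (Re (Q A))) * g rc A)
      (\<lambda>A. of_real (\<beta>' (Re (Q A))) * h rc A)"
      by (rule wirtinger_real[OF i rc 1(1)[rule_format, OF rc] assms(2) \<beta>])
  next
    fix A assume A: "A \<in> space M"
    have "0 = of_real (\<beta>' (Re (Q A))) * (\<Sum>rc\<in>I \<times> J. field i E A (i, False) $$ rc * g rc A +
        field i E A (i, True) $$ (snd rc, fst rc) * h rc A)" using 1(2) A by simp
    also have "\<dots> = (\<Sum>rc\<in>I \<times> J. field i E A (i, False) $$ rc * (of_real (\<beta>' (Re (Q A))) * g rc A) +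
        field i E A (i, True) $$ (snd rc, fst rc) * (of_real (\<beta>' (Re (Q A))) * h rc A))"
      unfolding sum_distrib_left by (rule sum.cong) (simp_all add: algebra_simps)
    finally show "0 = (\<Sum>rc\<in>I \<times> J. field i E A (i, False) $$ rc * (of_real (\<beta>' (Re (Q A))) * g rc A) +
        field i E A (i, True) $$ (snd rc, fst rc) * (of_real (\<beta>' (Re (Q A))) * h rc A))" .
  qed
qed

lemma mat_tuple_space: "A \<in> space M \<Longrightarrow> mat_tuple n N A"
  using space_M_D by unfold_locales auto

lemma field_index:
  assumes A: "A \<in> space M" and uv: "u < n" "v < n"
  shows "field i E A (i, False) $$ (u, v) = (\<Sum>s<n. E $$ (u, s) * A i $$ (s, v)) - (\<Sum>s<n. A i $$ (u, s) * E $$ (s, v))"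
    and "field i E A (i, True) $$ (u, v) = (\<Sum>s<n. E $$ (u, s) * cnj (A i $$ (v, s))) - (\<Sum>s<n. cnj (A i $$ (s, u)) * E $$ (s, v))"
proof -
  have a: "A i \<in> carrier_mat n n" using space_M_D(1)[OF A i] .
  have aa: "mat_adjoint (A i) \<in> carrier_mat n n" by (rule mat_adjoint_carrier[OF a])
  have adj: "mat_adjoint (A i) $$ (u, v) = cnj (A i $$ (v, u))" if "u < n" "v < n" for u v using a that by simp
  have c: "E * A i \<in> carrier_mat n n" "A i * E \<in> carrier_mat n n" "E * mat_adjoint (A i) \<in> carrier_mat n n" "mat_adjoint (A i) * E \<in> carrier_mat n n"
    using a aa E by (auto intro: mult_carrier_mat[of _ n n])
  show "field i E A (i, False) $$ (u, v) = (\<Sum>s<n. E $$ (u, s) * A i $$ (s, v)) - (\<Sum>s<n. A i $$ (u, s) * E $$ (s, v))"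
    by (simp add: field_def lmat_def mat_minus_index[OF c(1,2) uv] mat_mult_index[OF E a uv] mat_mult_index[OF a E uv]
      del: index_minus_mat index_mult_mat)
  show "field i E A (i, True) $$ (u, v) = (\<Sum>s<n. E $$ (u, s) * cnj (A i $$ (v, s))) - (\<Sum>s<n. cnj (A i $$ (s, u)) * E $$ (s, v))"
    using uv by (simp add: field_def lmat_def mat_minus_index[OF c(3,4) uv] mat_mult_index[OF E aa uv] mat_mult_index[OF aa E uv] adj
      del: index_minus_mat index_mult_mat mat_adjoint_index)
qed

text \<open>\<open>E\<close> respects the row set \<open>I\<close> and the column set
  \<open>J\<close>, so its commutator with a matrix supported there is supported there. The field
  thus has components only in the coordinates over which one integrates.\<close>

lemma field_off_block:
  assumes A: "A \<in> space M" and uv: "u < n" "v < n"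
  shows "(u, v) \<notin> I \<times> J \<Longrightarrow> field i E A (i, False) $$ (u, v) = 0"
    and "(v, u) \<notin> I \<times> J \<Longrightarrow> field i E A (i, True) $$ (u, v) = 0"
proof -
  have z: "A i $$ (x, y) = 0" if "x < n" "y < n" "x \<notin> I \<or> y \<notin> J" for x y by (rule space_M_D(3)[OF A i that])
  show "field i E A (i, False) $$ (u, v) = 0" if "(u, v) \<notin> I \<times> J"
  proof -
    have "E $$ (u, s) * A i $$ (s, v) = 0" "A i $$ (u, s) * E $$ (s, v) = 0" if "s < n" for s
      using E_block[of u s] E_block[of s v] z[of s v] z[of u s] \<open>(u, v) \<notin> I \<times> J\<close> uv that by auto
    hence "(\<Sum>s<n. E $$ (u, s) * A i $$ (s, v)) = 0" "(\<Sum>s<n. A i $$ (u, s) * E $$ (s, v)) = 0"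
      by (auto intro!: sum.neutral)
    thus ?thesis unfolding field_index(1)[OF A uv] by (simp only: diff_self)
  qed
  show "field i E A (i, True) $$ (u, v) = 0" if "(v, u) \<notin> I \<times> J"
  proof -
    have "E $$ (u, s) * cnj (A i $$ (v, s)) = 0" "cnj (A i $$ (s, u)) * E $$ (s, v) = 0" if "s < n" for s
      using E_block[of u s] E_block[of s v] z[of v s] z[of s u] \<open>(v, u) \<notin> I \<times> J\<close> uv that by auto
    hence "(\<Sum>s<n. E $$ (u, s) * cnj (A i $$ (v, s))) = 0" "(\<Sum>s<n. cnj (A i $$ (s, u)) * E $$ (s, v)) = 0"
      by (auto intro!: sum.neutral)
    thus ?thesis unfolding field_index(2)[OF A uv] by (simp only: diff_self)
  qed
qed

lemma Der_letter:
  assumes x: "fst x \<in> {1..N}" and uv: "u < n" "v < n"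
  shows "Der i E (\<lambda>A. lmat A x $$ (u, v)) (\<lambda>A. field i E A x $$ (u, v))"
proof (cases "snd x")
  case False
  have lm: "lmat A x = A (fst x)" for A using False by (simp add: lmat_def)
  show ?thesis unfolding lm
  proof (rule DerI[where g="\<lambda>rc _. if fst x = i \<and> (u, v) = rc then 1 else 0" and h="\<lambda>_ _. 0"])
    fix A assume A: "A \<in> space M"
    have "(\<Sum>rc\<in>I \<times> J. field i E A (i, False) $$ rc * (if fst x = i \<and> (u, v) = rc then 1 else 0) +
      field i E A (i, True) $$ (snd rc, fst rc) * 0) =
      (\<Sum>rc\<in>I \<times> J. if rc = (u, v) then (if fst x = i then field i E A (i, False) $$ (u, v) else 0) else 0)"
      by (rule sum.cong) auto
    also have "\<dots> = (if (u, v) \<in> I \<times> J \<and> fst x = i then field i E A (i, False) $$ (u, v) else 0)"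
      using finite_IJ(3) by auto
    also have "\<dots> = field i E A x $$ (u, v)"
      using field_off_block(1)[OF A uv] uv False by (cases x) (auto simp: field_def)
    finally show "field i E A x $$ (u, v) = (\<Sum>rc\<in>I \<times> J. field i E A (i, False) $$ rc * (if fst x = i \<and> (u, v) = rc then 1 else 0) +
      field i E A (i, True) $$ (snd rc, fst rc) * 0)" by (rule sym)
  qed (use wirtinger_entry(1)[OF x uv] regular_entry[OF x uv] in auto)
next
  case True
  have lm: "lmat A x $$ (u, v) = cnj (A (fst x) $$ (v, u))" if "A \<in> space M" for A
    using True uv space_M_D(1)[OF that x] by (simp add: lmat_def)
  have "Der i E (\<lambda>A. cnj (A (fst x) $$ (v, u))) (\<lambda>A. field i E A x $$ (u, v))" 
  proof (rule DerI[where g="\<lambda>_ _. 0" and h="\<lambda>rc _. if fst x = i \<and> (v, u) = rc then 1 else 0"])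
    fix A assume A: "A \<in> space M"
    have "(\<Sum>rc\<in>I \<times> J. field i E A (i, False) $$ rc * 0 +
      field i E A (i, True) $$ (snd rc, fst rc) * (if fst x = i \<and> (v, u) = rc then 1 else 0)) =
      (\<Sum>rc\<in>I \<times> J. if rc = (v, u) then (if fst x = i then field i E A (i, True) $$ (u, v) else 0) else 0)"
      by (rule sum.cong) auto
    also have "\<dots> = (if (v, u) \<in> I \<times> J \<and> fst x = i then field i E A (i, True) $$ (u, v) else 0)"
      using finite_IJ(3) by auto
    also have "\<dots> = field i E A x $$ (u, v)"
      using field_off_block(2)[OF A uv] uv True by (cases x) (auto simp: field_def)
    finally show "field i E A x $$ (u, v) = (\<Sum>rc\<in>I \<times> J. field i E A (i, False) $$ rc * 0 +
      field i E A (i, True) $$ (snd rc, fst rc) * (if fst x = i \<and> (v, u) = rc then 1 else 0))" by (rule sym)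
  qed (use wirtinger_entry(2)[OF x uv(2,1)] regular_cnj[OF regular_entry[OF x uv(2,1)]] in auto)
  thus ?thesis by (rule Der_cong) (use lm in auto)
qed

lemma Der_word:
  assumes "fst ` set w \<subseteq> {1..N}" "u < n" "v < n"
  shows "Der i E (\<lambda>A. mat_word n A w $$ (u, v)) (\<lambda>A. dword n A i E w $$ (u, v))"
  using assms
proof (induction w arbitrary: u)
  case Nil
  thus ?case using Der_const by (simp add: mat_word_eq)
next
  case (Cons x w)
  have x: "fst x \<in> {1..N}" "fst ` set w \<subseteq> {1..N}" using Cons.prems by auto
  have "Der i E (\<lambda>A. \<Sum>s<n. lmat A x $$ (u, s) * mat_word n A w $$ (s, v))
    (\<lambda>A. \<Sum>s<n. lmat A x $$ (u, s) * dword n A i E w $$ (s, v) + field i E A x $$ (u, s) * mat_word n A w $$ (s, v))"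
    by (intro Der_sum Der_mult Der_letter[OF x(1)] Cons.IH x) (use Cons.prems in auto)
  thus ?case
  proof (rule Der_cong)
    fix A assume A: "A \<in> space M"
    interpret mat_tuple n N A by (rule mat_tuple_space[OF A])
    have c: "lmat A x \<in> carrier_mat n n" "mat_word n A w \<in> carrier_mat n n" "dword n A i E w \<in> carrier_mat n n"
      by (rule lmat_carrier[OF x(1)], rule word_carrier[OF x(2)], rule dword_carrier[OF E x(2)])
    have F: "field i E A x \<in> carrier_mat n n" using commutator_carrier[OF E x(1)] by (simp add: field_def)
    show "(\<Sum>s<n. lmat A x $$ (u, s) * mat_word n A w $$ (s, v)) = mat_word n A (x # w) $$ (u, v)"
      unfolding word_Cons using mat_mult_index[OF c(1,2) Cons.prems(2,3)] by simp
    have "dword n A i E (x # w) = field i E A x * mat_word n A w + lmat A x * dword n A i E w"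
      using c(2) by (auto simp: field_def left_mult_zero_mat[of _ n n])
    moreover have "field i E A x * mat_word n A w \<in> carrier_mat n n" "lmat A x * dword n A i E w \<in> carrier_mat n n"
      using c F by (auto intro: mult_carrier_mat[of _ n n])
    ultimately show "(\<Sum>s<n. lmat A x $$ (u, s) * dword n A i E w $$ (s, v) + field i E A x $$ (u, s) * mat_word n A w $$ (s, v)) =
      dword n A i E (x # w) $$ (u, v)"
      using mat_mult_index[OF F c(2) Cons.prems(2,3)] mat_mult_index[OF c(1,3) Cons.prems(2,3)]
        mat_add_index[of "field i E A x * mat_word n A w" n n, OF _ _ Cons.prems(2,3)]
      by (simp add: sum.distrib add.commute del: index_add_mat index_mult_mat)
  qed
qed

lemma Der_btr:
  assumes "fst ` set w \<subseteq> {1..N}" "S \<subseteq> {..<n}"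
  shows "Der i E (\<lambda>A. btr S (mat_word n A w)) (\<lambda>A. btr S (dword n A i E w))"
  unfolding btr_def by (intro Der_sum Der_word assms) (use assms in auto)

lemma Der_tpoly:
  assumes "\<And>c u v. (c, u, v) \<in> set T \<Longrightarrow> fst ` set u \<subseteq> {1..N} \<and> fst ` set v \<subseteq> {1..N}" "S \<subseteq> {..<n}"
  shows "Der i E (tpoly n S T) (\<lambda>A. dtpoly n S T A i E)"
  using assms(1)
proof (induction T)
  case Nil
  thus ?case using Der_const[of 0] by (simp add: tpoly_def[abs_def] dtpoly_def)
next
  case (Cons t T)
  obtain c u v where t: "t = (c, u, v)" by (cases t)
  have uv: "fst ` set u \<subseteq> {1..N}" "fst ` set v \<subseteq> {1..N}" using Cons.prems[of c u v] t by auto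
  have IH: "Der i E (tpoly n S T) (\<lambda>A. dtpoly n S T A i E)"
  proof (rule Cons.IH)
    fix c' u' v' assume "(c', u', v') \<in> set T"
    thus "fst ` set u' \<subseteq> {1..N} \<and> fst ` set v' \<subseteq> {1..N}" by (rule Cons.prems[OF list.set_intros(2)])
  qed
  have "Der i E (\<lambda>A. c * (btr S (mat_word n A u) * btr S (mat_word n A v)) + tpoly n S T A)
    (\<lambda>A. c * (btr S (mat_word n A u) * btr S (dword n A i E v) + btr S (dword n A i E u) * btr S (mat_word n A v)) + dtpoly n S T A i E)"
    by (intro Der_add Der_cmult Der_mult Der_btr uv assms(2) IH)
  thus ?case by (rule Der_cong) (auto simp: t dtpoly_def algebra_simps)
qed

text \<open>The field is free of divergence: its (r, c) component differentiated in the entry (r, c)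
  gives E_rr - E_cc, and the conjugate coordinate gives the opposite. Integration by parts leaves
  only the integral of \<open>f'\<close>.\<close>

lemma Der_integral:
  assumes D: "Der i E f f'" and supp: "\<And>A. A \<in> space M \<Longrightarrow> A \<notin> Box L \<Longrightarrow> f A = 0"
  shows "integrable M f' \<and> integral\<^sup>L M f' = 0"
proof -
  obtain g h where w: "\<And>rc. rc \<in> I \<times> J \<Longrightarrow> wirtinger i rc f (g rc) (h rc)"
    and f': "\<And>A. A \<in> space M \<Longrightarrow> f' A = (\<Sum>rc\<in>I \<times> J. field i E A (i, False) $$ rc * g rc A +
        field i E A (i, True) $$ (snd rc, fst rc) * h rc A)" using D unfolding Der_def by blast
  \<comment> \<open>\<open>G\<close> and \<open>H\<close> are full Wirtinger derivatives of a
    component of the field times \<open>f\<close>, hence integrate to 0; what they add to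
    \<open>f'\<close> cancels between the two.\<close>
  define G where "G = (\<lambda>rc A. field i E A (i, False) $$ rc * g rc A + (E $$ (fst rc, fst rc) - E $$ (snd rc, snd rc)) * f A)"
  define H where "H = (\<lambda>rc A. field i E A (i, True) $$ (snd rc, fst rc) * h rc A + (E $$ (snd rc, snd rc) - E $$ (fst rc, fst rc)) * f A)"
  have GH: "(integrable M (G rc) \<and> integral\<^sup>L M (G rc) = 0) \<and> (integrable M (H rc) \<and> integral\<^sup>L M (H rc) = 0)" if rc: "rc \<in> I \<times> J" for rc
  proof -
    obtain r c where rc': "rc = (r, c)" by (cases rc)
    have lt: "r < n" "c < n" using rc rc' I_sub J_sub by auto
    have "wirtinger i rc (\<lambda>A. (\<Sum>s<n. E $$ (r, s) * A i $$ (s, c)) + (\<Sum>s<n. (- E $$ (s, c)) * A i $$ (r, s)))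
       (\<lambda>A. (\<Sum>s<n. E $$ (r, s) * (if i = i \<and> (s, c) = rc then 1 else 0) + 0 * A i $$ (s, c)) + (\<Sum>s<n. (- E $$ (s, c)) * (if i = i \<and> (r, s) = rc then 1 else 0) + 0 * A i $$ (r, s)))
       (\<lambda>A. (\<Sum>s<n. E $$ (r, s) * 0 + 0 * A i $$ (s, c)) + (\<Sum>s<n. (- E $$ (s, c)) * 0 + 0 * A i $$ (r, s)))"
      by (intro wirtinger_add wirtinger_sum wirtinger_mult[OF i wirtinger_const] wirtinger_entry(1)[OF i] lt) auto
    moreover have "(\<lambda>A. (\<Sum>s<n. E $$ (r, s) * (if i = i \<and> (s, c) = rc then 1 else 0) + 0 * A i $$ (s, c)) + (\<Sum>s<n. (- E $$ (s, c)) * (if i = i \<and> (r, s) = rc then 1 else 0) + 0 * A i $$ (r, s)))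
      = (\<lambda>_. E $$ (r, r) - E $$ (c, c))"
    proof
      fix A
      have "(\<Sum>s<n. E $$ (r, s) * (if i = i \<and> (s, c) = rc then 1 else 0) + 0 * A i $$ (s, c)) = (\<Sum>s<n. if s = r then E $$ (r, r) else 0)"
        by (rule sum.cong) (auto simp: rc')
      moreover have "(\<Sum>s<n. (- E $$ (s, c)) * (if i = i \<and> (r, s) = rc then 1 else 0) + 0 * A i $$ (r, s)) = (\<Sum>s<n. if s = c then - E $$ (c, c) else 0)"
        by (rule sum.cong) (auto simp: rc')
      ultimately show "(\<Sum>s<n. E $$ (r, s) * (if i = i \<and> (s, c) = rc then 1 else 0) + 0 * A i $$ (s, c)) + (\<Sum>s<n. (- E $$ (s, c)) * (if i = i \<and> (r, s) = rc then 1 else 0) + 0 * A i $$ (r, s))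
         = E $$ (r, r) - E $$ (c, c)" using lt by simp
    qed
    ultimately have "wirtinger i rc (\<lambda>A. (\<Sum>s<n. E $$ (r, s) * A i $$ (s, c)) + (\<Sum>s<n. (- E $$ (s, c)) * A i $$ (r, s)))
      (\<lambda>_. E $$ (r, r) - E $$ (c, c)) (\<lambda>_. 0)" by simp
    hence wF: "wirtinger i rc (\<lambda>A. field i E A (i, False) $$ rc) (\<lambda>_. E $$ (r, r) - E $$ (c, c)) (\<lambda>_. 0)"
      by (rule wirtinger_cong[OF i rc, rotated]) (simp add: rc' field_index(1)[OF _ lt] sum_negf mult.commute)
    have "wirtinger i rc (\<lambda>A. field i E A (i, False) $$ rc * f A)
       (\<lambda>A. field i E A (i, False) $$ rc * g rc A + (E $$ (r, r) - E $$ (c, c)) * f A)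
       (\<lambda>A. field i E A (i, False) $$ rc * h rc A + 0 * f A)"
      by (rule wirtinger_mult[OF i wF w[OF rc]])
    from wirtinger_integral[OF this i rc, of L] supp
    have 1: "integrable M (G rc) \<and> integral\<^sup>L M (G rc) = 0" by (auto simp: G_def rc')
    have "wirtinger i rc (\<lambda>A. (\<Sum>s<n. E $$ (c, s) * cnj (A i $$ (r, s))) + (\<Sum>s<n. (- E $$ (s, r)) * cnj (A i $$ (s, c))))
       (\<lambda>A. (\<Sum>s<n. E $$ (c, s) * 0 + 0 * cnj (A i $$ (r, s))) + (\<Sum>s<n. (- E $$ (s, r)) * 0 + 0 * cnj (A i $$ (s, c))))
       (\<lambda>A. (\<Sum>s<n. E $$ (c, s) * (if i = i \<and> (r, s) = rc then 1 else 0) + 0 * cnj (A i $$ (r, s))) + (\<Sum>s<n. (- E $$ (s, r)) * (if i = i \<and> (s, c) = rc then 1 else 0) + 0 * cnj (A i $$ (s, c))))"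
      by (intro wirtinger_add wirtinger_sum wirtinger_mult[OF i wirtinger_const] wirtinger_entry(2)[OF i] lt) auto
    moreover have "(\<lambda>A. (\<Sum>s<n. E $$ (c, s) * (if i = i \<and> (r, s) = rc then 1 else 0) + 0 * cnj (A i $$ (r, s))) + (\<Sum>s<n. (- E $$ (s, r)) * (if i = i \<and> (s, c) = rc then 1 else 0) + 0 * cnj (A i $$ (s, c))))
      = (\<lambda>_. E $$ (c, c) - E $$ (r, r))"
    proof
      fix A
      have "(\<Sum>s<n. E $$ (c, s) * (if i = i \<and> (r, s) = rc then 1 else 0) + 0 * cnj (A i $$ (r, s))) = (\<Sum>s<n. if s = c then E $$ (c, c) else 0)"
        by (rule sum.cong) (auto simp: rc')
      moreover have "(\<Sum>s<n. (- E $$ (s, r)) * (if i = i \<and> (s, c) = rc then 1 else 0) + 0 * cnj (A i $$ (s, c))) = (\<Sum>s<n. if s = r then - E $$ (r, r) else 0)"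
        by (rule sum.cong) (auto simp: rc')
      ultimately show "(\<Sum>s<n. E $$ (c, s) * (if i = i \<and> (r, s) = rc then 1 else 0) + 0 * cnj (A i $$ (r, s))) + (\<Sum>s<n. (- E $$ (s, r)) * (if i = i \<and> (s, c) = rc then 1 else 0) + 0 * cnj (A i $$ (s, c)))
        = E $$ (c, c) - E $$ (r, r)" using lt by simp
    qed
    ultimately have "wirtinger i rc (\<lambda>A. (\<Sum>s<n. E $$ (c, s) * cnj (A i $$ (r, s))) + (\<Sum>s<n. (- E $$ (s, r)) * cnj (A i $$ (s, c))))
      (\<lambda>_. 0) (\<lambda>_. E $$ (c, c) - E $$ (r, r))" by simp
    hence wF: "wirtinger i rc (\<lambda>A. field i E A (i, True) $$ (snd rc, fst rc)) (\<lambda>_. 0) (\<lambda>_. E $$ (c, c) - E $$ (r, r))"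
      by (rule wirtinger_cong[OF i rc, rotated]) (simp add: rc' field_index(2)[OF _ lt(2,1)] sum_negf mult.commute)
    have "wirtinger i rc (\<lambda>A. field i E A (i, True) $$ (snd rc, fst rc) * f A)
       (\<lambda>A. field i E A (i, True) $$ (snd rc, fst rc) * g rc A + 0 * f A)
       (\<lambda>A. field i E A (i, True) $$ (snd rc, fst rc) * h rc A + (E $$ (c, c) - E $$ (r, r)) * f A)"
      by (rule wirtinger_mult[OF i wF w[OF rc]])
    from wirtinger_integral[OF this i rc, of L] supp
    have "integrable M (H rc) \<and> integral\<^sup>L M (H rc) = 0" by (auto simp: H_def rc')
    with 1 show ?thesis by blast
  qed
  have eq: "f' A = (\<Sum>rc\<in>I \<times> J. G rc A + H rc A)" if "A \<in> space M" for A
    unfolding f'[OF that] by (rule sum.cong) (auto simp: G_def H_def algebra_simps)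
  have int: "integrable M (\<lambda>A. \<Sum>rc\<in>I \<times> J. G rc A + H rc A)"
    using GH by (intro Bochner_Integration.integrable_sum Bochner_Integration.integrable_add) auto
  have "integral\<^sup>L M (\<lambda>A. \<Sum>rc\<in>I \<times> J. G rc A + H rc A) = (\<Sum>rc\<in>I \<times> J. integral\<^sup>L M (G rc) + integral\<^sup>L M (H rc))"
    using GH by (subst Bochner_Integration.integral_sum) (auto intro!: sum.cong)
  also have "\<dots> = 0" using GH by (intro sum.neutral) auto
  finally show ?thesis using int Bochner_Integration.integrable_cong[OF refl eq, of M] Bochner_Integration.integral_cong[OF refl eq, of M] by auto
qed

end

end

section \<open>Concentration of the liberation gradient\<close>

text \<open>Differentiating c tr(u) tr(v) produces at most 2 (|u| + |v|) products of two traces, the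
  2 coming from the commutator.\<close>

definition terms_weight :: "trace_poly \<Rightarrow> real" where
  "terms_weight T = (\<Sum>(c, u, v)\<leftarrow>T. cmod c * real (2 * (length u + length v)))"

context mat_tuple
begin

text \<open>Used to resum the directions given by matrix units into the single direction P w
  P.\<close>

lemma dword_linear:
  assumes E: "\<And>k. k \<in> K \<Longrightarrow> E k \<in> carrier_mat n n" "X \<in> carrier_mat n n"
    and X: "\<And>u v. u < n \<Longrightarrow> v < n \<Longrightarrow> X $$ (u, v) = (\<Sum>k\<in>K. c k * E k $$ (u, v))"
  shows "fst ` set w \<subseteq> {1..N} \<Longrightarrow> u < n \<Longrightarrow> v < n \<Longrightarrow>
    dword n A i X w $$ (u, v) = (\<Sum>k\<in>K. c k * dword n A i (E k) w $$ (u, v))"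
proof (induction w arbitrary: u)
  case Nil
  thus ?case by simp
next
  case (Cons x w)
  define y where "y = lmat A x"
  define W where "W = mat_word n A w"
  have x: "fst x \<in> {1..N}" "fst ` set w \<subseteq> {1..N}" using Cons.prems by auto
  have c: "y \<in> carrier_mat n n" "W \<in> carrier_mat n n"
    unfolding y_def W_def by (rule lmat_carrier[OF x(1)], rule word_carrier[OF x(2)])
  have expand: "dword n A i F (x # w) $$ (u, v) =
      (if fst x = i then \<Sum>s<n. ((\<Sum>t<n. F $$ (u, t) * y $$ (t, s)) - (\<Sum>t<n. y $$ (u, t) * F $$ (t, s))) * W $$ (s, v) else 0) +
      (\<Sum>s<n. y $$ (u, s) * dword n A i F w $$ (s, v))" if F: "F \<in> carrier_mat n n" for F
  proof -
    have car: "F * y \<in> carrier_mat n n" "y * F \<in> carrier_mat n n" "F * y - y * F \<in> carrier_mat n n"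
      "dword n A i F w \<in> carrier_mat n n"
      using c F dword_carrier[OF F x(2)] by (auto intro: mult_carrier_mat[of _ n n])
    have car2: "(F * y - y * F) * W \<in> carrier_mat n n" "y * dword n A i F w \<in> carrier_mat n n"
      using car c by (auto intro: mult_carrier_mat[of _ n n])
    have 1: "((F * y - y * F) * W) $$ (u, v) =
      (\<Sum>s<n. ((\<Sum>t<n. F $$ (u, t) * y $$ (t, s)) - (\<Sum>t<n. y $$ (u, t) * F $$ (t, s))) * W $$ (s, v))"
      unfolding mat_mult_index[OF car(3) c(2) Cons.prems(2,3)]
      by (rule sum.cong) (simp_all add: mat_minus_index[OF car(1,2) Cons.prems(2)]
        mat_mult_index[OF F c(1) Cons.prems(2)] mat_mult_index[OF c(1) F Cons.prems(2)] del: index_minus_mat index_mult_mat)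
    have 2: "(y * dword n A i F w) $$ (u, v) = (\<Sum>s<n. y $$ (u, s) * dword n A i F w $$ (s, v))"
      by (rule mat_mult_index[OF c(1) car(4) Cons.prems(2,3)])
    have d: "dword n A i F (x # w) = (if fst x = i then (F * y - y * F) * W else 0\<^sub>m n n) + y * dword n A i F w"
      by (simp only: dword.simps y_def W_def)
    show ?thesis
    proof (cases "fst x = i")
      case True
      thus ?thesis unfolding d using mat_add_index[OF car2 Cons.prems(2,3)] 1 2 by simp
    next
      case False
      thus ?thesis unfolding d using mat_add_index[OF zero_carrier_mat car2(2) Cons.prems(2,3)] 2 Cons.prems(2,3) by simp
    qed
  qed
  have A1: "(\<Sum>s<n. ((\<Sum>t<n. X $$ (u, t) * y $$ (t, s)) - (\<Sum>t<n. y $$ (u, t) * X $$ (t, s))) * W $$ (s, v)) =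
    (\<Sum>k\<in>K. c k * (\<Sum>s<n. ((\<Sum>t<n. E k $$ (u, t) * y $$ (t, s)) - (\<Sum>t<n. y $$ (u, t) * E k $$ (t, s))) * W $$ (s, v)))"
  proof -
    have a: "(\<Sum>t<n. X $$ (u, t) * y $$ (t, s)) = (\<Sum>k\<in>K. c k * (\<Sum>t<n. E k $$ (u, t) * y $$ (t, s)))" for s
    proof -
      have "(\<Sum>t<n. X $$ (u, t) * y $$ (t, s)) = (\<Sum>t<n. \<Sum>k\<in>K. c k * (E k $$ (u, t) * y $$ (t, s)))"
        by (rule sum.cong) (simp_all add: X[OF Cons.prems(2)] sum_distrib_right mult.assoc)
      thus ?thesis by (subst (asm) sum.swap) (simp add: sum_distrib_left)
    qed
    have b: "(\<Sum>t<n. y $$ (u, t) * X $$ (t, s)) = (\<Sum>k\<in>K. c k * (\<Sum>t<n. y $$ (u, t) * E k $$ (t, s)))" if "s < n" for s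
    proof -
      have "(\<Sum>t<n. y $$ (u, t) * X $$ (t, s)) = (\<Sum>t<n. \<Sum>k\<in>K. c k * (y $$ (u, t) * E k $$ (t, s)))"
        by (rule sum.cong) (simp_all add: X[OF _ that] sum_distrib_left mult.left_commute)
      thus ?thesis by (subst (asm) sum.swap) (simp add: sum_distrib_left)
    qed
    have "(\<Sum>s<n. ((\<Sum>t<n. X $$ (u, t) * y $$ (t, s)) - (\<Sum>t<n. y $$ (u, t) * X $$ (t, s))) * W $$ (s, v)) =
      (\<Sum>s<n. \<Sum>k\<in>K. c k * (((\<Sum>t<n. E k $$ (u, t) * y $$ (t, s)) - (\<Sum>t<n. y $$ (u, t) * E k $$ (t, s))) * W $$ (s, v)))"
      by (rule sum.cong) (simp_all add: a b sum_subtractf[symmetric] sum_distrib_right right_diff_distrib[symmetric] mult.assoc)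
    thus ?thesis by (subst (asm) sum.swap) (simp add: sum_distrib_left)
  qed
  have A2: "(\<Sum>s<n. y $$ (u, s) * dword n A i X w $$ (s, v)) = (\<Sum>k\<in>K. c k * (\<Sum>s<n. y $$ (u, s) * dword n A i (E k) w $$ (s, v)))"
  proof -
    have "(\<Sum>s<n. y $$ (u, s) * dword n A i X w $$ (s, v)) = (\<Sum>s<n. \<Sum>k\<in>K. c k * (y $$ (u, s) * dword n A i (E k) w $$ (s, v)))"
      by (rule sum.cong) (simp_all add: Cons.IH[OF x(2) _ Cons.prems(3)] sum_distrib_left mult.left_commute)
    thus ?thesis by (subst (asm) sum.swap) (simp add: sum_distrib_left)
  qed
  show ?case
  proof (cases "fst x = i")
    case True
    thus ?thesis unfolding expand[OF E(2)] A1 A2 using expand[OF E(1)] by (simp add: sum.distrib distrib_left)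
  next
    case False
    thus ?thesis unfolding expand[OF E(2)] A2 using expand[OF E(1)] by simp
  qed
qed

text \<open>Summed against the entries of \<open>w\<close>, the derivatives along matrix units
  become the derivative along P w P, whose terms are products of traces bounded by \<open>b\<close>.
  The 3 in the lengths counts the two projections around \<open>w\<close> and the one that cuts out
  the block trace.\<close>

lemma sum_dtpoly_bound:
  assumes S: "S \<subseteq> {..<n}" and w: "fst ` set w \<subseteq> {1..N}" and b: "b \<ge> 0"
    and T: "\<And>c u v. (c, u, v) \<in> set T \<Longrightarrow> fst ` set u \<subseteq> {1..N} \<and> fst ` set v \<subseteq> {1..N} \<and>
         length u + length w + 3 \<le> m \<and> length v + length w + 3 \<le> m"
    and bound: "\<And>L. set L \<subseteq> lmat A ` ({1..N} \<times> UNIV) \<union> {bproj n S} \<Longrightarrow> length L \<le> m \<Longrightarrow> cmod (mat_trace (mprod n L)) \<le> b"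
  shows "cmod (\<Sum>\<alpha>\<in>S. \<Sum>\<beta>\<in>S. mat_word n A w $$ (\<alpha>, \<beta>) * dtpoly n S T A i (munit n \<alpha> \<beta>)) \<le> terms_weight T * b\<^sup>2"
proof -
  let ?P = "bproj n S"
  let ?X = "?P * mat_word n A w * ?P"
  have W: "mat_word n A w \<in> carrier_mat n n" by (rule word_carrier[OF w])
  have X: "?X \<in> carrier_mat n n" using W by (auto intro!: mult_carrier_mat[of _ n n])
  have fin: "finite S" using S finite_subset by blast
  have lin: "(\<Sum>(\<alpha>, \<beta>)\<in>S \<times> S. mat_word n A w $$ (\<alpha>, \<beta>) * btr S (dword n A i (munit n \<alpha> \<beta>) u)) = btr S (dword n A i ?X u)"
    if u: "fst ` set u \<subseteq> {1..N}" for u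
  proof -
    have "dword n A i ?X u $$ (s, s) = (\<Sum>k\<in>S \<times> S. mat_word n A w $$ k * dword n A i (munit n (fst k) (snd k)) u $$ (s, s))" if s: "s \<in> S" for s
    proof (rule dword_linear[OF _ X _ u])
      fix x y assume xy: "x < n" "y < n"
      have PW: "?P * mat_word n A w \<in> carrier_mat n n" using W by (auto intro!: mult_carrier_mat[of _ n n])
      have "(\<Sum>k\<in>S \<times> S. mat_word n A w $$ k * munit n (fst k) (snd k) $$ (x, y)) =
        (\<Sum>k\<in>S \<times> S. if k = (x, y) then mat_word n A w $$ (x, y) else 0)"
        using xy by (intro sum.cong) (auto simp: munit_def)
      also have "\<dots> = ?X $$ (x, y)"
        using fin bproj_mult_index(2)[OF PW xy, of S] bproj_mult_index(1)[OF W xy, of S] by simp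
      finally show "?X $$ (x, y) = (\<Sum>k\<in>S \<times> S. mat_word n A w $$ k * munit n (fst k) (snd k) $$ (x, y))" by (rule sym)
    qed (use s S in auto)
    hence "btr S (dword n A i ?X u) = (\<Sum>s\<in>S. \<Sum>k\<in>S \<times> S. mat_word n A w $$ k * dword n A i (munit n (fst k) (snd k)) u $$ (s, s))"
      by (simp add: btr_def)
    also have "\<dots> = (\<Sum>k\<in>S \<times> S. mat_word n A w $$ k * btr S (dword n A i (munit n (fst k) (snd k)) u))"
      by (subst sum.swap) (simp add: btr_def sum_distrib_left)
    finally show ?thesis by (simp add: case_prod_beta)
  qed
  have P1: "mprod n [?P] = ?P" by (simp add: right_mult_one_mat[of _ n n])
  have bd: "cmod (btr S (dword n A i ?X u)) \<le> real (2 * length u) * b"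
    if u: "fst ` set u \<subseteq> {1..N}" "length u + length w + 3 \<le> m" for u
  proof -
    have "cmod (mat_trace (mprod n [?P] * dword n A i ?X u)) \<le> real (2 * length u) * b"
      by (rule btr_dword_bound[where P="bproj n S" and P'="bproj n S" and m=m, OF S bproj_carrier w b _ bproj_carrier])
        (use bound u in auto)
    thus ?thesis unfolding P1 btr_eq_trace[OF dword_carrier[OF X u(1)] S] .
  qed
  have bw: "cmod (btr S (mat_word n A u)) \<le> b"
    if u: "fst ` set u \<subseteq> {1..N}" "length u + length w + 3 \<le> m" for u
  proof -
    have "cmod (mat_trace (mprod n (?P # map (lmat A) u))) \<le> b"
      using u by (intro bound) auto
    thus ?thesis using btr_eq_trace[OF word_carrier[OF u(1)] S] by (simp add: mat_word_eq)
  qed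
  have "cmod (\<Sum>k\<in>S \<times> S. mat_word n A w $$ k * dtpoly n S T A i (munit n (fst k) (snd k))) \<le> terms_weight T * b\<^sup>2"
    using T
  proof (induction T)
    case (Cons t T)
    obtain c u v where t: "t = (c, u, v)" by (cases t)
    have uv: "fst ` set u \<subseteq> {1..N}" "fst ` set v \<subseteq> {1..N}" "length u + length w + 3 \<le> m" "length v + length w + 3 \<le> m"
      using Cons.prems[of c u v] t by auto
    have IH: "cmod (\<Sum>k\<in>S \<times> S. mat_word n A w $$ k * dtpoly n S T A i (munit n (fst k) (snd k))) \<le> terms_weight T * b\<^sup>2"
      by (rule Cons.IH) (rule Cons.prems[OF list.set_intros(2)])
    have "(\<Sum>k\<in>S \<times> S. mat_word n A w $$ k * dtpoly n S (t # T) A i (munit n (fst k) (snd k))) =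
      c * (btr S (dword n A i ?X u) * btr S (mat_word n A v) + btr S (mat_word n A u) * btr S (dword n A i ?X v)) +
      (\<Sum>k\<in>S \<times> S. mat_word n A w $$ k * dtpoly n S T A i (munit n (fst k) (snd k)))"
    proof -
      let ?m = "\<lambda>k. mat_word n A w $$ k" and ?d = "\<lambda>u k. btr S (dword n A i (munit n (fst k) (snd k)) u)"
      have l: "btr S (dword n A i ?X z) = (\<Sum>k\<in>S \<times> S. ?m k * ?d z k)" if "fst ` set z \<subseteq> {1..N}" for z
        unfolding lin[OF that, symmetric] by (rule sum.cong) auto
      have "?m k * dtpoly n S (t # T) A i (munit n (fst k) (snd k)) =
        c * ((?m k * ?d u k) * btr S (mat_word n A v) + btr S (mat_word n A u) * (?m k * ?d v k)) +
        ?m k * dtpoly n S T A i (munit n (fst k) (snd k))" for k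
        by (simp add: t dtpoly_def algebra_simps)
      thus ?thesis unfolding l[OF uv(1)] l[OF uv(2)]
        by (simp only: sum.distrib sum_distrib_left[symmetric] sum_distrib_right[symmetric])
    qed
    moreover have "cmod (btr S (dword n A i ?X u) * btr S (mat_word n A v) + btr S (mat_word n A u) * btr S (dword n A i ?X v)) \<le>
      real (2 * (length u + length v)) * b\<^sup>2"
    proof -
      have "cmod (btr S (dword n A i ?X u) * btr S (mat_word n A v)) \<le> (real (2 * length u) * b) * b"
        unfolding norm_mult using bd[OF uv(1,3)] bw[OF uv(2,4)] b by (intro mult_mono) auto
      moreover have "cmod (btr S (mat_word n A u) * btr S (dword n A i ?X v)) \<le> b * (real (2 * length v) * b)"
        unfolding norm_mult using bd[OF uv(2,4)] bw[OF uv(1,3)] b by (intro mult_mono) auto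
      ultimately show ?thesis
        by (intro order_trans[OF norm_triangle_ineq]) (simp add: algebra_simps power2_eq_square)
    qed
    hence "cmod (c * (btr S (dword n A i ?X u) * btr S (mat_word n A v) + btr S (mat_word n A u) * btr S (dword n A i ?X v))) \<le>
      cmod c * (real (2 * (length u + length v)) * b\<^sup>2)"
      unfolding norm_mult[of c] by (rule mult_left_mono) simp
    moreover have "terms_weight (t # T) * b\<^sup>2 = cmod c * (real (2 * (length u + length v)) * b\<^sup>2) + terms_weight T * b\<^sup>2"
      by (simp add: terms_weight_def t algebra_simps)
    ultimately show ?case using IH by (simp only:) (rule norm_triangle_le, linarith)
  qed (simp add: dtpoly_def terms_weight_def)
  thus ?thesis by (simp add: sum.cartesian_product case_prod_beta)
qed

text \<open>Words of length at most \<open>2\<^sup>q\<^sup>+\<^sup>1\<close> are padded with identity matrices.\<close>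

lemma trace_list_bound:
  assumes S: "S \<subseteq> {..<n}" and b: "real n \<le> b"
    and bound: "\<And>x. fst x \<in> {1..N} \<Longrightarrow> Re (mat_trace (mprod n (alternating_list (lmat A x) (2 ^ q)))) \<le> b"
    and L: "set L \<subseteq> lmat A ` ({1..N} \<times> UNIV) \<union> {bproj n S}" "length L \<le> 2 * 2 ^ q"
  shows "cmod (mat_trace (mprod n L)) \<le> b"
proof -
  let ?C = "lmat A ` ({1..N} \<times> UNIV) \<union> {bproj n S, 1\<^sub>m n}"
  let ?L = "L @ replicate (2 * 2 ^ q - length L) (1\<^sub>m n)"
  have Ccar: "?C \<subseteq> carrier_mat n n" using lmat_carrier by auto
  have idem: "mprod n (replicate (Suc m) P) = P" if "P \<in> carrier_mat n n" "P * P = P" for P m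
    using that by (induction m) (auto simp: right_mult_one_mat[of _ n n])
  have alt: "alternating_list P t = replicate (2 * t) P" if "mat_adjoint P = P" for P t
    by (induction t) (auto simp: alternating_list_def that)
  \<comment> \<open>The block projection and the identity are self-adjoint idempotents: their
    alternating words collapse to one factor, whose trace is at most \<open>n\<close>.\<close>
  have sa: "Re (mat_trace (mprod n (alternating_list P (2 ^ q)))) = Re (mat_trace P)" 
    if "P \<in> carrier_mat n n" "P * P = P" "mat_adjoint P = P" for P
  proof -
    obtain m where m: "2 * 2 ^ q = Suc m" by (metis not0_implies_Suc mult_eq_0_iff power_eq_0_iff zero_neq_numeral)
    show ?thesis unfolding alt[OF that(3)] m idem[OF that(1,2)] ..
  qed
  have PP: "bproj n S * bproj n S = bproj n S"
    using bproj_mult_index(1)[OF bproj_carrier] by (intro eq_matI) (auto simp: bproj_def)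
  have "cmod (mat_trace (mprod n ?L)) \<le> b"
  proof (rule trace_chessboard[OF _ Ccar])
    fix C assume C: "C \<in> ?C"
    have "Re (mat_trace (bproj n S)) \<le> real n"
    proof -
      have "Re (mat_trace (bproj n S)) = (\<Sum>i<n. if i \<in> S then 1 else 0)"
        unfolding mat_trace_def Re_sum by (rule sum.cong) (auto simp: bproj_def)
      also have "\<dots> \<le> (\<Sum>i<n. 1)" by (rule sum_mono) auto
      finally show ?thesis by simp
    qed
    moreover have "Re (mat_trace (1\<^sub>m n)) = real n" by (simp add: mat_trace_def)
    ultimately show "Re (mat_trace (mprod n (alternating_list C (2 ^ q)))) \<le> b"
      using C bound b sa[OF bproj_carrier PP bproj_adjoint] sa[of "1\<^sub>m n"] by fastforce
    show "mat_adjoint C \<in> ?C"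
    proof -
      have "mat_adjoint (lmat A (i, s)) = lmat A (i, \<not> s)" for i s by (simp add: lmat_def)
      thus ?thesis using C by fastforce
    qed
  next
    show "set ?L \<subseteq> ?C" using L(1) by (auto simp: set_replicate_conv_if)
    show "length ?L = 2 * 2 ^ q" using L(2) by simp
  qed simp
  moreover have "mprod n ?L = mprod n L"
  proof -
    have Lc: "set L \<subseteq> carrier_mat n n" using L(1) Ccar by auto
    have "mprod n (replicate m (1\<^sub>m n)) = 1\<^sub>m n" for m by (induction m) auto
    thus ?thesis using mprod_append[OF Lc, of "replicate (2 * 2 ^ q - length L) (1\<^sub>m n)"]
      by (simp add: right_mult_one_mat[OF mprod_carrier[OF Lc]] set_replicate_conv_if)
  qed
  ultimately show ?thesis by simp
qed

end

context rect_tuple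
begin

lemma regular_integrable:
  assumes "regular f" "\<And>A. A \<in> space M \<Longrightarrow> A \<notin> Box L \<Longrightarrow> f A = 0"
  shows "integrable M f"
proof -
  obtain B where B: "\<And>A. A \<in> Box L \<Longrightarrow> cmod (f A) \<le> B" using assms(1) unfolding regular_def by metis
  show ?thesis
  proof (rule Bochner_Integration.integrable_bound)
    show "integrable M (\<lambda>A. B * indicator (Box L) A)"
      using emeasure_Box[of L] by (intro integrable_mult_right integrable_real_indicator) auto
    show "f \<in> borel_measurable M" using assms(1) by (simp add: regular_def)
    have "cmod (f A) \<le> norm (B * indicator (Box L) A)" if "A \<in> space M" for A
      using that assms(2)[of A] B[of A] by (cases "A \<in> Box L") auto
    thus "AE A in M. cmod (f A) \<le> norm (B * indicator (Box L) A)" by (rule AE_I2)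
  qed
qed

section \<open>Moments of the liberation gradient under an invariant cut-off\<close>

context
  fixes i :: nat and S :: "nat set" and w :: "(nat \<times> bool) list" and \<psi> :: "(nat \<Rightarrow> complex Matrix.mat) \<Rightarrow> real" and L K :: real
  assumes i: "i \<in> {1..N}" and S: "S \<subseteq> {..<n}" and w: "fst ` set w \<subseteq> {1..N}"
    and S_block: "\<And>u v. u \<in> S \<Longrightarrow> v \<in> S \<Longrightarrow> (u \<in> I \<longleftrightarrow> v \<in> I) \<and> (u \<in> J \<longleftrightarrow> v \<in> J)"
    and \<psi>_nonneg: "\<And>A. A \<in> space M \<Longrightarrow> \<psi> A \<ge> 0"
    and \<psi>_Der: "\<And>\<alpha> \<beta>. \<alpha> \<in> S \<Longrightarrow> \<beta> \<in> S \<Longrightarrow> Der i (munit n \<alpha> \<beta>) (\<lambda>A. of_real (\<psi> A)) (\<lambda>_. 0)"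
    and \<psi>_regular: "regular (\<lambda>A. of_real (\<psi> A))"
    and \<psi>_supp: "\<And>A. A \<in> space M \<Longrightarrow> A \<notin> Box L \<Longrightarrow> \<psi> A = 0"
    and K: "\<And>A. A \<in> space M \<Longrightarrow> \<psi> A \<noteq> 0 \<Longrightarrow>
        cmod (\<Sum>\<alpha>\<in>S. \<Sum>\<beta>\<in>S. mat_word n A w $$ (\<alpha>, \<beta>) * dtpoly n S (liberation_terms i [] w) A i (munit n \<alpha> \<beta>)) \<le> K"
      "\<And>A. A \<in> space M \<Longrightarrow> \<psi> A \<noteq> 0 \<Longrightarrow>
        cmod (\<Sum>\<alpha>\<in>S. \<Sum>\<beta>\<in>S. mat_word n A w $$ (\<alpha>, \<beta>) * dtpoly n S (star_terms (liberation_terms i [] w)) A i (munit n \<alpha> \<beta>)) \<le> K"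
begin

abbreviation "\<Delta> \<equiv> tpoly n S (liberation_terms i [] w)"

lemma liberation_terms_ok:
  "(c, u, v) \<in> set (liberation_terms i [] w) \<Longrightarrow> fst ` set u \<subseteq> {1..N} \<and> fst ` set v \<subseteq> {1..N}"
  using liberation_terms_fst[of c u v i "[]" w] w by fastforce

lemma star_terms_ok:
  "(c, u, v) \<in> set (star_terms (liberation_terms i [] w)) \<Longrightarrow> fst ` set u \<subseteq> {1..N} \<and> fst ` set v \<subseteq> {1..N}"
proof -
  assume "(c, u, v) \<in> set (star_terms (liberation_terms i [] w))"
  then obtain c' u' v' where "(c', u', v') \<in> set (liberation_terms i [] w)" "u = star_word u'" "v = star_word v'"
    unfolding star_terms_def by auto
  thus ?thesis using liberation_terms_ok by (metis fst_star_word)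
qed

lemma \<Delta>_star: "A \<in> space M \<Longrightarrow> tpoly n S (star_terms (liberation_terms i [] w)) A = cnj (\<Delta> A)"
proof -
  assume "A \<in> space M"
  then interpret mat_tuple n N A using space_M_D by unfold_locales auto
  show ?thesis by (rule tpoly_star[OF S liberation_terms_ok])
qed

lemma munit_good:
  assumes "\<alpha> \<in> S" "\<beta> \<in> S" "u < n" "v < n" "munit n \<alpha> \<beta> $$ (u, v) \<noteq> 0"
  shows "(u \<in> I \<longleftrightarrow> v \<in> I) \<and> (u \<in> J \<longleftrightarrow> v \<in> J)"
  using assms S_block[of \<alpha> \<beta>] by (auto simp: munit_def split: if_splits)

lemma \<Delta>_regular: "regular \<Delta>"
proof (cases "S = {}")
  case True
  have "tpoly n S T A = 0" for T A
    by (induction T) (auto simp: True btr_def)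
  thus ?thesis by (simp add: regular_cong[of \<Delta> "\<lambda>_. 0"])
next
  case False
  then obtain \<alpha> where \<alpha>: "\<alpha> \<in> S" by auto
  have "Der i (munit n \<alpha> \<alpha>) \<Delta> (\<lambda>A. dtpoly n S (liberation_terms i [] w) A i (munit n \<alpha> \<alpha>))"
    by (rule Der_tpoly[OF i munit_carrier munit_good[OF \<alpha> \<alpha>] liberation_terms_ok S])
  thus ?thesis by (simp add: Der_def)
qed

definition Moment :: "nat \<Rightarrow> real" where
  "Moment s = integral\<^sup>L M (\<lambda>A. \<psi> A * cmod (\<Delta> A) ^ (2 * s))"

lemma moment_integrable: "integrable M (\<lambda>A. \<psi> A * cmod (\<Delta> A) ^ (2 * s))"
proof -
  have "regular (\<lambda>A. of_real (\<psi> A) * (\<Delta> A * cnj (\<Delta> A)) ^ s)"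
  proof (intro regular_mult \<psi>_regular)
    show "regular (\<lambda>A. (\<Delta> A * cnj (\<Delta> A)) ^ s)"
      by (induction s) (auto intro!: regular_mult \<Delta>_regular regular_cnj)
  qed
  hence "integrable M (\<lambda>A. of_real (\<psi> A) * (\<Delta> A * cnj (\<Delta> A)) ^ s)"
    by (rule regular_integrable[of _ L]) (simp add: \<psi>_supp)
  moreover have "of_real (\<psi> A) * (\<Delta> A * cnj (\<Delta> A)) ^ s = complex_of_real (\<psi> A * cmod (\<Delta> A) ^ (2 * s))" for A
    by (simp add: complex_norm_square[symmetric] power_mult)
  ultimately have "integrable M (\<lambda>A. complex_of_real (\<psi> A * cmod (\<Delta> A) ^ (2 * s)))" by (simp only:)
  from integrable_Re[OF this] show ?thesis by (simp only: Re_complex_of_real)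
qed

lemma Moment_nonneg: "Moment s \<ge> 0"
  unfolding Moment_def by (intro integral_nonneg_AE AE_I2 mult_nonneg_nonneg \<psi>_nonneg) auto

text \<open>The function \<psi> W_(\<alpha>\<beta>) \<Delta>^s conj(\<Delta>)^(s+1) is
  differentiated along the matrix unit of \<alpha>, \<beta>, summed and integrated to 0. Where the
  derivative falls on W, it yields the next moment; on the 2s + 1 factors \<Delta> and
  conj(\<Delta>) it yields terms bounded by \<open>K\<close>; on \<psi> it vanishes.\<close>

lemma Moment_Suc: "Moment (Suc s) \<le> real (2 * s + 1) * K * Moment s"
proof -
  let ?T = "liberation_terms i [] w" and ?T' = "star_terms (liberation_terms i [] w)"
  let ?W = "\<lambda>A \<alpha> \<beta>. mat_word n A w $$ (\<alpha>, \<beta>)"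
  let ?\<Delta>' = "tpoly n S ?T'"
  define d where "d = (\<lambda>A \<alpha> \<beta>. dtpoly n S ?T A i (munit n \<alpha> \<beta>))"
  define d' where "d' = (\<lambda>A \<alpha> \<beta>. dtpoly n S ?T' A i (munit n \<alpha> \<beta>))"
  define D where "D = (\<lambda>A \<alpha> \<beta>. dword n A i (munit n \<alpha> \<beta>) w $$ (\<alpha>, \<beta>))"
  define F where "F = (\<lambda>\<alpha> \<beta> A. of_real (\<psi> A) * (?W A \<alpha> \<beta> * (\<Delta> A ^ s * (of_nat (Suc s) * ?\<Delta>' A ^ s * d' A \<alpha> \<beta>) +
      (of_nat s * \<Delta> A ^ (s - 1) * d A \<alpha> \<beta>) * ?\<Delta>' A ^ Suc s) + D A \<alpha> \<beta> * (\<Delta> A ^ s * ?\<Delta>' A ^ Suc s)))"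
  have int: "integrable M (F \<alpha> \<beta>) \<and> integral\<^sup>L M (F \<alpha> \<beta>) = 0" if ab: "\<alpha> \<in> S" "\<beta> \<in> S" for \<alpha> \<beta>
  proof (rule Der_integral[OF i munit_carrier munit_good[OF ab]])
    have lt: "\<alpha> < n" "\<beta> < n" using ab S by auto
    note rules = i munit_carrier munit_good[OF ab]
    have 1: "Der i (munit n \<alpha> \<beta>) (\<lambda>A. ?W A \<alpha> \<beta>) (\<lambda>A. D A \<alpha> \<beta>)"
      unfolding D_def by (rule Der_word[OF rules w lt])
    have 2: "Der i (munit n \<alpha> \<beta>) (\<lambda>A. \<Delta> A ^ s) (\<lambda>A. of_nat s * \<Delta> A ^ (s - 1) * d A \<alpha> \<beta>)"
      unfolding d_def by (rule Der_power[OF rules Der_tpoly[OF rules liberation_terms_ok S]])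
    have 3: "Der i (munit n \<alpha> \<beta>) (\<lambda>A. ?\<Delta>' A ^ Suc s) (\<lambda>A. of_nat (Suc s) * ?\<Delta>' A ^ (Suc s - 1) * d' A \<alpha> \<beta>)"
      unfolding d'_def by (rule Der_power[OF rules Der_tpoly[OF rules star_terms_ok S]])
    have "Der i (munit n \<alpha> \<beta>) (\<lambda>A. of_real (\<psi> A) * (?W A \<alpha> \<beta> * (\<Delta> A ^ s * ?\<Delta>' A ^ Suc s)))
      (\<lambda>A. of_real (\<psi> A) * (?W A \<alpha> \<beta> * (\<Delta> A ^ s * (of_nat (Suc s) * ?\<Delta>' A ^ (Suc s - 1) * d' A \<alpha> \<beta>) +
      (of_nat s * \<Delta> A ^ (s - 1) * d A \<alpha> \<beta>) * ?\<Delta>' A ^ Suc s) + D A \<alpha> \<beta> * (\<Delta> A ^ s * ?\<Delta>' A ^ Suc s)) +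
      0 * (?W A \<alpha> \<beta> * (\<Delta> A ^ s * ?\<Delta>' A ^ Suc s)))"
      by (intro Der_mult[OF rules] \<psi>_Der ab 1 2 3)
    moreover have "(\<lambda>A. of_real (\<psi> A) * (?W A \<alpha> \<beta> * (\<Delta> A ^ s * (of_nat (Suc s) * ?\<Delta>' A ^ (Suc s - 1) * d' A \<alpha> \<beta>) +
      (of_nat s * \<Delta> A ^ (s - 1) * d A \<alpha> \<beta>) * ?\<Delta>' A ^ Suc s) + D A \<alpha> \<beta> * (\<Delta> A ^ s * ?\<Delta>' A ^ Suc s)) +
      0 * (?W A \<alpha> \<beta> * (\<Delta> A ^ s * ?\<Delta>' A ^ Suc s))) = F \<alpha> \<beta>"
      unfolding F_def by (simp only: mult_zero_left add_0_right diff_Suc_1)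
    ultimately show "Der i (munit n \<alpha> \<beta>) (\<lambda>A. of_real (\<psi> A) * (?W A \<alpha> \<beta> * (\<Delta> A ^ s * ?\<Delta>' A ^ Suc s))) (F \<alpha> \<beta>)"
      by (simp only:)
    fix A assume "A \<in> space M" "A \<notin> Box L"
    thus "of_real (\<psi> A) * (?W A \<alpha> \<beta> * (\<Delta> A ^ s * ?\<Delta>' A ^ Suc s)) = 0" using \<psi>_supp by simp
  qed
  define X where "X = (\<lambda>A. \<psi> A * cmod (\<Delta> A) ^ (2 * Suc s))"
  define Z where "Z = (\<lambda>A. \<psi> A * cmod (\<Delta> A) ^ (2 * s))"
  define R1 where "R1 = (\<lambda>A. \<Sum>\<alpha>\<in>S. \<Sum>\<beta>\<in>S. ?W A \<alpha> \<beta> * d A \<alpha> \<beta>)"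
  define R2 where "R2 = (\<lambda>A. \<Sum>\<alpha>\<in>S. \<Sum>\<beta>\<in>S. ?W A \<alpha> \<beta> * d' A \<alpha> \<beta>)"
  define Y where "Y = (\<lambda>A. of_real (\<psi> A) * (\<Delta> A ^ s * (of_nat (Suc s) * ?\<Delta>' A ^ s * R2 A) +
      (of_nat s * \<Delta> A ^ (s - 1) * R1 A) * ?\<Delta>' A ^ Suc s))"
  \<comment> \<open>\<open>X\<close> is the part in which W is differentiated, evaluated by
    \<open>sum_dword\<close>; \<open>Y\<close> is the part in which the powers are.\<close>
  have sumF: "(\<Sum>\<alpha>\<in>S. \<Sum>\<beta>\<in>S. F \<alpha> \<beta> A) = of_real (X A) + Y A" if A: "A \<in> space M" for A
  proof -
    interpret mat_tuple n N A using space_M_D[OF A] by unfold_locales auto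
    have "(\<Sum>\<alpha>\<in>S. \<Sum>\<beta>\<in>S. D A \<alpha> \<beta>) = \<Delta> A"
    proof -
      have "(\<Sum>\<alpha>\<in>S. \<Sum>\<beta>\<in>S. (mat_word n A [] * dword n A i (munit n \<alpha> \<beta>) w) $$ (\<alpha>, \<beta>)) = \<Delta> A"
        by (rule sum_dword[OF S w]) simp
      moreover have "mat_word n A [] * dword n A i (munit n \<alpha> \<beta>) w = dword n A i (munit n \<alpha> \<beta>) w" for \<alpha> \<beta>
        using dword_carrier[OF munit_carrier w] by (simp add: mat_word_eq left_mult_one_mat[of _ n n])
      ultimately show ?thesis by (simp add: D_def)
    qed
    moreover have "(\<Sum>\<alpha>\<in>S. \<Sum>\<beta>\<in>S. F \<alpha> \<beta> A) = Y A + of_real (\<psi> A) * ((\<Sum>\<alpha>\<in>S. \<Sum>\<beta>\<in>S. D A \<alpha> \<beta>) * (\<Delta> A ^ s * ?\<Delta>' A ^ Suc s))"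
      unfolding F_def Y_def R1_def R2_def by (simp add: sum.distrib sum_distrib_left sum_distrib_right algebra_simps)
    moreover have "\<Delta> A * (\<Delta> A ^ s * ?\<Delta>' A ^ Suc s) = of_real (cmod (\<Delta> A) ^ (2 * Suc s))"
    proof -
      have "\<Delta> A * (\<Delta> A ^ s * ?\<Delta>' A ^ Suc s) = (\<Delta> A * cnj (\<Delta> A)) ^ Suc s"
        unfolding \<Delta>_star[OF A] power_mult_distrib by (simp add: mult_ac)
      thus ?thesis by (simp only: complex_norm_square[symmetric] of_real_power power_mult)
    qed
    ultimately show ?thesis unfolding X_def by (simp add: add.commute)
  qed
  have sum_int: "integrable M (\<lambda>A. \<Sum>\<alpha>\<in>S. \<Sum>\<beta>\<in>S. F \<alpha> \<beta> A)" 
    using int by (intro Bochner_Integration.integrable_sum) auto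
  have sum_zero: "integral\<^sup>L M (\<lambda>A. \<Sum>\<alpha>\<in>S. \<Sum>\<beta>\<in>S. F \<alpha> \<beta> A) = 0"
    using int by (simp add: Bochner_Integration.integral_sum Bochner_Integration.integrable_sum)
  have XY: "integrable M (\<lambda>A. of_real (X A) + Y A)" "integral\<^sup>L M (\<lambda>A. of_real (X A) + Y A) = 0"
    using sum_int sum_zero Bochner_Integration.integrable_cong[OF refl sumF, of M]
      Bochner_Integration.integral_cong[OF refl sumF, of M] by auto
  have Xi: "integrable M X" "integrable M Z" unfolding X_def Z_def by (rule moment_integrable)+
  hence Xc: "integrable M (\<lambda>A. complex_of_real (X A))" by (simp add: integrable_of_real)
  have Yi: "integrable M Y"
    using Bochner_Integration.integrable_diff[OF XY(1) Xc] by simp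
  have "integral\<^sup>L M (\<lambda>A. complex_of_real (X A)) + integral\<^sup>L M Y = 0"
    using XY(2) Bochner_Integration.integral_add[OF Xc Yi] by simp
  hence eq: "complex_of_real (integral\<^sup>L M X) = - integral\<^sup>L M Y" by (simp add: add_eq_0_iff2)
  have Yb: "cmod (Y A) \<le> real (2 * s + 1) * K * Z A" if A: "A \<in> space M" for A
  proof (cases "\<psi> A = 0")
    case False
    have R: "cmod (R1 A) \<le> K" "cmod (R2 A) \<le> K" 
      unfolding R1_def R2_def d_def d'_def using K[OF A False] by auto
    have d': "cmod (?\<Delta>' A) = cmod (\<Delta> A)" using \<Delta>_star[OF A] by simp
    let ?x = "cmod (\<Delta> A)"
    have "cmod (\<Delta> A ^ s * (of_nat (Suc s) * ?\<Delta>' A ^ s * R2 A)) = real (Suc s) * ?x ^ (2 * s) * cmod (R2 A)"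
      by (simp add: norm_mult norm_power d' mult_2 power_add del: of_nat_Suc)
    moreover have "\<dots> \<le> real (Suc s) * ?x ^ (2 * s) * K" using R by (intro mult_left_mono) auto
    moreover have "cmod ((of_nat s * \<Delta> A ^ (s - 1) * R1 A) * ?\<Delta>' A ^ Suc s) = real s * ?x ^ (2 * s) * cmod (R1 A)"
      by (cases s) (simp_all add: norm_mult norm_power d' mult_2 power_add del: of_nat_Suc)
    moreover have "\<dots> \<le> real s * ?x ^ (2 * s) * K" using R by (intro mult_left_mono) auto
    ultimately have "cmod (\<Delta> A ^ s * (of_nat (Suc s) * ?\<Delta>' A ^ s * R2 A) + (of_nat s * \<Delta> A ^ (s - 1) * R1 A) * ?\<Delta>' A ^ Suc s)
       \<le> real (Suc s) * ?x ^ (2 * s) * K + real s * ?x ^ (2 * s) * K"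
      by (intro order_trans[OF norm_triangle_ineq]) linarith
    also have "\<dots> = real (2 * s + 1) * K * ?x ^ (2 * s)" by (simp add: algebra_simps)
    finally show ?thesis using \<psi>_nonneg[OF A] unfolding Y_def Z_def norm_mult[of "of_real _"]
      by (simp add: mult_left_mono mult.left_commute)
  qed (simp add: Y_def Z_def)
  have "integral\<^sup>L M X \<le> cmod (integral\<^sup>L M Y)" using eq
    by (metis abs_ge_self norm_minus_cancel norm_of_real)
  also have "\<dots> \<le> integral\<^sup>L M (\<lambda>A. cmod (Y A))" by (rule integral_norm_bound)
  also have "\<dots> \<le> integral\<^sup>L M (\<lambda>A. real (2 * s + 1) * K * Z A)"
    using Yb Yi Xi(2) by (intro integral_mono) auto
  also have "\<dots> = real (2 * s + 1) * K * integral\<^sup>L M Z" by simp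
  finally show ?thesis by (simp add: Moment_def X_def Z_def)
qed

lemma Moment_bound: 
  assumes "K \<ge> 0" shows "Moment s \<le> (2 * real s * K) ^ s * Moment 0"
proof -
  have "Moment t \<le> (2 * real s * K) ^ t * Moment 0" if "t \<le> s" for t
    using that
  proof (induction t)
    case (Suc t)
    have "Moment (Suc t) \<le> real (2 * t + 1) * K * Moment t" by (rule Moment_Suc)
    \<comment> \<open>Each factor 2t + 1 with t < s is at most 2s. Nothing more precise is required,
      as \<open>s\<close> will be proportional to n^2.\<close>
    also have "\<dots> \<le> (2 * real s * K) * ((2 * real s * K) ^ t * Moment 0)"
      using Suc assms Moment_nonneg by (intro mult_mono mult_right_mono) auto
    finally show ?case by simp
  qed simp
  thus ?thesis by simp
qed

lemma concentration:
  assumes "K \<ge> 0" "\<delta> \<ge> 0"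
  shows "measure M {A \<in> space M. 1 \<le> \<psi> A \<and> \<delta> \<le> cmod (\<Delta> A)} * \<delta> ^ (2 * s) \<le> (2 * real s * K) ^ s * integral\<^sup>L M \<psi>"
proof -
  let ?G = "{A \<in> space M. 1 \<le> \<psi> A \<and> \<delta> \<le> cmod (\<Delta> A)}"
  have m: "\<Delta> \<in> borel_measurable M" "(\<lambda>A. complex_of_real (\<psi> A)) \<in> borel_measurable M"
    using \<Delta>_regular \<psi>_regular by (auto simp: regular_def)
  have "(\<lambda>A. Re (complex_of_real (\<psi> A))) \<in> borel_measurable M" using m(2) by measurable
  hence m2: "\<psi> \<in> borel_measurable M" by simp
  have G: "?G \<in> sets M" using m(1) m2 by measurable
  have "?G \<subseteq> Box L" using \<psi>_supp by force
  hence fin: "emeasure M ?G < \<infinity>" using emeasure_mono[OF _ Box_sets, of ?G L] emeasure_Box[of L] by (simp add: order_le_less_trans)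
  have "measure M ?G * \<delta> ^ (2 * s) = integral\<^sup>L M (\<lambda>A. \<delta> ^ (2 * s) * indicator ?G A)"
    using G fin by simp
  also have "\<dots> \<le> Moment s" unfolding Moment_def
  proof (rule integral_mono[OF _ moment_integrable])
    show "integrable M (\<lambda>A. \<delta> ^ (2 * s) * indicator ?G A)" using G fin by (intro integrable_mult_right integrable_real_indicator) auto
    fix A assume A: "A \<in> space M"
    show "\<delta> ^ (2 * s) * indicator ?G A \<le> \<psi> A * cmod (\<Delta> A) ^ (2 * s)"
    proof (cases "A \<in> ?G")
      case True
      have "1 * \<delta> ^ (2 * s) \<le> \<psi> A * cmod (\<Delta> A) ^ (2 * s)"
        using True assms by (intro mult_mono power_mono) auto
      thus ?thesis using True by simp
    qed (use \<psi>_nonneg[OF A] in auto)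
  qed
  also have "\<dots> \<le> (2 * real s * K) ^ s * Moment 0" by (rule Moment_bound[OF assms(1)])
  finally show ?thesis by (simp add: Moment_def)
qed

end

end

section \<open>Microstates\<close>

lemma entry_le_op_norm:
  assumes "A \<in> carrier_mat n n" "mat_op_norm A \<le> R" "u < n" "v < n"
  shows "cmod (A $$ (u, v)) \<le> R"
proof -
  have e: "(unit_vec n v :: complex Matrix.vec) \<in> carrier_vec n" by simp
  have "(\<Sum>j<n. (cmod (vec_index (unit_vec n v :: complex Matrix.vec) j))\<^sup>2) = (\<Sum>j<n. if j = v then 1 else 0)"
    by (rule sum.cong) (auto simp: assms)
  hence ne: "vec_l2_norm (unit_vec n v :: complex Matrix.vec) = 1" using assms by (simp add: vec_l2_norm_def)
  have "vec_index (A *\<^sub>v unit_vec n v) u = (\<Sum>s<n. if s = v then A $$ (u, v) else 0)"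
    unfolding mult_mat_vec_index[OF assms(1) e assms(3)] by (rule sum.cong) (auto simp: assms)
  hence "A $$ (u, v) = vec_index (A *\<^sub>v unit_vec n v) u" using assms by simp
  also have "cmod \<dots> \<le> vec_l2_norm (A *\<^sub>v unit_vec n v)"
    using assms by (intro cmod_index_le) simp
  also have "\<dots> \<le> R * 1" using mat_op_norm_bound[OF assms(1,2) e] ne by simp
  finally show ?thesis by simp
qed

section \<open>The norm on the diagonal algebra and the block structure\<close>

context rect_space
begin

lemma norm_p: "j \<in> {1..d} \<Longrightarrow> norm (p j) = 1"
  using cstar_identity[of "p j"] p_star[of j] p_idem[of j] p_nonzero[of j]
  by (simp add: power2_eq_square)

lemma norm_diag_power:
  "norm (\<Sum>j=1..d. of_real (b j) *\<^sub>C p j) ^ (2 ^ m) = norm (\<Sum>j=1..d. of_real (b j ^ (2 ^ m)) *\<^sub>C p j)"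
proof (induction m)
  case (Suc m)
  let ?y = "\<Sum>j=1..d. of_real (b j ^ (2 ^ m)) *\<^sub>C p j"
  have st: "star (sum f S) = (\<Sum>x\<in>S. star (f x))" if "finite S" for f :: "nat \<Rightarrow> 'a" and S
    using that
  proof (induction rule: finite_induct)
    case empty
    show ?case using star_scaleC[of 0 0] by simp
  qed (simp add: star_add)
  have "star ?y = ?y" unfolding st[OF finite_atLeastAtMost] by (rule sum.cong) (auto simp: star_scaleC p_star)
  moreover have "?y * ?y = (\<Sum>j=1..d. of_real (b j ^ (2 ^ Suc m)) *\<^sub>C p j)"
    unfolding sum_distrib_right
  proof (rule sum.cong)
    fix j assume j: "j \<in> {1..d}"
    have "of_real (b j ^ 2 ^ m) *\<^sub>C p j * ?y = of_real (b j ^ 2 ^ m) *\<^sub>C (of_real (b j ^ 2 ^ m) *\<^sub>C p j)"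
      by (simp only: mult_scaleC_left p_mult_diag[OF j])
    moreover have "b j ^ 2 ^ Suc m = b j ^ 2 ^ m * b j ^ 2 ^ m" by (simp add: power_add[symmetric] mult_2)
    ultimately show "of_real (b j ^ 2 ^ m) *\<^sub>C p j * ?y = of_real (b j ^ 2 ^ Suc m) *\<^sub>C p j"
      by (simp only: scaleC_scaleC of_real_mult)
  qed simp
  ultimately have "(norm ?y)\<^sup>2 = norm (\<Sum>j=1..d. of_real (b j ^ (2 ^ Suc m)) *\<^sub>C p j)"
    using cstar_identity[of ?y] by (simp only:)
  moreover have "norm (\<Sum>j=1..d. of_real (b j) *\<^sub>C p j) ^ 2 ^ Suc m = (norm (\<Sum>j=1..d. of_real (b j) *\<^sub>C p j) ^ 2 ^ m)\<^sup>2"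
    by (simp add: power_mult[symmetric] mult.commute)
  ultimately show ?case using Suc by (simp only:)
qed simp

text \<open>Multiplying by \<open>p j\<close> reads off a coefficient and gives one direction. For
  the other, the C*-identity turns high powers of the norm of x* x into the norm of its powers,
  where the triangle inequality loses only a factor \<open>d\<close>; this factor is negligible as
  the exponent grows.\<close>

lemma norm_diag_le_iff:
  assumes "\<epsilon> > 0"
  shows "norm (\<Sum>j=1..d. c j *\<^sub>C p j) \<le> \<epsilon> \<longleftrightarrow> (\<forall>j\<in>{1..d}. cmod (c j) \<le> \<epsilon>)"
proof
  assume le: "norm (\<Sum>j=1..d. c j *\<^sub>C p j) \<le> \<epsilon>"
  show "\<forall>j\<in>{1..d}. cmod (c j) \<le> \<epsilon>"
  proof
    fix j assume j: "j \<in> {1..d}"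
    have "cmod (c j) = norm (p j * (\<Sum>j=1..d. c j *\<^sub>C p j))"
      unfolding p_mult_diag[OF j] norm_scaleC norm_p[OF j] by simp
    also have "\<dots> \<le> norm (p j) * norm (\<Sum>j=1..d. c j *\<^sub>C p j)" by (rule norm_mult_ineq)
    finally show "cmod (c j) \<le> \<epsilon>" using le norm_p[OF j] by simp
  qed
next
  assume c: "\<forall>j\<in>{1..d}. cmod (c j) \<le> \<epsilon>"
  define x where "x = (\<Sum>j=1..d. c j *\<^sub>C p j)"
  define y where "y = (\<Sum>j=1..d. complex_of_real ((cmod (c j))\<^sup>2) *\<^sub>C p j)"
  have st: "star (sum f S) = (\<Sum>x\<in>S. star (f x))" if "finite S" for f :: "nat \<Rightarrow> 'a" and S
    using that
  proof (induction rule: finite_induct)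
    case empty
    show ?case using star_scaleC[of 0 0] by simp
  qed (simp add: star_add)
  have "star x = (\<Sum>j=1..d. cnj (c j) *\<^sub>C p j)" unfolding x_def st[OF finite_atLeastAtMost] by (rule sum.cong) (auto simp: star_scaleC p_star)
  moreover have "(\<Sum>j=1..d. cnj (c j) *\<^sub>C p j) * x = y"
    unfolding sum_distrib_right y_def
  proof (rule sum.cong)
    fix j assume j: "j \<in> {1..d}"
    have "cnj (c j) *\<^sub>C p j * x = cnj (c j) *\<^sub>C (c j *\<^sub>C p j)"
      by (simp only: mult_scaleC_left p_mult_diag[OF j] x_def)
    moreover have "cnj (c j) * c j = complex_of_real ((cmod (c j))\<^sup>2)"
      unfolding complex_norm_square by (rule mult.commute)
    ultimately show "cnj (c j) *\<^sub>C p j * x = complex_of_real ((cmod (c j))\<^sup>2) *\<^sub>C p j"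
      by (simp only: scaleC_scaleC)
  qed simp
  ultimately have xy: "(norm x)\<^sup>2 = norm y" using cstar_identity[of x] by (simp only:)
  have "norm y \<le> \<epsilon>\<^sup>2"
  proof (rule ccontr)
    assume "\<not> norm y \<le> \<epsilon>\<^sup>2"
    moreover have "0 < \<epsilon>\<^sup>2" using assms by (intro zero_less_power)
    ultimately have gt: "norm y / \<epsilon>\<^sup>2 > 1" by (simp only: less_divide_eq_1_pos not_le)
    have le: "(norm y / \<epsilon>\<^sup>2) ^ (2 ^ m) \<le> real d" for m
    proof -
      have "norm y ^ (2 ^ m) \<le> (\<Sum>j=1..d. norm (complex_of_real (((cmod (c j))\<^sup>2) ^ (2 ^ m)) *\<^sub>C p j))"
        unfolding y_def norm_diag_power by (rule norm_sum)
      also have "\<dots> \<le> (\<Sum>j=1..d. (\<epsilon>\<^sup>2) ^ (2 ^ m))"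
      proof (rule sum_mono)
        fix j assume j: "j \<in> {1..d}"
        have "((cmod (c j))\<^sup>2) ^ (2 ^ m) \<le> (\<epsilon>\<^sup>2) ^ (2 ^ m)" using c j by (intro power_mono) auto
        thus "norm (complex_of_real (((cmod (c j))\<^sup>2) ^ (2 ^ m)) *\<^sub>C p j) \<le> (\<epsilon>\<^sup>2) ^ (2 ^ m)"
          unfolding norm_scaleC norm_p[OF j] norm_of_real by simp
      qed
      finally have "norm y ^ (2 ^ m) \<le> real d * (\<epsilon>\<^sup>2) ^ (2 ^ m)" by (simp only: sum_constant card_atLeastAtMost diff_Suc_1)
      moreover have pos: "0 < (\<epsilon>\<^sup>2) ^ (2 ^ m)" using assms by (intro zero_less_power)
      ultimately show ?thesis unfolding power_divide pos_divide_le_eq[OF pos] by (simp only: mult.commute)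
    qed
    obtain m where m: "real d < (norm y / \<epsilon>\<^sup>2) ^ m" using real_arch_pow[OF gt] by blast
    have "(norm y / \<epsilon>\<^sup>2) ^ m \<le> (norm y / \<epsilon>\<^sup>2) ^ (2 ^ m)"
      using gt less_exp[of m] by (intro power_increasing) auto
    thus False using m le[of m] by linarith
  qed
  hence "(norm x)\<^sup>2 \<le> \<epsilon>\<^sup>2" using xy by simp
  hence "norm x \<le> \<epsilon>" using assms by (intro power2_le_imp_le[of "norm x" \<epsilon>]) auto
  thus "norm (\<Sum>j=1..d. c j *\<^sub>C p j) \<le> \<epsilon>" by (simp only: x_def)
qed

lemma block_subset: assumes "j \<in> {1..d}" shows "block \<phi> p n j \<subseteq> {..<n}"
proof -
  have "real (\<Sum>j=1..<Suc j. block_size \<phi> p n j) \<le> (\<Sum>j=1..<Suc j. rho \<phi> p j * real n)"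
    unfolding of_nat_sum
  proof (rule sum_mono)
    fix i assume "i \<in> {1..<Suc j}"
    hence "rho \<phi> p i > 0" using assms by (intro rho_pos) auto
    hence "0 \<le> rho \<phi> p i * real n" by simp
    thus "real (block_size \<phi> p n i) \<le> rho \<phi> p i * real n"
      unfolding block_size_def by (rule of_nat_floor)
  qed
  also have "\<dots> \<le> (\<Sum>j=1..d. rho \<phi> p j * real n)"
  proof (rule sum_mono2)
    fix i assume "i \<in> {1..d} - {1..<Suc j}"
    hence "rho \<phi> p i > 0" by (intro rho_pos) auto
    thus "0 \<le> rho \<phi> p i * real n" by simp
  qed (use assms in auto)
  also have "\<dots> = real n" unfolding sum_distrib_right[symmetric] rho_sum by simp
  finally have "(\<Sum>j=1..<Suc j. block_size \<phi> p n j) \<le> n" unfolding of_nat_le_iff .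
  thus ?thesis by (auto simp: block_def)
qed

lemma card_block: assumes "j \<ge> 1" shows "card (block \<phi> p n j) = block_size \<phi> p n j"
  using assms by (simp add: block_def)

lemma block_disjoint:
  assumes "1 \<le> i" "i < j" shows "block \<phi> p n i \<inter> block \<phi> p n j = {}"
proof -
  have "(\<Sum>j=1..<Suc i. block_size \<phi> p n j) \<le> (\<Sum>j=1..<j. block_size \<phi> p n j)"
    using assms by (intro sum_mono2) auto
  thus ?thesis by (auto simp: block_def)
qed

lemma block_disjoint': "i \<ge> 1 \<Longrightarrow> j \<ge> 1 \<Longrightarrow> i \<noteq> j \<Longrightarrow> block \<phi> p n i \<inter> block \<phi> p n j = {}"
  using block_disjoint[of i j n] block_disjoint[of j i n] by (cases "i < j") auto

lemma block_projection_eq: "block_projection \<phi> p n j = bproj n (block \<phi> p n j)"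
  by (simp add: block_projection_def bproj_def)

lemma mat_cond_exp_eq:
  assumes "A \<in> carrier_mat n n"
  shows "mat_cond_exp \<phi> d p n A = (\<Sum>j=1..d. (btr (block \<phi> p n j) A / of_nat (block_size \<phi> p n j)) *\<^sub>C p j)"
  unfolding mat_cond_exp_def block_projection_eq
  by (rule sum.cong) (auto simp: btr_cut[OF assms block_subset])

lemma cond_exp_close_iff:
  assumes "A \<in> carrier_mat n n" "\<epsilon> > 0"
  shows "norm (mat_cond_exp \<phi> d p n A - cond_exp \<phi> d p x) \<le> \<epsilon> \<longleftrightarrow>
    (\<forall>j\<in>{1..d}. cmod (btr (block \<phi> p n j) A / of_nat (block_size \<phi> p n j) - \<phi> (p j * x) / of_real (rho \<phi> p j)) \<le> \<epsilon>)"
proof -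
  have "mat_cond_exp \<phi> d p n A - cond_exp \<phi> d p x = 
    (\<Sum>j=1..d. (btr (block \<phi> p n j) A / of_nat (block_size \<phi> p n j) - \<phi> (p j * x) / of_real (rho \<phi> p j)) *\<^sub>C p j)"
    unfolding mat_cond_exp_eq[OF assms(1)] cond_exp_eq sum_subtractf[symmetric]
  proof (rule sum.cong)
    fix j
    have "(x - y) *\<^sub>C p j = x *\<^sub>C p j - y *\<^sub>C p j" for x y
      using scaleC_add_left[of "x - y" y "p j"] by (simp add: algebra_simps)
    thus "(btr (block \<phi> p n j) A / of_nat (block_size \<phi> p n j)) *\<^sub>C p j - (\<phi> (p j * x) / of_real (rho \<phi> p j)) *\<^sub>C p j =
      (btr (block \<phi> p n j) A / of_nat (block_size \<phi> p n j) - \<phi> (p j * x) / of_real (rho \<phi> p j)) *\<^sub>C p j" by simp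
  qed simp
  thus ?thesis using norm_diag_le_iff[OF assms(2)] by simp
qed

lemma block_matrices_eq:
  "block_matrices \<phi> p n k l = rect_mats n (block \<phi> p n k) (block \<phi> p n l)"
proof -
  let ?I = "block \<phi> p n k" and ?J = "block \<phi> p n l"
  have ind: "(bproj n ?I * A * bproj n ?J) $$ (u, v) = (if u \<in> ?I \<and> v \<in> ?J then A $$ (u, v) else 0)"
    if "A \<in> carrier_mat n n" "u < n" "v < n" for A u v
  proof -
    have "bproj n ?I * A \<in> carrier_mat n n" using that by (auto intro: mult_carrier_mat[of _ n n])
    thus ?thesis using bproj_mult_index(2)[of "bproj n ?I * A" n u v] bproj_mult_index(1)[of A n u v] that by simp
  qed
  have car: "bproj n ?I * A * bproj n ?J \<in> carrier_mat n n" if "A \<in> carrier_mat n n" for A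
    using that by (auto intro!: mult_carrier_mat[of _ n n])
  have "A = bproj n ?I * A * bproj n ?J" if A: "A \<in> rect_mats n ?I ?J" for A
  proof (rule eq_matI)
    have Ac: "A \<in> carrier_mat n n" using A by (simp add: rect_mats_def)
    fix u v assume "u < dim_row (bproj n ?I * A * bproj n ?J)" "v < dim_col (bproj n ?I * A * bproj n ?J)"
    hence uv: "u < n" "v < n" using car[OF Ac] by auto
    show "A $$ (u, v) = (bproj n ?I * A * bproj n ?J) $$ (u, v)"
      unfolding ind[OF Ac uv] using A uv by (auto simp: rect_mats_def)
  qed (use A in \<open>auto simp: rect_mats_def bproj_def\<close>)
  moreover have "bproj n ?I * A * bproj n ?J \<in> rect_mats n ?I ?J" if "A \<in> carrier_mat n n" for A
    using ind[OF that] car[OF that] by (auto simp: rect_mats_def)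
  ultimately show ?thesis unfolding block_matrices_def block_projection_eq rect_mats_def by blast
qed

lemma block_lebesgue_eq:
  "block_lebesgue \<phi> p n k l = rect_lebesgue n (block \<phi> p n k) (block \<phi> p n l)"
proof -
  have "fill_block \<phi> p n k l = fill_mat n (block \<phi> p n k) (block \<phi> p n l)"
    by (simp add: fill_block_def fill_mat_def fun_eq_iff)
  thus ?thesis by (simp add: block_lebesgue_def rect_lebesgue_def)
qed

end

text \<open>Words in one matrix are described by their star pattern alone, so one finite set of
  patterns serves every index.\<close>

definition single_word :: "nat \<Rightarrow> bool list \<Rightarrow> (nat \<times> bool) list" where
  "single_word i bs = map (Pair i) bs"

lemma fst_single_word: "fst ` set (single_word i bs) \<subseteq> {i}"
  by (auto simp: single_word_def)

lemma length_single_word [simp]: "length (single_word i bs) = length bs"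
  by (simp add: single_word_def)

lemma single_wordI: "fst ` set w \<subseteq> {i} \<Longrightarrow> w = single_word i (map snd w)"
  by (induction w) (auto simp: single_word_def)

lemma word_single_word: "word a (single_word i bs) = word (\<lambda>_. a i) (single_word 1 bs)"
  by (simp add: word_def single_word_def comp_def)

lemma mat_word_single_word: "mat_word n A (single_word i bs) = mat_word n (\<lambda>_. A i) (single_word 1 bs)"
  by (simp add: mat_word_eq single_word_def comp_def lmat_def cong: if_cong)

lemma word_letter: "word a w = prod_list (map snd (map (letter a) w))"
  unfolding word_def by (rule arg_cong[of _ _ prod_list]) (simp add: letter_def case_prod_beta)

definition alt_word :: "bool \<Rightarrow> nat \<Rightarrow> bool list" where
  "alt_word s t = concat (replicate t [s, \<not> s])"

lemma length_alt_word [simp]: "length (alt_word s t) = 2 * t"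
  by (induction t) (auto simp: alt_word_def)

lemma map_lmat_alt_word:
  "map (lmat A) (single_word i (alt_word s t)) = alternating_list (lmat A (i, s)) t"
  by (induction t) (auto simp: alt_word_def alternating_list_def single_word_def lmat_def)

lemma mat_word_alt_word:
  "mat_word n A (single_word i (alt_word s t)) = mprod n (alternating_list (lmat A (i, s)) t)"
  by (simp add: mat_word_eq map_lmat_alt_word)

lemma mat_trace_eq_btr: "M \<in> carrier_mat n n \<Longrightarrow> mat_trace M = btr {..<n} M"
  by (simp add: mat_trace_def btr_def)

context mat_tuple
begin

lemma dword_other_index:
  "i \<notin> fst ` set w \<Longrightarrow> fst ` set w \<subseteq> {1..N} \<Longrightarrow> dword n A i E w = 0\<^sub>m n n"
proof (induction w)
  case (Cons x w)
  have "fst x \<in> {1..N}" using Cons.prems by auto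
  thus ?case using Cons lmat_carrier[of x] by (auto simp: right_mult_zero_mat[of _ n n])
qed simp

lemma btr_dword_single_word:
  assumes "i \<in> {1..N}" "i' \<in> {1..N}" "fst ` set w \<subseteq> {i'}" "S \<subseteq> {..<n}" "\<alpha> < n" "\<beta> < n" "\<alpha> \<in> S \<longleftrightarrow> \<beta> \<in> S"
  shows "btr S (dword n A i (munit n \<alpha> \<beta>) w) = 0"
proof (cases "i' = i")
  case True
  thus ?thesis using btr_dword_single_index[OF assms(1) _ assms(4-7)] assms(3) by simp
next
  case False
  have "fst ` set w \<subseteq> {1..N}" using assms(2,3) by auto
  moreover have "i \<notin> fst ` set w" using False assms(3) by auto
  ultimately have "dword n A i (munit n \<alpha> \<beta>) w = 0\<^sub>m n n" using dword_other_index by blast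
  moreover have "0\<^sub>m n n $$ (s, s) = (0 :: complex)" if "s \<in> S" for s using that assms(4) by auto
  ultimately show ?thesis by (simp add: btr_def)
qed

text \<open>An even number of pairs splits into a matrix times its adjoint.\<close>

lemma trace_alternating_eq:
  assumes "i \<in> {1..N}"
  shows "mat_trace (mprod n (alternating_list (lmat A (i, s)) (2 * t))) \<in> \<real>"
    and "Re (mat_trace (mprod n (alternating_list (lmat A (i, s)) (2 * t)))) \<ge> 0"
proof -
  define M where "M = mprod n (alternating_list (lmat A (i, s)) t)"
  have c: "set (alternating_list (lmat A (i, s)) t) \<subseteq> carrier_mat n n"
    using assms lmat_carrier[of "(i, s)"] by (intro alternating_list_carrier) auto
  have "mprod n (alternating_list (lmat A (i, s)) (2 * t)) = M * mat_adjoint M"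
    unfolding mult_2 alternating_list_add mprod_append[OF c c] M_def using mprod_star[OF c] by simp
  moreover have "M \<in> carrier_mat n n" unfolding M_def using c by (rule mprod_carrier)
  ultimately have *: "mat_trace (mprod n (alternating_list (lmat A (i, s)) (2 * t))) = of_real (\<Sum>i<n. \<Sum>j<n. (cmod (M $$ (i, j)))\<^sup>2)"
    using mat_trace_mult_adjoint by simp
  show "mat_trace (mprod n (alternating_list (lmat A (i, s)) (2 * t))) \<in> \<real>" unfolding * by simp
  show "Re (mat_trace (mprod n (alternating_list (lmat A (i, s)) (2 * t)))) \<ge> 0" unfolding * by (simp add: sum_nonneg)
qed

text \<open>The first letter has non-zero rows only in \<open>S\<close>, so nothing is lost outside
  the block. This connects the full traces of the chessboard estimate with the block traces that
  microstates control.\<close>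

lemma mat_trace_word_block:
  assumes x: "fst x \<in> {1..N}" and w: "fst ` set w \<subseteq> {1..N}"
    and zero: "\<And>u v. u < n \<Longrightarrow> v < n \<Longrightarrow> u \<notin> S \<Longrightarrow> lmat A x $$ (u, v) = 0" and S: "S \<subseteq> {..<n}"
  shows "mat_trace (mat_word n A (x # w)) = btr S (mat_word n A (x # w))"
proof -
  have c: "lmat A x \<in> carrier_mat n n" "mat_word n A w \<in> carrier_mat n n"
    using x w lmat_carrier word_carrier by auto
  have xw: "mat_word n A (x # w) \<in> carrier_mat n n" using x w by (intro word_carrier) auto
  have "mat_word n A (x # w) $$ (u, u) = 0" if "u < n" "u \<notin> S" for u
    unfolding word_Cons mat_mult_index[OF c that(1,1)] using zero[OF that(1) _ that(2)] by simp
  hence "(\<Sum>u<n. mat_word n A (x # w) $$ (u, u)) = (\<Sum>u\<in>S. mat_word n A (x # w) $$ (u, u))"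
    using S by (intro sum.mono_neutral_right) auto
  thus ?thesis using xw by (simp add: mat_trace_eq_btr[OF xw] btr_def)
qed

end

context rect_tuple
begin

lemma regular_word:
  assumes "N \<ge> 1" "fst ` set w \<subseteq> {1..N}" "u < n" "v < n"
  shows "regular (\<lambda>A. mat_word n A w $$ (u, v))"
proof -
  \<comment> \<open>Regularity is part of \<open>Der\<close>, and E = 0 meets the block condition
    trivially.\<close>
  have "Der 1 (0\<^sub>m n n) (\<lambda>A. mat_word n A w $$ (u, v)) (\<lambda>A. dword n A 1 (0\<^sub>m n n) w $$ (u, v))"
    by (rule Der_word) (use assms in auto)
  thus ?thesis by (simp add: Der_def)
qed

lemma regular_btr:
  assumes "N \<ge> 1" "fst ` set w \<subseteq> {1..N}" "S \<subseteq> {..<n}"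
  shows "regular (\<lambda>A. btr S (mat_word n A w))"
  unfolding btr_def by (intro regular_sum regular_word assms) (use assms in auto)

end

text \<open>Squaring makes the truncation continuously differentiable at 2. On [0, 1] the function
  lies between 1 and 4, and from 2 on it vanishes.\<close>

lemma quadratic_cutoff_deriv:
  "((\<lambda>u. (max 0 (2 - u))\<^sup>2) has_real_derivative (- 2 * max 0 (2 - x))) (at (x :: real))"
proof (cases x "2 :: real" rule: linorder_cases)
  case less
  have "((\<lambda>u. (2 - u)\<^sup>2) has_real_derivative (- 2 * max 0 (2 - x))) (at x)"
    using less by (auto intro!: derivative_eq_intros simp: max_def)
  thus ?thesis
    by (rule has_field_derivative_transform_within_open[of _ _ _ "{..<2}"]) (use less in \<open>auto simp: max_def\<close>)
next
  case greater
  have "((\<lambda>u. 0) has_real_derivative (- 2 * max 0 (2 - x))) (at x)"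
    using greater by (auto simp: max_def)
  thus ?thesis
    by (rule has_field_derivative_transform_within_open[of _ _ _ "{2<..}"]) (use greater in \<open>auto simp: max_def\<close>)
next
  case equal
  have "((\<lambda>h. (max 0 (2 - (2 + h)))\<^sup>2 / h) \<longlongrightarrow> 0) (at (0 :: real))"
  proof (rule Lim_null_comparison)
    show "\<forall>\<^sub>F h in at 0. norm ((max 0 (2 - (2 + h)))\<^sup>2 / h) \<le> \<bar>h\<bar>"
      by (intro always_eventually allI) (auto simp: max_def power2_eq_square)
    show "((\<lambda>h. \<bar>h\<bar>) \<longlongrightarrow> 0) (at (0 :: real))" by (intro tendsto_rabs_zero tendsto_ident_at)
  qed
  thus ?thesis using equal by (simp add: DERIV_def)
qed

section \<open>Microstates of the family and of its single members\<close>

locale microstate_family = rect_space \<phi> p d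
  for \<phi> :: "'a::cstar_algebra \<Rightarrow> complex" and p :: "nat \<Rightarrow> 'a" and d :: nat +
  fixes k l N :: nat and a :: "nat \<Rightarrow> 'a"
  assumes k: "k \<in> {1..d}" and l: "l \<in> {1..d}" and kl: "k \<noteq> l" and N: "N \<ge> 1"
begin

abbreviation "Bl n j \<equiv> block \<phi> p n j"
abbreviation "bs n j \<equiv> block_size \<phi> p n j"

definition target :: "nat \<Rightarrow> bool list \<Rightarrow> nat \<Rightarrow> complex" where
  "target i b j = \<phi> (p j * word (\<lambda>_. a i) (single_word 1 b)) / of_real (rho \<phi> p j)"

text \<open>Microstates of one element as a set of matrices, with the norm on the diagonal algebra
  unfolded into coefficients. Products of these sets supply the reference volume.\<close>

definition single_states :: "nat \<Rightarrow> nat \<Rightarrow> real \<Rightarrow> nat \<Rightarrow> real \<Rightarrow> complex Matrix.mat set" where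
  "single_states n i R r \<epsilon> = {X \<in> rect_mats n (Bl n k) (Bl n l). mat_op_norm X \<le> R \<and>
     (\<forall>b. 1 \<le> length b \<and> length b \<le> r \<longrightarrow> (\<forall>j\<in>{1..d}.
        cmod (btr (Bl n j) (mat_word n (\<lambda>_. X) (single_word 1 b)) / of_nat (bs n j) - target i b j) \<le> \<epsilon>))}"

lemma rt: "rect_tuple n (Bl n k) (Bl n l)"
  by unfold_locales (use block_subset k l in auto)

lemma tuple_lebesgue_eq: "tuple_lebesgue \<phi> p n k l m = rect_tuple.M n m (Bl n k) (Bl n l)"
  unfolding tuple_lebesgue_def block_lebesgue_eq rect_tuple.M_def[OF rt] ..

lemma single_word_carrier:
  "X \<in> rect_mats n (Bl n k) (Bl n l) \<Longrightarrow> mat_word n (\<lambda>_. X) (single_word 1 b) \<in> carrier_mat n n"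
proof -
  assume "X \<in> rect_mats n (Bl n k) (Bl n l)"
  then interpret mat_tuple n 1 "\<lambda>_. X" by unfold_locales (auto simp: rect_mats_def)
  show ?thesis using fst_single_word[of 1 b] by (intro word_carrier) auto
qed

lemma microstates_single:
  assumes "\<epsilon> > 0"
  shows "microstates \<phi> d p k l R 1 (\<lambda>_. a i) n r \<epsilon> = {1..1} \<rightarrow>\<^sub>E single_states n i R r \<epsilon>"
proof -
  have iff: "(\<forall>w. 1 \<le> length w \<and> length w \<le> r \<and> fst ` set w \<subseteq> {1..1} \<longrightarrow>
           norm (mat_cond_exp \<phi> d p n (mat_word n A w) - cond_exp \<phi> d p (word (\<lambda>_. a i) w)) \<le> \<epsilon>) \<longleftrightarrow>
    (\<forall>b. 1 \<le> length b \<and> length b \<le> r \<longrightarrow> (\<forall>j\<in>{1..d}.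
        cmod (btr (Bl n j) (mat_word n (\<lambda>_. A 1) (single_word 1 b)) / of_nat (bs n j) - target i b j) \<le> \<epsilon>))"
    if A: "A 1 \<in> rect_mats n (Bl n k) (Bl n l)" for A
  proof -
    have 1: "norm (mat_cond_exp \<phi> d p n (mat_word n A (single_word 1 b)) - cond_exp \<phi> d p (word (\<lambda>_. a i) (single_word 1 b))) \<le> \<epsilon> \<longleftrightarrow>
      (\<forall>j\<in>{1..d}. cmod (btr (Bl n j) (mat_word n (\<lambda>_. A 1) (single_word 1 b)) / of_nat (bs n j) - target i b j) \<le> \<epsilon>)" for b
      unfolding mat_word_single_word[of n A] target_def by (rule cond_exp_close_iff[OF single_word_carrier[OF A] assms])
    show ?thesis
    proof (intro iffI allI impI)
      fix w :: "(nat \<times> bool) list" assume "\<forall>b. 1 \<le> length b \<and> length b \<le> r \<longrightarrow> (\<forall>j\<in>{1..d}.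
        cmod (btr (Bl n j) (mat_word n (\<lambda>_. A 1) (single_word 1 b)) / of_nat (bs n j) - target i b j) \<le> \<epsilon>)"
        "1 \<le> length w \<and> length w \<le> r \<and> fst ` set w \<subseteq> {1..1}"
      thus "norm (mat_cond_exp \<phi> d p n (mat_word n A w) - cond_exp \<phi> d p (word (\<lambda>_. a i) w)) \<le> \<epsilon>"
        using 1[of "map snd w"] single_wordI[of w 1] by simp
    next
      fix b :: "bool list" assume "\<forall>w. 1 \<le> length w \<and> length w \<le> r \<and> fst ` set w \<subseteq> {1..1} \<longrightarrow>
           norm (mat_cond_exp \<phi> d p n (mat_word n A w) - cond_exp \<phi> d p (word (\<lambda>_. a i) w)) \<le> \<epsilon>"
        "1 \<le> length b \<and> length b \<le> r"
      thus "\<forall>j\<in>{1..d}. cmod (btr (Bl n j) (mat_word n (\<lambda>_. A 1) (single_word 1 b)) / of_nat (bs n j) - target i b j) \<le> \<epsilon>"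
        using 1[of b] fst_single_word[of 1 b] by simp
    qed
  qed
  show ?thesis
  proof (rule subset_antisym; rule subsetI)
    fix A assume A: "A \<in> microstates \<phi> d p k l R 1 (\<lambda>_. a i) n r \<epsilon>"
    hence A1: "A 1 \<in> rect_mats n (Bl n k) (Bl n l)" unfolding microstates_def block_matrices_eq by auto
    have "A 1 \<in> single_states n i R r \<epsilon>"
      using A A1 iff[of A] unfolding single_states_def microstates_def by auto
    thus "A \<in> {1..1} \<rightarrow>\<^sub>E single_states n i R r \<epsilon>" using A unfolding microstates_def by (auto simp: PiE_def)
  next
    fix A assume A: "A \<in> {1..1::nat} \<rightarrow>\<^sub>E single_states n i R r \<epsilon>"
    hence A1: "A 1 \<in> single_states n i R r \<epsilon>" using PiE_mem[OF A, of 1] by simp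
    hence "A 1 \<in> rect_mats n (Bl n k) (Bl n l)" unfolding single_states_def by auto
    thus "A \<in> microstates \<phi> d p k l R 1 (\<lambda>_. a i) n r \<epsilon>"
      using A A1 iff[of A] unfolding single_states_def microstates_def block_matrices_eq by (auto simp: PiE_def)
  qed
qed

lemma microstates_family:
  assumes "\<epsilon> > 0" and A: "A \<in> microstates \<phi> d p k l R N a n r \<epsilon>"
  shows "A \<in> {1..N} \<rightarrow>\<^sub>E rect_mats n (Bl n k) (Bl n l)"
    and "i \<in> {1..N} \<Longrightarrow> A i \<in> single_states n i R r \<epsilon>"
    and "1 \<le> length w \<Longrightarrow> length w \<le> r \<Longrightarrow> fst ` set w \<subseteq> {1..N} \<Longrightarrow> j \<in> {1..d} \<Longrightarrow>
      cmod (btr (Bl n j) (mat_word n A w) / of_nat (bs n j) - \<phi> (p j * word a w) / of_real (rho \<phi> p j)) \<le> \<epsilon>"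
proof -
  show sp: "A \<in> {1..N} \<rightarrow>\<^sub>E rect_mats n (Bl n k) (Bl n l)"
    using A unfolding microstates_def block_matrices_eq by blast
  interpret mat_tuple n N A using sp by unfold_locales (auto simp: rect_mats_def PiE_def Pi_def)
  show close: "cmod (btr (Bl n j) (mat_word n A w) / of_nat (bs n j) - \<phi> (p j * word a w) / of_real (rho \<phi> p j)) \<le> \<epsilon>"
    if w: "1 \<le> length w" "length w \<le> r" "fst ` set w \<subseteq> {1..N}" and j: "j \<in> {1..d}" for w j
  proof -
    have "norm (mat_cond_exp \<phi> d p n (mat_word n A w) - cond_exp \<phi> d p (word a w)) \<le> \<epsilon>"
      using A w unfolding microstates_def by blast
    thus ?thesis using cond_exp_close_iff[OF word_carrier[OF w(3)] assms(1)] j by blast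
  qed
  show "A i \<in> single_states n i R r \<epsilon>" if i: "i \<in> {1..N}"
  proof -
    have "A i \<in> rect_mats n (Bl n k) (Bl n l)" "mat_op_norm (A i) \<le> R"
      using sp A i unfolding microstates_def by auto
    moreover have "cmod (btr (Bl n j) (mat_word n (\<lambda>_. A i) (single_word 1 b)) / of_nat (bs n j) - target i b j) \<le> \<epsilon>"
      if "1 \<le> length b" "length b \<le> r" "j \<in> {1..d}" for b j
    proof -
      have "fst ` set (single_word i b) \<subseteq> {1..N}" using order_trans[OF fst_single_word] i by auto
      from close[OF _ _ this that(3)] that(1,2) show ?thesis
        unfolding mat_word_single_word[of n A i] word_single_word[of a i] target_def by simp
    qed
    ultimately show ?thesis unfolding single_states_def by blast
  qed
qed

text \<open>The norm bound enters through countably many trace inequalities, and the words of length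
  at most \<open>r\<close> are finite in number.\<close>

lemma single_states_sets:
  assumes R: "R > 0"
  shows "single_states n i R r \<epsilon> \<in> sets (rect_lebesgue n (Bl n k) (Bl n l))"
proof -
  interpret rt: rect_tuple n 1 "Bl n k" "Bl n l" by (rule rt)
  let ?Rm = "rect_lebesgue n (Bl n k) (Bl n l)"
  have meas: "(\<lambda>X. btr S (mat_word n (\<lambda>_. X) (single_word 1 b))) \<in> borel_measurable ?Rm" if "S \<subseteq> {..<n}" for S b
  proof -
    have "(\<lambda>A. btr S (mat_word n A (single_word 1 b))) \<in> borel_measurable rt.M"
    proof -
      have "rt.regular (\<lambda>A. btr S (mat_word n A (single_word 1 b)))"
        by (rule rt.regular_btr[OF _ _ that]) (use fst_single_word[of 1 b] in auto)
      thus ?thesis unfolding rt.regular_def by blast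
    qed
    moreover have "(\<lambda>X. \<lambda>i\<in>{1..1}. X) \<in> measurable ?Rm rt.M"
      unfolding rt.M_def by (intro measurable_restrict) auto
    ultimately have "(\<lambda>X. btr S (mat_word n (\<lambda>i\<in>{1..1}. X) (single_word 1 b))) \<in> borel_measurable ?Rm"
      using measurable_compose by fast
    moreover have "mat_word n (\<lambda>i\<in>{1..1::nat}. X) (single_word 1 b) = mat_word n (\<lambda>_. X) (single_word 1 b)" for X
      unfolding mat_word_single_word[of n "\<lambda>i\<in>{1..1}. X"] by simp
    ultimately show ?thesis by simp
  qed
  let ?B = "{b :: bool list. 1 \<le> length b \<and> length b \<le> r}"
  have "single_states n i R r \<epsilon> = {X \<in> space ?Rm. 
     (\<forall>q. Re (btr {..<n} (mat_word n (\<lambda>_. X) (single_word 1 (alt_word True (2 ^ Suc q))))) \<le> real n * R ^ (2 * 2 ^ Suc q)) \<and>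
     (\<forall>b\<in>?B. \<forall>j\<in>{1..d}. cmod (btr (Bl n j) (mat_word n (\<lambda>_. X) (single_word 1 b)) / of_nat (bs n j) - target i b j) \<le> \<epsilon>)}"
  proof -
    have "mat_op_norm X \<le> R \<longleftrightarrow> (\<forall>q. Re (btr {..<n} (mat_word n (\<lambda>_. X) (single_word 1 (alt_word True (2 ^ Suc q))))) \<le> real n * R ^ (2 * 2 ^ Suc q))"
      if X: "X \<in> rect_mats n (Bl n k) (Bl n l)" for X
    proof -
      have c: "X \<in> carrier_mat n n" using X by (simp add: rect_mats_def)
      have "mat_trace (mprod n (alternating_list (mat_adjoint X) t)) = btr {..<n} (mat_word n (\<lambda>_. X) (single_word 1 (alt_word True t)))" for t
        using mat_trace_eq_btr[OF single_word_carrier[OF X], of "alt_word True t"]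
        unfolding mat_word_alt_word by (simp add: lmat_def)
      thus ?thesis using mat_op_norm_le_iff_trace[OF c R] by simp
    qed
    thus ?thesis unfolding single_states_def rt.space_R by auto
  qed
  also have "\<dots> \<in> sets ?Rm"
  proof (intro sets.sets_Collect_conj)
    have "{X \<in> space ?Rm. Re (btr {..<n} (mat_word n (\<lambda>_. X) (single_word 1 (alt_word True (2 ^ Suc q))))) \<le> real n * R ^ (2 * 2 ^ Suc q)} \<in> sets ?Rm" for q
      by (intro borel_measurable_le borel_measurable_const measurable_compose[OF meas borel_measurable_Re]) simp
    thus "{X \<in> space ?Rm. \<forall>q. Re (btr {..<n} (mat_word n (\<lambda>_. X) (single_word 1 (alt_word True (2 ^ Suc q))))) \<le> real n * R ^ (2 * 2 ^ Suc q)} \<in> sets ?Rm"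
      by (rule sets.sets_Collect_countable_All)
    have "{b :: bool list. length b \<le> r} = {b. set b \<subseteq> UNIV \<and> length b \<le> r}" by auto
    hence finB: "finite {b :: bool list. length b \<le> r}" using finite_lists_length_le[of "UNIV :: bool set" r] by simp
    have "{X \<in> space ?Rm. cmod (btr (Bl n j) (mat_word n (\<lambda>_. X) (single_word 1 b)) / of_nat (bs n j) - target i b j) \<le> \<epsilon>} \<in> sets ?Rm"
      if "j \<in> {1..d}" for b j
    proof (rule borel_measurable_le)
      have "(\<lambda>X. btr (Bl n j) (mat_word n (\<lambda>_. X) (single_word 1 b))) \<in> borel_measurable ?Rm" by (rule meas[OF block_subset[OF that]])
      thus "(\<lambda>X. cmod (btr (Bl n j) (mat_word n (\<lambda>_. X) (single_word 1 b)) / of_nat (bs n j) - target i b j)) \<in> borel_measurable ?Rm"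
        by measurable
    qed simp
    thus "{X \<in> space ?Rm. \<forall>b\<in>?B. \<forall>j\<in>{1..d}. cmod (btr (Bl n j) (mat_word n (\<lambda>_. X) (single_word 1 b)) / of_nat (bs n j) - target i b j) \<le> \<epsilon>} \<in> sets ?Rm"
      using finite_subset[OF _ finB, of ?B] by (intro sets.sets_Collect_finite_All) auto
  qed
  finally show ?thesis .
qed

lemma single_states_mono:
  "R \<le> R' \<Longrightarrow> r' \<le> r \<Longrightarrow> \<epsilon> \<le> \<epsilon>' \<Longrightarrow> single_states n i R r \<epsilon> \<subseteq> single_states n i R' r' \<epsilon>'"
  unfolding single_states_def by (auto intro: order_trans)

lemma emeasure_single:
  assumes "\<epsilon> > 0" "R > 0"
  shows "emeasure (tuple_lebesgue \<phi> p n k l 1) (microstates \<phi> d p k l R 1 (\<lambda>_. a i) n r \<epsilon>) =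
    emeasure (rect_lebesgue n (Bl n k) (Bl n l)) (single_states n i R r \<epsilon>)"
proof -
  interpret rt: rect_tuple n 1 "Bl n k" "Bl n l" by (rule rt)
  show ?thesis unfolding microstates_single[OF assms(1)] tuple_lebesgue_eq rt.M_def
    by (subst rt.R.emeasure_PiM) (use single_states_sets[OF assms(2)] in auto)
qed

lemma emeasure_product:
  assumes "R > 0"
  shows "emeasure (tuple_lebesgue \<phi> p n k l N) (Pi\<^sub>E {1..N} (\<lambda>i. single_states n i R r \<epsilon>)) =
    (\<Prod>i=1..N. emeasure (rect_lebesgue n (Bl n k) (Bl n l)) (single_states n i R r \<epsilon>))"
    and "Pi\<^sub>E {1..N} (\<lambda>i. single_states n i R r \<epsilon>) \<in> sets (tuple_lebesgue \<phi> p n k l N)"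
proof -
  interpret rt: rect_tuple n N "Bl n k" "Bl n l" by (rule rt)
  show "emeasure (tuple_lebesgue \<phi> p n k l N) (Pi\<^sub>E {1..N} (\<lambda>i. single_states n i R r \<epsilon>)) =
    (\<Prod>i=1..N. emeasure (rect_lebesgue n (Bl n k) (Bl n l)) (single_states n i R r \<epsilon>))"
    unfolding tuple_lebesgue_eq rt.M_def
    by (subst rt.R.emeasure_PiM) (use single_states_sets[OF assms] in auto)
  show "Pi\<^sub>E {1..N} (\<lambda>i. single_states n i R r \<epsilon>) \<in> sets (tuple_lebesgue \<phi> p n k l N)"
    unfolding tuple_lebesgue_eq rt.M_def
    by (intro sets_PiM_I_finite) (use single_states_sets[OF assms] in auto)
qed

end

lemma liberation_terms_length:
  "(c, u', v') \<in> set (liberation_terms i u w) \<Longrightarrow> length u' \<le> length u + length w \<and> length v' \<le> length w"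
proof (induction w arbitrary: u)
  case (Cons x w)
  show ?case using Cons.prems Cons.IH[of "u @ [x]"] by (auto split: if_splits)
qed simp

lemma terms_weight_nonneg: "terms_weight T \<ge> 0"
  unfolding terms_weight_def by (intro sum_list_nonneg) auto

lemma terms_weight_star: "terms_weight (star_terms T) = terms_weight T"
  by (induction T) (auto simp: terms_weight_def star_terms_def)

lemma finite_bool_lists: "finite {b :: bool list. 1 \<le> length b \<and> length b \<le> r}"
  by (rule finite_subset[OF _ finite_lists_length_le[of UNIV r]]) auto

section \<open>The differentiable cut-off and concentration on joint microstates\<close>

context microstate_family
begin

lemma block_mem_iff:
  assumes "j \<in> {1..d}" "j' \<in> {1..d}" "u \<in> Bl n j" "v \<in> Bl n j"
  shows "u \<in> Bl n j' \<longleftrightarrow> v \<in> Bl n j'"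
  using assms block_disjoint'[of j j' n] by (cases "j = j'") auto

lemma btr_bound:
  assumes j: "j \<in> {1..d}" and c: "cmod (btr (Bl n j) M / of_nat (bs n j) - x) \<le> e"
  shows "cmod (btr (Bl n j) M) \<le> real n * (cmod x + e)"
proof (cases "bs n j = 0")
  case True
  \<comment> \<open>The quotient by block size 0 is 0 by convention and says nothing about the
    trace, but an empty block has trace 0.\<close>
  hence "Bl n j = {}" using card_block[of j n] j by (simp add: block_def)
  moreover have "e \<ge> 0" using c norm_ge_zero order_trans by blast
  ultimately show ?thesis by (simp add: btr_def)
next
  case False
  have e: "e \<ge> 0" using c norm_ge_zero order_trans by blast
  have "cmod (btr (Bl n j) M / of_nat (bs n j)) \<le> cmod x + e"
    using c norm_triangle_ineq2[of "btr (Bl n j) M / of_nat (bs n j)" x] by linarith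
  hence "cmod (btr (Bl n j) M) \<le> real (bs n j) * (cmod x + e)"
    using False by (simp add: norm_divide field_simps)
  also have "\<dots> \<le> real n * (cmod x + e)"
  proof (rule mult_right_mono)
    have "bs n j \<le> n" using card_mono[OF _ block_subset[OF j, of n]] card_block[of j n] j by simp
    thus "real (bs n j) \<le> real n" by simp
  qed (use e in simp)
  finally show ?thesis .
qed

text \<open>The cut-off truncates a polynomial in traces of words in one matrix each. It is at least
  1 on joint microstates and non-zero only on the product of separate ones with bounds relaxed to
  \<open>R + 1\<close> and \<open>e2\<close>. The measurable set \<open>G\<close> encloses the joint
  microstates on which the gradient is large.\<close>

lemma microstates_concentration:
  assumes i: "i \<in> {1..N}" and j0: "j0 \<in> {1..d}" and w: "fst ` set w \<subseteq> {1..N}" and n: "n \<ge> 1"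
    and R: "R > 0" and e2: "0 < e2" "e2 \<le> 1" and eps: "0 < \<epsilon>"
      "real (card ({1..N} \<times> {b :: bool list. 1 \<le> length b \<and> length b \<le> r} \<times> {1..d})) * \<epsilon>\<^sup>2 \<le> e2\<^sup>2 / 4"
    and Q0: "2 * length w + 3 \<le> 2 * 2 ^ Q0" "2 * 2 ^ Q0 \<le> r"
    and Mb: "Mb \<ge> 1" "\<And>i s j. i \<in> {1..N} \<Longrightarrow> j \<in> {1..d} \<Longrightarrow> cmod (target i (alt_word s (2 ^ Q0)) j) + 1 \<le> Mb"
    and \<kappa>: "terms_weight (liberation_terms i [] w) * Mb\<^sup>2 \<le> \<kappa>" and \<delta>: "\<delta> \<ge> 0"
  obtains G where "G \<in> sets (tuple_lebesgue \<phi> p n k l N)" "emeasure (tuple_lebesgue \<phi> p n k l N) G < \<infinity>"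
    "{A \<in> microstates \<phi> d p k l R N a n r \<epsilon>. \<delta> \<le> cmod (tpoly n (Bl n j0) (liberation_terms i [] w) A)} \<subseteq> G"
    "emeasure (tuple_lebesgue \<phi> p n k l N) (Pi\<^sub>E {1..N} (\<lambda>i. single_states n i (R + 1) r e2)) < \<infinity>"
    "\<And>s. measure (tuple_lebesgue \<phi> p n k l N) G * \<delta> ^ (2 * s) \<le>
       (2 * real s * (\<kappa> * (real n)\<^sup>2)) ^ s *
       (4 * measure (tuple_lebesgue \<phi> p n k l N) (Pi\<^sub>E {1..N} (\<lambda>i. single_states n i (R + 1) r e2)))"
proof -
  let ?I = "Bl n k" and ?J = "Bl n l" and ?S = "Bl n j0"
  interpret rt: rect_tuple n N ?I ?J by (rule rt)
  have Meq: "tuple_lebesgue \<phi> p n k l N = rt.M" by (rule tuple_lebesgue_eq)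
  let ?T = "liberation_terms i [] w"
  define idx where "idx = {1..N} \<times> {b :: bool list. 1 \<le> length b \<and> length b \<le> r} \<times> {1..d}"
  have fin: "finite idx"
    unfolding idx_def using finite_bool_lists[of r] by (intro finite_cartesian_product) auto
  \<comment> \<open>The exponent depends on \<open>n\<close>: this power of 1 + 1/R absorbs the
    factor 4 N n that separates the trace from the norm.\<close>
  obtain q where q: "4 * real N * real n \<le> ((R + 1) / R) ^ (2 * 2 ^ Suc q)"
  proof -
    have gt: "(R + 1) / R > 1" using R by simp
    obtain m where m: "4 * real N * real n < ((R + 1) / R) ^ m" using real_arch_pow[OF gt] by blast
    have "m \<le> 2 * 2 ^ Suc m" using less_exp[of m] unfolding power_Suc by linarith
    hence "((R + 1) / R) ^ m \<le> ((R + 1) / R) ^ (2 * 2 ^ Suc m)" by (rule power_increasing[OF _ less_imp_le[OF gt]])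
    thus ?thesis by (intro that[of m] less_imp_le[OF less_le_trans[OF m]])
  qed
  define t :: nat where "t = 2 ^ Suc q"
  \<comment> \<open>The weights make each half of \<open>Q\<close> at most 1/2 on joint microstates,
    while Q < 2 still forces |\<tau>| \<le> \<open>e2\<close> and norms at most
    \<open>R + 1\<close>.\<close>
  define C0 where "C0 = 2 / e2\<^sup>2"
  define C1 where "C1 = 1 / (2 * real N * real n * R ^ (2 * t))"
  have C0: "C0 > 0" using e2 by (simp add: C0_def)
  have C1: "C1 > 0" unfolding C1_def
    by (intro divide_pos_pos mult_pos_pos zero_less_power) (use n N R in auto)
  define \<tau> where "\<tau> = (\<lambda>(i, b, j) A. btr (Bl n j) (mat_word n A (single_word i b)) / of_nat (bs n j) - target i b j)"
  \<comment> \<open>The conjugate of \<tau>, written with the adjoint word so that \<tau> \<tau>' is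
    a polynomial in traces of words and \<open>Der\<close> applies to it.\<close>
  define \<tau>' where "\<tau>' = (\<lambda>(i, b, j) A. btr (Bl n j) (mat_word n A (star_word (single_word i b))) / of_nat (bs n j) - cnj (target i b j))"
  define OT where "OT = (\<lambda>i A. btr {..<n} (mat_word n A (single_word i (alt_word True t))))"
  define Q where "Q = (\<lambda>A. of_real C0 * (\<Sum>x\<in>idx. \<tau> x A * \<tau>' x A) + of_real C1 * (\<Sum>i\<in>{1..N}. OT i A))"
  define \<psi> where "\<psi> = (\<lambda>A. (max 0 (2 - Re (Q A)))\<^sup>2)"
  have mt: "mat_tuple n N A" if "A \<in> space rt.M" for A
    by (rule mat_tuple.intro) (rule rt.space_M_D(1)[OF that])
  have sw: "fst ` set (single_word i' b) \<subseteq> {1..N}" if "i' \<in> {1..N}" for i' b using order_trans[OF fst_single_word, of i' "{1..N}"] that by simp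
  have \<tau>'_eq: "\<tau>' x A = cnj (\<tau> x A)" if A: "A \<in> space rt.M" and x: "x \<in> idx" for A x
  proof -
    interpret mat_tuple n N A by (rule mt[OF A])
    obtain i' b j where x': "x = (i', b, j)" by (cases x)
    have ij: "i' \<in> {1..N}" "j \<in> {1..d}" using x x' by (auto simp: idx_def)
    show ?thesis unfolding \<tau>_def \<tau>'_def x'
      by (simp add: word_star[OF sw[OF ij(1)]] btr_adjoint[OF word_carrier[OF sw[OF ij(1)]] block_subset[OF ij(2)]])
  qed
  have OT_tr: "OT i' A = mat_trace (mprod n (alternating_list (mat_adjoint (A i')) t))"
    and OT_real: "OT i' A = of_real (Re (OT i' A))" and OT_nonneg: "Re (OT i' A) \<ge> 0"
    if A: "A \<in> space rt.M" and i': "i' \<in> {1..N}" for A i'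
  proof -
    interpret mat_tuple n N A by (rule mt[OF A])
    have "OT i' A = mat_trace (mat_word n A (single_word i' (alt_word True t)))"
      unfolding OT_def by (rule mat_trace_eq_btr[symmetric, OF word_carrier[OF sw[OF i']]])
    also have "\<dots> = mat_trace (mprod n (alternating_list (lmat A (i', True)) (2 * 2 ^ q)))"
      by (simp only: mat_word_alt_word t_def power_Suc)
    finally have e: "OT i' A = mat_trace (mprod n (alternating_list (lmat A (i', True)) (2 * 2 ^ q)))" .
    have "lmat A (i', True) = mat_adjoint (A i')" by (simp add: lmat_def)
    thus "OT i' A = mat_trace (mprod n (alternating_list (mat_adjoint (A i')) t))" unfolding e by (simp add: t_def)
    show "OT i' A = of_real (Re (OT i' A))" using trace_alternating_eq(1)[OF i', of True "2 ^ q"] unfolding e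
      by (simp only: of_real_Re)
    show "Re (OT i' A) \<ge> 0" using trace_alternating_eq(2)[OF i', of True "2 ^ q"] unfolding e .
  qed
  have Q_eq: "Q A = of_real (C0 * (\<Sum>x\<in>idx. (cmod (\<tau> x A))\<^sup>2) + C1 * (\<Sum>i\<in>{1..N}. Re (OT i A)))" if A: "A \<in> space rt.M" for A
  proof -
    have "(\<Sum>x\<in>idx. \<tau> x A * \<tau>' x A) = of_real (\<Sum>x\<in>idx. (cmod (\<tau> x A))\<^sup>2)"
      unfolding of_real_sum by (rule sum.cong) (simp_all only: \<tau>'_eq[OF A] complex_norm_square)
    moreover have "(\<Sum>i\<in>{1..N}. OT i A) = of_real (\<Sum>i\<in>{1..N}. Re (OT i A))"
      unfolding of_real_sum by (rule sum.cong) (simp_all only: OT_real[OF A, symmetric])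
    ultimately show ?thesis unfolding Q_def by simp
  qed
  have ReQ: "Re (Q A) = C0 * (\<Sum>x\<in>idx. (cmod (\<tau> x A))\<^sup>2) + C1 * (\<Sum>i\<in>{1..N}. Re (OT i A))" "Im (Q A) = 0"
    if "A \<in> space rt.M" for A unfolding Q_eq[OF that] by simp_all
  have S0: "(\<Sum>x\<in>idx. (cmod (\<tau> x A))\<^sup>2) \<ge> 0" for A by (simp add: sum_nonneg)
  have S1: "(\<Sum>i\<in>{1..N}. Re (OT i A)) \<ge> 0" if "A \<in> space rt.M" for A by (intro sum_nonneg OT_nonneg[OF that])
  have ReQ_nonneg: "Re (Q A) \<ge> 0" if "A \<in> space rt.M" for A
    unfolding ReQ(1)[OF that] using C0 C1 S0 S1[OF that] by (intro add_nonneg_nonneg mult_nonneg_nonneg) auto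
  have supp: "A i' \<in> single_states n i' (R + 1) r e2" if A: "A \<in> space rt.M" and nz: "\<psi> A \<noteq> 0" and i': "i' \<in> {1..N}" for A i'
  proof -
    have lt: "Re (Q A) < 2" using nz unfolding \<psi>_def by (rule contrapos_np) simp
    have Ac: "A i' \<in> carrier_mat n n" "A i' \<in> rect_mats n ?I ?J"
      using rt.space_M_D(1,2)[OF A i'] unfolding rt.space_R by blast+
    have "C1 * Re (OT i' A) \<le> C1 * (\<Sum>i\<in>{1..N}. Re (OT i A))"
      by (intro mult_left_mono member_le_sum i' less_imp_le[OF C1] OT_nonneg[OF A]) auto
    also have "\<dots> \<le> Re (Q A)" unfolding ReQ(1)[OF A]
      using mult_nonneg_nonneg[OF less_imp_le[OF C0] S0[of A]] by linarith
    finally have "C1 * Re (OT i' A) \<le> 2" using lt by simp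
    hence "Re (OT i' A) \<le> 2 / C1" by (simp only: pos_le_divide_eq[OF C1] mult.commute)
    also have "2 / C1 = 4 * real N * real n * R ^ (2 * t)" by (simp add: C1_def)
    also have "\<dots> \<le> ((R + 1) / R) ^ (2 * t) * R ^ (2 * t)"
      using q R unfolding t_def by (intro mult_right_mono zero_le_power) (simp_all only: less_imp_le)
    also have "\<dots> = (R + 1) ^ (2 * t)"
    proof -
      have "R ^ (2 * t) \<noteq> 0" using R by simp
      thus ?thesis unfolding power_divide by (rule nonzero_eq_divide_eq[THEN iffD1]) (rule refl)
    qed
    finally have op: "mat_op_norm (A i') \<le> R + 1"
      using OT_tr[OF A i'] R unfolding t_def by (intro mat_op_norm_le_if_trace[OF Ac(1), of "R + 1" q]) simp_all
    have "cmod (\<tau> x A) \<le> e2" if x: "x \<in> idx" for x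
    proof -
      have "C0 * (cmod (\<tau> x A))\<^sup>2 \<le> C0 * (\<Sum>x\<in>idx. (cmod (\<tau> x A))\<^sup>2)"
        by (intro mult_left_mono member_le_sum x fin less_imp_le[OF C0]) auto
      also have "\<dots> \<le> Re (Q A)" unfolding ReQ(1)[OF A]
        using mult_nonneg_nonneg[OF less_imp_le[OF C1] S1[OF A]] by linarith
      finally have "C0 * (cmod (\<tau> x A))\<^sup>2 \<le> 2" using lt by simp
      hence "(cmod (\<tau> x A))\<^sup>2 \<le> 2 / C0" by (simp only: pos_le_divide_eq[OF C0] mult.commute)
      also have "2 / C0 = e2\<^sup>2" by (simp add: C0_def)
      finally have "(cmod (\<tau> x A))\<^sup>2 \<le> e2\<^sup>2" .
      thus ?thesis by (rule power2_le_imp_le) (use e2 in simp)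
    qed
    hence "cmod (\<tau> (i', b, j) A) \<le> e2" if "1 \<le> length b" "length b \<le> r" "j \<in> {1..d}" for b j
      using that i' by (auto simp: idx_def)
    hence "cmod (btr (Bl n j) (mat_word n (\<lambda>_. A i') (single_word 1 b)) / of_nat (bs n j) - target i' b j) \<le> e2"
      if "1 \<le> length b" "length b \<le> r" "j \<in> {1..d}" for b j
      using that unfolding \<tau>_def prod.case mat_word_single_word[of n A i'] by blast
    thus ?thesis using Ac(2) op unfolding single_states_def by blast
  qed
  have \<psi>_ge: "\<psi> A \<ge> 1" if A: "A \<in> microstates \<phi> d p k l R N a n r \<epsilon>" for A
  proof -
    have Asp: "A \<in> space rt.M" using microstates_family(1)[OF eps(1) A] unfolding rt.space_M .
    have single: "A i' \<in> single_states n i' R r \<epsilon>" if "i' \<in> {1..N}" for i' using microstates_family(2)[OF eps(1) A that] .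
    have "(\<Sum>x\<in>idx. (cmod (\<tau> x A))\<^sup>2) \<le> (\<Sum>x\<in>idx. \<epsilon>\<^sup>2)"
    proof (rule sum_mono)
      fix x assume x: "x \<in> idx"
      obtain i' b j where x': "x = (i', b, j)" by (cases x)
      have ijb: "i' \<in> {1..N}" "1 \<le> length b" "length b \<le> r" "j \<in> {1..d}" using x by (auto simp: x' idx_def)
      have "cmod (\<tau> x A) \<le> \<epsilon>"
        using single[OF ijb(1)] ijb unfolding x' \<tau>_def prod.case mat_word_single_word[of n A i'] single_states_def by blast
      thus "(cmod (\<tau> x A))\<^sup>2 \<le> \<epsilon>\<^sup>2" by (intro power_mono) auto
    qed
    hence "(\<Sum>x\<in>idx. (cmod (\<tau> x A))\<^sup>2) \<le> e2\<^sup>2 / 4" using eps(2) unfolding idx_def[symmetric] by simp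
    hence "C0 * (\<Sum>x\<in>idx. (cmod (\<tau> x A))\<^sup>2) \<le> C0 * (e2\<^sup>2 / 4)" using C0 by (intro mult_left_mono) auto
    also have "\<dots> = 1 / 2" using e2 by (simp add: C0_def)
    finally have 1: "C0 * (\<Sum>x\<in>idx. (cmod (\<tau> x A))\<^sup>2) \<le> 1 / 2" .
    have "(\<Sum>i\<in>{1..N}. Re (OT i A)) \<le> (\<Sum>i\<in>{1..N}. real n * R ^ (2 * t))"
    proof (rule sum_mono)
      fix i' assume i': "i' \<in> {1..N}"
      have "mat_op_norm (A i') \<le> R" using single[OF i'] by (simp add: single_states_def)
      thus "Re (OT i' A) \<le> real n * R ^ (2 * t)"
        using trace_alternating_le[OF rt.space_M_D(1)[OF Asp i'] _ R, of t] OT_tr[OF Asp i'] by simp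
    qed
    hence "C1 * (\<Sum>i\<in>{1..N}. Re (OT i A)) \<le> C1 * (real N * (real n * R ^ (2 * t)))" using C1 by (intro mult_left_mono) auto
    also have "\<dots> = 1 / 2" using n N R by (simp add: C1_def)
    finally have "Re (Q A) \<le> 1" unfolding ReQ(1)[OF Asp] using 1 by linarith
    hence "1 \<le> max 0 (2 - Re (Q A))" by simp
    from power_mono[OF this, of 2] show ?thesis by (simp add: \<psi>_def)
  qed
  have box: "A \<in> rt.Box (R + 1)" if A: "A \<in> space rt.M" and nz: "\<psi> A \<noteq> 0" for A
  proof -
    have "cmod (A i' $$ (u, v)) \<le> R + 1" if i': "i' \<in> {1..N}" and uv: "u < n" "v < n" for i' u v
      using supp[OF A nz i'] rt.space_M_D(1)[OF A i'] uv unfolding single_states_def by (intro entry_le_op_norm) auto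
    thus ?thesis using A by (auto simp: rt.Box_def)
  qed
  have Sb: "(u \<in> ?I \<longleftrightarrow> v \<in> ?I) \<and> (u \<in> ?J \<longleftrightarrow> v \<in> ?J)" if "u \<in> ?S" "v \<in> ?S" for u v
    using block_mem_iff[OF j0 k that] block_mem_iff[OF j0 l that] by blast
  have mg: "(u \<in> ?I \<longleftrightarrow> v \<in> ?I) \<and> (u \<in> ?J \<longleftrightarrow> v \<in> ?J)" 
    if "\<alpha> \<in> ?S" "\<beta> \<in> ?S" "u < n" "v < n" "munit n \<alpha> \<beta> $$ (u, v) \<noteq> 0" for \<alpha> \<beta> u v
    using that Sb[of \<alpha> \<beta>] by (auto simp: munit_def split: if_splits)
  \<comment> \<open>\<open>Q\<close> consists of block traces and full traces of words in one
    matrix. They are invariant, since \<alpha> and \<beta> lie in one block and hence both inside or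
    both outside any other.\<close>
  have Q_Der: "rt.Der i (munit n \<alpha> \<beta>) Q (\<lambda>_. 0)" if ab: "\<alpha> \<in> ?S" "\<beta> \<in> ?S" for \<alpha> \<beta>
  proof -
    have E_block: "(u \<in> ?I \<longleftrightarrow> v \<in> ?I) \<and> (u \<in> ?J \<longleftrightarrow> v \<in> ?J)"
      if "u < n" "v < n" "munit n \<alpha> \<beta> $$ (u, v) \<noteq> 0" for u v by (rule mg[OF ab that])
    note rules = i munit_carrier[of n \<alpha> \<beta>] E_block
    have lt: "\<alpha> < n" "\<beta> < n" using ab block_subset[OF j0, of n] by auto
    have D0: "rt.Der i (munit n \<alpha> \<beta>) (\<lambda>A. btr S (mat_word n A v)) (\<lambda>_. 0)"
      if "i' \<in> {1..N}" "fst ` set v \<subseteq> {i'}" "S \<subseteq> {..<n}" "\<alpha> \<in> S \<longleftrightarrow> \<beta> \<in> S" for S v i'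
    proof -
      have "fst ` set v \<subseteq> {1..N}" using that(1,2) by auto
      hence d: "rt.Der i (munit n \<alpha> \<beta>) (\<lambda>A. btr S (mat_word n A v)) (\<lambda>A. btr S (dword n A i (munit n \<alpha> \<beta>) v))"
        by (intro rt.Der_btr[OF rules] that(3))
      show ?thesis
      proof (rule rt.Der_cong[OF i munit_carrier _ d])
        fix A assume "A \<in> space rt.M"
        then interpret mat_tuple n N A by (rule mt)
        show "btr S (dword n A i (munit n \<alpha> \<beta>) v) = 0"
          by (rule btr_dword_single_word[OF i that(1,2,3) lt that(4)])
      qed (use E_block in auto)
    qed
    have D1: "rt.Der i (munit n \<alpha> \<beta>) (\<lambda>A. btr S (mat_word n A v) / c - c') (\<lambda>_. 0)"
      if "i' \<in> {1..N}" "fst ` set v \<subseteq> {i'}" "S \<subseteq> {..<n}" "\<alpha> \<in> S \<longleftrightarrow> \<beta> \<in> S" for S v i' c c'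
    proof -
      have "rt.Der i (munit n \<alpha> \<beta>) (\<lambda>A. (1 / c) * btr S (mat_word n A v) + (- c')) (\<lambda>_. (1 / c) * 0 + 0)"
        by (intro rt.Der_add[OF rules] rt.Der_cmult[OF rules] rt.Der_const[OF rules] D0[OF that])
      thus ?thesis by simp
    qed
    have "rt.Der i (munit n \<alpha> \<beta>) (\<lambda>A. \<tau> x A * \<tau>' x A) (\<lambda>_. 0)" if x: "x \<in> idx" for x
    proof -
      obtain i' b j where x': "x = (i', b, j)" by (cases x)
      have ij: "i' \<in> {1..N}" "j \<in> {1..d}" using x x' by (auto simp: idx_def)
      have "rt.Der i (munit n \<alpha> \<beta>) (\<tau> x) (\<lambda>_. 0)" unfolding \<tau>_def x' prod.case
        by (rule D1[OF ij(1) fst_single_word block_subset[OF ij(2)] block_mem_iff[OF j0 ij(2) ab]])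
      moreover have "rt.Der i (munit n \<alpha> \<beta>) (\<tau>' x) (\<lambda>_. 0)" unfolding \<tau>'_def x' prod.case
        by (rule D1[OF ij(1) _ block_subset[OF ij(2)] block_mem_iff[OF j0 ij(2) ab]]) (use fst_single_word[of i' b] in simp)
      ultimately have "rt.Der i (munit n \<alpha> \<beta>) (\<lambda>A. \<tau> x A * \<tau>' x A) (\<lambda>A. \<tau> x A * 0 + 0 * \<tau>' x A)"
        by (intro rt.Der_mult[OF rules])
      thus ?thesis by simp
    qed
    moreover have "rt.Der i (munit n \<alpha> \<beta>) (OT i') (\<lambda>_. 0)" if "i' \<in> {1..N}" for i'
      unfolding OT_def by (rule D0[OF that fst_single_word]) (use lt in auto)
    ultimately have "rt.Der i (munit n \<alpha> \<beta>) Q (\<lambda>_. of_real C0 * (\<Sum>x\<in>idx. 0) + of_real C1 * (\<Sum>i\<in>{1..N}. 0))"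
      unfolding Q_def by (intro rt.Der_add[OF rules] rt.Der_cmult[OF rules] rt.Der_sum[OF rules]) auto
    thus ?thesis by simp
  qed
  have Q_reg: "rt.regular Q"
  proof -
    have btr_reg: "rt.regular (\<lambda>A. btr S (mat_word n A v) / c - c')" if "fst ` set v \<subseteq> {1..N}" "S \<subseteq> {..<n}" for S v c c'
    proof -
      have "rt.regular (\<lambda>A. (1 / c) * btr S (mat_word n A v) + (- c'))"
        by (intro rt.regular_add rt.regular_mult rt.regular_const rt.regular_btr N that)
      thus ?thesis by simp
    qed
    have "rt.regular (\<tau> x) \<and> rt.regular (\<tau>' x)" if x: "x \<in> idx" for x
    proof -
      obtain i' b j where x': "x = (i', b, j)" by (cases x)
      have ij: "i' \<in> {1..N}" "j \<in> {1..d}" using x x' by (auto simp: idx_def)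
      show ?thesis unfolding \<tau>_def \<tau>'_def x' prod.case
        by (intro conjI btr_reg block_subset[OF ij(2)]) (use sw[OF ij(1)] in auto)
    qed
    moreover have "rt.regular (OT i')" if "i' \<in> {1..N}" for i'
      unfolding OT_def by (rule rt.regular_btr[OF N sw[OF that]]) simp
    ultimately show ?thesis unfolding Q_def by (intro rt.regular_add rt.regular_mult rt.regular_const rt.regular_sum) auto
  qed
  have cont: "continuous_on UNIV (\<lambda>u :: real. (max 0 (2 - u))\<^sup>2)" "continuous_on UNIV (\<lambda>u :: real. - 2 * max 0 (2 - u))"
    by (intro continuous_intros)+
  have \<psi>_reg: "rt.regular (\<lambda>A. of_real (\<psi> A))" unfolding \<psi>_def by (rule rt.regular_real[OF Q_reg cont(1)])
  have \<psi>_Der: "rt.Der i (munit n \<alpha> \<beta>) (\<lambda>A. of_real (\<psi> A)) (\<lambda>_. 0)" if ab: "\<alpha> \<in> ?S" "\<beta> \<in> ?S" for \<alpha> \<beta>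
    unfolding \<psi>_def
    by (rule rt.Der_real[OF i munit_carrier mg[OF ab] Q_Der[OF ab] ReQ(2) quadratic_cutoff_deriv cont(2)])
  \<comment> \<open>A bound for all traces that occur, built from moments of the \<open>a i\<close>;
    neither \<open>R\<close> nor the exponent \<open>q\<close> enters.\<close>
  define b where "b = real n * Mb"
  have bnn: "real n \<le> b" "b \<ge> 0" using Mb(1) n by (auto simp: b_def)
  have traces: "cmod (mat_trace (mprod n L)) \<le> b" 
    if A: "A \<in> space rt.M" and nz: "\<psi> A \<noteq> 0" and L: "set L \<subseteq> lmat A ` ({1..N} \<times> UNIV) \<union> {bproj n ?S}" "length L \<le> 2 * 2 ^ Q0" for A L
  proof -
    interpret mat_tuple n N A by (rule mt[OF A])
    show ?thesis
    proof (rule trace_list_bound[OF block_subset[OF j0] bnn(1) _ L])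
      fix x :: "nat \<times> bool" assume x: "fst x \<in> {1..N}"
      obtain i' s where x': "x = (i', s)" by (cases x)
      \<comment> \<open>The rows of \<open>A i'\<close> lie in block \<open>k\<close> and those of
        its adjoint in block \<open>l\<close>; in that block the full trace becomes a
        moment.\<close>
      define j where "j = (if s then l else k)"
      have j: "j \<in> {1..d}" using k l by (simp add: j_def)
      have i': "i' \<in> {1..N}" using x x' by simp
      obtain b' where b': "alt_word s (2 ^ Q0) = s # b'"
        by (cases "2 ^ Q0 :: nat") (auto simp: alt_word_def)
      have zero: "lmat A x $$ (u, v) = 0" if "u < n" "v < n" "u \<notin> Bl n j" for u v
        using rt.space_M_D(1)[OF A i'] rt.space_M_D(3)[OF A i', of u v] rt.space_M_D(3)[OF A i', of v u] that
        by (auto simp: lmat_def x' j_def split: if_splits)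
      have W: "mprod n (alternating_list (lmat A x) (2 ^ Q0)) = mat_word n A (x # single_word i' b')"
        unfolding x' mat_word_alt_word[symmetric] b' by (simp add: single_word_def)
      have "mat_trace (mat_word n A (x # single_word i' b')) = btr (Bl n j) (mat_word n A (x # single_word i' b'))"
        by (rule mat_trace_word_block[OF x sw[OF i'] zero block_subset[OF j]])
      moreover have "x # single_word i' b' = single_word i' (alt_word s (2 ^ Q0))" by (simp add: b' single_word_def x')
      ultimately have tr: "mat_trace (mprod n (alternating_list (lmat A x) (2 ^ Q0))) = btr (Bl n j) (mat_word n (\<lambda>_. A i') (single_word 1 (alt_word s (2 ^ Q0))))"
        unfolding W by (simp add: mat_word_single_word[of n A i'])
      have "cmod (btr (Bl n j) (mat_word n (\<lambda>_. A i') (single_word 1 (alt_word s (2 ^ Q0)))) / of_nat (bs n j) - target i' (alt_word s (2 ^ Q0)) j) \<le> e2"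
        using supp[OF A nz i'] j Q0(2) unfolding single_states_def by auto
      from btr_bound[OF j this] have "cmod (mat_trace (mprod n (alternating_list (lmat A x) (2 ^ Q0)))) \<le> real n * (cmod (target i' (alt_word s (2 ^ Q0)) j) + e2)"
        unfolding tr .
      also have "\<dots> \<le> b" unfolding b_def using Mb(2)[OF i' j, of s] e2 by (intro mult_left_mono) auto
      finally show "Re (mat_trace (mprod n (alternating_list (lmat A x) (2 ^ Q0)))) \<le> b"
        using complex_Re_le_cmod order_trans by blast
    qed
  qed
  \<comment> \<open>Two traces of order \<open>n\<close> in every term of the derivative give the
    n^2.\<close>
  define K where "K = \<kappa> * (real n)\<^sup>2"
  have K0: "K \<ge> 0" using \<kappa> terms_weight_nonneg[of ?T] unfolding K_def by (meson mult_nonneg_nonneg order_trans zero_le_power2)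
  have K: "cmod (\<Sum>\<alpha>\<in>?S. \<Sum>\<beta>\<in>?S. mat_word n A w $$ (\<alpha>, \<beta>) * dtpoly n ?S T' A i (munit n \<alpha> \<beta>)) \<le> K"
    if A: "A \<in> space rt.M" and nz: "\<psi> A \<noteq> 0" and T': "T' = ?T \<or> T' = star_terms ?T" for A T'
  proof -
    interpret mat_tuple n N A by (rule mt[OF A])
    have len: "fst ` set u \<subseteq> {1..N} \<and> fst ` set v \<subseteq> {1..N} \<and> length u + length w + 3 \<le> 2 * 2 ^ Q0 \<and> length v + length w + 3 \<le> 2 * 2 ^ Q0"
      if "(c, u, v) \<in> set ?T" for c u v
      using liberation_terms_fst[OF that] liberation_terms_length[OF that] w Q0(1) by fastforce
    have len': "fst ` set u \<subseteq> {1..N} \<and> fst ` set v \<subseteq> {1..N} \<and> length u + length w + 3 \<le> 2 * 2 ^ Q0 \<and> length v + length w + 3 \<le> 2 * 2 ^ Q0"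
      if mem: "(c, u, v) \<in> set T'" for c u v
    proof (cases "T' = ?T")
      case False
      then obtain c' u' v' where "(c', u', v') \<in> set ?T" "u = star_word u'" "v = star_word v'"
        using T' mem unfolding star_terms_def by auto
      thus ?thesis using len[of c' u' v'] by simp
    qed (use len mem in auto)
    have "cmod (\<Sum>\<alpha>\<in>?S. \<Sum>\<beta>\<in>?S. mat_word n A w $$ (\<alpha>, \<beta>) * dtpoly n ?S T' A i (munit n \<alpha> \<beta>)) \<le> terms_weight T' * b\<^sup>2"
      by (rule sum_dtpoly_bound[OF block_subset[OF j0] w bnn(2) len' traces[OF A nz]])
    also have "terms_weight T' = terms_weight ?T" using T' terms_weight_star by auto
    also have "terms_weight ?T * b\<^sup>2 = (terms_weight ?T * Mb\<^sup>2) * (real n)\<^sup>2" by (simp add: b_def power_mult_distrib)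
    also have "\<dots> \<le> K" unfolding K_def using \<kappa> by (intro mult_right_mono) auto
    finally show ?thesis .
  qed
  let ?P = "Pi\<^sub>E {1..N} (\<lambda>i. single_states n i (R + 1) r e2)"
  have P_sets: "?P \<in> sets rt.M" using emeasure_product(2)[of "R + 1" n r e2] R unfolding Meq by simp
  have P_box: "?P \<subseteq> rt.Box (R + 1)"
  proof
    fix A assume A: "A \<in> ?P"
    have mem: "A i' \<in> single_states n i' (R + 1) r e2" if "i' \<in> {1..N}" for i' using PiE_mem[OF A that] .
    have "A \<in> space rt.M" unfolding rt.space_M using A mem by (auto simp: PiE_def single_states_def)
    moreover have "cmod (A i' $$ (u, v)) \<le> R + 1" if i': "i' \<in> {1..N}" and uv: "u < n" "v < n" for i' u v
      using mem[OF i'] uv unfolding single_states_def rect_mats_def by (intro entry_le_op_norm) auto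
    ultimately show "A \<in> rt.Box (R + 1)" by (auto simp: rt.Box_def)
  qed
  have P_fin: "emeasure rt.M ?P < \<infinity>"
    using emeasure_mono[OF P_box rt.Box_sets] rt.emeasure_Box[of "R + 1"] by (rule order_le_less_trans)
  define G where "G = {A \<in> space rt.M. 1 \<le> \<psi> A \<and> \<delta> \<le> cmod (tpoly n ?S ?T A)}"
  have \<psi>0: "\<psi> A \<ge> 0" for A by (simp add: \<psi>_def)
  have \<psi>_supp: "\<psi> A = 0" if "A \<in> space rt.M" "A \<notin> rt.Box (R + 1)" for A using box that by blast
  have conc: "measure rt.M G * \<delta> ^ (2 * s) \<le> (2 * real s * K) ^ s * integral\<^sup>L rt.M \<psi>" for s
    unfolding G_def
    by (rule rt.concentration[OF i block_subset[OF j0] w Sb \<psi>0 \<psi>_Der \<psi>_reg \<psi>_supp K K K0 \<delta>]) auto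
  have \<psi>_int: "integrable rt.M \<psi>"
  proof -
    have "integrable rt.M (\<lambda>A. complex_of_real (\<psi> A))"
      by (rule rt.regular_integrable[OF \<psi>_reg, of "R + 1"]) (simp add: \<psi>_supp)
    from integrable_Re[OF this] show ?thesis by (simp only: Re_complex_of_real)
  qed
  have int_le: "integral\<^sup>L rt.M \<psi> \<le> 4 * measure rt.M ?P"
  proof -
    have "integral\<^sup>L rt.M \<psi> \<le> integral\<^sup>L rt.M (\<lambda>A. 4 * indicator ?P A)"
    proof (rule integral_mono[OF \<psi>_int])
      show "integrable rt.M (\<lambda>A. 4 * indicator ?P A :: real)"
        using P_sets P_fin by (intro integrable_mult_right integrable_real_indicator) auto
      fix A assume A: "A \<in> space rt.M"
      show "\<psi> A \<le> 4 * indicator ?P A"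
      proof (cases "\<psi> A = 0")
        case False
        have "A \<in> ?P" using supp[OF A False] A unfolding rt.space_M by (auto simp: PiE_def)
        \<comment> \<open>As \<open>Q\<close> is non-negative, the cut-off is at most 2^2, the
          origin of the 4 in front of the product volume.\<close>
        moreover have "max 0 (2 - Re (Q A)) \<le> 2" using ReQ_nonneg[OF A] by simp
        hence "\<psi> A \<le> 2\<^sup>2" unfolding \<psi>_def by (intro power_mono) auto
        ultimately show ?thesis by simp
      qed simp
    qed
    thus ?thesis using P_sets P_fin by simp
  qed
  show thesis
  proof (rule that[of G])
    have m1: "\<psi> \<in> borel_measurable rt.M" using \<psi>_int by (rule borel_measurable_integrable)
    have m2: "tpoly n ?S ?T \<in> borel_measurable rt.M"
    proof -
      have "rt.regular (tpoly n ?S T')" if "\<And>c u v. (c, u, v) \<in> set T' \<Longrightarrow> fst ` set u \<subseteq> {1..N} \<and> fst ` set v \<subseteq> {1..N}" for T'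
        using that
      proof (induction T')
        case Nil
        thus ?case by (simp add: tpoly_def[abs_def])
      next
        case (Cons x T')
        obtain c u v where x: "x = (c, u, v)" by (cases x)
        have uv: "fst ` set u \<subseteq> {1..N}" "fst ` set v \<subseteq> {1..N}" using Cons.prems[of c u v] x by auto
        have "rt.regular (tpoly n ?S T')"
        proof (rule Cons.IH)
          fix c' u' v' assume "(c', u', v') \<in> set T'"
          thus "fst ` set u' \<subseteq> {1..N} \<and> fst ` set v' \<subseteq> {1..N}" by (rule Cons.prems[OF list.set_intros(2)])
        qed
        hence "rt.regular (\<lambda>A. c * btr ?S (mat_word n A u) * btr ?S (mat_word n A v) + tpoly n ?S T' A)"
          by (intro rt.regular_add rt.regular_mult rt.regular_const rt.regular_btr N uv block_subset j0)
        thus ?case by (simp add: x)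
      qed
      moreover have "fst ` set u \<subseteq> {1..N} \<and> fst ` set v \<subseteq> {1..N}" if "(c, u, v) \<in> set ?T" for c u v
        using liberation_terms_fst[OF that] w by fastforce
      ultimately have "rt.regular (tpoly n ?S ?T)" by blast
      thus ?thesis by (simp add: rt.regular_def)
    qed
    have m3: "(\<lambda>A. cmod (tpoly n ?S ?T A)) \<in> borel_measurable rt.M" by (rule measurable_compose[OF m2 borel_measurable_norm])
    show "G \<in> sets (tuple_lebesgue \<phi> p n k l N)" unfolding Meq G_def
      by (intro sets.sets_Collect_conj borel_measurable_le borel_measurable_const m1 m3)
    have G_box: "G \<subseteq> rt.Box (R + 1)"
    proof
      fix A assume "A \<in> G"
      hence "A \<in> space rt.M" "\<psi> A \<noteq> 0" by (auto simp: G_def)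
      thus "A \<in> rt.Box (R + 1)" by (rule box)
    qed
    show "emeasure (tuple_lebesgue \<phi> p n k l N) G < \<infinity>" unfolding Meq
      by (rule order_le_less_trans[OF emeasure_mono[OF G_box rt.Box_sets] rt.emeasure_Box])
    show "{A \<in> microstates \<phi> d p k l R N a n r \<epsilon>. \<delta> \<le> cmod (tpoly n ?S ?T A)} \<subseteq> G"
    proof
      fix A assume "A \<in> {A \<in> microstates \<phi> d p k l R N a n r \<epsilon>. \<delta> \<le> cmod (tpoly n ?S ?T A)}"
      hence A: "A \<in> microstates \<phi> d p k l R N a n r \<epsilon>" "\<delta> \<le> cmod (tpoly n ?S ?T A)" by auto
      have "A \<in> space rt.M" unfolding rt.space_M by (rule microstates_family(1)[OF eps(1) A(1)])
      thus "A \<in> G" using \<psi>_ge[OF A(1)] A(2) by (simp add: G_def)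
    qed
    show "emeasure (tuple_lebesgue \<phi> p n k l N) ?P < \<infinity>" using P_fin unfolding Meq .
    fix s
    have "measure rt.M G * \<delta> ^ (2 * s) \<le> (2 * real s * K) ^ s * integral\<^sup>L rt.M \<psi>" by (rule conc)
    also have "\<dots> \<le> (2 * real s * K) ^ s * (4 * measure rt.M ?P)"
      using int_le K0 by (intro mult_left_mono) auto
    finally show "measure (tuple_lebesgue \<phi> p n k l N) G * \<delta> ^ (2 * s) \<le>
       (2 * real s * (\<kappa> * (real n)\<^sup>2)) ^ s * (4 * measure (tuple_lebesgue \<phi> p n k l N) ?P)" unfolding Meq K_def .
  qed
qed

end

section \<open>The liberation gradient on joint microstates\<close>

definition tval :: "((nat \<times> bool) list \<Rightarrow> complex) \<Rightarrow> trace_poly \<Rightarrow> complex" where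
  "tval x T = (\<Sum>(c, u, v)\<leftarrow>T. c * x u * x v)"

lemma tval_simps [simp]: "tval x [] = 0" "tval x ((c, u, v) # T) = c * x u * x v + tval x T"
  by (simp_all add: tval_def)

text \<open>The tolerance depends on \<open>y\<close> and \<open>T\<close> alone, which makes the
  accuracy of the microstates independent of \<open>n\<close>.\<close>

lemma tval_continuous:
  assumes "\<delta> > 0"
  shows "\<exists>\<eta>>0. \<forall>x. (\<forall>(c, u, v)\<in>set T. cmod (x u - y u) \<le> \<eta> \<and> cmod (x v - y v) \<le> \<eta>) \<longrightarrow>
    cmod (tval x T - tval y T) \<le> \<delta>"
  using assms
proof (induction T arbitrary: \<delta>)
  case Nil
  thus ?case by (intro exI[of _ 1]) auto
next
  case (Cons t T)
  obtain c u v where t: "t = (c, u, v)" by (cases t)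
  have "\<delta> / 2 > 0" using Cons.prems by simp
  from Cons.IH[OF this] obtain \<eta>1 where \<eta>1: "\<eta>1 > 0"
    "\<And>x. (\<forall>(c, u, v)\<in>set T. cmod (x u - y u) \<le> \<eta>1 \<and> cmod (x v - y v) \<le> \<eta>1) \<Longrightarrow> cmod (tval x T - tval y T) \<le> \<delta> / 2"
    by auto
  \<comment> \<open>For \<eta> \<le> 1 the error of c x_u x_v is at most \<eta> |c| (1 + |y_u| +
    |y_v|); the final 1 keeps \<open>B\<close> positive.\<close>
  define B where "B = cmod c * (1 + cmod (y u) + cmod (y v)) + 1"
  have B: "B > 0" unfolding B_def by (intro add_nonneg_pos mult_nonneg_nonneg) auto
  define \<eta> where "\<eta> = min (min \<eta>1 1) (\<delta> / (2 * B))"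
  have \<eta>: "\<eta> > 0" "\<eta> \<le> \<eta>1" "\<eta> \<le> 1" "\<eta> \<le> \<delta> / (2 * B)" using \<eta>1(1) B Cons.prems by (auto simp: \<eta>_def)
  have "cmod (tval x (t # T) - tval y (t # T)) \<le> \<delta>"
    if x: "\<forall>(c, u, v)\<in>set (t # T). cmod (x u - y u) \<le> \<eta> \<and> cmod (x v - y v) \<le> \<eta>" for x
  proof -
    have xu: "cmod (x u - y u) \<le> \<eta>" "cmod (x v - y v) \<le> \<eta>" using x t by auto
    have "\<forall>(c, u, v)\<in>set T. cmod (x u - y u) \<le> \<eta>1 \<and> cmod (x v - y v) \<le> \<eta>1"
    proof (intro ballI, clarify)
      fix c u v assume "(c, u, v) \<in> set T"
      hence "cmod (x u - y u) \<le> \<eta> \<and> cmod (x v - y v) \<le> \<eta>" using x by auto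
      thus "cmod (x u - y u) \<le> \<eta>1 \<and> cmod (x v - y v) \<le> \<eta>1" using \<eta>(2) by linarith
    qed
    from \<eta>1(2)[OF this] have T: "cmod (tval x T - tval y T) \<le> \<delta> / 2" .
    have "c * x u * x v - c * y u * y v = c * ((x u - y u) * (x v - y v) + (x u - y u) * y v + y u * (x v - y v))"
      by (simp add: algebra_simps)
    also have "cmod \<dots> \<le> cmod c * (\<eta> * 1 + \<eta> * cmod (y v) + cmod (y u) * \<eta>)"
      unfolding norm_mult[of c]
    proof (intro mult_left_mono norm_triangle_mono)
      show "cmod ((x u - y u) * (x v - y v)) \<le> \<eta> * 1" unfolding norm_mult using xu \<eta> by (intro mult_mono) auto
      show "cmod ((x u - y u) * y v) \<le> \<eta> * cmod (y v)" unfolding norm_mult using xu by (intro mult_right_mono) auto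
      show "cmod (y u * (x v - y v)) \<le> cmod (y u) * \<eta>" unfolding norm_mult using xu by (intro mult_left_mono) auto
    qed simp
    also have "\<dots> = \<eta> * (B - 1)" by (simp add: B_def algebra_simps)
    also have "\<dots> \<le> (\<delta> / (2 * B)) * B" using \<eta> B by (intro mult_mono) (auto simp: B_def)
    also have "\<dots> = \<delta> / 2" using B by simp
    finally have H: "cmod (c * x u * x v - c * y u * y v) \<le> \<delta> / 2" .
    have "tval x (t # T) - tval y (t # T) = (c * x u * x v - c * y u * y v) + (tval x T - tval y T)" by (simp add: t)
    also have "cmod \<dots> \<le> \<delta> / 2 + \<delta> / 2" by (rule norm_triangle_mono[OF H T])
    finally show ?thesis by simp
  qed
  thus ?case by (intro exI[of _ \<eta>] conjI allI impI \<eta>(1))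
qed

lemma word_append: "word a (u @ v) = word a u * word a v"
  by (simp add: word_letter)

lemma word_Cons: "word a (x # w) = snd (letter a x) * word a w"
  by (simp add: word_letter)

lemma liberation_gradient_eq_terms:
  "liberation_gradient \<phi> i q (word a u) (map (letter a) w) =
   (\<Sum>(c, u', v')\<leftarrow>liberation_terms i u w. c * \<phi> (word a u' * q) * \<phi> (q * word a v'))"
proof (induction w arbitrary: u)
  case (Cons x w)
  have x: "letter a x = (fst x, snd (letter a x))" by (metis fst_letter prod.collapse)
  have ux: "word a (u @ [x]) = word a u * snd (letter a x)" by (simp add: word_append word_Cons word_def[of a "[]"])
  have "liberation_gradient \<phi> i q (word a u) (map (letter a) (x # w)) =
    (if fst x = i then \<phi> (word a u * q) * \<phi> (q * snd (letter a x) * word a w) -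
           \<phi> (word a u * snd (letter a x) * q) * \<phi> (q * word a w) else 0) +
    liberation_gradient \<phi> i q (word a (u @ [x])) (map (letter a) w)"
    unfolding list.map by (subst x) (simp add: ux word_letter)
  thus ?case using Cons.IH[of "u @ [x]"] by (simp add: word_Cons mult.assoc ux)
qed simp

context microstate_family
begin

lemma block_ratio:
  assumes j: "j \<in> {1..d}" and n: "n \<ge> 1"
  shows "\<bar>real (bs n j) / real n - rho \<phi> p j\<bar> \<le> 1 / real n" "bs n j \<le> n"
proof -
  have r: "rho \<phi> p j > 0" by (rule rho_pos[OF j])
  have "real (bs n j) = of_int \<lfloor>rho \<phi> p j * real n\<rfloor>" using r by (simp add: block_size_def)
  hence "real (bs n j) \<le> rho \<phi> p j * real n" "rho \<phi> p j * real n - 1 \<le> real (bs n j)" by linarith+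
  hence "\<bar>real (bs n j) - rho \<phi> p j * real n\<bar> \<le> 1" by linarith
  moreover have "real (bs n j) / real n - rho \<phi> p j = (real (bs n j) - rho \<phi> p j * real n) / real n"
    using n by (simp add: diff_divide_distrib)
  ultimately show "\<bar>real (bs n j) / real n - rho \<phi> p j\<bar> \<le> 1 / real n"
    using n by (simp add: divide_right_mono)
  show "bs n j \<le> n" using card_mono[OF _ block_subset[OF j, of n]] card_block[of j n] j by simp
qed

text \<open>Two errors add up: \<epsilon> from the microstate condition, and one of order 1/n from
  rounding the block size, as the trace is divided by \<open>n\<close> here and by the block size
  there. The empty word, which microstates do not constrain, has only the second.\<close>

lemma microstate_trace:
  assumes A: "A \<in> microstates \<phi> d p k l R N a n r \<epsilon>" and eps: "\<epsilon> > 0" and n: "n \<ge> 1" and j: "j \<in> {1..d}"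
    and u: "length u \<le> r" "fst ` set u \<subseteq> {1..N}"
  shows "cmod (btr (Bl n j) (mat_word n A u) / of_nat n - \<phi> (p j * word a u)) \<le>
    \<epsilon> + cmod (\<phi> (p j * word a u) / of_real (rho \<phi> p j)) / real n"
proof -
  have r: "rho \<phi> p j > 0" by (rule rho_pos[OF j])
  have ratio: "cmod (of_nat (bs n j) / of_nat n - of_real (rho \<phi> p j)) \<le> 1 / real n"
  proof -
    have "of_nat (bs n j) / of_nat n - complex_of_real (rho \<phi> p j) = of_real (real (bs n j) / real n - rho \<phi> p j)" by simp
    thus ?thesis unfolding \<open>_ = of_real _\<close> norm_of_real using block_ratio(1)[OF j n] by simp
  qed
  show ?thesis
  proof (cases "u = []")
    case True
    have "btr (Bl n j) (mat_word n A []) = of_nat (bs n j)"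
    proof -
      have "btr (Bl n j) (1\<^sub>m n :: complex Matrix.mat) = (\<Sum>i\<in>Bl n j. 1)"
        unfolding btr_def by (rule sum.cong) (use block_subset[OF j, of n] in auto)
      thus ?thesis using card_block[of j n] j by (simp add: mat_word_eq)
    qed
    moreover have "\<phi> (p j * word a []) = of_real (rho \<phi> p j)" by (simp add: word_def phi_p[OF j])
    ultimately have "cmod (btr (Bl n j) (mat_word n A u) / of_nat n - \<phi> (p j * word a u)) \<le> 1 / real n"
      using ratio True by simp
    moreover have "cmod (\<phi> (p j * word a u) / of_real (rho \<phi> p j)) = 1" using True r by (simp add: word_def phi_p[OF j])
    ultimately show ?thesis using eps by simp
  next
    case False
    define x where "x = btr (Bl n j) (mat_word n A u) / of_nat (bs n j)"
    define y where "y = \<phi> (p j * word a u) / of_real (rho \<phi> p j)"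
    have xy: "cmod (x - y) \<le> \<epsilon>" unfolding x_def y_def
      by (rule microstates_family(3)[OF eps A _ u j]) (use False in \<open>simp add: Suc_le_eq\<close>)
    have "btr (Bl n j) (mat_word n A u) = x * of_nat (bs n j)"
    proof (cases "bs n j = 0")
      case True
      hence "Bl n j = {}" using card_block[of j n] j by (simp add: block_def)
      thus ?thesis using True by (simp add: btr_def)
    qed (simp add: x_def)
    moreover have "\<phi> (p j * word a u) = y * of_real (rho \<phi> p j)" using r by (simp add: y_def)
    ultimately have "btr (Bl n j) (mat_word n A u) / of_nat n - \<phi> (p j * word a u) =
      (x - y) * (of_nat (bs n j) / of_nat n) + y * (of_nat (bs n j) / of_nat n - of_real (rho \<phi> p j))"
      by (simp add: left_diff_distrib right_diff_distrib diff_divide_distrib)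
    also have "cmod \<dots> \<le> \<epsilon> * 1 + cmod y * (1 / real n)"
    proof (rule norm_triangle_mono)
      have "cmod (of_nat (bs n j) / of_nat n) \<le> 1" using block_ratio(2)[OF j n] n by (simp add: norm_divide)
      thus "cmod ((x - y) * (of_nat (bs n j) / of_nat n)) \<le> \<epsilon> * 1" unfolding norm_mult using xy eps by (intro mult_mono) auto
      show "cmod (y * (of_nat (bs n j) / of_nat n - of_real (rho \<phi> p j))) \<le> cmod y * (1 / real n)"
        unfolding norm_mult using ratio by (intro mult_left_mono) auto
    qed
    finally show ?thesis by (simp add: y_def)
  qed
qed

lemma emeasure_states_finite:
  assumes "R > 0"
  shows "emeasure (rect_lebesgue n (Bl n k) (Bl n l)) (single_states n i R r \<epsilon>) < \<infinity>"
proof -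
  interpret rt: rect_tuple n N "Bl n k" "Bl n l" by (rule rt)
  have "single_states n i R r \<epsilon> \<subseteq> {X \<in> space rt.R. \<forall>u\<in>{..<n}. \<forall>v\<in>{..<n}. cmod (X $$ (u, v)) \<le> R}"
    unfolding single_states_def rt.space_R rect_mats_def using entry_le_op_norm by auto
  from order_le_less_trans[OF emeasure_mono[OF this rt.R_entries_le(1)] rt.R_entries_le(2)] show ?thesis .
qed

text \<open>That \<open>\<gamma>\<close> is independent of \<open>R\<close> lets the gain survive the supremum over cut-offs.\<close>

lemma microstates_volume:
  assumes i: "i \<in> {1..N}" and j: "j \<in> {1..d}" and w: "fst ` set w \<subseteq> {1..N}"
    and lg: "liberation_gradient \<phi> i (p j) 1 (map (letter a) w) \<noteq> 0"
  obtains \<gamma> where "\<gamma> > 0" and "\<And>R r e. R > 0 \<Longrightarrow> e > 0 \<Longrightarrow> \<exists>r2\<ge>1. \<exists>\<epsilon>>0. \<exists>n0. \<forall>n\<ge>n0.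
     emeasure (tuple_lebesgue \<phi> p n k l N) (microstates \<phi> d p k l R N a n r2 \<epsilon>) \<le>
     ennreal (8 * exp (- \<gamma> * (real n)\<^sup>2)) *
     (\<Prod>i=1..N. emeasure (tuple_lebesgue \<phi> p n k l 1) (microstates \<phi> d p k l (R + 1) 1 (\<lambda>_. a i) n r e))"
proof -
  let ?T = "liberation_terms i [] w"
  define lgv where "lgv = liberation_gradient \<phi> i (p j) 1 (map (letter a) w)"
  define y where "y = (\<lambda>u. \<phi> (p j * word a u))"
  have lgv: "lgv = tval y ?T"
    using liberation_gradient_eq_terms[of \<phi> i "p j" a "[]" w] phi_comm[of _ "p j"]
    by (simp add: lgv_def tval_def y_def word_def[of a "[]"])
  \<comment> \<open>Half of the modulus of the gradient: a value within \<open>c\<close> of it still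
    has modulus at least \<open>c\<close>.\<close>
  define c where "c = cmod lgv / 2"
  have c: "c > 0" using lg by (simp add: c_def lgv_def)
  obtain \<eta> where \<eta>: "\<eta> > 0" "\<And>x. (\<forall>(c, u, v)\<in>set ?T. cmod (x u - y u) \<le> \<eta> \<and> cmod (x v - y v) \<le> \<eta>) \<Longrightarrow> cmod (tval x ?T - tval y ?T) \<le> c"
    using tval_continuous[OF c, of ?T y] by blast
  \<comment> \<open>A crude exponent with 2^Q0 above all lengths that occur; it depends on
    \<open>w\<close> alone, and so do the moments that enter \<open>Mb\<close>.\<close>
  define Q0 where "Q0 = 2 * length w + 3"
  have Q0: "2 * length w + 3 \<le> 2 * 2 ^ Q0" unfolding Q0_def using less_exp[of "2 * length w + 3"] by linarith
  define Mb where "Mb = 1 + (\<Sum>(i, s, j)\<in>{1..N} \<times> UNIV \<times> {1..d}. cmod (target i (alt_word s (2 ^ Q0)) j))"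
  have Mb: "Mb \<ge> 1" unfolding Mb_def by (auto intro!: sum_nonneg)
  have Mb2: "cmod (target i (alt_word s (2 ^ Q0)) j) + 1 \<le> Mb" if "i \<in> {1..N}" "j \<in> {1..d}" for i s j
    using member_le_sum[of "(i, s, j)" "{1..N} \<times> UNIV \<times> {1..d}" "\<lambda>(i, s, j). cmod (target i (alt_word s (2 ^ Q0)) j)"] that
    by (simp add: Mb_def case_prod_beta)
  define \<kappa> where "\<kappa> = terms_weight ?T * Mb\<^sup>2 + 1"
  have \<kappa>: "\<kappa> > 0" "terms_weight ?T * Mb\<^sup>2 \<le> \<kappa>" 
    using mult_nonneg_nonneg[OF terms_weight_nonneg[of ?T], of "Mb\<^sup>2"] by (simp_all add: \<kappa>_def add_nonneg_pos)
  \<comment> \<open>Chosen so that s \<le> \<gamma>' n^2 makes 2 s \<kappa> n^2 times n^0 comparable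
    with \<delta>^2 / n^2: precisely, 2 s (\<kappa> n^2) \<le> \<delta>^2 / 2 for \<delta> = c n^2,
    a gain of 1/2 for each of the \<open>s\<close> factors.\<close>
  define \<gamma>' where "\<gamma>' = c\<^sup>2 / (4 * \<kappa>)"
  have \<gamma>': "\<gamma>' > 0" using c \<kappa> by (simp add: \<gamma>'_def)
  define B where "B = 1 + (\<Sum>(c, u, v)\<leftarrow>?T. cmod (y u / of_real (rho \<phi> p j)) + cmod (y v / of_real (rho \<phi> p j)))"
  have B_mem: "cmod (y u / of_real (rho \<phi> p j)) \<le> B \<and> cmod (y v / of_real (rho \<phi> p j)) \<le> B" if "(c, u, v) \<in> set ?T" for c u v
  proof -
    have "cmod (y u / of_real (rho \<phi> p j)) + cmod (y v / of_real (rho \<phi> p j)) \<le>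
      (\<Sum>(c, u, v)\<leftarrow>?T. cmod (y u / of_real (rho \<phi> p j)) + cmod (y v / of_real (rho \<phi> p j)))"
      using that by (intro member_le_sum_list) (auto intro!: image_eqI[of _ _ "(c, u, v)"] add_nonneg_nonneg)
    thus ?thesis unfolding B_def
      using norm_ge_zero[of "y u / of_real (rho \<phi> p j)"] norm_ge_zero[of "y v / of_real (rho \<phi> p j)"] by linarith
  qed
  show thesis
  proof (rule that[of "\<gamma>' * ln 2"])
    show "\<gamma>' * ln 2 > 0" using \<gamma>' by simp
    fix R e :: real and r :: nat assume R: "R > 0" and e: "e > 0"
    define r2 where "r2 = max (max r 1) (2 * 2 ^ Q0)"
    define e2 where "e2 = min e 1"
    define cd where "cd = real (card ({1..N} \<times> {b :: bool list. 1 \<le> length b \<and> length b \<le> r2} \<times> {1..d}))"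
    \<comment> \<open>The first bound keeps the normalised gradient near its limit, the second keeps
      \<open>Q\<close> at most 1 on the microstates.\<close>
    define \<epsilon> where "\<epsilon> = min (\<eta> / 2) (e2 / (2 * (cd + 1)))"
    have e2: "0 < e2" "e2 \<le> 1" "e2 \<le> e" using e by (auto simp: e2_def)
    have cd: "cd \<ge> 0" by (simp add: cd_def)
    have eps: "\<epsilon> > 0" "\<epsilon> \<le> \<eta> / 2"
      unfolding \<epsilon>_def using \<eta>(1) e2(1) cd by (simp_all only: min.cobounded1 min_less_iff_conj) simp
    have eps2: "cd * \<epsilon>\<^sup>2 \<le> e2\<^sup>2 / 4"
    proof -
      have *: "cd * (e2 / (2 * x))\<^sup>2 = (e2\<^sup>2 / 4) * (cd / x\<^sup>2)" for x :: real
        by (simp add: power_divide power_mult_distrib)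
      have "\<epsilon>\<^sup>2 \<le> (e2 / (2 * (cd + 1)))\<^sup>2" using eps(1) by (intro power_mono) (auto simp: \<epsilon>_def)
      hence "cd * \<epsilon>\<^sup>2 \<le> cd * (e2 / (2 * (cd + 1)))\<^sup>2" using cd by (rule mult_left_mono)
      also have "\<dots> = (e2\<^sup>2 / 4) * (cd / (cd + 1)\<^sup>2)" by (rule *)
      also have "\<dots> \<le> (e2\<^sup>2 / 4) * 1"
      proof (rule mult_left_mono)
        have "cd \<le> (cd + 1)\<^sup>2" using cd by (simp add: power2_eq_square algebra_simps)
        thus "cd / (cd + 1)\<^sup>2 \<le> 1" using cd by (simp add: divide_le_eq_1)
      qed simp
      finally show ?thesis by simp
    qed
    \<comment> \<open>From here on the rounding of the blocks costs at most \<eta> / 2.\<close>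
    obtain n0 :: nat where n0: "2 * B / \<eta> \<le> real n0" using real_arch_simple by blast
    show "\<exists>r2\<ge>1. \<exists>\<epsilon>>0. \<exists>n0. \<forall>n\<ge>n0.
     emeasure (tuple_lebesgue \<phi> p n k l N) (microstates \<phi> d p k l R N a n r2 \<epsilon>) \<le>
     ennreal (8 * exp (- (\<gamma>' * ln 2) * (real n)\<^sup>2)) *
     (\<Prod>i=1..N. emeasure (tuple_lebesgue \<phi> p n k l 1) (microstates \<phi> d p k l (R + 1) 1 (\<lambda>_. a i) n r e))"
    proof (rule exI[of _ r2], intro exI[of _ \<epsilon>] exI[of _ "max n0 1"] conjI allI impI)
      show "r2 \<ge> 1" "\<epsilon> > 0" using eps by (auto simp: r2_def)
      fix n assume n: "max n0 1 \<le> n"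
      hence n1: "n \<ge> 1" by simp
      have "2 * B / \<eta> \<le> real n" using n n0 by simp
      hence "2 * B \<le> real n * \<eta>" using \<eta>(1) by (simp only: pos_divide_le_eq)
      hence nB: "B / real n \<le> \<eta> / 2" using n1 by (simp add: pos_divide_le_eq mult.commute)
      let ?M = "tuple_lebesgue \<phi> p n k l N"
      let ?\<Gamma> = "microstates \<phi> d p k l R N a n r2 \<epsilon>"
      let ?P = "Pi\<^sub>E {1..N} (\<lambda>i. single_states n i (R + 1) r2 e2)"
      define \<delta> where "\<delta> = c * (real n)\<^sup>2"
      have \<delta>: "\<delta> > 0" using c n1 by (simp add: \<delta>_def)
      have big: "\<delta> \<le> cmod (tpoly n (Bl n j) ?T A)" if A: "A \<in> ?\<Gamma>" for A
      proof -
        define x where "x = (\<lambda>u. btr (Bl n j) (mat_word n A u) / of_nat n)"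
        have close: "cmod (x u - y u) \<le> \<eta>" if u: "length u \<le> r2" "fst ` set u \<subseteq> {1..N}" "cmod (y u / of_real (rho \<phi> p j)) \<le> B" for u
        proof -
          have "cmod (x u - y u) \<le> \<epsilon> + cmod (y u / of_real (rho \<phi> p j)) / real n"
            unfolding x_def y_def by (rule microstate_trace[OF A eps(1) n1 j u(1,2)])
          also have "\<dots> \<le> \<epsilon> + B / real n" using u(3) by (intro add_left_mono divide_right_mono) auto
          finally show ?thesis using nB eps(2) by linarith
        qed
        have "\<forall>(c, u, v)\<in>set ?T. cmod (x u - y u) \<le> \<eta> \<and> cmod (x v - y v) \<le> \<eta>"
        proof (clarify)
          fix c u v assume t: "(c, u, v) \<in> set ?T"
          have "length u \<le> r2" "length v \<le> r2" using liberation_terms_length[OF t] Q0 by (auto simp: r2_def)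
          moreover have "fst ` set u \<subseteq> {1..N}" "fst ` set v \<subseteq> {1..N}" using liberation_terms_fst[OF t] w by fastforce+
          ultimately show "cmod (x u - y u) \<le> \<eta> \<and> cmod (x v - y v) \<le> \<eta>" using close B_mem[OF t] by blast
        qed
        from \<eta>(2)[OF this] have "cmod (tval x ?T - lgv) \<le> c" by (simp add: lgv)
        hence "c \<le> cmod (tval x ?T)" using norm_triangle_ineq2[of lgv "lgv - tval x ?T"]
          by (simp add: c_def norm_minus_commute)
        moreover have "tpoly n (Bl n j) ?T A = of_nat n ^ 2 * tval x ?T"
        proof -
          have "tpoly n (Bl n j) T' A = of_nat n ^ 2 * tval x T'" for T'
            by (induction T') (use n1 in \<open>auto simp: x_def power2_eq_square field_simps\<close>)
          thus ?thesis .
        qed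
        ultimately show ?thesis unfolding \<delta>_def
          by (simp only: norm_mult norm_power norm_of_nat mult.commute[of c] mult_left_mono zero_le_power2)
      qed
      obtain G where G: "G \<in> sets ?M" "emeasure ?M G < \<infinity>" "{A \<in> ?\<Gamma>. \<delta> \<le> cmod (tpoly n (Bl n j) ?T A)} \<subseteq> G"
        "emeasure ?M ?P < \<infinity>" "\<And>s. measure ?M G * \<delta> ^ (2 * s) \<le> (2 * real s * (\<kappa> * (real n)\<^sup>2)) ^ s * (4 * measure ?M ?P)"
        by (rule microstates_concentration[OF i j w n1 R e2(1,2) eps(1) eps2[unfolded cd_def] Q0 _ Mb Mb2 \<kappa>(2) less_imp_le[OF \<delta>]])
          (auto simp: r2_def)
      define s where "s = nat \<lfloor>\<gamma>' * (real n)\<^sup>2\<rfloor>"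
      have s: "real s \<le> \<gamma>' * (real n)\<^sup>2" "\<gamma>' * (real n)\<^sup>2 - 1 \<le> real s"
      proof -
        have "real s = of_int \<lfloor>\<gamma>' * (real n)\<^sup>2\<rfloor>" unfolding s_def using \<gamma>' by simp
        thus "real s \<le> \<gamma>' * (real n)\<^sup>2" "\<gamma>' * (real n)\<^sup>2 - 1 \<le> real s" by linarith+
      qed
      have half: "2 * real s * (\<kappa> * (real n)\<^sup>2) \<le> \<delta>\<^sup>2 / 2"
      proof -
        have "2 * real s * (\<kappa> * (real n)\<^sup>2) \<le> 2 * (\<gamma>' * (real n)\<^sup>2) * (\<kappa> * (real n)\<^sup>2)"
          using s(1) \<kappa>(1) by (intro mult_right_mono) auto
        also have "\<dots> = \<delta>\<^sup>2 / 2" using \<kappa>(1) by (simp add: \<gamma>'_def \<delta>_def power2_eq_square field_simps)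
        finally show ?thesis .
      qed
      have "measure ?M G * \<delta> ^ (2 * s) \<le> (\<delta>\<^sup>2 / 2) ^ s * (4 * measure ?M ?P)"
        using \<kappa>(1) by (intro order_trans[OF G(5)] mult_right_mono power_mono half) auto
      also have "\<dots> = \<delta> ^ (2 * s) * (4 * measure ?M ?P / 2 ^ s)" by (simp add: power_divide power_mult)
      finally have "\<delta> ^ (2 * s) * measure ?M G \<le> \<delta> ^ (2 * s) * (4 * measure ?M ?P / 2 ^ s)" by (simp only: mult.commute)
      hence mG: "measure ?M G \<le> 4 * measure ?M ?P / 2 ^ s"
        using zero_less_power[OF \<delta>, of "2 * s"] by (simp only: mult_le_cancel_left_pos)
      \<comment> \<open>Rounding \<open>s\<close> down loses at most a factor 2, which turns 4 into
        8.\<close>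
      have "2 powr (\<gamma>' * (real n)\<^sup>2 - 1) \<le> 2 ^ s" using s(2) by (simp add: powr_realpow[symmetric])
      hence "8 * (1 / 2 ^ s) \<le> 8 * (1 / 2 powr (\<gamma>' * (real n)\<^sup>2 - 1))" by (intro mult_left_mono divide_left_mono) auto
      also have "\<dots> = 2 * (8 * exp (- (\<gamma>' * ln 2) * (real n)\<^sup>2))"
        by (simp add: powr_def exp_diff exp_minus field_simps)
      finally have "4 / 2 ^ s \<le> 8 * exp (- (\<gamma>' * ln 2) * (real n)\<^sup>2)" by simp
      hence "4 / 2 ^ s * measure ?M ?P \<le> 8 * exp (- (\<gamma>' * ln 2) * (real n)\<^sup>2) * measure ?M ?P"
        by (rule mult_right_mono) simp
      with mG have mG2: "measure ?M G \<le> 8 * exp (- (\<gamma>' * ln 2) * (real n)\<^sup>2) * measure ?M ?P" by simp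
      have "?\<Gamma> \<subseteq> G" using G(3) big by blast
      hence "emeasure ?M ?\<Gamma> \<le> emeasure ?M G" using G(1) by (rule emeasure_mono)
      also have "\<dots> = ennreal (measure ?M G)" using G(2) by (intro emeasure_eq_ennreal_measure) auto
      also have "\<dots> \<le> ennreal (8 * exp (- (\<gamma>' * ln 2) * (real n)\<^sup>2) * measure ?M ?P)" by (rule ennreal_leI[OF mG2])
      also have "\<dots> = ennreal (8 * exp (- (\<gamma>' * ln 2) * (real n)\<^sup>2)) * emeasure ?M ?P"
        using G(4) by (subst ennreal_mult) (auto simp: emeasure_eq_ennreal_measure)
      also have "\<dots> \<le> ennreal (8 * exp (- (\<gamma>' * ln 2) * (real n)\<^sup>2)) *
        (\<Prod>i=1..N. emeasure (tuple_lebesgue \<phi> p n k l 1) (microstates \<phi> d p k l (R + 1) 1 (\<lambda>_. a i) n r e))"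
      proof (rule mult_left_mono)
        have R1: "R + 1 > 0" using R by simp
        show "emeasure ?M ?P \<le> (\<Prod>i=1..N. emeasure (tuple_lebesgue \<phi> p n k l 1) (microstates \<phi> d p k l (R + 1) 1 (\<lambda>_. a i) n r e))"
          unfolding emeasure_product(1)[OF R1] emeasure_single[OF e R1]
          using e2(3) by (intro prod_mono_ennreal emeasure_mono single_states_mono single_states_sets[OF R1]) (auto simp: r2_def)
      qed simp
      finally show "emeasure ?M ?\<Gamma> \<le> ennreal (8 * exp (- (\<gamma>' * ln 2) * (real n)\<^sup>2)) *
        (\<Prod>i=1..N. emeasure (tuple_lebesgue \<phi> p n k l 1) (microstates \<phi> d p k l (R + 1) 1 (\<lambda>_. a i) n r e))" .
    qed
  qed
qed

end

section \<open>The entropy inequality\<close>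

text \<open>Where m \<le> n |z|^2 < m + 1 the integrand is at most 2^(-m), and \<open>z\<close> lies
  in a square of area 4 (m + 1) / n; the series sums to 16 / n. The order 1/n is what counts, as a
  constant per entry changes the entropy by a bounded amount.\<close>

lemma nn_integral_gaussian_le:
  assumes "n > 0"
  shows "(\<integral>\<^sup>+ z. ennreal (2 powr (- (real n * (cmod z)\<^sup>2))) \<partial>lborel) \<le> ennreal (16 / real n)"
proof -
  define r where "r = (\<lambda>m. sqrt (real (Suc m) / real n))"
  define D where "D = (\<lambda>m. box (Complex (- r m) (- r m)) (Complex (r m) (r m)))"
  have r: "r m > 0" "(r m)\<^sup>2 = real (Suc m) / real n" for m using assms by (simp_all add: r_def)
  have D: "emeasure lborel (D m) = ennreal (4 * (real (Suc m) / real n))" for m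
  proof -
    have "emeasure lborel (D m) = ennreal (2 * r m * (2 * r m))"
      unfolding D_def using r(1)[of m]
      by (subst emeasure_lborel_box) (auto simp: Basis_complex_def)
    also have "2 * r m * (2 * r m) = 4 * (real (Suc m) / real n)" using r(2)[of m] by (simp add: power2_eq_square)
    finally show ?thesis .
  qed
  have le: "ennreal (2 powr (- (real n * (cmod z)\<^sup>2))) \<le> (\<Sum>m. ennreal ((1 / 2) ^ m) * indicator (D m) z)" for z
  proof -
    define m where "m = nat \<lfloor>real n * (cmod z)\<^sup>2\<rfloor>"
    have "real m = of_int \<lfloor>real n * (cmod z)\<^sup>2\<rfloor>" by (simp add: m_def)
    hence m: "real m \<le> real n * (cmod z)\<^sup>2" "real n * (cmod z)\<^sup>2 < real (Suc m)" by linarith+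
    have "(cmod z)\<^sup>2 < (r m)\<^sup>2" using m(2) assms by (simp add: r(2) pos_less_divide_eq mult.commute)
    hence "cmod z < r m" using r(1)[of m] by (simp add: power_less_imp_less_base)
    hence "\<bar>Re z\<bar> < r m" "\<bar>Im z\<bar> < r m" using abs_Re_le_cmod[of z] abs_Im_le_cmod[of z] by linarith+
    hence z: "z \<in> D m" by (auto simp: D_def box_def Basis_complex_def)
    have "2 powr (- (real n * (cmod z)\<^sup>2)) \<le> 2 powr (- real m)" using m(1) by simp
    also have "\<dots> = (1 / 2) ^ m" by (simp add: powr_minus powr_realpow power_divide inverse_eq_divide)
    finally have "ennreal (2 powr (- (real n * (cmod z)\<^sup>2))) \<le> ennreal ((1 / 2) ^ m) * indicator (D m) z"
      using z by (simp add: ennreal_leI)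
    also have "\<dots> \<le> (\<Sum>m. ennreal ((1 / 2) ^ m) * indicator (D m) z)"
    proof -
      have "sum f {m} \<le> suminf f" for f :: "nat \<Rightarrow> ennreal" by (rule sum_le_suminf) auto
      thus ?thesis by (simp only: sum.insert sum.empty finite.emptyI empty_iff not_False_eq_True add_0_right)
    qed
    finally show ?thesis .
  qed
  have "(\<integral>\<^sup>+ z. ennreal (2 powr (- (real n * (cmod z)\<^sup>2))) \<partial>lborel) \<le>
    (\<integral>\<^sup>+ z. (\<Sum>m. ennreal ((1 / 2) ^ m) * indicator (D m) z) \<partial>lborel)"
    by (intro nn_integral_mono le)
  also have "\<dots> = (\<Sum>m. \<integral>\<^sup>+ z. ennreal ((1 / 2) ^ m) * indicator (D m) z \<partial>lborel)"
    by (intro nn_integral_suminf) (simp add: D_def)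
  also have "\<dots> = (\<Sum>m. ennreal (4 / real n * (real (Suc m) * (1 / 2) ^ m)))"
  proof (intro suminf_cong)
    fix m
    have "(\<integral>\<^sup>+ z. ennreal ((1 / 2) ^ m) * indicator (D m) z \<partial>lborel) = ennreal ((1 / 2) ^ m) * ennreal (4 * (real (Suc m) / real n))"
    proof (subst nn_integral_cmult_indicator)
      show "D m \<in> sets lborel" by (simp add: D_def)
    qed (simp only: D)
    also have "\<dots> = ennreal (4 / real n * (real (Suc m) * (1 / 2) ^ m))"
      by (subst ennreal_mult[symmetric]) (auto simp: mult.commute)
    finally show "(\<integral>\<^sup>+ z. ennreal ((1 / 2) ^ m) * indicator (D m) z \<partial>lborel) = ennreal (4 / real n * (real (Suc m) * (1 / 2) ^ m))" .
  qed
  also have "\<dots> = ennreal (4 / real n * 4)"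
  proof (rule suminf_ennreal_eq)
    have "(\<lambda>m. real (Suc m) * (1 / 2) ^ m) sums (1 / (1 - 1 / 2)\<^sup>2)" by (rule geometric_deriv_sums) simp
    from sums_mult[OF this, of "4 / real n"]
    show "(\<lambda>m. 4 / real n * (real (Suc m) * (1 / 2) ^ m)) sums (4 / real n * 4)" by (simp add: power2_eq_square)
  qed auto
  finally show ?thesis by simp
qed

context rect_tuple
begin

text \<open>An exponential Markov inequality replaces the volume of the Euclidean ball.\<close>

lemma emeasure_R_l2_le:
  assumes n: "n > 0" and S: "S \<in> sets R" and K: "\<And>X. X \<in> S \<Longrightarrow> (\<Sum>x\<in>I \<times> J. (cmod (X $$ x))\<^sup>2) \<le> K"
  shows "emeasure R S \<le> ennreal (2 powr (real n * K) * (16 / real n) ^ (card I * card J))"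
proof -
  let ?g = "\<lambda>z. ennreal (2 powr (- (real n * (cmod z)\<^sup>2)))"
  have "emeasure R S = emeasure P (fill_mat n I J -` S \<inter> space P)"
    by (subst R_distr, rule emeasure_distr[OF fill_mat_measurable S])
  also have "\<dots> = (\<integral>\<^sup>+ z. indicator (fill_mat n I J -` S \<inter> space P) z \<partial>P)"
    using measurable_sets[OF fill_mat_measurable S] by simp
  also have "\<dots> \<le> (\<integral>\<^sup>+ z. ennreal (2 powr (real n * K)) * (\<Prod>x\<in>I \<times> J. ?g (z x)) \<partial>P)"
  proof (rule nn_integral_mono)
    fix z
    show "indicator (fill_mat n I J -` S \<inter> space P) z \<le> ennreal (2 powr (real n * K)) * (\<Prod>x\<in>I \<times> J. ?g (z x))"
    proof (cases "z \<in> fill_mat n I J -` S \<inter> space P")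
      case True
      have "fill_mat n I J z $$ x = z x" if "x \<in> I \<times> J" for x
        using that I_sub J_sub by (auto simp: fill_mat_def subset_iff)
      hence "(\<Sum>x\<in>I \<times> J. (cmod (z x))\<^sup>2) = (\<Sum>x\<in>I \<times> J. (cmod (fill_mat n I J z $$ x))\<^sup>2)" by simp
      also have "\<dots> \<le> K" using True by (intro K) auto
      finally have "real n * (\<Sum>x\<in>I \<times> J. (cmod (z x))\<^sup>2) \<le> real n * K" by (rule mult_left_mono) simp
      \<comment> \<open>On \<open>S\<close> the total exponent is non-negative, so the integrand
        dominates the indicator.\<close>
      hence "2 powr 0 \<le> 2 powr (real n * K + - (real n * (\<Sum>x\<in>I \<times> J. (cmod (z x))\<^sup>2)))" by (intro powr_mono) auto
      also have "\<dots> = 2 powr (real n * K) * (\<Prod>x\<in>I \<times> J. 2 powr (- (real n * (cmod (z x))\<^sup>2)))"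
        unfolding powr_add by (simp add: powr_sum sum_distrib_left sum_negf[symmetric])
      finally have "1 \<le> ennreal (2 powr (real n * K) * (\<Prod>x\<in>I \<times> J. 2 powr (- (real n * (cmod (z x))\<^sup>2))))" by simp
      also have "\<dots> = ennreal (2 powr (real n * K)) * (\<Prod>x\<in>I \<times> J. ?g (z x))"
        by (simp add: ennreal_mult prod_nonneg prod_ennreal)
      finally show ?thesis using True by simp
    qed simp
  qed
  also have "\<dots> = ennreal (2 powr (real n * K)) * (\<integral>\<^sup>+ z. (\<Prod>x\<in>I \<times> J. ?g (z x)) \<partial>P)"
    by (intro nn_integral_cmult) measurable
  also have "(\<integral>\<^sup>+ z. (\<Prod>x\<in>I \<times> J. ?g (z x)) \<partial>P) = (\<Prod>x\<in>I \<times> J. \<integral>\<^sup>+ z. ?g z \<partial>lborel)"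
    by (intro lborel_product.product_nn_integral_prod finite_IJ) measurable
  also have "\<dots> \<le> (\<Prod>x\<in>I \<times> J. ennreal (16 / real n))"
    by (intro prod_mono_ennreal nn_integral_gaussian_le n)
  also have "\<dots> = ennreal ((16 / real n) ^ (card I * card J))"
    by (simp add: ennreal_power card_cartesian_product)
  also have "ennreal (2 powr (real n * K)) * \<dots> = ennreal (2 powr (real n * K) * (16 / real n) ^ (card I * card J))"
    by (simp add: ennreal_mult)
  finally show ?thesis by (simp add: mult_left_mono)
qed

end

section \<open>Logarithms of volumes\<close>

lemma ln_ennreal_mono: "x \<le> y \<Longrightarrow> ln_ennreal x \<le> ln_ennreal y"
proof -
  assume xy: "x \<le> y"
  show ?thesis
  proof (cases "x = 0 \<or> y = \<infinity>")
    case False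
    hence "x \<noteq> 0" "y \<noteq> \<infinity>" "y \<noteq> 0" "x \<noteq> \<infinity>" using xy by (auto simp: top_unique)
    moreover have "enn2real x \<le> enn2real y" using xy \<open>y \<noteq> \<infinity>\<close> by (intro enn2real_mono) (auto simp: less_top)
    moreover have "0 < enn2real x" using \<open>x \<noteq> 0\<close> \<open>x \<noteq> \<infinity>\<close> by (simp add: enn2real_positive_iff less_top zero_less_iff_neq_zero)
    ultimately show ?thesis by (simp add: ln_ennreal_def)
  qed (use xy in \<open>auto simp: ln_ennreal_def\<close>)
qed

lemma ln_ennreal_ennreal: "x > 0 \<Longrightarrow> ln_ennreal (ennreal x) = ereal (ln x)"
  by (simp add: ln_ennreal_def)

text \<open>Finite factors exclude \<infinity> - \<infinity> on the right. A zero factor makes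
  \<open>V\<close> zero and the left side -\<infinity>; otherwise all factors are positive reals and
  the logarithm is additive.\<close>

lemma ln_ennreal_prod_le:
  assumes "finite A" "c > 0" "\<And>i. i \<in> A \<Longrightarrow> v i < \<infinity>" "V \<le> ennreal c * (\<Prod>i\<in>A. v i)" "\<kappa> > 0"
  shows "ereal \<kappa> * ln_ennreal V + ereal (real (card A) * t) \<le>
    ereal (\<kappa> * ln c) + (\<Sum>i\<in>A. ereal \<kappa> * ln_ennreal (v i) + ereal t)"
proof (cases "\<exists>i\<in>A. v i = 0")
  case True
  hence "(\<Prod>i\<in>A. v i) = 0" using assms(1) by (auto simp: prod_zero_iff)
  hence "V = 0" using assms(4) by (simp only: mult_zero_right le_zero_eq)
  thus ?thesis using assms(5) by (simp add: ln_ennreal_def)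
next
  case False
  define x where "x = (\<lambda>i. enn2real (v i))"
  have x: "x i > 0" "v i = ennreal (x i)" if "i \<in> A" for i
    using False assms(3)[OF that] that by (auto simp: x_def enn2real_positive_iff zero_less_iff_neq_zero)
  have "(\<Prod>i\<in>A. v i) = ennreal (\<Prod>i\<in>A. x i)" using x by (subst prod_ennreal[symmetric]) (auto intro: less_imp_le)
  hence "V \<le> ennreal (c * (\<Prod>i\<in>A. x i))" using assms(2,4) by (simp add: ennreal_mult prod_nonneg x(1) less_imp_le)
  moreover have pos: "(\<Prod>i\<in>A. x i) > 0" using x by (intro prod_pos) auto
  ultimately have "ln_ennreal V \<le> ereal (ln (c * (\<Prod>i\<in>A. x i)))"
    using assms(2) ln_ennreal_mono[of V] by (metis ln_ennreal_ennreal mult_pos_pos)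
  also have "ln (c * (\<Prod>i\<in>A. x i)) = ln c + (\<Sum>i\<in>A. ln (x i))"
  proof -
    have "ln (\<Prod>i\<in>A. x i) = (\<Sum>i\<in>A. ln (x i))" using x(1) by (intro ln_prod assms(1)) fastforce
    thus ?thesis using assms(2) pos by (simp add: ln_mult)
  qed
  finally have "ereal \<kappa> * ln_ennreal V \<le> ereal \<kappa> * ereal (ln c + (\<Sum>i\<in>A. ln (x i)))"
    using assms(5) by (intro ereal_mult_left_mono) auto
  hence "ereal \<kappa> * ln_ennreal V + ereal (real (card A) * t) \<le> ereal (\<kappa> * (ln c + (\<Sum>i\<in>A. ln (x i)))) + ereal (real (card A) * t)"
    by (intro add_right_mono) simp
  also have "\<dots> = ereal (\<kappa> * ln c) + (\<Sum>i\<in>A. ereal (\<kappa> * ln (x i) + t))"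
    by (simp add: sum.distrib sum_distrib_left algebra_simps)
  also have "(\<Sum>i\<in>A. ereal (\<kappa> * ln (x i) + t)) = (\<Sum>i\<in>A. ereal \<kappa> * ln_ennreal (v i) + ereal t)"
    using x by (intro sum.cong) (auto simp: ln_ennreal_ennreal)
  finally show ?thesis .
qed


section \<open>Finiteness of single entropies and the contradiction with additivity\<close>

context microstate_family
begin

lemma rho_le_1: "j \<in> {1..d} \<Longrightarrow> rho \<phi> p j \<le> 1"
proof (rule field_le_epsilon)
  fix e :: real assume j: "j \<in> {1..d}" and e: "0 < e"
  obtain n :: nat where n: "1 / e < real n" using reals_Archimedean2 by blast
  hence n0: "n \<ge> 1" using e by (cases n) (auto simp: not_less)
  have "1 / real n \<le> e" using n e n0 by (simp add: field_simps)
  moreover have "real (bs n j) / real n \<le> 1" using block_ratio(2)[OF j n0] n0 by simp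
  ultimately show "rho \<phi> p j \<le> 1 + e" using block_ratio(1)[OF j n0] by linarith
qed

text \<open>The full trace of X X* is a block trace, as the rows lie in block \<open>k\<close>, and
  it is the squared Hilbert-Schmidt norm. The states thus lie in a Euclidean ball that does not
  depend on \<open>R\<close>.\<close>

lemma single_states_l2:
  assumes X: "X \<in> single_states n i R 2 1"
  shows "(\<Sum>x\<in>Bl n k \<times> Bl n l. (cmod (X $$ x))\<^sup>2) \<le> real n * (cmod (target i [False, True] k) + 1)"
proof -
  have Xr: "X \<in> rect_mats n (Bl n k) (Bl n l)" using X by (simp add: single_states_def)
  then interpret mat_tuple n 1 "\<lambda>_. X" by unfold_locales (auto simp: rect_mats_def)
  have c: "X \<in> carrier_mat n n" using Xr by (simp add: rect_mats_def)
  have sw: "single_word 1 [False, True] = [(1, False), (1, True)]" by (simp add: single_word_def)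
  have w: "mat_word n (\<lambda>_. X) (single_word 1 [False, True]) = X * mat_adjoint X"
    unfolding sw mat_word_def using c right_mult_one_mat[OF mat_adjoint_carrier[OF c]] by simp
  have "mat_trace (mat_word n (\<lambda>_. X) [(1, False), (1, True)]) = btr (Bl n k) (mat_word n (\<lambda>_. X) [(1, False), (1, True)])"
    by (rule mat_trace_word_block) (use Xr block_subset[OF k, of n] in \<open>auto simp: lmat_def rect_mats_def\<close>)
  hence "btr (Bl n k) (mat_word n (\<lambda>_. X) (single_word 1 [False, True])) = of_real (\<Sum>u<n. \<Sum>v<n. (cmod (X $$ (u, v)))\<^sup>2)"
    using mat_trace_mult_adjoint[OF c] w unfolding sw by simp
  moreover have "cmod (btr (Bl n k) (mat_word n (\<lambda>_. X) (single_word 1 [False, True]))) \<le> real n * (cmod (target i [False, True] k) + 1)"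
    by (rule btr_bound[OF k]) (use X k in \<open>auto simp: single_states_def\<close>)
  ultimately have "(\<Sum>u<n. \<Sum>v<n. (cmod (X $$ (u, v)))\<^sup>2) \<le> real n * (cmod (target i [False, True] k) + 1)"
    by (simp only: norm_of_real)
  moreover have "(\<Sum>u<n. \<Sum>v<n. (cmod (X $$ (u, v)))\<^sup>2) = (\<Sum>x\<in>{..<n} \<times> {..<n}. (cmod (X $$ x))\<^sup>2)"
    by (simp add: sum.cartesian_product)
  moreover have "(\<Sum>x\<in>Bl n k \<times> Bl n l. (cmod (X $$ x))\<^sup>2) \<le> (\<Sum>x\<in>{..<n} \<times> {..<n}. (cmod (X $$ x))\<^sup>2)"
    using block_subset[OF k, of n] block_subset[OF l, of n] by (intro sum_mono2) auto
  ultimately show ?thesis by linarith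
qed

text \<open>Rounding lowers the product of the two ratios by at most 2 / n, and ln n \<le> n. Hence
  the powers of 1/n in the volume cancel the logarithmic normalisation up to a constant.\<close>

lemma block_size_product_ratio:
  assumes n: "n \<ge> 1"
  shows "(rho \<phi> p k * rho \<phi> p l - real (bs n k * bs n l) / (real n)\<^sup>2) * ln (real n) \<le> 2"
    and "real (bs n k * bs n l) / (real n)\<^sup>2 \<le> 1"
proof -
  define x where "x = real (bs n k) / real n"
  define y where "y = real (bs n l) / real n"
  have x: "rho \<phi> p k - x \<le> 1 / real n" "0 \<le> x" "x \<le> 1"
    using block_ratio[OF k n] n unfolding x_def by (auto simp: abs_le_iff)
  have y: "rho \<phi> p l - y \<le> 1 / real n" "0 \<le> y" "y \<le> 1"
    using block_ratio[OF l n] n unfolding y_def by (auto simp: abs_le_iff)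
  have xy: "real (bs n k * bs n l) / (real n)\<^sup>2 = x * y" by (simp add: x_def y_def power2_eq_square)
  show "real (bs n k * bs n l) / (real n)\<^sup>2 \<le> 1" unfolding xy using x y by (simp add: mult_le_one)
  have "rho \<phi> p k * rho \<phi> p l - x * y = (rho \<phi> p k - x) * rho \<phi> p l + x * (rho \<phi> p l - y)" by (simp add: algebra_simps)
  also have "\<dots> \<le> 1 / real n * 1 + 1 * (1 / real n)"
  proof (rule add_mono)
    have "(rho \<phi> p k - x) * rho \<phi> p l \<le> 1 / real n * rho \<phi> p l" using x(1) rho_pos[OF l] by (intro mult_right_mono) auto
    also have "\<dots> \<le> 1 / real n * 1" using rho_le_1[OF l] by (intro mult_left_mono) auto
    finally show "(rho \<phi> p k - x) * rho \<phi> p l \<le> 1 / real n * 1" .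
    have "x * (rho \<phi> p l - y) \<le> x * (1 / real n)" using x y by (intro mult_left_mono) auto
    also have "\<dots> \<le> 1 * (1 / real n)" using x by (intro mult_right_mono) auto
    finally show "x * (rho \<phi> p l - y) \<le> 1 * (1 / real n)" .
  qed
  finally have "(rho \<phi> p k * rho \<phi> p l - x * y) * ln (real n) \<le> (2 / real n) * ln (real n)"
    using n by (intro mult_right_mono) auto
  also have "\<dots> \<le> (2 / real n) * real n" using n ln_le_minus_one[of "real n"] by (intro mult_left_mono) auto
  finally show "(rho \<phi> p k * rho \<phi> p l - real (bs n k * bs n l) / (real n)\<^sup>2) * ln (real n) \<le> 2" unfolding xy using n by simp
qed

text \<open>Already r = 2 and \<epsilon> = 1 confine the states to a ball whose radius does not
  involve \<open>R\<close>, and the logarithmic term compensates the decay of its volume.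
  Boundedness from above keeps the sum of the entropies free of \<infinity> - \<infinity>.\<close>

lemma single_entropy_finite: "free_entropy \<phi> d p k l 1 (\<lambda>_. a i) < \<infinity>"
proof -
  define C where "C = cmod (target i [False, True] k) + 1"
  define tm where "tm = (\<lambda>R n. ereal (1 / (real n)\<^sup>2) *
     ln_ennreal (emeasure (tuple_lebesgue \<phi> p n k l 1) (microstates \<phi> d p k l R 1 (\<lambda>_. a i) n 2 1)) +
     ereal (real 1 * rho \<phi> p k * rho \<phi> p l * ln (real n)))"
  have bound: "tm R n \<le> ereal (C * ln 2 + ln 16 + 2)" if R: "R > 0" and n: "n \<ge> 1" for R n
  proof -
    interpret rt: rect_tuple n 1 "Bl n k" "Bl n l" by (rule rt)
    let ?D = "bs n k * bs n l"
    have n0: "n > 0" using n by simp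
    have "emeasure (tuple_lebesgue \<phi> p n k l 1) (microstates \<phi> d p k l R 1 (\<lambda>_. a i) n 2 1) =
      emeasure rt.R (single_states n i R 2 1)" using R by (intro emeasure_single) auto
    also have "\<dots> \<le> ennreal (2 powr (real n * (real n * C)) * (16 / real n) ^ (card (Bl n k) * card (Bl n l)))"
      unfolding C_def by (rule rt.emeasure_R_l2_le[OF n0 single_states_sets[OF R] single_states_l2])
    also have "card (Bl n k) * card (Bl n l) = ?D" using card_block k l by simp
    finally have "ln_ennreal (emeasure (tuple_lebesgue \<phi> p n k l 1) (microstates \<phi> d p k l R 1 (\<lambda>_. a i) n 2 1)) \<le>
      ln_ennreal (ennreal (2 powr (real n * (real n * C)) * (16 / real n) ^ ?D))" by (rule ln_ennreal_mono)
    also have "\<dots> = ereal (ln (2 powr (real n * (real n * C)) * (16 / real n) ^ ?D))"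
      using n0 by (intro ln_ennreal_ennreal mult_pos_pos) auto
    also have "ln (2 powr (real n * (real n * C)) * (16 / real n) ^ ?D) = (real n)\<^sup>2 * (C * ln 2) + real ?D * (ln 16 - ln (real n))"
      using n0 by (simp add: ln_mult ln_powr ln_realpow ln_div power2_eq_square)
    finally have "tm R n \<le> ereal (1 / (real n)\<^sup>2) * ereal ((real n)\<^sup>2 * (C * ln 2) + real ?D * (ln 16 - ln (real n))) +
       ereal (real 1 * rho \<phi> p k * rho \<phi> p l * ln (real n))"
      unfolding tm_def by (intro add_right_mono ereal_mult_left_mono) auto
    also have "\<dots> = ereal (1 / (real n)\<^sup>2 * ((real n)\<^sup>2 * (C * ln 2) + real ?D * (ln 16 - ln (real n))) + rho \<phi> p k * rho \<phi> p l * ln (real n))"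
      by simp
    also have "1 / (real n)\<^sup>2 * ((real n)\<^sup>2 * (C * ln 2) + real ?D * (ln 16 - ln (real n))) + rho \<phi> p k * rho \<phi> p l * ln (real n) =
      C * ln 2 + real ?D / (real n)\<^sup>2 * ln 16 + (rho \<phi> p k * rho \<phi> p l - real ?D / (real n)\<^sup>2) * ln (real n)"
    proof -
      have alg: "1 / x * (x * c + D * (L - M)) + q * M = c + D / x * L + (q - D / x) * M" if "x \<noteq> 0" for x c D L M q :: real
        using that by (simp add: field_simps)
      show ?thesis by (rule alg) (use n0 in simp)
    qed
    also have "ereal \<dots> \<le> ereal (C * ln 2 + 1 * ln 16 + 2)"
      unfolding ereal_less_eq by (intro add_mono mult_right_mono block_size_product_ratio n order_refl) auto
    finally show ?thesis by simp
  qed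
  have "free_entropy \<phi> d p k l 1 (\<lambda>_. a i) \<le> ereal (C * ln 2 + ln 16 + 2)"
    unfolding free_entropy_def
  proof (rule SUP_least)
    fix R :: real assume R: "R \<in> {0<..}"
    have "limsup (tm R) \<le> ereal (C * ln 2 + ln 16 + 2)"
      using R bound by (intro Limsup_bounded eventually_sequentiallyI[of 1]) auto
    thus "(INF r\<in>{1..}. INF \<epsilon>\<in>{0<..}. limsup (\<lambda>n. ereal (1 / (real n)\<^sup>2) *
            ln_ennreal (emeasure (tuple_lebesgue \<phi> p n k l 1) (microstates \<phi> d p k l R 1 (\<lambda>_. a i) n r \<epsilon>))
          + ereal (real 1 * rho \<phi> p k * rho \<phi> p l * ln (real n)))) \<le> ereal (C * ln 2 + ln 16 + 2)"
      unfolding tm_def by (intro INF_lower2[of 2] INF_lower2[of 1]) auto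
  qed
  thus ?thesis by (rule le_less_trans) simp
qed

lemma limsup_single_mono:
  assumes "R > 0" "0 < \<epsilon>" "\<epsilon> \<le> \<epsilon>'" "r' \<le> r"
  shows "limsup (\<lambda>n. ereal (1 / (real n)\<^sup>2) *
      ln_ennreal (emeasure (tuple_lebesgue \<phi> p n k l 1) (microstates \<phi> d p k l R 1 (\<lambda>_. a i) n r \<epsilon>)) + ereal (t n)) \<le>
    limsup (\<lambda>n. ereal (1 / (real n)\<^sup>2) *
      ln_ennreal (emeasure (tuple_lebesgue \<phi> p n k l 1) (microstates \<phi> d p k l R 1 (\<lambda>_. a i) n r' \<epsilon>')) + ereal (t n))"
proof (rule Limsup_mono[OF always_eventually[OF allI]], intro add_right_mono ereal_mult_left_mono ln_ennreal_mono)
  fix n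
  have "\<epsilon>' > 0" using assms by simp
  show "emeasure (tuple_lebesgue \<phi> p n k l 1) (microstates \<phi> d p k l R 1 (\<lambda>_. a i) n r \<epsilon>) \<le>
    emeasure (tuple_lebesgue \<phi> p n k l 1) (microstates \<phi> d p k l R 1 (\<lambda>_. a i) n r' \<epsilon>')"
    unfolding emeasure_single[OF assms(2,1)] emeasure_single[OF \<open>\<epsilon>' > 0\<close> assms(1)]
    by (intro emeasure_mono single_states_mono single_states_sets assms order_refl)
qed simp

text \<open>The exponential gain \<gamma> becomes a loss of \<gamma> / 4 in the entropy for every
  cut-off \<open>R\<close>: half of \<gamma> pays for the factor 8, a quarter for approximating the
  N separate entropies. These are approximated at \<open>R + 1\<close>, which their supremum over
  cut-offs allows.\<close>

lemma liberation_gradient_eq_0: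
  assumes additive: "free_entropy \<phi> d p k l N a = (\<Sum>i=1..N. free_entropy \<phi> d p k l 1 (\<lambda>_. a i))"
    and finite: "free_entropy \<phi> d p k l N a > - \<infinity>"
    and i: "i \<in> {1..N}" and j: "j \<in> {1..d}" and w: "fst ` set w \<subseteq> {1..N}"
  shows "liberation_gradient \<phi> i (p j) 1 (map (letter a) w) = 0"
proof (rule ccontr)
  assume "liberation_gradient \<phi> i (p j) 1 (map (letter a) w) \<noteq> 0"
  then obtain \<gamma> where \<gamma>: "\<gamma> > 0" and vol: "\<And>R r e. R > 0 \<Longrightarrow> e > 0 \<Longrightarrow> \<exists>r2\<ge>1. \<exists>\<epsilon>>0. \<exists>n0. \<forall>n\<ge>n0.
     emeasure (tuple_lebesgue \<phi> p n k l N) (microstates \<phi> d p k l R N a n r2 \<epsilon>) \<le>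
     ennreal (8 * exp (- \<gamma> * (real n)\<^sup>2)) *
     (\<Prod>i=1..N. emeasure (tuple_lebesgue \<phi> p n k l 1) (microstates \<phi> d p k l (R + 1) 1 (\<lambda>_. a i) n r e))"
    using microstates_volume[OF i j w] by metis
  define t where "t = (\<lambda>n. rho \<phi> p k * rho \<phi> p l * ln (real n))"
  define tm where "tm = (\<lambda>i R r e n. ereal (1 / (real n)\<^sup>2) *
     ln_ennreal (emeasure (tuple_lebesgue \<phi> p n k l 1) (microstates \<phi> d p k l R 1 (\<lambda>_. a i) n r e)) + ereal (t n))"
  define T where "T = (\<lambda>R r e n. ereal (1 / (real n)\<^sup>2) *
     ln_ennreal (emeasure (tuple_lebesgue \<phi> p n k l N) (microstates \<phi> d p k l R N a n r e)) + ereal (real N * t n))"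
  have fe1: "free_entropy \<phi> d p k l 1 (\<lambda>_. a i) = (SUP R\<in>{0<..}. INF r\<in>{1..}. INF e\<in>{0<..}. limsup (tm i R r e))" for i
    unfolding free_entropy_def tm_def t_def by (simp add: mult.assoc)
  have feN: "free_entropy \<phi> d p k l N a = (SUP R\<in>{0<..}. INF r\<in>{1..}. INF e\<in>{0<..}. limsup (T R r e))"
    unfolding free_entropy_def T_def t_def by (simp add: mult.assoc)
  define x where "x = (\<lambda>i. real_of_ereal (free_entropy \<phi> d p k l 1 (\<lambda>_. a i)))"
  have x: "free_entropy \<phi> d p k l 1 (\<lambda>_. a i) = ereal (x i)" if i: "i \<in> {1..N}" for i
  proof -
    \<comment> \<open>As no summand is +\<infinity>, a single -\<infinity> would make the whole sum
      -\<infinity>.\<close>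
    have "free_entropy \<phi> d p k l 1 (\<lambda>_. a i) \<noteq> - \<infinity>"
    proof
      assume "free_entropy \<phi> d p k l 1 (\<lambda>_. a i) = - \<infinity>"
      moreover have "(\<Sum>i\<in>{1..N} - {i}. free_entropy \<phi> d p k l 1 (\<lambda>_. a i)) \<noteq> \<infinity>"
        using single_entropy_finite by (simp add: sum_Pinfty less_top[symmetric])
      ultimately have "(\<Sum>i=1..N. free_entropy \<phi> d p k l 1 (\<lambda>_. a i)) = - \<infinity>"
        by (subst sum.remove[OF _ i]) auto
      thus False using additive finite by simp
    qed
    thus ?thesis using single_entropy_finite[of i] unfolding x_def by (intro ereal_real'[symmetric]) auto
  qed
  have total: "free_entropy \<phi> d p k l N a = ereal (\<Sum>i=1..N. x i)" 
  proof -
    have "(\<Sum>i=1..N. free_entropy \<phi> d p k l 1 (\<lambda>_. a i)) = (\<Sum>i=1..N. ereal (x i))" by (intro sum.cong refl x)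
    thus ?thesis unfolding additive by simp
  qed
  have "free_entropy \<phi> d p k l N a \<le> ereal ((\<Sum>i=1..N. x i) - \<gamma> / 4)"
    unfolding feN
  proof (rule SUP_least)
    fix R :: real assume "R \<in> {0<..}"
    hence R: "R > 0" by simp
    define B where "B = (\<lambda>i. x i + \<gamma> / (4 * real N))"
    have "\<exists>r e. 1 \<le> r \<and> e > 0 \<and> limsup (tm i (R + 1) r e) < ereal (B i)" if i: "i \<in> {1..N}" for i
    proof -
      have "(INF r\<in>{1..}. INF e\<in>{0<..}. limsup (tm i (R + 1) r e)) \<le> free_entropy \<phi> d p k l 1 (\<lambda>_. a i)"
        unfolding fe1 using R by (intro SUP_upper) simp
      also have "\<dots> < ereal (B i)" unfolding x[OF i] B_def using \<gamma> N by simp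
      finally show ?thesis by (auto simp: INF_less_iff)
    qed
    then obtain rr ee where re: "\<And>i. i \<in> {1..N} \<Longrightarrow> ee i > 0 \<and> limsup (tm i (R + 1) (rr i) (ee i)) < ereal (B i)"
      by metis
    \<comment> \<open>Common parameters for all members: enlarging \<open>r\<close> and shrinking
      \<open>e\<close> can only decrease each limsup.\<close>
    define r where "r = Max (rr ` {1..N})"
    define e where "e = Min (ee ` {1..N})"
    have e: "e > 0" unfolding e_def using re N by (subst Min_gr_iff) auto
    have lim: "limsup (tm i (R + 1) r e) < ereal (B i)" if i: "i \<in> {1..N}" for i
    proof -
      have "limsup (tm i (R + 1) r e) \<le> limsup (tm i (R + 1) (rr i) (ee i))"
        unfolding tm_def using R e i by (intro limsup_single_mono) (auto simp: r_def e_def)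
      thus ?thesis using re[OF i] by (auto intro: le_less_trans)
    qed
    from vol[OF R e, of r] obtain r2 \<epsilon> n0 where r2: "r2 \<ge> 1" "\<epsilon> > 0" and n0: "\<And>n. n \<ge> n0 \<Longrightarrow>
     emeasure (tuple_lebesgue \<phi> p n k l N) (microstates \<phi> d p k l R N a n r2 \<epsilon>) \<le>
     ennreal (8 * exp (- \<gamma> * (real n)\<^sup>2)) *
     (\<Prod>i=1..N. emeasure (tuple_lebesgue \<phi> p n k l 1) (microstates \<phi> d p k l (R + 1) 1 (\<lambda>_. a i) n r e))"
      by blast
    \<comment> \<open>Beyond \<open>n1\<close> the constant 8 uses up at most half of
      \<gamma>.\<close>
    obtain n1 :: nat where n1: "2 * ln 8 / \<gamma> \<le> real n1" using real_arch_simple by blast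
    have step: "T R r2 \<epsilon> n \<le> ereal (- \<gamma> / 2) + (\<Sum>i=1..N. tm i (R + 1) r e n)" if n: "n \<ge> n0" "n \<ge> n1" "n \<ge> 1" for n
    proof -
      have "T R r2 \<epsilon> n = ereal (1 / (real n)\<^sup>2) * ln_ennreal (emeasure (tuple_lebesgue \<phi> p n k l N) (microstates \<phi> d p k l R N a n r2 \<epsilon>))
          + ereal (real (card {1..N}) * t n)" by (simp add: T_def)
      also have "\<dots> \<le> ereal (1 / (real n)\<^sup>2 * ln (8 * exp (- \<gamma> * (real n)\<^sup>2))) + (\<Sum>i=1..N. tm i (R + 1) r e n)"
        unfolding tm_def
      proof (rule ln_ennreal_prod_le[OF _ _ _ n0[OF n(1)]])
        fix i
        show "emeasure (tuple_lebesgue \<phi> p n k l 1) (microstates \<phi> d p k l (R + 1) 1 (\<lambda>_. a i) n r e) < \<infinity>"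
          using emeasure_single[OF e, of "R + 1" n i r] emeasure_states_finite[of "R + 1" n i r e] R by simp
      qed (use n in auto)
      also have "1 / (real n)\<^sup>2 * ln (8 * exp (- \<gamma> * (real n)\<^sup>2)) \<le> - \<gamma> / 2"
      proof -
        have "2 * ln 8 / \<gamma> \<le> real n" using n1 n(2) by simp
        hence "2 * ln 8 \<le> real n * \<gamma>" using \<gamma> by (simp only: pos_divide_le_eq)
        also have "\<dots> \<le> (real n * real n) * \<gamma>" using n(3) \<gamma> by (intro mult_right_mono) auto
        finally have "ln 8 \<le> (real n)\<^sup>2 * (\<gamma> / 2)" by (simp add: power2_eq_square)
        hence "ln (8 * exp (- \<gamma> * (real n)\<^sup>2)) \<le> (- \<gamma> / 2) * (real n)\<^sup>2"
          by (simp add: ln_mult_pos algebra_simps)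
        thus ?thesis using n(3) by (simp add: pos_divide_le_eq)
      qed
      finally show ?thesis by (simp add: add_right_mono)
    qed
    have ev: "\<forall>\<^sub>F n in sequentially. \<forall>i\<in>{1..N}. tm i (R + 1) r e n < ereal (B i)"
      by (intro eventually_ball_finite ballI Limsup_lessD lim) auto
    have "\<forall>\<^sub>F n in sequentially. T R r2 \<epsilon> n \<le> ereal ((\<Sum>i=1..N. x i) - \<gamma> / 4)"
      using ev eventually_ge_at_top[of n0] eventually_ge_at_top[of n1] eventually_ge_at_top[of 1]
    proof eventually_elim
      case (elim n)
      have "(\<Sum>i=1..N. tm i (R + 1) r e n) \<le> (\<Sum>i=1..N. ereal (B i))"
        using elim(1) by (intro sum_mono less_imp_le) auto
      hence "ereal (- \<gamma> / 2) + (\<Sum>i=1..N. tm i (R + 1) r e n) \<le> ereal (- \<gamma> / 2) + (\<Sum>i=1..N. ereal (B i))"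
        by (rule add_left_mono)
      also have "\<dots> = ereal ((\<Sum>i=1..N. x i) - \<gamma> / 4)"
        using N by (simp add: B_def sum.distrib)
      finally show ?case using step[OF elim(2-4)] by (rule order_trans[rotated])
    qed
    hence "limsup (T R r2 \<epsilon>) \<le> ereal ((\<Sum>i=1..N. x i) - \<gamma> / 4)" by (rule Limsup_bounded)
    thus "(INF r\<in>{1..}. INF e\<in>{0<..}. limsup (T R r e)) \<le> ereal ((\<Sum>i=1..N. x i) - \<gamma> / 4)"
      using r2 by (intro INF_lower2[of r2] INF_lower2[of \<epsilon>]) auto
  qed
  thus False using total \<gamma> by simp
qed

end

theorem corollary5p15:
  fixes \<phi> :: "'a::cstar_algebra \<Rightarrow> complex"
    and p :: "nat \<Rightarrow> 'a"
    and a :: "nat \<Rightarrow> 'a"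
    and d k l N :: nat
  assumes "tracial_wstar_probability_space \<phi>"
    and "projection_partition d p"
    and "k \<in> {1..d}" and "l \<in> {1..d}" and "k \<noteq> l"
    and "rho \<phi> p k \<le> rho \<phi> p l"
    and "1 \<le> N"
    and "\<forall>i\<in>{1..N}. has_type p k l (a i)"
    and "free_entropy \<phi> d p k l N a = (\<Sum>i=1..N. free_entropy \<phi> d p k l 1 (\<lambda>_. a i))"
    and "free_entropy \<phi> d p k l N a > - \<infinity>"
  shows "free_with_amalgamation \<phi> d p N a"
proof -
  interpret microstate_family \<phi> p d k l N a
    using assms by unfold_locales auto
  show ?thesis
    by (rule free_if_lg_zero[OF assms(3-5)])
      (use assms(8) liberation_gradient_eq_0[OF assms(9,10)] in blast)+
qed

end
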